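(* There exists a residual set $\mathcal{R} \subset \mathcal{E}^1$ (in the $C^1$ topology) such that if $f \in \mathcal{R}$ then $f$ has no aci$\sigma$; that is, there is no nonzero $\sigma$-finite $f$-invariant measure on $\mathbb{T}^1$ which is absolutely continuous with respect to Lebesgue measure $m$.
   Context: $\mathbb{T}^1=\mathbb{R}/\mathbb{Z}$ is the circle and $m$ is Lebesgue measure on $\mathbb{T}^1$ with $m(\mathbb{T}^1)=1$. $\mathcal{E}^1$ is the set of all $C^1$ maps $f:\mathbb{T}^1\to\mathbb{T}^1$ that are expanding, i.e. there exist $c>0$ and $\lambda>1$ such that $|(f^n)'(x)|>c\lambda^n$ for all $x\in\mathbb{T}^1$ and all integers $n\ge 1$. $\mathcal{E}^1$ is endowed with the $C^1$ topology. A set is residual if it contains a countable intersection of open dense subsets of the space. An aci$\sigma$ for a map $f:\mathbb{T}^1\to\mathbb{T}^1$ is a nonzero $\sigma$-finite measure $\mu$ on $\mathbb{T}^1$ which is absolutely continuous with respect to $m$ and $f$-invariant ($\mu(f^{-1}(A))=\mu(A)$ for all measurable $A$). *)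

theory Defs
  imports "HOL-Analysis.Analysis"
begin

section \<open>The circle\<close>

text \<open>The quotient of the reals by the integers, metrised by the distance to the nearest integer.\<close>

definition circle_rel :: "real \<Rightarrow> real \<Rightarrow> bool" where
  "circle_rel x y \<longleftrightarrow> x - y \<in> \<int>"

lemma equivp_circle_rel: "equivp circle_rel"
proof (rule equivpI)
  show "reflp circle_rel" by (simp add: reflp_def circle_rel_def)
  show "symp circle_rel"
    unfolding symp_def circle_rel_def by (metis Ints_minus minus_diff_eq)
  show "transp circle_rel"
  proof (rule transpI)
    fix x y z assume "circle_rel x y" "circle_rel y z"
    then have "(x - y) + (y - z) \<in> \<int>" unfolding circle_rel_def by (rule Ints_add)
    then show "circle_rel x z" by (simp add: circle_rel_def)
  qed
qed

quotient_type circle = real / circle_rel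
  morphisms rep_circle proj
  by (rule equivp_circle_rel)

lemma proj_eq_iff: "proj x = proj y \<longleftrightarrow> x - y \<in> \<int>"
  by (simp add: circle.abs_eq_iff circle_rel_def)

lemma proj_surj: "\<exists>t. x = proj t"
  by (metis Quotient_abs_rep Quotient_circle)

lemma round_dist_shift:
  fixes z w :: real
  assumes "z - w \<in> \<int>"
  shows "\<bar>z - of_int (round z)\<bar> \<le> \<bar>w - of_int (round w)\<bar>"
proof -
  obtain k where k: "z - w = of_int k" using assms Ints_cases by blast
  have "\<bar>z - of_int (round z)\<bar> \<le> \<bar>z - of_int (round w + k)\<bar>" by (rule round_diff_minimal)
  also have "z - of_int (round w + k) = w - of_int (round w)" using k by simp
  finally show ?thesis .
qed

instantiation circle :: metric_space
begin

lift_definition dist_circle :: "circle \<Rightarrow> circle \<Rightarrow> real"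
  is "\<lambda>x y. \<bar>(x - y) - of_int (round (x - y))\<bar>"
proof -
  fix a b c d assume *: "circle_rel a b" "circle_rel c d"
  have "(a - b) - (c - d) \<in> \<int>" using * unfolding circle_rel_def by (rule Ints_diff)
  then have 1: "(a - c) - (b - d) \<in> \<int>" by (simp add: algebra_simps)
  then have 2: "(b - d) - (a - c) \<in> \<int>" by (metis Ints_minus minus_diff_eq)
  show "\<bar>(a - c) - of_int (round (a - c))\<bar> = \<bar>(b - d) - of_int (round (b - d))\<bar>"
    using round_dist_shift[OF 1] round_dist_shift[OF 2] by simp
qed

definition uniformity_circle :: "(circle \<times> circle) filter" where
  "uniformity_circle = (INF e\<in>{0<..}. principal {(x, y). dist x y < e})"

definition open_circle :: "circle set \<Rightarrow> bool" where
  "open_circle U \<longleftrightarrow> (\<forall>x\<in>U. eventually (\<lambda>(x', y). x' = x \<longrightarrow> y \<in> U) uniformity)"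

instance
proof
  fix x y z :: circle
  show "dist x y = 0 \<longleftrightarrow> x = y"
  proof transfer
    fix x y :: real
    show "\<bar>(x - y) - of_int (round (x - y))\<bar> = 0 \<longleftrightarrow> circle_rel x y"
      unfolding circle_rel_def by (auto elim!: Ints_cases) (metis Ints_of_int)
  qed
  show "dist x y \<le> dist x z + dist y z"
  proof transfer
    fix x y z :: real
    have "\<bar>(x - y) - of_int (round (x - y))\<bar> \<le> \<bar>(x - y) - of_int (round (x - z) - round (y - z))\<bar>"
      by (rule round_diff_minimal)
    also have "\<dots> \<le> \<bar>(x - z) - of_int (round (x - z))\<bar> + \<bar>(y - z) - of_int (round (y - z))\<bar>"
      by simp
    finally show "\<bar>(x - y) - of_int (round (x - y))\<bar> \<le>
      \<bar>(x - z) - of_int (round (x - z))\<bar> + \<bar>(y - z) - of_int (round (y - z))\<bar>" .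
  qed
qed (simp_all add: uniformity_circle_def open_circle_def)

end

lemma dist_proj_le: "dist (proj x) (proj y) \<le> \<bar>x - y\<bar>"
proof -
  have "dist (proj x) (proj y) = \<bar>(x - y) - of_int (round (x - y))\<bar>"
    by (simp add: dist_circle.abs_eq)
  also have "\<dots> \<le> \<bar>(x - y) - of_int 0\<bar>" by (rule round_diff_minimal)
  finally show ?thesis by simp
qed

lemma dist_circle_le: "dist (x :: circle) y \<le> 1 / 2"
proof transfer
  fix x y :: real
  show "\<bar>(x - y) - of_int (round (x - y))\<bar> \<le> 1 / 2"
    using of_int_round_abs_le[of "x - y"] by (simp add: abs_minus_commute)
qed

lemma continuous_on_proj: "continuous_on A proj"
  unfolding continuous_on_iff dist_real_def
  by (metis dist_proj_le dist_real_def order_le_less_trans)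

lemma range_proj: "proj ` {0..<1} = UNIV"
proof -
  have "x \<in> proj ` {0..<1}" for x
  proof -
    obtain t where t: "x = proj t" using proj_surj by blast
    have "proj t = proj (frac t)" by (simp add: proj_eq_iff frac_def)
    then show ?thesis using t frac_ge_0[of t] frac_lt_1[of t] by auto
  qed
  then show ?thesis by blast
qed

lemma compact_circle: "compact (UNIV :: circle set)"
proof -
  have "proj ` {0..1} = UNIV" using range_proj image_mono[OF atLeastLessThan_subseteq_atLeastAtMost_iff[THEN iffD2], of 0 1 0 1 proj] by auto
  then show ?thesis
    by (metis compact_Icc compact_continuous_image continuous_on_proj)
qed

lemma open_circle_iff_quotient: "open U \<longleftrightarrow> open (proj -` U)"
proof
  assume "open U" then show "open (proj -` U)"
    using continuous_on_proj[of UNIV] by (simp add: continuous_on_open_vimage)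
next
  assume o: "open (proj -` U)"
  show "open U" unfolding open_dist
  proof
    fix x assume "x \<in> U"
    obtain t where t: "x = proj t" using proj_surj by blast
    obtain e where e: "e > 0" "\<And>s. dist s t < e \<Longrightarrow> proj s \<in> U"
      using o \<open>x \<in> U\<close> t unfolding open_dist by auto
    have "y \<in> U" if "dist y x < e" for y
    proof -
      obtain s where s: "y = proj s" using proj_surj by blast
      define s' where "s' = s - of_int (round (s - t))"
      have "proj s' = y" using s by (simp add: s'_def proj_eq_iff)
      moreover have "dist s' t = dist y x"
        using s t by (simp add: s'_def dist_circle.abs_eq dist_real_def algebra_simps)
      ultimately show ?thesis using e(2)[of s'] that by simp
    qed
    then show "\<exists>e>0. \<forall>y. dist y x < e \<longrightarrow> y \<in> U" using e(1) by blast
  qed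
qed

text \<open>Normalised Lebesgue measure, transported from a fundamental domain.\<close>

definition circle_lebesgue :: "circle measure" where
  "circle_lebesgue = distr (restrict_space lborel {0..<1}) borel proj"

lemma measurable_proj: "proj \<in> borel_measurable (restrict_space lborel {0..<1})"
  using borel_measurable_continuous_onI[OF continuous_on_proj[of UNIV]]
  by (simp add: measurable_restrict_space1)

lemma emeasure_circle_lebesgue_UNIV: "emeasure circle_lebesgue UNIV = 1"
  unfolding circle_lebesgue_def
  by (subst emeasure_distr[OF measurable_proj])
     (simp_all add: emeasure_restrict_space space_restrict_space)


section \<open>Continuously differentiable maps of the circle\<close>

text \<open>The derivative is computed in the charts given by local inverses of \<^const>\<open>proj\<close>:
  near \<open>t\<close>, the map is represented by a function \<open>F\<close> on the reals. Other choices
  of \<open>t\<close> and \<open>F\<close> differ by integer translations near the point, so the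
  derivative is unique.\<close>

definition has_circle_deriv :: "(circle \<Rightarrow> circle) \<Rightarrow> real \<Rightarrow> circle \<Rightarrow> bool" where
  "has_circle_deriv f D x \<longleftrightarrow>
     (\<exists>t F. x = proj t \<and> (\<forall>\<^sub>F s in nhds t. f (proj s) = proj (F s)) \<and>
            (F has_real_derivative D) (at t))"

definition circle_deriv :: "(circle \<Rightarrow> circle) \<Rightarrow> circle \<Rightarrow> real" where
  "circle_deriv f x = (THE D. has_circle_deriv f D x)"

lemma has_circle_deriv_unique:
  assumes "has_circle_deriv f D x" "has_circle_deriv f E x"
  shows "D = E"
proof -
  obtain t F where 1: "x = proj t" "\<forall>\<^sub>F s in nhds t. f (proj s) = proj (F s)"
    "(F has_real_derivative D) (at t)"
    using assms(1) unfolding has_circle_deriv_def by blast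
  obtain u G where 2: "x = proj u" "\<forall>\<^sub>F s in nhds u. f (proj s) = proj (G s)"
    "(G has_real_derivative E) (at u)"
    using assms(2) unfolding has_circle_deriv_def by blast
  define k where "k = u - t"
  have k: "k \<in> \<int>" using 1(1) 2(1) unfolding k_def by (metis proj_eq_iff)
  define H where "H s = G (s + k)" for s
  have u: "u = t + k" by (simp add: k_def)
  have H': "(H has_real_derivative E) (at t)"
    using 2(3) unfolding H_def[abs_def] u by (simp add: DERIV_shift)
  have "filterlim (\<lambda>s. s + k) (nhds u) (nhds t)"
    unfolding u by (intro tendsto_intros filterlim_ident)
  then have "\<forall>\<^sub>F s in nhds t. f (proj (s + k)) = proj (G (s + k))"
    using 2(2) by (rule eventually_compose_filterlim[rotated])
  moreover have "proj (s + k) = proj s" for s using k by (simp add: proj_eq_iff)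
  ultimately have "\<forall>\<^sub>F s in nhds t. f (proj s) = proj (H s)" by (simp add: H_def)
  with 1(2) have i: "\<forall>\<^sub>F s in nhds t. F s - H s \<in> \<int>"
    by eventually_elim (metis proj_eq_iff)
  define c where "c = F t - H t"
  have c: "c \<in> \<int>" using eventually_nhds_x_imp_x[OF i] by (simp add: c_def)
  have "isCont (\<lambda>s. F s - H s) t"
    using 1(3) H' by (intro continuous_intros DERIV_isCont)
  then have "((\<lambda>s. F s - H s) \<longlongrightarrow> c) (nhds t)"
    using tendsto_at_iff_tendsto_nhds[of "\<lambda>s. F s - H s" t] unfolding c_def isCont_def by blast
  then have "\<forall>\<^sub>F s in nhds t. dist (F s - H s) c < 1" by (rule tendstoD) simp
  with i have "\<forall>\<^sub>F s in nhds t. F s = H s + c"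
  proof eventually_elim
    case (elim s)
    then have "F s - H s - c \<in> \<int>" using c Ints_diff by blast
    then obtain j where j: "F s - H s - c = of_int j" by (rule Ints_cases)
    with elim(2) have "\<bar>real_of_int j\<bar> < 1" by (simp add: dist_real_def)
    then have "j = 0" by linarith
    with j show ?case by simp
  qed
  then have "(F has_real_derivative D) (at t) \<longleftrightarrow> ((\<lambda>s. H s + c) has_real_derivative D) (at t)"
    by (rule DERIV_cong_ev[OF refl _ refl])
  then have "((\<lambda>s. H s + c) has_real_derivative D) (at t)" using 1(3) by blast
  moreover have "((\<lambda>s. H s + c) has_real_derivative E) (at t)"
    using H' by (auto intro!: derivative_eq_intros)
  ultimately show ?thesis by (rule DERIV_unique)
qed

lemma circle_deriv_eq: "has_circle_deriv f D x \<Longrightarrow> circle_deriv f x = D"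
  unfolding circle_deriv_def using has_circle_deriv_unique by blast

definition C1_maps :: "(circle \<Rightarrow> circle) set" where
  "C1_maps = {f. (\<forall>x. \<exists>D. has_circle_deriv f D x) \<and> continuous_on UNIV (circle_deriv f)}"

text \<open>The value outside \<open>C1_maps\<close> is irrelevant; it only makes the metric locale applicable.\<close>

definition C1_dist :: "(circle \<Rightarrow> circle) \<Rightarrow> (circle \<Rightarrow> circle) \<Rightarrow> real" where
  "C1_dist f g =
     (if f \<in> C1_maps \<and> g \<in> C1_maps
      then (SUP x. dist (f x) (g x)) + (SUP x. \<bar>circle_deriv f x - circle_deriv g x\<bar>)
      else 0)"

lemma bdd_above_dist: "bdd_above (range (\<lambda>x. dist (f x) (g x :: circle)))"
  by (rule bdd_aboveI[of _ "1/2"]) (auto simp del: le_divide_eq_numeral1 intro: dist_circle_le)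

lemma bdd_above_deriv:
  assumes "f \<in> C1_maps" "g \<in> C1_maps"
  shows "bdd_above (range (\<lambda>x. \<bar>circle_deriv f x - circle_deriv g x\<bar>))"
proof -
  have "continuous_on UNIV (\<lambda>x. \<bar>circle_deriv f x - circle_deriv g x\<bar>)"
    using assms unfolding C1_maps_def by (auto intro!: continuous_intros)
  then have "compact (range (\<lambda>x. \<bar>circle_deriv f x - circle_deriv g x\<bar>))"
    by (rule compact_continuous_image) (rule compact_circle)
  then show ?thesis by (intro bounded_imp_bdd_above compact_imp_bounded)
qed

interpretation C1: Metric_space C1_maps C1_dist
proof
  have d0: "0 \<le> (SUP x. \<bar>circle_deriv f x - circle_deriv g x\<bar>)"
    if "f \<in> C1_maps" "g \<in> C1_maps" for f g
    by (rule cSUP_upper2[OF bdd_above_deriv[OF that], of undefined]) auto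
  have ge: "dist (f y) (g y) \<le> (SUP x. dist (f x) (g x))" for f g :: "circle \<Rightarrow> circle" and y
    by (rule cSUP_upper[OF _ bdd_above_dist]) simp
  have s0: "0 \<le> (SUP x. dist (f x) (g x))" for f g :: "circle \<Rightarrow> circle"
    using ge[of f undefined g] zero_le_dist[of "f undefined" "g undefined"] by linarith
  show "0 \<le> C1_dist f g" for f g
    using d0 s0 by (auto simp: C1_dist_def)
  show "C1_dist f g = C1_dist g f" for f g
    by (auto simp: C1_dist_def dist_commute abs_minus_commute)
  show "C1_dist f g = 0 \<longleftrightarrow> f = g" if "f \<in> C1_maps" "g \<in> C1_maps" for f g
  proof
    assume "C1_dist f g = 0"
    then have "(SUP x. dist (f x) (g x)) \<le> 0"
      using d0[OF that] that by (simp add: C1_dist_def)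
    then have "dist (f y) (g y) \<le> 0" for y using ge[of f y g] by linarith
    then show "f = g" by auto
  qed (simp add: C1_dist_def)
  show "C1_dist f h \<le> C1_dist f g + C1_dist g h"
    if m: "f \<in> C1_maps" "g \<in> C1_maps" "h \<in> C1_maps" for f g h
  proof -
    have 1: "(SUP x. dist (f x) (h x)) \<le> (SUP x. dist (f x) (g x)) + (SUP x. dist (g x) (h x))"
    proof (rule cSUP_least)
      fix x
      show "dist (f x) (h x) \<le> (SUP x. dist (f x) (g x)) + (SUP x. dist (g x) (h x))"
        using dist_triangle[of "f x" "h x" "g x"] ge[of f x g] ge[of g x h] by linarith
    qed simp
    let ?D = "\<lambda>f g. SUP x. \<bar>circle_deriv f x - circle_deriv g x\<bar>"
    have "?D f h \<le> ?D f g + ?D g h"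
    proof (rule cSUP_least)
      fix x
      show "\<bar>circle_deriv f x - circle_deriv h x\<bar> \<le> ?D f g + ?D g h"
        using cSUP_upper[OF UNIV_I bdd_above_deriv[OF m(1,2)], of x]
          cSUP_upper[OF UNIV_I bdd_above_deriv[OF m(2,3)], of x] by linarith
    qed simp
    with 1 m show ?thesis by (simp add: C1_dist_def)
  qed
qed


section \<open>Expanding maps and invariant measures\<close>

definition expanding_maps :: "(circle \<Rightarrow> circle) set" where
  "expanding_maps = {f \<in> C1_maps. \<exists>c>0. \<exists>r>1. \<forall>x. \<forall>n\<ge>1.
     \<bar>circle_deriv (f ^^ n) x\<bar> > c * r ^ n}"

definition expanding_topology :: "(circle \<Rightarrow> circle) topology" where
  "expanding_topology = subtopology C1.mtopology expanding_maps"

lemma topspace_expanding_topology [simp]: "topspace expanding_topology = expanding_maps"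
  by (auto simp: expanding_topology_def expanding_maps_def)

definition residual_in :: "'a topology \<Rightarrow> 'a set \<Rightarrow> bool" where
  "residual_in X R \<longleftrightarrow> R \<subseteq> topspace X \<and>
     (\<exists>U :: nat \<Rightarrow> 'a set. (\<forall>n. openin X (U n) \<and> X closure_of U n = topspace X) \<and> (\<Inter>n. U n) \<subseteq> R)"

definition acisigma :: "(circle \<Rightarrow> circle) \<Rightarrow> circle measure \<Rightarrow> bool" where
  "acisigma f \<mu> \<longleftrightarrow> sets \<mu> = sets borel \<and> sigma_finite_measure \<mu> \<and> emeasure \<mu> UNIV \<noteq> 0 \<and>
     absolutely_continuous circle_lebesgue \<mu> \<and>
     (\<forall>A \<in> sets \<mu>. emeasure \<mu> (f -` A) = emeasure \<mu> A)"

end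

theory Submission
  imports Defs
begin

text \<open>
  An invariant density is nearly constant on suitable small scales, whereas the dynamics of a generic
  map forces it to oscillate on all of them.

  Let \<open>f0\<close> be expanding with Lipschitz derivative. Using mixing one finds a function \<open>u\<close> with values in
  \<open>[0, 1]\<close>, varying slowly along orbits, whose values \<open>0\<close> and \<open>\<ge> 1/2\<close> are both taken with definite
  probability (it records how far in time the orbit is from a rare set). For large \<open>M\<close> the
  function \<open>v = u \<circ> f0^M\<close> is equidistributed on every interval of a fixed fine partition. Let \<open>h\<close> be the
  homeomorphism with \<open>h'\<close> proportional to \<open>64^v\<close>. As \<open>v\<close> varies slowly along orbits, \<open>g = h \<circ> f0 \<circ> h^-1\<close>
  is \<open>C^1\<close>-close to \<open>f0\<close>; but for all large \<open>t\<close> and on every inverse branch of \<open>g^t\<close> over an interval of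
  the partition, the Jacobian of \<open>g^t\<close> is several times larger over the set where \<open>v \<ge> 1/2\<close> than over
  the set where \<open>v = 0\<close>. This persists under \<open>C^1\<close>-perturbation for any prescribed finite range of times.

  Now let \<open>\<mu>\<close> be an aci\<open>\<sigma>\<close>, and \<open>E\<close> a set of positive Lebesgue measure on which its density is almost
  constant. Since \<open>m(f^-t Q) \<ge> c m(Q)\<close> for the relevant times, most points of \<open>E\<close> return to \<open>E\<close> at
  least \<open>n\<close> times in a time window of length \<open>N\<close>, provided that \<open>n / (c N)\<close> is small. The \<open>n\<close>-th return pushes
  Lebesgue measure on \<open>E\<close> to a measure whose density on \<open>E\<close> is bounded by about \<open>1\<close>, by invariance of
  \<open>\<mu>\<close>, and whose total mass is about \<open>m(E)\<close>; so the density is about \<open>1\<close>. But by the oscillation of the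
  Jacobian and the density of \<open>E\<close> at small scales it is bounded by \<open>1/2\<close> on a definite part of \<open>E\<close>.
\<close>

section \<open>Lifts of covering maps of the circle\<close>

text \<open>An aci\<sigma> may be infinite, so no recurrence comes from the measure itself. It is
  read off from Lebesgue measure in a finite window of times, and this finiteness also makes the
  condition stable under perturbation. Counting \<open>n\<close>-th returns instead of first ones
  forces every return time to be at least \<open>n\<close>; from then on the inverse branches
  contract so much that \<open>v\<close> is nearly constant on each of them, and of the two factors
  \<open>h'\<close> in the conjugated Jacobian only the one at the end of the orbit still varies.
  The amplitude survives as a chain of constants: \<open>v\<close> going from 0 to 1/2 gives the
  ratio 8, bounded distortion leaves 6, perturbation 4, and the points missing from \<open>E\<close>
  3, so returns to the oscillating part have density about 1/3 at most. The proportion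
  \<open>\<kappa>\<close> and the distortion bound \<open>C\<close> are the same at every scale
  \<open>1 / k\<close>; this lets the precision be fixed first, then \<open>E\<close>, and the scale
  last. Mixing is established only for maps with Lipschitz derivative; the maps in the residual set
  inherit just the finite-time estimates.\<close>

locale lift =
  fixes F F' :: "real \<Rightarrow> real" and d :: int
  assumes F_deriv: "\<And>x. (F has_real_derivative F' x) (at x)"
    and F'_cont: "continuous_on UNIV F'"
    and F_shift1: "\<And>x. F (x + 1) = F x + of_int d"
    and F'_nz: "\<And>x. F' x \<noteq> 0"
begin

lemma F_shift: "F (x + of_int i) = F x + of_int (i * d)"
proof -
  have nat: "F (x + of_nat n) = F x + of_int (of_nat n * d)" for x n
  proof (induction n)
    case (Suc n)
    have "F (x + of_nat (Suc n)) = F ((x + of_nat n) + 1)" by (simp add: algebra_simps)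
    then show ?case using Suc F_shift1[of "x + of_nat n"] by (simp add: algebra_simps)
  qed simp
  show ?thesis
  proof (cases "i \<ge> 0")
    case True
    then show ?thesis using nat[of x "nat i"] by simp
  next
    case False
    then show ?thesis using nat[of "x + of_int i" "nat (- i)"] by simp
  qed
qed

lemma F'_shift1: "F' (x + 1) = F' x"
proof -
  have "((\<lambda>y. F (y + 1)) has_real_derivative F' (x + 1)) (at x)"
    using F_deriv[of "x + 1"] by (simp add: DERIV_shift)
  moreover have "((\<lambda>y. F y + of_int d) has_real_derivative F' x) (at x)"
    by (auto intro!: derivative_eq_intros F_deriv)
  ultimately show ?thesis using F_shift1 DERIV_unique by (metis (no_types, lifting) ext)
qed

lemma F'_shift: "F' (x + of_int i) = F' x"
proof -
  have nat: "F' (x + of_nat n) = F' x" for x n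
    by (induction n) (simp_all, metis F'_shift1 add.commute add.left_commute)
  show ?thesis
  proof (cases "i \<ge> 0")
    case True
    then show ?thesis using nat[of x "nat i"] by simp
  next
    case False
    then show ?thesis using nat[of "x + of_int i" "nat (- i)"] by simp
  qed
qed

lemma F_cont: "continuous_on A F"
  using F_deriv by (meson DERIV_isCont continuous_at_imp_continuous_on)

lemma F'_sgn: "(\<forall>x. F' x > 0) \<or> (\<forall>x. F' x < 0)"
proof (rule ccontr)
  assume "\<not> ?thesis"
  then obtain a b where "F' a \<le> 0" "F' b \<ge> 0" by (meson linorder_not_le)
  moreover have "connected (range F')"
    using F'_cont connected_continuous_image by blast
  ultimately have "0 \<in> range F'"
    by (meson connected_contains_Icc atLeastAtMost_iff rangeI subsetD)
  then show False using F'_nz by (metis rangeE)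
qed

lemma F_inj: "inj F"
proof (rule injI)
  fix x y assume e: "F x = F y"
  have *: False if eq: "F a = F b" and lt: "a < b" for a b
  proof -
    obtain z where "F b - F a = (b - a) * F' z"
      using MVT2[OF lt, of F F'] F_deriv by blast
    then show False using eq lt F'_nz[of z] by simp
  qed
  show "x = y" using *[of x y] *[of y x] e by (metis linorder_cases)
qed

lemma d_nz: "d \<noteq> 0"
proof
  assume "d = 0"
  then have "F (0 + 1) = F 0" using F_shift1[of 0] by simp
  then show False using F_inj by (metis injD add_0 zero_neq_one)
qed

lemma F_surj: "surj F"
proof -
  have c: "connected (range F)" using F_cont connected_continuous_image by blast
  have "y \<in> range F" for y
  proof -
    define i where "i = \<lceil>\<bar>y - F 0\<bar>\<rceil>"
    have i: "\<bar>y - F 0\<bar> \<le> of_int i" "0 \<le> i" by (auto simp: i_def)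
    have le: "real_of_int i \<le> of_int (i * \<bar>d\<bar>)"
      unfolding of_int_le_iff using mult_left_mono[of 1 "\<bar>d\<bar>" i] i(2) d_nz by simp
    \<comment> \<open>A shift by \<open>i * sgn d\<close> raises \<open>F\<close> by
      \<open>i * \<bar>d\<bar>\<close>, at least the distance from \<open>F 0\<close> to
      \<open>y\<close>; the opposite shift lowers it as much, and connectedness does the
      rest.\<close>
    have "F (0 + of_int (i * sgn d)) = F 0 + of_int (i * sgn d * d)" by (rule F_shift)
    also have "i * sgn d * d = i * \<bar>d\<bar>" by (simp add: abs_sgn)
    finally have 1: "F (of_int (i * sgn d)) \<ge> y" using i le by simp
    have "F (0 + of_int (- (i * sgn d))) = F 0 + of_int (- (i * sgn d) * d)" by (rule F_shift)
    also have "- (i * sgn d) * d = - (i * \<bar>d\<bar>)" by (simp add: abs_sgn)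
    finally have 2: "F (of_int (- (i * sgn d))) \<le> y" using i le by simp
    show ?thesis using c 1 2 by (meson connected_contains_Icc atLeastAtMost_iff rangeI subsetD)
  qed
  then show ?thesis by blast
qed

abbreviation G where "G \<equiv> inv F"

lemma FG [simp]: "F (G x) = x" by (simp add: F_surj surj_f_inv_f)
lemma GF [simp]: "G (F x) = x" by (simp add: F_inj)

lemma FG_pow: "s \<le> t \<Longrightarrow> (F ^^ s) ((G ^^ t) x) = (G ^^ (t - s)) x"
proof (induction s)
  case (Suc s)
  have "t - s = Suc (t - Suc s)" using Suc by simp
  then show ?case using Suc by simp
qed simp

lemma FG_pow_same [simp]: "(F ^^ t) ((G ^^ t) x) = x" using FG_pow[of t t x] by simp

lemma GF_pow_same [simp]: "(G ^^ t) ((F ^^ t) x) = x"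
  by (induction t arbitrary: x) (simp_all add: funpow_swap1)

lemma G_shift: "G (x + of_int (i * d)) = G x + of_int i"
  using F_shift[of "G x" i] by (metis FG GF)



lemma G_deriv: "(G has_real_derivative inverse (F' (G x))) (at x)"
proof (rule DERIV_inverse_function[where f = F and a = "x - 1" and b = "x + 1"])
  show "isCont G x"
  proof -
    have *: "isCont G (F z)" for z
      by (rule isCont_inverse_function[where d = 1]) (use F_deriv DERIV_isCont in auto)
    show ?thesis using *[of "G x"] by simp
  qed
qed (use F_deriv F'_nz in auto)

lemma G_cont: "continuous_on A G"
  using G_deriv by (meson DERIV_isCont continuous_at_imp_continuous_on)

lemma F_pow_deriv: "((F ^^ t) has_real_derivative (\<Prod>s<t. F' ((F ^^ s) x))) (at x)"
proof (induction t)
  case (Suc t)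
  have "((\<lambda>x. F ((F ^^ t) x)) has_real_derivative (\<Prod>s<t. F' ((F ^^ s) x)) * F' ((F ^^ t) x)) (at x)"
    by (rule DERIV_chain2[OF F_deriv Suc, THEN DERIV_cong]) simp
  then show ?case by (simp add: comp_def)
qed (simp add: id_def)

lemma F_pow_cont: "continuous_on A (F ^^ t)"
  using F_pow_deriv by (meson DERIV_isCont continuous_at_imp_continuous_on)

lemma G_pow_cont: "continuous_on A (G ^^ t)"
proof (induction t)
  case (Suc t)
  then show ?case using continuous_on_compose[OF Suc G_cont] by (simp add: comp_def)
qed (simp add: id_def continuous_on_id)

lemma lift_pow: "lift (F ^^ t) (\<lambda>x. \<Prod>s<t. F' ((F ^^ s) x)) (d ^ t)"
proof
  show "((F ^^ t) has_real_derivative (\<Prod>s<t. F' ((F ^^ s) x))) (at x)" for x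
    by (rule F_pow_deriv)
  show "continuous_on UNIV (\<lambda>x. \<Prod>s<t. F' ((F ^^ s) x))"
    by (intro continuous_intros continuous_on_compose2[OF F'_cont F_pow_cont]) auto
  show "(F ^^ t) (x + 1) = (F ^^ t) x + of_int (d ^ t)" for x
  proof (induction t)
    case (Suc t)
    then show ?case using F_shift[of "(F ^^ t) x" "d ^ t"] by (simp add: mult.commute)
  qed simp
  show "(\<Prod>s<t. F' ((F ^^ s) x)) \<noteq> 0" for x using F'_nz by simp
qed

lemma inv_pow: "inv (F ^^ t) = G ^^ t"
  by (rule inv_equality) auto

text \<open>Moving the end point by a multiple of \<open>d ^ t\<close> moves the preimage by an
  integer, hence not at all on the circle. So the inverse branches of the \<open>t\<close>-th
  iterate over \<open>x\<close> are the points over \<open>x + real i\<close> with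
  \<open>i < nat \<bar>d ^ t\<bar>\<close>; all sums over branches below have this form.\<close>

lemma G_pow_shift: "(G ^^ t) (x + of_int (i * d ^ t)) = (G ^^ t) x + of_int i"
  using lift.G_shift[OF lift_pow, of t x i] by (simp add: inv_pow)

text \<open>The Jacobian of the \<open>t\<close>-th iterate, as a function of the end point of the orbit.\<close>

definition J :: "nat \<Rightarrow> real \<Rightarrow> real" where
  "J t x = (\<Prod>s<t. \<bar>F' ((G ^^ Suc s) x)\<bar>)"

lemma J_pos: "J t x > 0" unfolding J_def using F'_nz by (intro prod_pos) simp

lemma J_0 [simp]: "J 0 x = 1" by (simp add: J_def)

lemma J_Suc: "J (Suc t) x = J t x * \<bar>F' ((G ^^ Suc t) x)\<bar>" by (simp add: J_def)

lemma J_add: "J (s + t) x = J s x * J t ((G ^^ s) x)"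
  by (induction t) (simp_all add: J_Suc funpow_add add.commute flip: funpow_add, simp add: funpow_add)

text \<open>The same factors in reverse order, along the forward orbit of the starting point; this
  is the absolute derivative of \<open>F ^^ t\<close> there.\<close>

lemma J_eq: "J t x = \<bar>\<Prod>s<t. F' ((F ^^ s) ((G ^^ t) x))\<bar>"
proof -
  have "J t x = (\<Prod>s<t. \<bar>F' ((G ^^ (t - s)) x)\<bar>)"
    unfolding J_def by (rule prod.reindex_bij_witness[of _ "\<lambda>s. t - Suc s" "\<lambda>s. t - Suc s"]) (auto simp: Suc_diff_Suc)
  also have "\<dots> = (\<Prod>s<t. \<bar>F' ((F ^^ s) ((G ^^ t) x))\<bar>)"
    by (rule prod.cong) (simp_all add: FG_pow)
  finally show ?thesis by (simp add: abs_prod)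
qed

lemma J_cont: "continuous_on A (J t)"
  unfolding J_def[abs_def]
  by (intro continuous_intros continuous_on_compose2[OF F'_cont G_pow_cont]) auto

lemma G_pow_deriv: "((G ^^ t) has_real_derivative inverse (\<Prod>s<t. F' ((F ^^ s) ((G ^^ t) x)))) (at x)"
  using lift.G_deriv[OF lift_pow, of t x] by (simp add: inv_pow)

lemma J_shift: "J t (x + of_int (i * d ^ t)) = J t x"
  unfolding J_eq G_pow_shift lift.F'_shift[OF lift_pow] ..

end

lemma (in lift) G_pow_lipschitz:
  assumes "\<And>z. z \<in> {x..y} \<Longrightarrow> c \<le> J t z" "c > 0" "x \<le> y"
  shows "\<bar>(G ^^ t) x - (G ^^ t) y\<bar> \<le> \<bar>x - y\<bar> / c"
proof (cases "x = y")
  case False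
  with assms have "x < y" by simp
  from MVT2[OF this, of "G ^^ t" "\<lambda>z. inverse (\<Prod>s<t. F' ((F ^^ s) ((G ^^ t) z)))"]
  obtain z where z: "x < z" "z < y"
    "(G ^^ t) y - (G ^^ t) x = (y - x) * inverse (\<Prod>s<t. F' ((F ^^ s) ((G ^^ t) z)))"
    using G_pow_deriv by blast
  then have "\<bar>(G ^^ t) y - (G ^^ t) x\<bar> = \<bar>y - x\<bar> / J t z"
    by (simp add: J_eq abs_mult divide_inverse abs_inverse)
  also have "\<dots> \<le> \<bar>y - x\<bar> / c"
    using assms(1)[of z] assms(2) z by (intro divide_left_mono) (auto intro: mult_pos_pos simp: J_pos)
  finally show ?thesis by (simp add: abs_minus_commute)
qed simp

subsection \<open>Change of variables\<close>

lemma nn_integral_periodic_shift: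
  fixes k :: "real \<Rightarrow> ennreal"
  assumes [measurable]: "k \<in> borel_measurable borel" and per: "\<And>x. k (x + 1) = k x"
  shows "(\<integral>\<^sup>+x\<in>{a..<a + 1}. k x \<partial>lborel) = (\<integral>\<^sup>+x\<in>{0..<1}. k x \<partial>lborel)"
proof -
  have nat: "k (x + of_nat n) = k x" for x n
    by (induction n) (simp_all, metis per add.commute add.left_commute)
  have int: "k (x + of_int i) = k x" for x i
  proof (cases "i \<ge> 0")
    case True
    then show ?thesis using nat[of x "nat i"] by simp
  next
    case False
    then show ?thesis using nat[of "x + of_int i" "nat (- i)"] by simp
  qed
  have sh: "(\<integral>\<^sup>+x\<in>{b..<c}. k x \<partial>lborel) = (\<integral>\<^sup>+x\<in>{b + of_int i..<c + of_int i}. k x \<partial>lborel)" for b c i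
  proof -
    have "(\<integral>\<^sup>+x\<in>{b + of_int i..<c + of_int i}. k x \<partial>lborel) =
      ennreal \<bar>1\<bar> * (\<integral>\<^sup>+x. k (of_int i + 1 * x) * indicator {b + of_int i..<c + of_int i} (of_int i + 1 * x) \<partial>lborel)"
      by (rule nn_integral_real_affine[where t = "of_int i" and c = 1, THEN trans]) auto
    also have "\<dots> = (\<integral>\<^sup>+x\<in>{b..<c}. k x \<partial>lborel)"
      using int by (auto intro!: nn_integral_cong simp: indicator_def add.commute)
    finally show ?thesis by simp
  qed
  have split: "(\<integral>\<^sup>+x\<in>{b..<e}. k x \<partial>lborel) = (\<integral>\<^sup>+x\<in>{b..<c}. k x \<partial>lborel) + (\<integral>\<^sup>+x\<in>{c..<e}. k x \<partial>lborel)"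
    if "b \<le> c" "c \<le> e" for b c e
    using that by (subst nn_integral_add[symmetric]) (auto intro!: nn_integral_cong split: split_indicator)
  define i where "i = \<lfloor>a\<rfloor>"
  define r where "r = frac a"
  have r: "0 \<le> r" "r \<le> 1" "a = r + of_int i"
    by (auto simp: r_def i_def frac_def) (use floor_correct[of a] in linarith)+
  have "(\<integral>\<^sup>+x\<in>{a..<a + 1}. k x \<partial>lborel) = (\<integral>\<^sup>+x\<in>{r..<r + 1}. k x \<partial>lborel)"
    using sh[of r "r + 1" i] r by (simp add: algebra_simps)
  also have "\<dots> = (\<integral>\<^sup>+x\<in>{r..<1}. k x \<partial>lborel) + (\<integral>\<^sup>+x\<in>{1..<r + 1}. k x \<partial>lborel)"
    using split[of r 1 "r + 1"] r by simp
  also have "(\<integral>\<^sup>+x\<in>{1..<r + 1}. k x \<partial>lborel) = (\<integral>\<^sup>+x\<in>{0..<r}. k x \<partial>lborel)"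
    using sh[of 0 r 1] by simp
  finally show ?thesis using split[of 0 r 1] r by (simp add: add.commute)
qed

lemma nn_integral_blocks:
  fixes k :: "real \<Rightarrow> ennreal"
  assumes [measurable]: "k \<in> borel_measurable borel"
  shows "(\<integral>\<^sup>+x\<in>{0..<real n}. k x \<partial>lborel) = (\<Sum>i<n. \<integral>\<^sup>+x\<in>{0..<1}. k (x + real i) \<partial>lborel)"
proof (induction n)
  case (Suc n)
  have "(\<integral>\<^sup>+x\<in>{0..<real (Suc n)}. k x \<partial>lborel) =
      (\<integral>\<^sup>+x\<in>{0..<real n}. k x \<partial>lborel) + (\<integral>\<^sup>+x\<in>{real n..<real n + 1}. k x \<partial>lborel)"
    by (subst nn_integral_add[symmetric]) (auto intro!: nn_integral_cong split: split_indicator)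
  also have "(\<integral>\<^sup>+x\<in>{real n..<real n + 1}. k x \<partial>lborel) = (\<integral>\<^sup>+x\<in>{0..<1}. k (x + real n) \<partial>lborel)"
    by (subst nn_integral_real_affine[where t = "real n" and c = 1])
      (auto intro!: nn_integral_cong simp: indicator_def add.commute)
  finally show ?case using Suc by simp
qed simp

text \<open>\<open>G\<close> maps an interval of length \<open>\<bar>d\<bar>\<close> onto one
  period; it is cut into unit intervals, one for each inverse branch.\<close>

lemma (in lift) nn_integral_lift:
  fixes k :: "real \<Rightarrow> ennreal"
  assumes k[measurable]: "k \<in> borel_measurable borel" and per: "\<And>x. k (x + 1) = k x"
  shows "(\<integral>\<^sup>+y\<in>{0..<1}. k y \<partial>lborel) =
    (\<Sum>i<nat \<bar>d\<bar>. \<integral>\<^sup>+x\<in>{0..<1}. k (G (x + real i)) * ennreal (1 / \<bar>F' (G (x + real i))\<bar>) \<partial>lborel)"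
proof -
  \<comment> \<open>The increasing case, for an arbitrary lift: it is applied a second time to the
    reflected map.\<close>
  have pos: "(\<integral>\<^sup>+y\<in>{0..<1}. k y \<partial>lborel) =
    (\<Sum>i<nat \<bar>e\<bar>. \<integral>\<^sup>+x\<in>{0..<1}. k (inv H (x + real i)) * ennreal (1 / \<bar>H' (inv H (x + real i))\<bar>) \<partial>lborel)"
    if L: "lift H H' e" and p: "\<forall>x. H' x > 0"
      and k[measurable]: "k \<in> borel_measurable borel" and per: "\<And>x. k (x + 1) = k x"
    for H H' e and k :: "real \<Rightarrow> ennreal"
  proof -
    interpret H: lift H H' e by (rule L)
    have inc: "H x < H y" if "x < y" for x y
      using DERIV_pos_imp_increasing[OF that] H.F_deriv p by blast
    have e: "e > 0" using inc[of 0 1] H.F_shift1[of 0] by simp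
    define g where "g = inv H"
    have gm[measurable]: "g \<in> borel_measurable borel"
      unfolding g_def by (rule borel_measurable_continuous_onI) (rule H.G_cont)
    have H'm[measurable]: "H' \<in> borel_measurable borel"
      by (rule borel_measurable_continuous_onI) (rule H.F'_cont)
    have ge: "g (real_of_int e) = g 0 + 1" using H.G_shift[of 0 1] by (simp add: g_def)
    have "(\<integral>\<^sup>+y\<in>{0..<1}. k y \<partial>lborel) = (\<integral>\<^sup>+y\<in>{g 0..<g 0 + 1}. k y \<partial>lborel)"
      by (rule nn_integral_periodic_shift[symmetric]) (use per in auto)
    also have "\<dots> = (\<integral>\<^sup>+y\<in>{g 0..g (real_of_int e)}. k y \<partial>lborel)"
      by (rule nn_integral_cong_AE, rule AE_mp[OF AE_lborel_singleton[of "g 0 + 1"]])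
        (auto simp: ge split: split_indicator)
    also have "\<dots> = (\<integral>\<^sup>+x. k (g x) * ennreal (inverse (H' (g x))) * indicator {0..real_of_int e} x \<partial>lborel)"
    proof (rule nn_integral_substitution_aux)
      show "(g has_real_derivative inverse (H' (g x))) (at x)" for x
        unfolding g_def by (rule H.G_deriv)
      show "continuous_on {0..real_of_int e} (\<lambda>x. inverse (H' (g x)))"
        unfolding g_def
        by (intro continuous_intros continuous_on_compose2[OF H.F'_cont H.G_cont]) (auto simp: H.F'_nz)
    qed (use p e in \<open>auto simp: less_imp_le\<close>)
    also have "\<dots> = (\<integral>\<^sup>+x\<in>{0..<real (nat \<bar>e\<bar>)}. k (g x) * ennreal (1 / \<bar>H' (g x)\<bar>) \<partial>lborel)"
      by (rule nn_integral_cong_AE, rule AE_mp[OF AE_lborel_singleton[of "real_of_int e"]])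
        (use p e in \<open>auto split: split_indicator simp: divide_inverse abs_of_pos\<close>)
    also have "\<dots> = (\<Sum>i<nat \<bar>e\<bar>. \<integral>\<^sup>+x\<in>{0..<1}. k (g (x + real i)) * ennreal (1 / \<bar>H' (g (x + real i))\<bar>) \<partial>lborel)"
      by (rule nn_integral_blocks) simp
    finally show ?thesis by (simp add: g_def)
  qed
  consider "\<forall>x. F' x > 0" | "\<forall>x. F' x < 0" using F'_sgn by blast
  then show ?thesis
  proof cases
    case 1
    show ?thesis by (rule pos[OF lift_axioms 1 k per])
  next
    case 2
    \<comment> \<open>Reflecting the source turns a decreasing lift into an increasing one of degree
      \<open>- d\<close>.\<close>
    have L: "lift (\<lambda>x. F (- x)) (\<lambda>x. - F' (- x)) (- d)"
    proof
      show "((\<lambda>x. F (- x)) has_real_derivative - F' (- x)) (at x)" for x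
        by (rule DERIV_mirror[THEN iffD1, OF F_deriv[of "- x"], simplified])
      show "continuous_on UNIV (\<lambda>x. - F' (- x))"
        by (intro continuous_intros continuous_on_compose2[OF F'_cont]) auto
      show "F (- (x + 1)) = F (- x) + of_int (- d)" for x
        using F_shift[of "- x" "-1"] by simp
    qed (simp add: F'_nz)
    have inv: "inv (\<lambda>x. F (- x)) = (\<lambda>x. - G x)" by (rule inv_equality) auto
    have per': "k (- (x + 1)) = k (- x)" for x using per[of "- x - 1"] by simp
    have "(\<integral>\<^sup>+y\<in>{0..<1}. k y \<partial>lborel) = (\<integral>\<^sup>+y\<in>{-1..<-1 + 1}. k y \<partial>lborel)"
      by (rule nn_integral_periodic_shift[symmetric]) (use per in auto)
    also have "\<dots> = (\<integral>\<^sup>+y. k (- y) * indicator {-1..<0} (- y) \<partial>lborel)"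
      by (subst nn_integral_real_affine[where t = 0 and c = "-1"]) auto
    also have "\<dots> = (\<integral>\<^sup>+y\<in>{0..<1}. k (- y) \<partial>lborel)"
      by (rule nn_integral_cong_AE, rule AE_mp[OF AE_lborel_singleton[of "0"]],
          rule AE_mp[OF AE_lborel_singleton[of "1"]]) (auto split: split_indicator)
    also have "\<dots> = (\<Sum>i<nat \<bar>- d\<bar>. \<integral>\<^sup>+x\<in>{0..<1}. k (- inv (\<lambda>x. F (- x)) (x + real i)) *
        ennreal (1 / \<bar>- F' (- inv (\<lambda>x. F (- x)) (x + real i))\<bar>) \<partial>lborel)"
      by (rule pos[OF L]) (use 2 per' in auto)
    finally show ?thesis by (simp add: inv)
  qed
qed

lemma (in lift) nn_integral_lift_pow:
  fixes k :: "real \<Rightarrow> ennreal"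
  assumes "k \<in> borel_measurable borel" and "\<And>x. k (x + 1) = k x"
  shows "(\<integral>\<^sup>+y\<in>{0..<1}. k y \<partial>lborel) =
    (\<Sum>i<nat \<bar>d ^ t\<bar>. \<integral>\<^sup>+x\<in>{0..<1}. k ((G ^^ t) (x + real i)) * ennreal (1 / J t (x + real i)) \<partial>lborel)"
  using lift.nn_integral_lift[OF lift_pow assms, of t] by (simp add: inv_pow J_eq)

section \<open>Circle maps, their lifts and the C1 distance\<close>

lemma dist_proj: "dist (proj x) (proj y) = \<bar>(x - y) - of_int (round (x - y))\<bar>"
  by (simp add: dist_circle.abs_eq)

lemma proj_add_int [simp]: "proj (x + of_int i) = proj x" "proj (x + real n) = proj x" "proj (x + 1) = proj x"
  by (simp_all add: proj_eq_iff)

text \<open>The circle distance is the distance of the difference to the nearest integer, and that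
  is a 1-Lipschitz function of the difference.\<close>

lemma dist_proj_diff_le:
  "\<bar>dist (proj a) (proj b) - dist (proj a') (proj b')\<bar> \<le> \<bar>(a - b) - (a' - b')\<bar>"
proof -
  have *: "dist (proj a) (proj b) - dist (proj a') (proj b') \<le> \<bar>(a - b) - (a' - b')\<bar>" for a b a' b'
    unfolding dist_proj
    using round_diff_minimal[of "a - b" "round (a' - b')"] by linarith
  show ?thesis using *[of a b a' b'] *[of a' b' a b] by (simp add: abs_le_iff)
qed

lemma continuous_on_circle_iff:
  fixes g :: "circle \<Rightarrow> 'a::topological_space"
  shows "continuous_on UNIV g \<longleftrightarrow> continuous_on UNIV (\<lambda>x. g (proj x))"
proof
  assume "continuous_on UNIV g"
  then show "continuous_on UNIV (\<lambda>x. g (proj x))"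
    by (rule continuous_on_compose2[OF _ continuous_on_proj]) auto
next
  assume c: "continuous_on UNIV (\<lambda>x. g (proj x))"
  have "open (g -` B)" if "open B" for B
    using c that unfolding open_circle_iff_quotient
    by (simp add: continuous_on_open_vimage vimage_def)
  then show "continuous_on UNIV g" by (simp add: continuous_on_open_vimage)
qed

locale circle_lift = lift +
  fixes f :: "circle \<Rightarrow> circle"
  assumes f_proj: "\<And>x. f (proj x) = proj (F x)"
begin

lemma has_circle_deriv: "has_circle_deriv f (F' x) (proj x)"
  unfolding has_circle_deriv_def using f_proj F_deriv by (intro exI[of _ x] exI[of _ F]) auto

lemma circle_deriv_proj: "circle_deriv f (proj x) = F' x"
  by (rule circle_deriv_eq[OF has_circle_deriv])

lemma f_C1: "f \<in> C1_maps"
  unfolding C1_maps_def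
proof (intro CollectI conjI allI)
  show "\<exists>D. has_circle_deriv f D x" for x using proj_surj[of x] has_circle_deriv by blast
  show "continuous_on UNIV (circle_deriv f)"
    unfolding continuous_on_circle_iff using F'_cont by (simp add: circle_deriv_proj)
qed

lemma f_cont: "continuous_on UNIV f"
  unfolding continuous_on_circle_iff f_proj
  by (rule continuous_on_compose2[OF continuous_on_proj F_cont]) auto

lemma f_pow_proj: "(f ^^ t) (proj x) = proj ((F ^^ t) x)"
  by (induction t) (simp_all add: f_proj)

lemma circle_lift_pow: "circle_lift (F ^^ t) (\<lambda>x. \<Prod>s<t. F' ((F ^^ s) x)) (d ^ t) (f ^^ t)"
  by (intro circle_lift.intro lift_pow circle_lift_axioms.intro f_pow_proj)

lemma circle_deriv_pow: "\<bar>circle_deriv (f ^^ t) (proj x)\<bar> = J t ((F ^^ t) x)"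
  using circle_lift.circle_deriv_proj[OF circle_lift_pow, of t x] by (simp add: J_eq)

lemma expanding_iff:
  "f \<in> expanding_maps \<longleftrightarrow> (\<exists>c>0. \<exists>r>1. \<forall>n\<ge>1. \<forall>x. J n x > c * r ^ n)"
proof -
  have "(\<forall>x. \<bar>circle_deriv (f ^^ n) x\<bar> > C) \<longleftrightarrow> (\<forall>x. J n x > C)" for n C
  proof
    assume *: "\<forall>x. \<bar>circle_deriv (f ^^ n) x\<bar> > C"
    show "\<forall>x. J n x > C"
    proof
      fix x show "J n x > C" using *[rule_format, of "proj ((G ^^ n) x)"] by (simp add: circle_deriv_pow)
    qed
  next
    assume *: "\<forall>x. J n x > C"
    show "\<forall>x. \<bar>circle_deriv (f ^^ n) x\<bar> > C"
    proof
      fix x obtain t where "x = proj t" using proj_surj by blast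
      then show "\<bar>circle_deriv (f ^^ n) x\<bar> > C" using * by (simp add: circle_deriv_pow)
    qed
  qed
  then show ?thesis using f_C1 unfolding expanding_maps_def by blast
qed

end

lemma (in lift) circle_lift_exists: "\<exists>f. circle_lift F F' d f"
proof -
  have "proj (F (rep_circle (proj x))) = proj (F x)" for x
  proof -
    have "proj (rep_circle (proj x)) = proj x" by (metis Quotient_abs_rep Quotient_circle)
    then obtain i where "rep_circle (proj x) - x = of_int i" unfolding proj_eq_iff using Ints_cases by blast
    then have "rep_circle (proj x) = x + of_int i" by simp
    then show ?thesis using F_shift[of x i] by (metis proj_add_int(1))
  qed
  then have "circle_lift F F' d (\<lambda>y. proj (F (rep_circle y)))"
    by (intro circle_lift.intro lift_axioms circle_lift_axioms.intro)
  then show ?thesis by blast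
qed

text \<open>A lift is an antiderivative of the derivative of \<open>f\<close>. Near each point
  \<open>f\<close> has a local lift with the same derivative, so the circle distance
  \<open>e\<close> between \<open>f\<close> and the projected antiderivative has derivative zero; it
  vanishes at \<open>0\<close>.\<close>

lemma ex_circle_lift:
  assumes f: "f \<in> C1_maps" and nonzero: "\<And>x. circle_deriv f x \<noteq> 0" and t0: "f (proj 0) = proj t0"
  shows "\<exists>F d. circle_lift F (\<lambda>x. circle_deriv f (proj x)) d f \<and> F 0 = t0"
proof -
  define \<phi> where "\<phi> x = circle_deriv f (proj x)" for x
  have cont: "continuous_on A \<phi>" for A
    using f unfolding C1_maps_def \<phi>_def continuous_on_circle_iff
    using continuous_on_subset by blast
  obtain F0 where F0: "\<And>x. (F0 has_vector_derivative \<phi> x) (at x)"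
    using einterval_antiderivative[of "-\<infinity>" "\<infinity>" \<phi>] cont[of UNIV]
    by (auto simp: continuous_on_eq_continuous_at)
  define F where "F x = F0 x - F0 0 + t0" for x
  have FD: "(F has_real_derivative \<phi> x) (at x)" for x
    unfolding F_def using F0[of x]
    by (auto intro!: derivative_eq_intros simp: has_real_derivative_iff_has_vector_derivative)
  define e where "e s = dist (f (proj s)) (proj (F s))" for s
  have "(e has_real_derivative 0) (at t)" for t
  proof -
    obtain D where "has_circle_deriv f D (proj t)" using f unfolding C1_maps_def by blast
    then have "has_circle_deriv f (\<phi> t) (proj t)" using circle_deriv_eq \<phi>_def by simp
    then obtain u H where H: "proj t = proj u" "\<forall>\<^sub>F s in nhds u. f (proj s) = proj (H s)"
      "(H has_real_derivative \<phi> t) (at u)" unfolding has_circle_deriv_def by blast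
    define k where "k = u - t"
    have k: "k \<in> \<int>" using H(1) unfolding k_def by (metis proj_eq_iff)
    have u: "u = t + k" by (simp add: k_def)
    define K where "K s = H (s + k)" for s
    have K': "(K has_real_derivative \<phi> t) (at t)"
      using H(3) unfolding K_def[abs_def] u by (simp add: DERIV_shift)
    have "filterlim (\<lambda>s. s + k) (nhds u) (nhds t)"
      unfolding u by (intro tendsto_intros filterlim_ident)
    then have "\<forall>\<^sub>F s in nhds t. f (proj (s + k)) = proj (H (s + k))"
      using H(2) by (rule eventually_compose_filterlim[rotated])
    moreover have "proj (s + k) = proj s" for s using k by (simp add: proj_eq_iff)
    ultimately have ev: "\<forall>\<^sub>F s in nhds t. f (proj s) = proj (K s)" by (simp add: K_def)
    have "((\<lambda>s. K s - F s) has_real_derivative 0) (at t)"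
      using DERIV_diff[OF K' FD[of t]] by simp
    then have lim: "((\<lambda>s. ((K s - F s) - (K t - F t)) / (s - t)) \<longlongrightarrow> 0) (at t)"
      unfolding has_field_derivative_iff .
    have kt: "f (proj t) = proj (K t)" using eventually_nhds_x_imp_x[OF ev] .
    show ?thesis unfolding has_field_derivative_iff
    proof (rule Lim_null_comparison[OF _ tendsto_rabs_zero[OF lim]])
      show "\<forall>\<^sub>F s in at t. norm ((e s - e t) / (s - t)) \<le> \<bar>(K s - F s - (K t - F t)) / (s - t)\<bar>"
        using ev[unfolded eventually_nhds_conv_at, THEN conjunct1]
      proof eventually_elim
        case (elim s)
        show ?case using dist_proj_diff_le[of "K s" "F s" "K t" "F t"]
          by (simp add: e_def elim kt abs_divide divide_right_mono)
      qed
    qed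
  qed
  then have "e x = e 0" for x by (intro DERIV_isconst_all) auto
  then have fp: "f (proj x) = proj (F x)" for x using t0 by (simp add: e_def F_def)
  have sh: "\<phi> (x + 1) = \<phi> x" for x by (simp add: \<phi>_def)
  \<comment> \<open>The increment over a period is constant because \<open>\<phi>\<close> is
    periodic, and an integer because both ends project to one point.\<close>
  have "((\<lambda>x. F (x + 1) - F x) has_real_derivative 0) (at x)" for x
    using DERIV_diff[OF DERIV_shift[THEN iffD1, OF FD[of "x + 1"]] FD[of x]] sh by simp
  then have c: "F (x + 1) - F x = F (0 + 1) - F 0" for x
    by (intro DERIV_isconst_all) auto
  have "proj (F (0 + 1)) = proj (F 0)" using fp[of "0 + 1"] fp[of 0] by (metis proj_add_int(3))
  then obtain d where d: "F (0 + 1) - F 0 = of_int d" unfolding proj_eq_iff using Ints_cases by blast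
  have "lift F \<phi> d"
    by standard (use FD cont d c nonzero in \<open>auto simp: \<phi>_def algebra_simps\<close>)
  then have "circle_lift F \<phi> d f" by (intro circle_lift.intro circle_lift_axioms.intro fp)
  then show ?thesis by (intro exI[of _ F] exI[of _ d]) (simp add: \<phi>_def[abs_def] F_def)
qed

lemma expanding_deriv_nz:
  assumes "f \<in> expanding_maps" shows "circle_deriv f x \<noteq> 0"
proof -
  obtain c r where "c > 0" "r > 1" "\<And>x n. n \<ge> 1 \<Longrightarrow> \<bar>circle_deriv (f ^^ n) x\<bar> > c * r ^ n"
    using assms unfolding expanding_maps_def by blast
  from this(3)[of 1 x] this(1,2) have "\<bar>circle_deriv (f ^^ 1) x\<bar> > c * r ^ 1" "c * r ^ 1 > 0" by simp_all
  then have "\<bar>circle_deriv f x\<bar> > 0" by (simp add: comp_def)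
  then show ?thesis by simp
qed

lemma expanding_lift:
  assumes "f \<in> expanding_maps"
  obtains F F' d where "circle_lift F F' d f"
proof -
  obtain t0 where "f (proj 0) = proj t0" using proj_surj by blast
  then show ?thesis using ex_circle_lift[of f t0] assms expanding_deriv_nz that
    by (metis (no_types, lifting) expanding_maps_def mem_Collect_eq)
qed

lemma C1_dist_le_lift:
  assumes "circle_lift F F' d f" "circle_lift H H' e g"
    and "\<And>x. \<bar>F x - H x\<bar> \<le> a" "\<And>x. \<bar>F' x - H' x\<bar> \<le> b"
  shows "C1_dist f g \<le> a + b"
proof -
  interpret f: circle_lift F F' d f by fact
  interpret g: circle_lift H H' e g by fact
  have "(SUP x. dist (f x) (g x)) \<le> a"
  proof (rule cSUP_least)
    fix x obtain t where "x = proj t" using proj_surj by blast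
    then show "dist (f x) (g x) \<le> a"
      using dist_proj_le[of "F t" "H t"] assms(3)[of t] by (simp add: f.f_proj g.f_proj)
  qed simp
  moreover have "(SUP x. \<bar>circle_deriv f x - circle_deriv g x\<bar>) \<le> b"
  proof (rule cSUP_least)
    fix x obtain t where "x = proj t" using proj_surj by blast
    then show "\<bar>circle_deriv f x - circle_deriv g x\<bar> \<le> b"
      using assms(4)[of t] by (simp add: f.circle_deriv_proj g.circle_deriv_proj)
  qed simp
  ultimately show ?thesis using f.f_C1 g.f_C1 by (simp add: C1_dist_def)
qed

text \<open>The starting value is the translate nearest to \<open>F 0\<close>. Over one period
  \<open>F - H\<close> then changes by at most the distance of the derivatives, which is less than
  1, so the integer degrees agree.\<close>

lemma close_lift:
  assumes "circle_lift F F' d f" and g: "g \<in> C1_maps" and nonzero: "\<And>x. circle_deriv g x \<noteq> 0"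
    and dist: "C1_dist f g < \<delta>" and \<delta>: "\<delta> < 1"
  obtains H H' where "circle_lift H H' d g" "\<And>x. \<bar>F x - H x\<bar> \<le> 2 * \<delta>" "\<And>x. \<bar>F' x - H' x\<bar> \<le> \<delta>"
proof -
  interpret f: circle_lift F F' d f by fact
  let ?A = "SUP x. dist (f x) (g x)" and ?B = "SUP x. \<bar>circle_deriv f x - circle_deriv g x\<bar>"
  have A: "dist (f x) (g x) \<le> ?A" for x by (rule cSUP_upper[OF _ bdd_above_dist]) simp
  have B: "\<bar>circle_deriv f x - circle_deriv g x\<bar> \<le> ?B" for x
    by (rule cSUP_upper[OF _ bdd_above_deriv[OF f.f_C1 g]]) simp
  have AB: "?A + ?B < \<delta>" using dist f.f_C1 g by (simp add: C1_dist_def)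
  have A0: "0 \<le> ?A" using A[of undefined] zero_le_dist by (rule order_trans[rotated])
  have B0: "0 \<le> ?B" using B[of undefined] abs_ge_zero by (rule order_trans[rotated])
  obtain t where t: "g (proj 0) = proj t" using proj_surj by blast
  define t0 where "t0 = t + of_int (round (F 0 - t))"
  have t0: "g (proj 0) = proj t0" by (simp add: t0_def t)
  have close0: "\<bar>F 0 - t0\<bar> \<le> ?A"
    using A[of "proj 0"] by (simp add: f.f_proj t dist_proj t0_def algebra_simps)
  obtain H e where H: "circle_lift H (\<lambda>x. circle_deriv g (proj x)) e g" "H 0 = t0"
    using ex_circle_lift[OF g nonzero t0] by blast
  interpret g: circle_lift H "\<lambda>x. circle_deriv g (proj x)" e g by (rule H)
  have B': "\<bar>F' x - circle_deriv g (proj x)\<bar> \<le> ?B" for x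
    using B[of "proj x"] by (simp add: f.circle_deriv_proj)
  have near: "\<bar>F x - H x\<bar> \<le> ?A + ?B" if "x \<in> {0..1}" for x
  proof -
    have "\<bar>(F x - H x) - (F 0 - H 0)\<bar> \<le> ?B * \<bar>x - 0\<bar>"
      using field_differentiable_bound[of UNIV "\<lambda>x. F x - H x" "\<lambda>x. F' x - circle_deriv g (proj x)" ?B x 0]
        B' DERIV_diff[OF f.F_deriv g.F_deriv] by simp
    also have "\<dots> \<le> ?B" using that B0 by (simp add: mult_left_le)
    finally show ?thesis using close0 H(2) by linarith
  qed
  have "\<bar>(F 1 - H 1) - (F 0 - H 0)\<bar> \<le> ?B"
      using field_differentiable_bound[of UNIV "\<lambda>x. F x - H x" "\<lambda>x. F' x - circle_deriv g (proj x)" ?B 1 0]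
        B' DERIV_diff[OF f.F_deriv g.F_deriv] by simp
  then have "\<bar>real_of_int (d - e)\<bar> < 1"
    using f.F_shift1[of 0] g.F_shift1[of 0] AB A0 \<delta> by simp
  then have de: "e = d" by linarith
  have "\<bar>F x - H x\<bar> \<le> 2 * \<delta>" for x
  proof -
    have x: "x = frac x + of_int \<lfloor>x\<rfloor>" by (simp add: frac_def)
    have "F x - H x = F (frac x) - H (frac x)"
      using f.F_shift[of "frac x" "\<lfloor>x\<rfloor>"] g.F_shift[of "frac x" "\<lfloor>x\<rfloor>"] de x by simp
    then show ?thesis using near[of "frac x"] frac_ge_0[of x] frac_lt_1[of x] AB A0 B0 by simp
  qed
  moreover have "\<bar>F' x - circle_deriv g (proj x)\<bar> \<le> \<delta>" for x
    using B'[of x] AB A0 by linarith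
  ultimately show ?thesis using that H(1) de by blast
qed

subsection \<open>Lebesgue measure on the circle\<close>

lemma sets_circle_lebesgue [simp, measurable_cong]: "sets circle_lebesgue = sets borel"
  by (simp add: circle_lebesgue_def)

lemma space_circle_lebesgue [simp]: "space circle_lebesgue = UNIV"
  by (simp add: circle_lebesgue_def)

lemma proj_measurable [measurable]: "proj \<in> borel_measurable borel"
  by (rule borel_measurable_continuous_onI) (rule continuous_on_proj)

lemma nn_integral_circle:
  assumes "k \<in> borel_measurable borel"
  shows "(\<integral>\<^sup>+x. k x \<partial>circle_lebesgue) = (\<integral>\<^sup>+x\<in>{0..<1}. k (proj x) \<partial>lborel)"
  unfolding circle_lebesgue_def
  using assms by (subst nn_integral_distr[OF measurable_proj])
     (auto simp: nn_integral_restrict_space)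

lemma emeasure_circle:
  assumes "A \<in> sets borel"
  shows "emeasure circle_lebesgue A = (\<integral>\<^sup>+x\<in>{0..<1}. indicator A (proj x) \<partial>lborel)"
  using nn_integral_circle[of "indicator A"] assms by simp

interpretation circle_lebesgue: finite_measure circle_lebesgue
  by standard (simp add: emeasure_circle_lebesgue_UNIV)

lemma (in circle_lift) f_pow_measurable [measurable]: "(f ^^ t) \<in> borel_measurable borel"
  by (rule borel_measurable_continuous_onI) (rule circle_lift.f_cont[OF circle_lift_pow])

lemma (in circle_lift) G_pow_measurable [measurable]: "(G ^^ t) \<in> borel_measurable borel"
  by (rule borel_measurable_continuous_onI) (rule G_pow_cont)

lemma (in circle_lift) J_measurable [measurable]: "J t \<in> borel_measurable borel"
  by (rule borel_measurable_continuous_onI) (rule J_cont)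

text \<open>The inner sum is the density, at \<open>x\<close>, of the image under the
  \<open>t\<close>-th iterate of Lebesgue measure restricted to \<open>V\<close>.\<close>

lemma (in circle_lift) emeasure_vimage:
  assumes V[measurable]: "V \<in> sets borel" and Q[measurable]: "Q \<in> sets borel"
  shows "emeasure circle_lebesgue (V \<inter> (f ^^ t) -` Q) =
    (\<integral>\<^sup>+x\<in>{0..<1}. indicator Q (proj x) *
      (\<Sum>i<nat \<bar>d ^ t\<bar>. indicator V (proj ((G ^^ t) (x + real i))) * ennreal (1 / J t (x + real i))) \<partial>lborel)"
proof -
  have [measurable]: "(f ^^ t) -` Q \<in> sets borel"
    using measurable_sets[OF f_pow_measurable Q] by simp
  have "emeasure circle_lebesgue (V \<inter> (f ^^ t) -` Q) =
    (\<integral>\<^sup>+x\<in>{0..<1}. indicator (V \<inter> (f ^^ t) -` Q) (proj x) \<partial>lborel)"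
    by (rule emeasure_circle) simp
  also have "\<dots> = (\<Sum>i<nat \<bar>d ^ t\<bar>. \<integral>\<^sup>+x\<in>{0..<1}. indicator (V \<inter> (f ^^ t) -` Q) (proj ((G ^^ t) (x + real i)))
      * ennreal (1 / J t (x + real i)) \<partial>lborel)"
    by (rule nn_integral_lift_pow) auto
  also have "\<dots> = (\<integral>\<^sup>+x. (\<Sum>i<nat \<bar>d ^ t\<bar>. indicator (V \<inter> (f ^^ t) -` Q) (proj ((G ^^ t) (x + real i)))
      * ennreal (1 / J t (x + real i)) * indicator {0..<1} x) \<partial>lborel)"
    by (subst nn_integral_sum) auto
  also have "\<dots> = (\<integral>\<^sup>+x\<in>{0..<1}. indicator Q (proj x) *
      (\<Sum>i<nat \<bar>d ^ t\<bar>. indicator V (proj ((G ^^ t) (x + real i))) * ennreal (1 / J t (x + real i))) \<partial>lborel)"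
    by (intro nn_integral_cong) (auto simp: indicator_def f_pow_proj sum_distrib_left)
  finally show ?thesis .
qed

section \<open>Return times\<close>

definition visits :: "('a \<Rightarrow> 'a) \<Rightarrow> 'a set \<Rightarrow> nat \<Rightarrow> 'a \<Rightarrow> nat" where
  "visits f B t y = card {s \<in> {1..t}. (f ^^ s) y \<in> B}"

text \<open>As time \<open>t\<close> is itself counted as a visit, \<open>t\<close> is the time of
  the \<open>n\<close>-th return of \<open>y\<close> to \<open>B\<close> when \<open>n\<close> is
  positive.\<close>

definition returns :: "('a \<Rightarrow> 'a) \<Rightarrow> 'a set \<Rightarrow> nat \<Rightarrow> nat \<Rightarrow> 'a set" where
  "returns f B n t = {y \<in> B. (f ^^ t) y \<in> B \<and> visits f B t y = n}"

text \<open>If the orbit of \<open>y\<close> met the other set at time \<open>t - t'\<close>, the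
  \<open>n\<close> visits counted from there together with that point itself would give
  \<open>n + 1\<close> visits of \<open>y\<close> up to time \<open>t\<close>.\<close>

lemma returns_antichain:
  assumes y: "y \<in> returns f B n t" and y': "(f ^^ (t - t')) y \<in> returns f B n t'" and t: "t' < t"
  shows False
proof -
  let ?A = "{s \<in> {1..t'}. (f ^^ s) ((f ^^ (t - t')) y) \<in> B}"
  have "insert (t - t') ((+) (t - t') ` ?A) \<subseteq> {s \<in> {1..t}. (f ^^ s) y \<in> B}"
    using y' t by (auto simp: returns_def funpow_add[symmetric, THEN fun_cong, unfolded comp_def] add.commute)
  then have "card (insert (t - t') ((+) (t - t') ` ?A)) \<le> n"
    using y card_mono[of "{s \<in> {1..t}. (f ^^ s) y \<in> B}"] by (auto simp: returns_def visits_def)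
  moreover have "card (insert (t - t') ((+) (t - t') ` ?A)) = Suc (card ?A)"
    by (subst card_insert_disjoint) (auto simp: card_image)
  moreover have "card ?A = n" using y' by (simp add: returns_def visits_def)
  ultimately show False by simp
qed

text \<open>Let \<open>t0\<close> be the first visit of the orbit to \<open>Q\<close>. Every later
  visit within the window is one of the fewer than \<open>n\<close> visits to \<open>B\<close> made
  by the point at time \<open>t0\<close>.\<close>

lemma few_visits:
  assumes Q: "Q = {y \<in> B. visits f B N y < n}"
  shows "card {t \<in> {..<N}. (f ^^ t) z \<in> Q} \<le> n"
proof (rule ccontr)
  let ?A = "{t \<in> {..<N}. (f ^^ t) z \<in> Q}"
  assume "\<not> ?thesis"
  then have c: "card ?A > n" by simp
  then have ne: "?A \<noteq> {}" by (metis card.empty less_nat_zero_code)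
  define t0 where "t0 = Min ?A"
  have t0: "t0 \<in> ?A" unfolding t0_def by (rule Min_in) (use ne in auto)
  have le: "t0 \<le> t" if "t \<in> ?A" for t unfolding t0_def by (rule Min_le) (use that in auto)
  have "(\<lambda>t. t - t0) ` (?A - {t0}) \<subseteq> {s \<in> {1..N}. (f ^^ s) ((f ^^ t0) z) \<in> B}"
  proof
    fix s assume "s \<in> (\<lambda>t. t - t0) ` (?A - {t0})"
    then obtain t where t: "t \<in> ?A" "t \<noteq> t0" "s = t - t0" by blast
    then have "s + t0 = t" "s \<ge> 1" "s \<le> N" using le[OF t(1)] by auto
    moreover have "(f ^^ s) ((f ^^ t0) z) = (f ^^ (s + t0)) z" by (simp add: funpow_add)
    ultimately show "s \<in> {s \<in> {1..N}. (f ^^ s) ((f ^^ t0) z) \<in> B}" using t(1) Q by auto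
  qed
  then have "card ((\<lambda>t. t - t0) ` (?A - {t0})) \<le> visits f B N ((f ^^ t0) z)"
    unfolding visits_def by (intro card_mono) auto
  moreover have "inj_on (\<lambda>t. t - t0) (?A - {t0})"
    using le by (intro inj_onI) (metis DiffD1 le_add_diff_inverse2)
  then have "card ((\<lambda>t. t - t0) ` (?A - {t0})) = card ?A - 1"
    using t0 by (simp add: card_image)
  moreover have "visits f B N ((f ^^ t0) z) < n" using t0 Q by simp
  ultimately show False using c by simp
qed

lemma visits_le: "visits f B t y \<le> t"
proof -
  have "visits f B t y \<le> card {1..t}" unfolding visits_def by (rule card_mono) auto
  then show ?thesis by simp
qed

text \<open>The count of visits grows by at most one per step, so it equals \<open>n\<close> when it
  first reaches \<open>n\<close>, and this takes at least \<open>n\<close> steps.\<close>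

lemma returns_exhaust:
  assumes "y \<in> B" "n \<le> visits f B N y" "n \<ge> 1"
  obtains t where "t \<in> {n..N}" "y \<in> returns f B n t"
proof -
  define t where "t = (LEAST t. n \<le> visits f B t y)"
  have t: "n \<le> visits f B t y" unfolding t_def by (rule LeastI[of _ N]) (rule assms)
  have tN: "t \<le> N" unfolding t_def by (rule Least_le) (rule assms)
  have tn: "n \<le> t" using t visits_le[of f B t y] by simp
  then obtain u where u: "t = Suc u" using assms(3) by (cases t) auto
  have "\<not> n \<le> visits f B u y" using not_less_Least[of u "\<lambda>t. n \<le> visits f B t y"] u unfolding t_def by auto
  moreover have "{s \<in> {1..t}. (f ^^ s) y \<in> B} =
      (if (f ^^ t) y \<in> B then insert t {s \<in> {1..u}. (f ^^ s) y \<in> B} else {s \<in> {1..u}. (f ^^ s) y \<in> B})"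
    unfolding u by (auto simp: le_Suc_eq)
  then have "visits f B t y = (if (f ^^ t) y \<in> B then Suc (visits f B u y) else visits f B u y)"
    unfolding visits_def by (auto simp: u)
  ultimately have "(f ^^ t) y \<in> B" "visits f B t y = n" using t by (auto split: if_splits)
  then show ?thesis using that[of t] assms(1) tN tn by (simp add: returns_def)
qed

lemma returns_measurable:
  assumes B[measurable]: "B \<in> sets M" and f[measurable]: "f \<in> measurable M M"
  shows "returns f B n t \<in> sets M"
proof -
  have "real (visits f B t y) = (\<Sum>s\<in>{1..t}. indicator B ((f ^^ s) y))" for y
    unfolding visits_def by (simp add: indicator_def sum.If_cases Int_def)
  then have "returns f B n t = {y \<in> space M. y \<in> B \<and> (f ^^ t) y \<in> B \<and> (\<Sum>s\<in>{1..t}. indicator B ((f ^^ s) y)) = real n}"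
    using sets.sets_into_space[OF B] unfolding returns_def
    by (metis (no_types, lifting) Collect_cong of_nat_eq_iff subsetD)
  then show ?thesis by simp
qed

section \<open>Density points\<close>

text \<open>Lebesgue density with one scale \<open>r\<close> for all intervals around a point. A bad
  interval that meets a compact \<open>K\<close> inside \<open>E\<close> lies in a neighbourhood
  \<open>W\<close> with \<open>W - K\<close> tiny, while more than a fraction
  \<open>\<epsilon>\<close> of it lies in \<open>W - K\<close>; Vitali covering sums this over
  disjoint intervals.\<close>

lemma density_real:
  fixes E :: "real set"
  assumes E[measurable]: "E \<in> sets borel" and \<epsilon>: "\<epsilon> > 0" and e: "e > 0"
  shows "\<exists>r>0. emeasure lborel (E \<inter> {0..1} \<inter>
    \<Union>{{a<..<b} | a b. a < b \<and> b - a < r \<and> measure lborel ({a<..<b} - E) > \<epsilon> * (b - a)}) \<le> ennreal e"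
proof -
  define E1 where "E1 = E \<inter> {0..1}"
  have E1: "E1 \<in> sets lebesgue" "E1 \<in> lmeasurable" unfolding E1_def
    by (auto intro!: bounded_set_imp_lmeasurable intro: bounded_subset[of "{0..1}"])
  obtain K where K: "compact K" "K \<subseteq> E1" "E1 - K \<in> lmeasurable" "emeasure lebesgue (E1 - K) < ennreal (e / 2)"
  proof -
    from sets_lebesgue_inner_closed[OF E1(1), of "e / 2"] e
    obtain T where "closed T" "T \<subseteq> E1" "E1 - T \<in> lmeasurable" "emeasure lebesgue (E1 - T) < ennreal (e / 2)"
      by auto
    moreover have "bounded T" using \<open>T \<subseteq> E1\<close> by (auto simp: E1_def intro: bounded_subset[of "{0..1}"])
    ultimately show ?thesis using that compact_eq_bounded_closed by blast
  qed
  \<comment> \<open>Vitali's factor 5 and the fraction \<open>\<epsilon>\<close> turn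
    \<open>\<delta>\<close> into \<open>5 / \<epsilon> * \<delta> = e / 4\<close>; the part outside
    \<open>K\<close> adds at most \<open>e / 2\<close>.\<close>
  define \<delta> where "\<delta> = \<epsilon> * e / 20"
  have \<delta>: "\<delta> > 0" using \<epsilon> e by (simp add: \<delta>_def)
  have Kb[measurable]: "K \<in> sets borel" using K(1) by (simp add: borel_compact)
  obtain W where W: "open W" "K \<subseteq> W" "W - K \<in> lmeasurable" "emeasure lebesgue (W - K) < ennreal \<delta>"
    using sets_lebesgue_outer_open[of K \<delta>] \<delta> K(1) by auto
  have Wb[measurable]: "W \<in> sets borel" using W by simp
  \<comment> \<open>An interval shorter than the gap between \<open>K\<close> and the complement of
    \<open>W\<close> cannot leave \<open>W\<close> once it meets \<open>K\<close>.\<close>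
  obtain r where r: "r > 0" "\<And>x y. x \<in> K \<Longrightarrow> y \<in> - W \<Longrightarrow> r \<le> dist x y"
    using separate_compact_closed[OF K(1), of "- W"] W(1,2) by (metis Compl_disjoint2 closed_Compl disjoint_eq_subset_Compl double_compl)
  define bad where "bad = {(a, b). a < b \<and> b - a < r \<and> measure lborel ({a<..<b} - E) > \<epsilon> * (b - a)}"
  define BK where "BK = {p \<in> bad. {fst p<..<snd p} \<inter> K \<noteq> {}}"
  define ctr rad where "ctr p = (fst p + snd p) / 2" and "rad p = (snd p - fst p) / 2" for p :: "real \<times> real"
  have ball: "ball (ctr p) (rad p) = {fst p<..<snd p}" for p
    unfolding ball_eq_greaterThanLessThan ctr_def rad_def by (simp add: field_simps)
  have rad: "0 < rad p \<and> rad p \<le> r" if "p \<in> BK" for p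
    using that r by (auto simp: BK_def bad_def rad_def)
  obtain C where C: "countable C" "C \<subseteq> BK"
    "pairwise (\<lambda>i j. disjnt (ball (ctr i) (rad i)) (ball (ctr j) (rad j))) C"
    "(\<Union>p\<in>BK. ball (ctr p) (rad p)) \<subseteq> (\<Union>p\<in>C. ball (ctr p) (5 * rad p))"
    using Vitali_covering_lemma_balls[OF order_refl, of BK rad r ctr] rad by blast
  have sub: "{fst p<..<snd p} \<subseteq> W" if "p \<in> BK" for p
  proof
    fix y assume y: "y \<in> {fst p<..<snd p}"
    have "{fst p<..<snd p} \<inter> K \<noteq> {}" using that by (simp add: BK_def)
    then obtain x where x: "x \<in> K" "x \<in> {fst p<..<snd p}" by blast
    have "dist x y < r" using x y that by (auto simp: BK_def bad_def dist_real_def)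
    then show "y \<in> W" using r(2)[OF x(1), of y] by force
  qed
  have one: "emeasure lborel (ball (ctr p) (5 * rad p)) \<le> ennreal (5 / \<epsilon>) * emeasure lborel ({fst p<..<snd p} - K)"
    if "p \<in> BK" for p
  proof -
    have p: "fst p < snd p" "\<epsilon> * (snd p - fst p) < measure lborel ({fst p<..<snd p} - E)"
      using that by (auto simp: BK_def bad_def)
    have "emeasure lborel ({fst p<..<snd p} - E) \<le> emeasure lborel {fst p<..<snd p}"
      by (rule emeasure_mono) auto
    also have "\<dots> < \<infinity>" using p(1) by simp
    finally have "emeasure lborel ({fst p<..<snd p} - E) = ennreal (measure lborel ({fst p<..<snd p} - E))"
      by (intro emeasure_eq_ennreal_measure) simp
    then have "ennreal (\<epsilon> * (snd p - fst p)) \<le> emeasure lborel ({fst p<..<snd p} - E)"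
      using p(2) by (simp add: ennreal_leI)
    also have "\<dots> \<le> emeasure lborel ({fst p<..<snd p} - K)"
      using K(2) by (intro emeasure_mono) (auto simp: E1_def)
    finally have "ennreal (5 / \<epsilon>) * ennreal (\<epsilon> * (snd p - fst p)) \<le> ennreal (5 / \<epsilon>) * emeasure lborel ({fst p<..<snd p} - K)"
      by (rule mult_left_mono) simp
    moreover have "ennreal (5 / \<epsilon>) * ennreal (\<epsilon> * (snd p - fst p)) = ennreal (5 * (snd p - fst p))"
      using \<epsilon> p(1) by (subst ennreal_mult[symmetric]) auto
    moreover have "emeasure lborel (ball (ctr p) (5 * rad p)) = ennreal (5 * (snd p - fst p))"
    proof -
      have "emeasure lborel (ball (ctr p) (5 * rad p)) = ennreal (10 * rad p)"
        using rad[OF that] unfolding ball_eq_greaterThanLessThan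
        by (subst emeasure_lborel_Ioo) (simp, simp)
      also have "10 * rad p = 5 * (snd p - fst p)" by (simp add: rad_def)
      finally show ?thesis .
    qed
    ultimately show ?thesis by (metis (no_types))
  qed
  have disj: "disjoint_family_on (\<lambda>p. {fst p<..<snd p} - K) C"
    using C(3) unfolding ball disjoint_family_on_def pairwise_def disjnt_def by blast
  \<comment> \<open>The countable disjoint family is enumerated by \<open>nat\<close>, with empty
    sets at the indices that enumerate nothing.\<close>
  define A where "A n = (if n \<in> to_nat_on C ` C then ball (ctr (from_nat_into C n)) (5 * rad (from_nat_into C n)) else {})" for n
  define D where "D n = (if n \<in> to_nat_on C ` C then {fst (from_nat_into C n)<..<snd (from_nat_into C n)} - K else {})" for n
  have c: "from_nat_into C (to_nat_on C p) = p" if "p \<in> C" for p using that C(1) by simp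
  have cC: "from_nat_into C n \<in> C" if "n \<in> to_nat_on C ` C" for n using that c by auto
  let ?U = "\<Union>{{a<..<b} | a b. a < b \<and> b - a < r \<and> measure lborel ({a<..<b} - E) > \<epsilon> * (b - a)}"
  have [measurable]: "?U \<in> sets borel" by (intro borel_open open_Union) auto
  have "K \<inter> ?U \<subseteq> (\<Union>p\<in>BK. ball (ctr p) (rad p))"
  proof
    fix x assume "x \<in> K \<inter> ?U"
    then obtain a b where ab: "x \<in> K" "a < x" "x < b" "a < b \<and> b - a < r \<and> measure lborel ({a<..<b} - E) > \<epsilon> * (b - a)"
      by auto
    then have "(a, b) \<in> BK" unfolding BK_def bad_def by auto
    then show "x \<in> (\<Union>p\<in>BK. ball (ctr p) (rad p))" using ab(2,3) unfolding ball by force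
  qed
  then have "K \<inter> ?U \<subseteq> (\<Union>p\<in>C. ball (ctr p) (5 * rad p))" using C(4) by blast
  then have "emeasure lborel (K \<inter> ?U) \<le> emeasure lborel (\<Union>p\<in>C. ball (ctr p) (5 * rad p))"
    by (intro emeasure_mono) (auto intro!: borel_open)
  also have "(\<Union>p\<in>C. ball (ctr p) (5 * rad p)) = (\<Union>n. A n)" unfolding A_def by (auto simp: c)
  also have "emeasure lborel (\<Union>n. A n) \<le> (\<Sum>n. emeasure lborel (A n))"
    by (rule emeasure_subadditive_countably) (auto simp: A_def)
  also have "\<dots> \<le> (\<Sum>n. ennreal (5 / \<epsilon>) * emeasure lborel (D n))"
  proof (rule suminf_le)
    fix n show "emeasure lborel (A n) \<le> ennreal (5 / \<epsilon>) * emeasure lborel (D n)"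
    proof (cases "n \<in> to_nat_on C ` C")
      case True
      then have "from_nat_into C n \<in> BK" using cC C(2) by blast
      from one[OF this] show ?thesis using True by (simp add: A_def D_def)
    qed (simp add: A_def)
  qed auto
  also have "\<dots> = ennreal (5 / \<epsilon>) * (\<Sum>n. emeasure lborel (D n))" by simp
  also have "(\<Sum>n. emeasure lborel (D n)) = emeasure lborel (\<Union>n. D n)"
  proof (rule suminf_emeasure)
    show "disjoint_family D"
      unfolding disjoint_family_on_def
    proof (intro ballI impI)
      fix m n :: nat assume mn: "m \<noteq> n"
      show "D m \<inter> D n = {}"
      proof (cases "m \<in> to_nat_on C ` C \<and> n \<in> to_nat_on C ` C")
        case True
        then have "from_nat_into C m \<noteq> from_nat_into C n" using mn c by auto
        then show ?thesis using disj True cC unfolding disjoint_family_on_def D_def by simp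
      qed (auto simp: D_def)
    qed
  qed (auto simp: D_def)
  also have "emeasure lborel (\<Union>n. D n) \<le> emeasure lborel (W - K)"
  proof (rule emeasure_mono)
    have "D n \<subseteq> W - K" for n
    proof (cases "n \<in> to_nat_on C ` C")
      case True
      then have "from_nat_into C n \<in> BK" using cC C(2) by blast
      from sub[OF this] show ?thesis using True unfolding D_def by auto
    qed (simp add: D_def)
    then show "(\<Union>n. D n) \<subseteq> W - K" by blast
  qed simp
  also have "\<dots> \<le> ennreal \<delta>" using W(4) by (simp add: emeasure_completion less_imp_le)
  finally have "emeasure lborel (K \<inter> ?U) \<le> ennreal (5 / \<epsilon>) * ennreal \<delta>" by (simp add: mult_left_mono)
  also have "\<dots> = ennreal (e / 4)" using \<epsilon> e by (simp add: \<delta>_def ennreal_mult[symmetric])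
  finally have 1: "emeasure lborel (K \<inter> ?U) \<le> ennreal (e / 4)" .
  have "emeasure lborel (E1 \<inter> ?U) \<le> emeasure lborel ((K \<inter> ?U) \<union> (E1 - K))"
    unfolding E1_def by (intro emeasure_mono) auto
  also have "\<dots> \<le> emeasure lborel (K \<inter> ?U) + emeasure lborel (E1 - K)"
    unfolding E1_def by (intro emeasure_subadditive) auto
  also have "\<dots> \<le> ennreal (e / 4) + ennreal (e / 2)"
    using K(4) by (intro add_mono 1) (simp add: emeasure_completion E1_def less_imp_le)
  also have "\<dots> \<le> ennreal e" using e by (simp add: ennreal_plus[symmetric] del: ennreal_plus)
  finally show ?thesis using r(1) unfolding E1_def by blast
qed

definition rep01 :: "circle \<Rightarrow> real" where
  "rep01 y = (THE x. x \<in> {0..<1} \<and> proj x = y)"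

lemma rep01_proj: "x \<in> {0..<1} \<Longrightarrow> rep01 (proj x) = x"
  unfolding rep01_def
proof (rule the_equality)
  fix x' assume x: "x \<in> {0..<1}" and x': "x' \<in> {0..<1} \<and> proj x' = proj x"
  then obtain i where "x' - x = of_int i" unfolding proj_eq_iff using Ints_cases by blast
  moreover from this have "\<bar>real_of_int i\<bar> < 1" using x x' by auto
  then have "i = 0" by linarith
  ultimately show "x' = x" by simp
qed simp

lemma rep01: "proj (rep01 y) = y" "rep01 y \<in> {0..<1}"
proof -
  obtain x where "x \<in> {0..<1}" "y = proj x" using range_proj by (metis UNIV_I imageE)
  then show "proj (rep01 y) = y" "rep01 y \<in> {0..<1}" by (simp_all add: rep01_proj)
qed

text \<open>\<open>rep01\<close> jumps at \<open>proj 0\<close>, but its sublevel sets are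
  projections of compact intervals, hence closed, or everything.\<close>

lemma rep01_measurable [measurable]: "rep01 \<in> borel_measurable borel"
proof (rule borel_measurable_iff_le[THEN iffD2], intro allI)
  fix a :: real
  show "{w \<in> space borel. rep01 w \<le> a} \<in> sets borel"
  proof (cases "a < 1")
    case True
    have "{w \<in> space borel. rep01 w \<le> a} = proj ` {0..a}"
    proof safe
      fix w assume "rep01 w \<le> a"
      then show "w \<in> proj ` {0..a}" using rep01[of w] by (intro image_eqI[of _ _ "rep01 w"]) auto
    next
      fix x assume "x \<in> {0..a}"
      then show "rep01 (proj x) \<le> a" using True by (subst rep01_proj) auto
    qed simp
    moreover have "compact (proj ` {0..a})" by (intro compact_continuous_image continuous_on_proj) simp
    ultimately show ?thesis using compact_imp_closed borel_closed by metis
  next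
    case False
    have "{w \<in> space borel. rep01 w \<le> a} = UNIV"
    proof -
      have "rep01 w \<le> a" for w using rep01(2)[of w] False by auto
      then show ?thesis by auto
    qed
    then show ?thesis by simp
  qed
qed

lemma emeasure_circle_real:
  assumes [measurable]: "A \<in> sets borel"
  shows "emeasure circle_lebesgue A = emeasure lborel (proj -` A \<inter> {0..<1})"
proof -
  have [measurable]: "proj -` A \<in> sets borel" using measurable_sets[OF proj_measurable assms] by simp
  have "emeasure circle_lebesgue A = (\<integral>\<^sup>+x. indicator (proj -` A \<inter> {0..<1}) x \<partial>lborel)"
    unfolding emeasure_circle[OF assms] by (intro nn_integral_cong) (auto simp: indicator_def)
  then show ?thesis by simp
qed

text \<open>Badness of an interval is invariant under integer translations, so removing from
  \<open>E\<close> the bad points of one period removes them from the whole preimage; intervals may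
  thus cross an integer.\<close>

lemma density_circle:
  assumes E[measurable]: "E \<in> sets borel" and \<epsilon>: "\<epsilon> > 0" and e: "e > 0"
  obtains r B where "r > 0" "B \<in> sets borel" "B \<subseteq> E" "measure circle_lebesgue (E - B) \<le> e"
    "\<And>a b x. a < x \<Longrightarrow> x < b \<Longrightarrow> b - a < r \<Longrightarrow> proj x \<in> B \<Longrightarrow>
      measure lborel ({a<..<b} - proj -` E) \<le> \<epsilon> * (b - a)"
proof -
  let ?E = "proj -` E"
  have [measurable]: "?E \<in> sets borel" using measurable_sets[OF proj_measurable E] by simp
  let ?U = "\<lambda>r. \<Union>{{a<..<b} | a b. a < b \<and> b - a < r \<and> measure lborel ({a<..<b} - ?E) > \<epsilon> * (b - a)}"
  obtain r where r: "r > 0" "emeasure lborel (?E \<inter> {0..1} \<inter> ?U r) \<le> ennreal e"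
    using density_real[of ?E \<epsilon> e] \<epsilon> e by auto
  have per: "x + of_int i \<in> ?U r" if x: "x \<in> ?U r" for x i
  proof -
    obtain a b where ab: "a < x" "x < b" "b - a < r" "measure lborel ({a<..<b} - ?E) > \<epsilon> * (b - a)"
      using x by auto
    have "measure lborel ({a + of_int i<..<b + of_int i} - ?E) = measure lborel ({a<..<b} - ?E)"
    proof -
      have "{a + of_int i<..<b + of_int i} - ?E = (+) (of_int i) ` ({a<..<b} - ?E)"
      proof (intro set_eqI iffI)
        fix y assume "y \<in> {a + of_int i<..<b + of_int i} - ?E"
        then show "y \<in> (+) (of_int i) ` ({a<..<b} - ?E)"
          using proj_add_int(1)[of "y - of_int i" i] by (intro image_eqI[of _ _ "y - of_int i"]) auto
      next
        fix y assume "y \<in> (+) (of_int i) ` ({a<..<b} - ?E)"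
        then show "y \<in> {a + of_int i<..<b + of_int i} - ?E" by (auto simp: add.commute)
      qed
      then have "measure lebesgue ({a + of_int i<..<b + of_int i} - ?E) = measure lebesgue ({a<..<b} - ?E)"
        by (simp add: measure_translation)
      then show ?thesis by (simp add: measure_completion)
    qed
    then have "{a + of_int i<..<b + of_int i} \<in> {{a<..<b} | a b. a < b \<and> b - a < r \<and> measure lborel ({a<..<b} - ?E) > \<epsilon> * (b - a)}"
      using ab by (intro CollectI exI[of _ "a + of_int i"] exI[of _ "b + of_int i"]) simp
    then show ?thesis by (rule UnionI) (use ab in simp)
  qed
  have U[measurable]: "?U r \<in> sets borel" by (intro borel_open open_Union) auto
  define U0 where "U0 = ?U r"
  note U' = U[folded U0_def] and per' = per[folded U0_def]
  define B where "B = {y \<in> E. rep01 y \<notin> U0}"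
  have [measurable]: "B \<in> sets borel"
  proof -
    have "B = E \<inter> (rep01 -` (- U0) \<inter> space borel)" unfolding B_def by auto
    also have "\<dots> \<in> sets borel"
      by (intro sets.Int E measurable_sets[OF rep01_measurable]) (use U' in simp)
    finally show ?thesis .
  qed
  show ?thesis
  proof (rule that[OF r(1) \<open>B \<in> sets borel\<close>])
    show "B \<subseteq> E" by (auto simp: B_def)
    have "proj -` (E - B) \<inter> {0..<1} \<subseteq> ?E \<inter> {0..1} \<inter> U0"
    proof
      fix x assume x: "x \<in> proj -` (E - B) \<inter> {0..<1}"
      then have rx: "rep01 (proj x) = x" by (simp add: rep01_proj)
      have "proj x \<in> E" "proj x \<notin> B" using x by auto
      then have "rep01 (proj x) \<in> U0" unfolding B_def by blast
      then show "x \<in> ?E \<inter> {0..1} \<inter> U0" using x \<open>proj x \<in> E\<close> unfolding rx by simp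
    qed
    then have "emeasure circle_lebesgue (E - B) \<le> emeasure lborel (?E \<inter> {0..1} \<inter> U0)"
      unfolding emeasure_circle_real[OF sets.Diff[OF E \<open>B \<in> sets borel\<close>]]
      by (rule emeasure_mono) (simp_all add: U' sets.Int)
    then have "emeasure circle_lebesgue (E - B) \<le> ennreal e" using r(2) unfolding U0_def by (rule order_trans)
    then show "measure circle_lebesgue (E - B) \<le> e"
      using e by (simp add: circle_lebesgue.emeasure_eq_measure)
    fix a b x :: real assume x: "a < x" "x < b" "b - a < r" "proj x \<in> B"
    have "rep01 (proj x) - x \<in> \<int>" using rep01(1)[of "proj x"] unfolding proj_eq_iff .
    then obtain i where "rep01 (proj x) - x = of_int i" using Ints_cases by blast
    then have rx: "rep01 (proj x) = x + of_int i" by simp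
    have "rep01 (proj x) \<notin> U0" using x(4) unfolding B_def by blast
    then have "x + of_int i \<notin> U0" unfolding rx .
    then have "x \<notin> U0" using per'[of x i] by blast
    have "\<not> (a < b \<and> b - a < r \<and> measure lborel ({a<..<b} - ?E) > \<epsilon> * (b - a))"
    proof
      assume *: "a < b \<and> b - a < r \<and> measure lborel ({a<..<b} - ?E) > \<epsilon> * (b - a)"
      have "x \<in> U0" unfolding U0_def
        by (rule UnionI, rule CollectI, rule exI[of _ a], rule exI[of _ b], rule conjI[OF refl *]) (use x in simp)
      then show False using \<open>x \<notin> U0\<close> by blast
    qed
    then show "measure lborel ({a<..<b} - proj -` E) \<le> \<epsilon> * (b - a)" using x(1-3) by (simp add: not_less)
  qed
qed

section \<open>Consequences of invariance and absolute continuity\<close>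

lemma acisigma_level_set:
  assumes \<mu>: "acisigma f \<mu>" and q: "q > 1"
  obtains E a where "E \<in> sets borel" "measure circle_lebesgue E > 0" "a > 0"
    "\<And>A. A \<in> sets borel \<Longrightarrow> A \<subseteq> E \<Longrightarrow> ennreal a * emeasure circle_lebesgue A \<le> emeasure \<mu> A"
    "\<And>A. A \<in> sets borel \<Longrightarrow> A \<subseteq> E \<Longrightarrow> emeasure \<mu> A \<le> ennreal (q * a) * emeasure circle_lebesgue A"
proof -
  have sets: "sets \<mu> = sets circle_lebesgue" and sf: "sigma_finite_measure \<mu>"
    and nonzero: "emeasure \<mu> UNIV \<noteq> 0" and ac: "absolutely_continuous circle_lebesgue \<mu>"
    using \<mu> by (auto simp: acisigma_def)
  obtain \<rho> where \<rho>[measurable]: "\<rho> \<in> borel_measurable borel" and d: "density circle_lebesgue \<rho> = \<mu>"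
    using circle_lebesgue.Radon_Nikodym[OF ac sets] by (auto simp: measurable_cong_sets[OF sets_circle_lebesgue refl])
  \<comment> \<open>Sigma-finiteness enters here: the density is finite almost everywhere.\<close>
  have fin: "AE x in circle_lebesgue. \<rho> x \<noteq> \<infinity>"
    using circle_lebesgue.sigma_finite_iff_density_finite[of \<rho>] sf unfolding d by simp
  \<comment> \<open>Level sets on a logarithmic scale of ratio \<open>q\<close>. Countably many of
    them cover the points where the density is neither 0 nor infinite, so one has positive
    measure.\<close>
  define L where "L j = {x. \<rho> x \<noteq> 0 \<and> \<rho> x \<noteq> \<infinity> \<and> \<lfloor>log q (enn2real (\<rho> x))\<rfloor> = j}" for j :: int
  have L[measurable]: "L j \<in> sets borel" for j
  proof -
    have "L j = {x \<in> space borel. \<rho> x \<noteq> 0 \<and> \<rho> x \<noteq> \<infinity> \<and> \<lfloor>log q (enn2real (\<rho> x))\<rfloor> = j}" by (simp add: L_def)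
    also have "\<dots> \<in> sets borel" by measurable
    finally show ?thesis .
  qed
  have em: "emeasure \<mu> A = (\<integral>\<^sup>+x\<in>A. \<rho> x \<partial>circle_lebesgue)" if "A \<in> sets borel" for A
    using that unfolding d[symmetric] by (subst emeasure_density) auto
  have "\<exists>j. measure circle_lebesgue (L j) > 0"
  proof (rule ccontr)
    assume "\<not> ?thesis"
    then have "measure circle_lebesgue (L j) = 0" for j
      using measure_nonneg[of circle_lebesgue "L j"] by (metis linorder_neqE_linordered_idom not_less)
    then have "L j \<in> null_sets circle_lebesgue" for j
      by (auto simp: null_sets_def circle_lebesgue.emeasure_eq_measure)
    then have "AE x in circle_lebesgue. \<forall>j. x \<notin> L j"
      by (subst AE_all_countable) (auto intro: AE_not_in)
    with fin have "AE x in circle_lebesgue. \<rho> x = 0"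
      by eventually_elim (auto simp: L_def)
    then have "emeasure \<mu> UNIV = 0" by (subst em) (auto simp: nn_integral_0_iff_AE)
    then show False using nonzero by simp
  qed
  then obtain j where j: "measure circle_lebesgue (L j) > 0" by blast
  define a where "a = q powr real_of_int j"
  have a: "a > 0" using q by (simp add: a_def)
  have bd: "ennreal a \<le> \<rho> x \<and> \<rho> x \<le> ennreal (q * a)" if "x \<in> L j" for x
  proof -
    define y where "y = enn2real (\<rho> x)"
    have "\<rho> x \<noteq> 0" "\<rho> x \<noteq> \<infinity>" using that by (auto simp: L_def)
    then have y: "\<rho> x = ennreal y" "y > 0"
      by (simp_all add: y_def enn2real_positive_iff less_top zero_less_iff_neq_zero)
    have fl: "\<lfloor>log q y\<rfloor> = j" using that by (simp add: L_def y_def)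
    have "real_of_int j \<le> log q y" "log q y \<le> 1 + real_of_int j" using fl by linarith+
    then have "q powr j \<le> y" "y \<le> q powr (1 + j)"
      using q y(2) le_log_iff[of q y j] log_le_iff[of q y "1 + j"] by (auto simp del: of_int_add)
    then show ?thesis using q y by (simp add: a_def powr_add ennreal_leI)
  qed
  show ?thesis
  proof (rule that[OF L j a])
    fix A assume A[measurable]: "A \<in> sets borel" and sub: "A \<subseteq> L j"
    have "ennreal a * emeasure circle_lebesgue A = (\<integral>\<^sup>+x\<in>A. ennreal a \<partial>circle_lebesgue)"
      by (subst nn_integral_cmult_indicator) auto
    also have "\<dots> \<le> emeasure \<mu> A"
      unfolding em[OF A] using sub bd by (intro nn_integral_mono) (auto simp: indicator_def)
    finally show "ennreal a * emeasure circle_lebesgue A \<le> emeasure \<mu> A" .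
    have "emeasure \<mu> A \<le> (\<integral>\<^sup>+x\<in>A. ennreal (q * a) \<partial>circle_lebesgue)"
      unfolding em[OF A] using sub bd by (intro nn_integral_mono) (auto simp: indicator_def)
    also have "\<dots> = ennreal (q * a) * emeasure circle_lebesgue A"
      by (subst nn_integral_cmult_indicator) auto
    finally show "emeasure \<mu> A \<le> ennreal (q * a) * emeasure circle_lebesgue A" .
  qed
qed

text \<open>Sets whose forward orbits are pairwise disjoint until they reach \<open>S\<close> can be pulled back to a
  common time \<open>N\<close>, where they are disjoint subsets of the preimage of \<open>S\<close>.\<close>

lemma acisigma_antichain:
  assumes \<mu>: "acisigma f \<mu>" and f[measurable]: "f \<in> borel_measurable borel"
    and W[measurable]: "\<And>t. t \<le> N \<Longrightarrow> W t \<in> sets borel" and S[measurable]: "S \<in> sets borel"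
    and sub: "\<And>t. t \<le> N \<Longrightarrow> W t \<subseteq> (f ^^ t) -` S"
    and disj: "\<And>t t' y. t' < t \<Longrightarrow> t \<le> N \<Longrightarrow> y \<in> W t \<Longrightarrow> (f ^^ (t - t')) y \<in> W t' \<Longrightarrow> False"
  shows "(\<Sum>t\<le>N. emeasure \<mu> (W t)) \<le> emeasure \<mu> S"
proof -
  have sets[measurable_cong]: "sets \<mu> = sets borel" using \<mu> by (simp add: acisigma_def)
  have fm: "(f ^^ t) -` A \<in> sets borel" if "A \<in> sets borel" for A t
    using measurable_sets[OF measurable_compose_n[OF f, of t] that] by simp
  have inv1: "emeasure \<mu> (f -` A) = emeasure \<mu> A" if "A \<in> sets borel" for A
    using \<mu> that unfolding acisigma_def by blast
  have inv: "emeasure \<mu> ((f ^^ t) -` A) = emeasure \<mu> A" if A: "A \<in> sets borel" for A t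
  proof (induction t)
    case (Suc t)
    have "(f ^^ Suc t) -` A = f -` ((f ^^ t) -` A)" by (metis funpow_Suc_right vimage_comp)
    then have "emeasure \<mu> ((f ^^ Suc t) -` A) = emeasure \<mu> ((f ^^ t) -` A)"
      using inv1[OF fm[OF A, of t]] by (rule ssubst)
    then show ?case using Suc by (rule trans)
  next
    case 0
    show ?case unfolding funpow_0 vimage_ident ..
  qed
  have "(\<Sum>t\<le>N. emeasure \<mu> (W t)) = (\<Sum>t\<le>N. emeasure \<mu> ((f ^^ (N - t)) -` W t))"
    by (intro sum.cong refl) (simp only: inv W atMost_iff)
  also have "\<dots> = emeasure \<mu> (\<Union>t\<le>N. (f ^^ (N - t)) -` W t)"
  proof (rule sum_emeasure)
    show "disjoint_family_on (\<lambda>t. (f ^^ (N - t)) -` W t) {..N}"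
      unfolding disjoint_family_on_def
    proof (intro ballI impI)
      have *: "(f ^^ (N - t)) -` W t \<inter> (f ^^ (N - t')) -` W t' = {}" if "t' < t" "t \<le> N" for t t'
      proof -
        have "N - t' = (t - t') + (N - t)" using that by simp
        then have "(f ^^ (N - t')) z = (f ^^ (t - t')) ((f ^^ (N - t)) z)" for z by (simp add: funpow_add)
        then show ?thesis using disj[OF that] by auto
      qed
      fix t t' assume "t \<in> {..N}" "t' \<in> {..N}" "t \<noteq> t'"
      then show "(f ^^ (N - t)) -` W t \<inter> (f ^^ (N - t')) -` W t' = {}"
        using *[of t' t] *[of t t'] by (cases "t' < t") auto
    qed
  next
    show "(\<lambda>t. (f ^^ (N - t)) -` W t) ` {..N} \<subseteq> sets \<mu>" unfolding sets using fm W by blast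
  qed simp
  also have "\<dots> \<le> emeasure \<mu> ((f ^^ N) -` S)"
  proof (rule emeasure_mono)
    show "(\<Union>t\<le>N. (f ^^ (N - t)) -` W t) \<subseteq> (f ^^ N) -` S"
    proof (rule subsetI)
      fix z assume "z \<in> (\<Union>t\<le>N. (f ^^ (N - t)) -` W t)"
      then obtain t where t: "t \<le> N" "(f ^^ (N - t)) z \<in> W t" by blast
      then have "(f ^^ t) ((f ^^ (N - t)) z) \<in> S" using sub by blast
      moreover have "(f ^^ N) z = (f ^^ t) ((f ^^ (N - t)) z)" using funpow_add[of t "N - t" f] t(1) by simp
      ultimately show "z \<in> (f ^^ N) -` S" by simp
    qed
  next
    show "(f ^^ N) -` S \<in> sets \<mu>" unfolding sets by (rule fm[OF S])
  qed
  also have "\<dots> = emeasure \<mu> S" by (rule inv[OF S])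
  finally show ?thesis .
qed

section \<open>A criterion for the absence of invariant measures\<close>

text \<open>\<open>\<kappa>\<close> and \<open>C\<close> are meant to be uniform in the scale
  \<open>k\<close>: the mesh of the partition \<open>a\<close> and the quotient
  \<open>n / (c * N)\<close> are at most \<open>1 / k\<close>. The Jacobian is small over
  \<open>X\<close> and large over \<open>X'\<close>, on every inverse branch and at all times from
  \<open>n\<close> to \<open>N\<close>. Only times up to \<open>N\<close> occur, so a version with
  better constants is stable under perturbation.\<close>

definition (in lift) oscillates :: "real \<Rightarrow> real \<Rightarrow> nat \<Rightarrow> bool" where
  "oscillates \<kappa> C k \<longleftrightarrow> (\<exists>n N c p a X X'.
     1 \<le> n \<and> 0 < c \<and> real k * real n \<le> c * real N \<and>
     (\<forall>t\<le>N. \<forall>x. c \<le> (\<Sum>i<nat \<bar>d ^ t\<bar>. 1 / J t (x + real i))) \<and>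
     a 0 = 0 \<and> a p = 1 \<and> (\<forall>l<p. a l < a (Suc l) \<and> real k * (a (Suc l) - a l) \<le> 1) \<and>
     X \<in> sets borel \<and> X' \<in> sets borel \<and>
     (\<forall>l<p. \<kappa> * (a (Suc l) - a l) \<le> measure lborel (X \<inter> {a l<..<a (Suc l)}) \<and>
            \<kappa> * (a (Suc l) - a l) \<le> measure lborel (X' \<inter> {a l<..<a (Suc l)})) \<and>
     (\<forall>l<p. \<forall>t\<in>{n..N}. \<forall>i::nat. \<forall>x\<in>{a l..a (Suc l)}. \<forall>x'\<in>{a l..a (Suc l)}.
        1 \<le> J t (x + real i) \<and> J t (x + real i) \<le> C * J t (x' + real i) \<and>
        (x \<in> X \<and> x' \<in> X' \<longrightarrow> 4 * J t (x + real i) \<le> J t (x' + real i))))"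

lemma emeasure_rep01:
  assumes [measurable]: "U \<in> sets borel"
  shows "emeasure circle_lebesgue {y. rep01 y \<in> U} = emeasure lborel (U \<inter> {0..<1})"
proof -
  have *: "{y. rep01 y \<in> U} = rep01 -` U \<inter> space borel" by auto
  have [measurable]: "{y. rep01 y \<in> U} \<in> sets borel" unfolding * by measurable
  show ?thesis by (subst emeasure_circle_real) (auto intro!: arg_cong[where f = "emeasure lborel"] simp: rep01_proj)
qed

lemma rep01_vimage_measurable:
  assumes "U \<in> sets borel" shows "{y. rep01 y \<in> U} \<in> sets borel"
proof -
  have "{y. rep01 y \<in> U} = rep01 -` U \<inter> space borel" by auto
  then show ?thesis using measurable_sets[OF rep01_measurable assms] by simp
qed

context circle_lift
begin

lemma vimage_pow_measurable: "Q \<in> sets borel \<Longrightarrow> (f ^^ t) -` Q \<in> sets borel"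
  using measurable_sets[OF f_pow_measurable[of t], of Q] by simp

text \<open>Every preimage of \<open>Q\<close> under \<open>t < N\<close> iterations has measure at
  least \<open>c\<close> times that of \<open>Q\<close>, whereas by \<open>few_visits\<close> a
  point lies in at most \<open>n\<close> of these \<open>N\<close> preimages.\<close>

lemma few_returns:
  assumes B[measurable]: "B \<in> sets borel" and c: "0 < c"
    and low: "\<And>t x. t < N \<Longrightarrow> c \<le> (\<Sum>i<nat \<bar>d ^ t\<bar>. 1 / J t (x + real i))"
  shows "c * real N * measure circle_lebesgue {y \<in> B. visits f B N y < n} \<le> real n"
proof -
  define Q where "Q = {y \<in> B. visits f B N y < n}"
  have "Q = B - (\<Union>m\<in>{n..N}. {y. visits f B N y = m})"
    using visits_le[of f B N] unfolding Q_def by force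
  moreover have "{y. visits f B N y = m} \<in> sets borel" for m
  proof -
    have "real (visits f B N y) = (\<Sum>s\<in>{1..N}. indicator B ((f ^^ s) y))" for y
      unfolding visits_def by (simp add: indicator_def sum.If_cases Int_def)
    then have "{y. visits f B N y = m} = {y \<in> space borel. (\<Sum>s\<in>{1..N}. indicator B ((f ^^ s) y)) = real m}"
      by (metis (no_types, lifting) of_nat_eq_iff space_borel UNIV_I)
    then show ?thesis by simp
  qed
  ultimately have Q[measurable]: "Q \<in> sets borel" by auto
  have 1: "ennreal c * emeasure circle_lebesgue Q \<le> emeasure circle_lebesgue ((f ^^ t) -` Q)" if t: "t < N" for t
  proof -
    have "ennreal c * emeasure circle_lebesgue Q = (\<integral>\<^sup>+x. ennreal c * (indicator Q (proj x) * indicator {0..<1} x) \<partial>lborel)"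
      unfolding emeasure_circle[OF Q] by (rule nn_integral_cmult[symmetric]) simp
    also have "\<dots> \<le> (\<integral>\<^sup>+x\<in>{0..<1}. indicator Q (proj x) *
      (\<Sum>i<nat \<bar>d ^ t\<bar>. indicator UNIV (proj ((G ^^ t) (x + real i))) * ennreal (1 / J t (x + real i))) \<partial>lborel)"
    proof (rule nn_integral_mono)
      fix x :: real
      have "(\<Sum>i<nat \<bar>d ^ t\<bar>. indicator UNIV (proj ((G ^^ t) (x + real i))) * ennreal (1 / J t (x + real i)))
         = ennreal (\<Sum>i<nat \<bar>d ^ t\<bar>. 1 / J t (x + real i))"
        by (simp add: sum_ennreal less_imp_le J_pos)
      then show "ennreal c * (indicator Q (proj x) * indicator {0..<1} x) \<le> indicator Q (proj x) *
        (\<Sum>i<nat \<bar>d ^ t\<bar>. indicator UNIV (proj ((G ^^ t) (x + real i))) * ennreal (1 / J t (x + real i))) * indicator {0..<1} x"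
        using low[OF t, of x] by (auto simp: indicator_def intro!: ennreal_leI)
    qed
    also have "\<dots> = emeasure circle_lebesgue (UNIV \<inter> (f ^^ t) -` Q)"
      by (rule emeasure_vimage[symmetric]) auto
    finally show ?thesis by simp
  qed
  have "ennreal (c * real N * measure circle_lebesgue Q) = (\<Sum>t<N. ennreal c * emeasure circle_lebesgue Q)"
    using c by (simp add: circle_lebesgue.emeasure_eq_measure ennreal_mult ennreal_of_nat_eq_real_of_nat[symmetric] mult_ac)
  also have "\<dots> \<le> (\<Sum>t<N. emeasure circle_lebesgue ((f ^^ t) -` Q))" by (rule sum_mono) (simp add: 1)
  also have "\<dots> = (\<Sum>t<N. \<integral>\<^sup>+y. indicator ((f ^^ t) -` Q) y \<partial>circle_lebesgue)"
    using vimage_pow_measurable[OF Q] by simp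
  also have "\<dots> = (\<integral>\<^sup>+y. (\<Sum>t<N. indicator ((f ^^ t) -` Q) y) \<partial>circle_lebesgue)"
    by (rule nn_integral_sum[symmetric]) (use vimage_pow_measurable[OF Q] in simp)
  also have "\<dots> \<le> (\<integral>\<^sup>+y. ennreal (real n) \<partial>circle_lebesgue)"
  proof (rule nn_integral_mono)
    fix y
    have "(\<Sum>t<N. indicator ((f ^^ t) -` Q) y :: ennreal) = of_nat (card {t \<in> {..<N}. (f ^^ t) y \<in> Q})"
      by (simp add: indicator_def sum.If_cases Int_def)
    also have "\<dots> \<le> of_nat n" using few_visits[OF Q_def, of y] by (intro of_nat_mono) auto
    finally show "(\<Sum>t<N. indicator ((f ^^ t) -` Q) y) \<le> ennreal (real n)"
      by (simp add: ennreal_of_nat_eq_real_of_nat)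
  qed
  also have "\<dots> = ennreal (real n)" by (simp add: emeasure_circle_lebesgue_UNIV)
  finally show ?thesis unfolding Q_def by simp
qed

text \<open>The interval pulls back along the branch to one of length less than \<open>r\<close>
  around a point of \<open>B\<close>, which is almost filled by \<open>E\<close>. Bounded distortion
  is paid twice: for the length of the pulled-back interval and for the Jacobian when its bad part
  is carried forward; hence \<open>C\<^sup>2\<close>.\<close>

lemma inverse_branch_density:
  assumes E[measurable]: "E \<in> sets borel" and ab: "0 \<le> \<alpha>" "\<alpha> < \<beta>" "\<beta> \<le> 1" "\<beta> - \<alpha> < r"
    and i: "i < nat \<bar>d ^ t\<bar>" and \<epsilon>: "0 \<le> \<epsilon>" and C: "1 \<le> C"
    and J1: "\<And>x. x \<in> {\<alpha>..\<beta>} \<Longrightarrow> 1 \<le> J t (x + real i)"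
    and JC: "\<And>x x'. x \<in> {\<alpha>..\<beta>} \<Longrightarrow> x' \<in> {\<alpha>..\<beta>} \<Longrightarrow> J t (x + real i) \<le> C * J t (x' + real i)"
    and z: "z \<in> {\<alpha><..<\<beta>}" "proj ((G ^^ t) (z + real i)) \<in> B"
    and dens: "\<And>a b x. a < x \<Longrightarrow> x < b \<Longrightarrow> b - a < r \<Longrightarrow> proj x \<in> B \<Longrightarrow>
      measure lborel ({a<..<b} - proj -` E) \<le> \<epsilon> * (b - a)"
  shows "measure lborel {x \<in> {\<alpha><..<\<beta>}. proj ((G ^^ t) (x + real i)) \<notin> E} \<le> C\<^sup>2 * \<epsilon> * (\<beta> - \<alpha>)"
proof -
  define g where "g x = (G ^^ t) (x + real i)" for x
  have [measurable]: "g \<in> borel_measurable borel" unfolding g_def by measurable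
  have E'[measurable]: "proj -` E \<in> sets borel" using measurable_sets[OF proj_measurable E] by simp
  have gc: "continuous_on {\<alpha>..\<beta>} g"
    unfolding g_def by (rule continuous_on_compose2[OF G_pow_cont[of UNIV]]) (auto intro!: continuous_intros)
  have gi: "inj_on g {\<alpha>..\<beta>}"
  proof (rule inj_onI)
    fix x y assume "g x = g y"
    then have "(F ^^ t) (g x) = (F ^^ t) (g y)" by simp
    then show "x = y" unfolding g_def by simp
  qed
  define u v where "u = min (g \<alpha>) (g \<beta>)" and "v = max (g \<alpha>) (g \<beta>)"
  have into: "u < g x \<and> g x < v" if "x \<in> {\<alpha><..<\<beta>}" for x
    using continuous_inj_imp_mono[of \<alpha> x \<beta> g] that gc gi unfolding u_def v_def by auto
  have vu: "v - u = \<bar>g \<alpha> - g \<beta>\<bar>" unfolding u_def v_def by auto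
  define Jz where "Jz = J t (z + real i)"
  have Jz: "1 \<le> Jz" using J1[of z] z(1) unfolding Jz_def by simp
  have "\<bar>g \<alpha> - g \<beta>\<bar> \<le> \<bar>(\<alpha> + real i) - (\<beta> + real i)\<bar> / 1"
    unfolding g_def by (rule G_pow_lipschitz) (use J1[of "_ - real i"] ab in auto)
  then have vu1: "v - u \<le> \<beta> - \<alpha>" using ab vu by simp
  have "\<bar>g \<alpha> - g \<beta>\<bar> \<le> \<bar>(\<alpha> + real i) - (\<beta> + real i)\<bar> / (Jz / C)"
    unfolding g_def
  proof (rule G_pow_lipschitz)
    fix y assume "y \<in> {\<alpha> + real i..\<beta> + real i}"
    then have "Jz \<le> C * J t (y - real i + real i)"
      unfolding Jz_def by (intro JC) (use z(1) in auto)
    then show "Jz / C \<le> J t y" using C by (simp add: divide_le_eq mult.commute)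
  qed (use ab C Jz in auto)
  then have vuC: "v - u \<le> (\<beta> - \<alpha>) * C / Jz" using ab vu by simp
  have dE: "measure lborel ({u<..<v} - proj -` E) \<le> \<epsilon> * (v - u)"
    by (rule dens[of u "g z" v]) (use into[OF z(1)] vu1 ab z(2) in \<open>auto simp: g_def\<close>)
  \<comment> \<open>The bad points of the pulled-back interval, made periodic so that the change of
    variables over one period applies; as \<open>v - u \<le> 1\<close>, no point is counted
    twice.\<close>
  define P where "P = (\<Union>j::int. (\<lambda>z. z + of_int j) -` ({u<..<v} - proj -` E))"
  have P[measurable]: "P \<in> sets borel"
  proof -
    have "(\<lambda>z. z + of_int j) -` ({u<..<v} - proj -` E) \<in> sets borel" for j :: int
      using measurable_sets[of "\<lambda>z. z + of_int j" borel borel "{u<..<v} - proj -` E"] by simp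
    then show ?thesis unfolding P_def by (intro sets.countable_UN'') auto
  qed
  have P1: "indicator P (x + 1) = (indicator P x :: ennreal)" for x
  proof -
    have "x + 1 \<in> P \<longleftrightarrow> x \<in> P"
    proof
      assume "x + 1 \<in> P"
      then obtain j where "x + 1 + of_int j \<in> {u<..<v} - proj -` E" unfolding P_def by auto
      then have "x + of_int (j + 1) \<in> {u<..<v} - proj -` E" by (simp add: algebra_simps)
      then show "x \<in> P" unfolding P_def by blast
    next
      assume "x \<in> P"
      then obtain j where "x + of_int j \<in> {u<..<v} - proj -` E" unfolding P_def by auto
      then have "x + 1 + of_int (j - 1) \<in> {u<..<v} - proj -` E" by (simp add: algebra_simps)
      then show "x + 1 \<in> P" unfolding P_def by blast
    qed
    then show ?thesis by (simp add: indicator_def)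
  qed
  have "(\<integral>\<^sup>+x\<in>{0..<1}. indicator P x \<partial>lborel) = (\<integral>\<^sup>+x\<in>{u..<u + 1}. indicator P x \<partial>lborel)"
    by (rule nn_integral_periodic_shift[symmetric]) (auto simp: P1)
  also have "\<dots> = (\<integral>\<^sup>+x. indicator ({u<..<v} - proj -` E) x \<partial>lborel)"
  proof (rule nn_integral_cong)
    fix x
    have "x \<in> P \<and> x \<in> {u..<u + 1} \<longleftrightarrow> x \<in> {u<..<v} - proj -` E"
    proof
      assume x: "x \<in> P \<and> x \<in> {u..<u + 1}"
      then obtain j where j: "x + of_int j \<in> {u<..<v} - proj -` E" unfolding P_def by auto
      have "\<bar>real_of_int j\<bar> < 1" using j x vu1 ab by auto
      then have "j = 0" by linarith
      then show "x \<in> {u<..<v} - proj -` E" using j by simp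
    next
      assume x: "x \<in> {u<..<v} - proj -` E"
      then have "x + of_int 0 \<in> {u<..<v} - proj -` E" by simp
      then have "x \<in> P" unfolding P_def by blast
      then show "x \<in> P \<and> x \<in> {u..<u + 1}" using x vu1 ab by auto
    qed
    then show "indicator P x * indicator {u..<u + 1} x = (indicator ({u<..<v} - proj -` E) x :: ennreal)"
      by (auto simp: indicator_def)
  qed
  also have "\<dots> = emeasure lborel ({u<..<v} - proj -` E)" by simp
  also have "\<dots> \<le> ennreal (\<epsilon> * (v - u))"
  proof -
    have "emeasure lborel ({u<..<v} - proj -` E) \<le> emeasure lborel {u<..<v}" by (rule emeasure_mono) auto
    also have "\<dots> < \<infinity>" unfolding u_def v_def by simp
    finally have "emeasure lborel ({u<..<v} - proj -` E) = ennreal (measure lborel ({u<..<v} - proj -` E))"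
      by (intro emeasure_eq_ennreal_measure) simp
    then show ?thesis using dE by (simp add: ennreal_leI)
  qed
  finally have up: "(\<integral>\<^sup>+x\<in>{0..<1}. indicator P x \<partial>lborel) \<le> ennreal (\<epsilon> * (v - u))" .
  define Z where "Z = {x \<in> {\<alpha><..<\<beta>}. proj (g x) \<notin> E}"
  have Z[measurable]: "Z \<in> sets borel"
  proof -
    have "Z = {\<alpha><..<\<beta>} \<inter> (g -` (- (proj -` E)) \<inter> space borel)" unfolding Z_def by auto
    also have "\<dots> \<in> sets borel" by measurable
    finally show ?thesis .
  qed
  have "ennreal (1 / (C * Jz)) * emeasure lborel Z = (\<integral>\<^sup>+x. ennreal (1 / (C * Jz)) * indicator Z x \<partial>lborel)"
    by (rule nn_integral_cmult_indicator[symmetric]) simp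
  also have "\<dots> \<le> (\<integral>\<^sup>+x\<in>{0..<1}. indicator P ((G ^^ t) (x + real i)) * ennreal (1 / J t (x + real i)) \<partial>lborel)"
  proof (rule nn_integral_mono)
    fix x
    show "ennreal (1 / (C * Jz)) * indicator Z x \<le>
      indicator P ((G ^^ t) (x + real i)) * ennreal (1 / J t (x + real i)) * indicator {0..<1} x"
    proof (cases "x \<in> Z")
      case True
      then have x: "x \<in> {\<alpha><..<\<beta>}" "proj (g x) \<notin> E" by (auto simp: Z_def)
      have "g x + of_int 0 \<in> {u<..<v} - proj -` E" using into[OF x(1)] x(2) by simp
      then have "g x \<in> P" unfolding P_def by blast
      moreover have "x \<in> {0..<1}" using x(1) ab by auto
      moreover have "1 / (C * Jz) \<le> 1 / J t (x + real i)"
        using JC[of x z] x(1) z(1) C Jz J_pos unfolding Jz_def by (intro divide_left_mono) auto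
      ultimately show ?thesis using True by (simp add: g_def ennreal_leI)
    qed simp
  qed
  \<comment> \<open>The branch \<open>i\<close> is one nonnegative summand in the sum over all
    branches.\<close>
  also have "\<dots> \<le> (\<Sum>i<nat \<bar>d ^ t\<bar>. \<integral>\<^sup>+x\<in>{0..<1}. indicator P ((G ^^ t) (x + real i)) * ennreal (1 / J t (x + real i)) \<partial>lborel)"
    using i by (intro member_le_sum) auto
  also have "\<dots> = (\<integral>\<^sup>+x\<in>{0..<1}. indicator P x \<partial>lborel)"
    by (rule nn_integral_lift_pow[symmetric]) (auto simp: P1)
  finally have "ennreal (1 / (C * Jz)) * emeasure lborel Z \<le> ennreal (\<epsilon> * (v - u))" using up by (rule order_trans)
  moreover have "emeasure lborel Z = ennreal (measure lborel Z)"
  proof -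
    have "emeasure lborel Z \<le> emeasure lborel {\<alpha><..<\<beta>}" by (rule emeasure_mono) (auto simp: Z_def)
    also have "\<dots> < \<infinity>" using ab by simp
    finally show ?thesis by (intro emeasure_eq_ennreal_measure) simp
  qed
  ultimately have "ennreal (1 / (C * Jz) * measure lborel Z) \<le> ennreal (\<epsilon> * (v - u))"
    using C Jz ennreal_mult[of "1 / (C * Jz)" "measure lborel Z"] by simp
  then have "1 / (C * Jz) * measure lborel Z \<le> \<epsilon> * (v - u)"
    using \<epsilon> into[OF z(1)] by (subst (asm) ennreal_le_iff) auto
  also have "\<dots> \<le> \<epsilon> * ((\<beta> - \<alpha>) * C / Jz)" using vuC \<epsilon> by (rule mult_left_mono)
  finally have "measure lborel Z \<le> (C * Jz) * (\<epsilon> * ((\<beta> - \<alpha>) * C / Jz))"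
    using C Jz by (simp add: divide_le_eq mult.commute)
  also have "\<dots> = C\<^sup>2 * \<epsilon> * (\<beta> - \<alpha>)" using Jz by (simp add: power2_eq_square)
  finally show ?thesis unfolding Z_def g_def .
qed


text \<open>That two branches lie on one orbit amounts to a congruence of \<open>i\<close> and
  \<open>i'\<close> modulo \<open>d ^ t'\<close>, in which the base point does not occur.\<close>

lemma pull_back_branch:
  assumes e: "(f ^^ (t - t')) (proj ((G ^^ t) (x + real i))) = proj ((G ^^ t') (x + real i'))" and t: "t' \<le> t"
  shows "(f ^^ (t - t')) (proj ((G ^^ t) (x' + real i))) = proj ((G ^^ t') (x' + real i'))"
proof -
  have *: "(f ^^ (t - t')) (proj ((G ^^ t) z)) = proj ((G ^^ t') z)" for z
    unfolding f_pow_proj using FG_pow[of "t - t'" t z] t by simp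
  have "proj ((G ^^ t') (x + real i)) = proj ((G ^^ t') (x + real i'))" using e unfolding * .
  then obtain j where "(G ^^ t') (x + real i) - (G ^^ t') (x + real i') = of_int j"
    unfolding proj_eq_iff using Ints_cases by blast
  then have "(G ^^ t') (x + real i) = (G ^^ t') (x + real i') + of_int j" by simp
  also have "\<dots> = (G ^^ t') (x + real i' + of_int (j * d ^ t'))" by (rule G_pow_shift[symmetric])
  finally have "(F ^^ t') ((G ^^ t') (x + real i)) = (F ^^ t') ((G ^^ t') (x + real i' + of_int (j * d ^ t')))"
    by simp
  then have "real i = real i' + of_int (j * d ^ t')" by simp
  then have "x' + real i = x' + real i' + of_int (j * d ^ t')" by simp
  then have "(G ^^ t') (x' + real i) = (G ^^ t') (x' + real i') + of_int j"
    using G_pow_shift[of t' "x' + real i'" j] by (simp add: add.assoc)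
  then show ?thesis unfolding * by simp
qed

text \<open>The points over \<open>x\<close> on the branches along which the \<open>n\<close>-th returns arrive at \<open>x'\<close> are again
  an antichain. As the Jacobian is smaller at \<open>x\<close>, invariance bounds the density of returns at \<open>x'\<close>.\<close>

lemma return_density:
  assumes \<mu>: "acisigma f \<mu>" and E[measurable]: "E \<in> sets borel"
    and a: "a > 0" and q: "q \<ge> 1"
    and lower: "\<And>A. A \<in> sets borel \<Longrightarrow> A \<subseteq> E \<Longrightarrow> ennreal a * emeasure circle_lebesgue A \<le> emeasure \<mu> A"
    and upper: "\<And>A. A \<in> sets borel \<Longrightarrow> A \<subseteq> E \<Longrightarrow> emeasure \<mu> A \<le> ennreal (q * a) * emeasure circle_lebesgue A"
    and B[measurable]: "B \<in> sets borel"
    and dens: "\<And>a b x. a < x \<Longrightarrow> x < b \<Longrightarrow> b - a < r \<Longrightarrow> proj x \<in> B \<Longrightarrow>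
      measure lborel ({a<..<b} - proj -` E) \<le> \<epsilon> * (b - a)"
    and \<epsilon>: "0 \<le> \<epsilon>" "(1 + C\<^sup>2) * \<epsilon> \<le> \<kappa> / 4" and C: "1 \<le> C" and \<kappa>: "\<kappa> > 0"
    and ab: "0 \<le> \<alpha>" "\<alpha> < \<beta>" "\<beta> \<le> 1" "\<beta> - \<alpha> < r"
    and X[measurable]: "X \<in> sets borel" and X\<kappa>: "\<kappa> * (\<beta> - \<alpha>) \<le> measure lborel (X \<inter> {\<alpha><..<\<beta>})"
    and J1: "\<And>t i x. t \<in> {n..N} \<Longrightarrow> x \<in> {\<alpha>..\<beta>} \<Longrightarrow> 1 \<le> J t (x + real i)"
    and JC: "\<And>t i x x'. t \<in> {n..N} \<Longrightarrow> x \<in> {\<alpha>..\<beta>} \<Longrightarrow> x' \<in> {\<alpha>..\<beta>} \<Longrightarrow> J t (x + real i) \<le> C * J t (x' + real i)"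
    and x': "x' \<in> {\<alpha><..<\<beta>}" "proj x' \<in> B"
    and J4: "\<And>t i x. t \<in> {n..N} \<Longrightarrow> x \<in> {\<alpha>..\<beta>} \<Longrightarrow> x \<in> X \<Longrightarrow> 4 * J t (x + real i) \<le> J t (x' + real i)"
    and V: "V = (\<lambda>t. returns f B n t)"
  shows "(\<Sum>t\<in>{n..N}. \<Sum>i<nat \<bar>d ^ t\<bar>. indicator (V t) (proj ((G ^^ t) (x' + real i))) * ennreal (1 / J t (x' + real i)))
    \<le> ennreal (q / 3)"
proof -
  \<comment> \<open>The branches along which an \<open>n\<close>-th return arrives at
    \<open>x'\<close>.\<close>
  define T where "T t = {i. i < nat \<bar>d ^ t\<bar> \<and> proj ((G ^^ t) (x' + real i)) \<in> V t}" for t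
  define U where "U = X \<inter> {\<alpha><..<\<beta>} \<inter> proj -` E"
  have E'[measurable]: "proj -` E \<in> sets borel" using measurable_sets[OF proj_measurable E] by simp
  have U[measurable]: "U \<in> sets borel" unfolding U_def by simp
  define S where "S = {y. rep01 y \<in> U}"
  have S[measurable]: "S \<in> sets borel" unfolding S_def by (rule rep01_vimage_measurable[OF U])
  have SE: "S \<subseteq> E" using rep01(1) by (auto simp: S_def U_def)
  \<comment> \<open>\<open>b t i y\<close> represents the point of branch \<open>i\<close> over
    \<open>(f ^^ t) y\<close>; the equation \<open>rep01 y = b t i y\<close> in \<open>W\<close>
    says that \<open>y\<close> itself lies on that branch.\<close>
  define b where "b t i y = rep01 (proj ((G ^^ t) (rep01 ((f ^^ t) y) + real i)))" for t i y
  have [measurable]: "b t i \<in> borel_measurable borel" for t i unfolding b_def by measurable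
  define W where "W t = (if n \<le> t then {y \<in> E. (f ^^ t) y \<in> S \<and> (\<exists>i\<in>T t. rep01 y = b t i y)} else {})" for t
  have W[measurable]: "W t \<in> sets borel" for t
  proof -
    have "finite (T t)" by (simp add: T_def)
    have "{y \<in> E. (f ^^ t) y \<in> S \<and> (\<exists>i\<in>T t. rep01 y = b t i y)} =
      E \<inter> (f ^^ t) -` S \<inter> (\<Union>i\<in>T t. {y \<in> space borel. rep01 y = b t i y})" by auto
    also have "\<dots> \<in> sets borel" using vimage_pow_measurable[OF S] \<open>finite (T t)\<close>
      by (intro sets.Int E sets.finite_UN) auto
    finally show ?thesis by (simp add: W_def)
  qed
  have "ennreal a * (\<Sum>t\<le>N. emeasure circle_lebesgue (W t)) \<le> (\<Sum>t\<le>N. emeasure \<mu> (W t))"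
    unfolding sum_distrib_left by (intro sum_mono lower W) (auto simp: W_def)
  also have "\<dots> \<le> emeasure \<mu> S"
  proof (rule acisigma_antichain[OF \<mu>])
    show "f \<in> borel_measurable borel" using f_pow_measurable[of 1] by (simp add: comp_def)
    show "W t \<subseteq> (f ^^ t) -` S" for t by (auto simp: W_def)
    fix t t' y assume t: "t' < t" "t \<le> N" and y: "y \<in> W t" and y': "(f ^^ (t - t')) y \<in> W t'"
    define x where "x = rep01 ((f ^^ t) y)"
    have tt: "n \<le> t'" "n \<le> t" using y' t by (auto simp: W_def split: if_splits)
    obtain i where i: "i \<in> T t" "rep01 y = b t i y" using y tt by (auto simp: W_def)
    obtain i' where i': "i' \<in> T t'" "rep01 ((f ^^ (t - t')) y) = b t' i' ((f ^^ (t - t')) y)"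
      using y' tt by (auto simp: W_def)
    have "(f ^^ t') ((f ^^ (t - t')) y) = (f ^^ t) y"
      using funpow_add[of t' "t - t'" f] t(1) by simp
    then have 1: "(f ^^ (t - t')) y = proj ((G ^^ t') (x + real i'))"
      using i'(2) unfolding b_def x_def by (metis rep01(1))
    have 2: "y = proj ((G ^^ t) (x + real i))" using i(2) unfolding b_def x_def by (metis rep01(1))
    \<comment> \<open>Over \<open>x\<close> nothing is known about returns; the coincidence of
      branches is carried to the base point \<open>x'\<close>, where it contradicts
      \<open>returns_antichain\<close>.\<close>
    have "(f ^^ (t - t')) (proj ((G ^^ t) (x' + real i))) = proj ((G ^^ t') (x' + real i'))"
      by (rule pull_back_branch[of _ _ x]) (use 1 2 t in auto)
    then show False
      using returns_antichain[of "proj ((G ^^ t) (x' + real i))" f B n t t'] i(1) i'(1) t(1) by (simp add: T_def V)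
  qed (use W in auto)
  also have "\<dots> \<le> ennreal (q * a) * emeasure circle_lebesgue S" by (rule upper[OF S SE])
  also have "emeasure circle_lebesgue S \<le> emeasure lborel (X \<inter> {\<alpha><..<\<beta>})"
    unfolding S_def emeasure_rep01[OF U] by (intro emeasure_mono) (auto simp: U_def)
  finally have main: "ennreal a * (\<Sum>t\<le>N. emeasure circle_lebesgue (W t)) \<le> ennreal (q * a) * emeasure lborel (X \<inter> {\<alpha><..<\<beta>})"
    by (simp add: mult_left_mono)
  define mX where "mX = measure lborel (X \<inter> {\<alpha><..<\<beta>})"
  have mX: "mX > 0" using X\<kappa> \<kappa> ab unfolding mX_def
    by (meson diff_gt_0_iff_gt less_le_trans mult_pos_pos)
  have fin: "emeasure lborel A = ennreal (measure lborel A)" if "A \<subseteq> {\<alpha><..<\<beta>}" for A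
  proof -
    have "emeasure lborel A \<le> emeasure lborel {\<alpha><..<\<beta>}" by (rule emeasure_mono) (use that in auto)
    also have "\<dots> < \<infinity>" using ab by simp
    finally show ?thesis by (intro emeasure_eq_ennreal_measure) simp
  qed
  have emmX: "emeasure lborel (X \<inter> {\<alpha><..<\<beta>}) = ennreal mX" unfolding mX_def by (rule fin) auto
  \<comment> \<open>Two losses from \<open>X\<close>, together at most a quarter: the points outside
    \<open>E\<close>, a proportion \<open>\<epsilon>\<close> of the interval, and those whose
    preimage on the branch is outside \<open>E\<close>, a proportion
    \<open>C\<^sup>2 * \<epsilon>\<close>.\<close>
  have \<beta>\<epsilon>: "(1 + C\<^sup>2) * \<epsilon> * (\<beta> - \<alpha>) \<le> mX / 4"
  proof -
    have "(1 + C\<^sup>2) * \<epsilon> * (\<beta> - \<alpha>) \<le> \<kappa> / 4 * (\<beta> - \<alpha>)" using \<epsilon>(2) ab by (intro mult_right_mono) auto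
    then show ?thesis using X\<kappa> unfolding mX_def by simp
  qed
  have branch: "ennreal (3 / 4 * mX) \<le> emeasure lborel {x \<in> U. proj ((G ^^ t) (x + real i)) \<in> E}"
    if t: "t \<in> {n..N}" and i: "i \<in> T t" for t i
  proof -
    let ?Z = "{x \<in> {\<alpha><..<\<beta>}. proj ((G ^^ t) (x + real i)) \<notin> E}"
    let ?Z' = "{\<alpha><..<\<beta>} - proj -` E"
    have Zm[measurable]: "?Z \<in> sets borel"
    proof -
      have "?Z = {\<alpha><..<\<beta>} \<inter> ((\<lambda>x. proj ((G ^^ t) (x + real i))) -` (- E) \<inter> space borel)" by auto
      also have "\<dots> \<in> sets borel" by measurable
      finally show ?thesis .
    qed
    have 1: "measure lborel ?Z \<le> C\<^sup>2 * \<epsilon> * (\<beta> - \<alpha>)"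
    proof (rule inverse_branch_density[OF E ab _ \<epsilon>(1) C])
      show "i < nat \<bar>d ^ t\<bar>" "proj ((G ^^ t) (x' + real i)) \<in> B"
        using i by (auto simp: T_def V returns_def)
      show "1 \<le> J t (x + real i)" if "x \<in> {\<alpha>..\<beta>}" for x using J1[OF t that] .
      show "J t (x + real i) \<le> C * J t (y + real i)" if "x \<in> {\<alpha>..\<beta>}" "y \<in> {\<alpha>..\<beta>}" for x y
        using JC[OF t that] .
      show "x' \<in> {\<alpha><..<\<beta>}" by (rule x')
      show "measure lborel ({a<..<b} - proj -` E) \<le> \<epsilon> * (b - a)"
        if "a < x" "x < b" "b - a < r" "proj x \<in> B" for a b x by (rule dens[OF that])
    qed
    have 2: "measure lborel ?Z' \<le> \<epsilon> * (\<beta> - \<alpha>)"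
      by (rule dens[of _ x']) (use ab(4) x' in simp_all)
    define D where "D = {x \<in> U. proj ((G ^^ t) (x + real i)) \<in> E}"
    have D[measurable]: "D \<in> sets borel"
    proof -
      have "D = U \<inter> ((\<lambda>x. proj ((G ^^ t) (x + real i))) -` E \<inter> space borel)" unfolding D_def by auto
      also have "\<dots> \<in> sets borel" by measurable
      finally show ?thesis .
    qed
    have "D \<union> (?Z \<union> ?Z') \<in> fmeasurable lborel"
    proof (rule fmeasurableI2)
      show "{\<alpha><..<\<beta>} \<in> fmeasurable lborel" using ab by (intro fmeasurableI) simp_all
      show "D \<union> (?Z \<union> ?Z') \<subseteq> {\<alpha><..<\<beta>}" unfolding D_def U_def by blast
    qed simp
    moreover have "X \<inter> {\<alpha><..<\<beta>} \<subseteq> D \<union> (?Z \<union> ?Z')" unfolding D_def U_def by blast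
    ultimately have "measure lborel (X \<inter> {\<alpha><..<\<beta>}) \<le> measure lborel (D \<union> (?Z \<union> ?Z'))"
      by (intro measure_mono_fmeasurable) simp_all
    also have "\<dots> \<le> measure lborel D + measure lborel (?Z \<union> ?Z')"
      by (rule measure_Un_le) simp_all
    also have "measure lborel (?Z \<union> ?Z') \<le> measure lborel ?Z + measure lborel ?Z'"
      by (rule measure_Un_le) simp_all
    finally have "mX \<le> measure lborel D + (measure lborel ?Z + measure lborel ?Z')"
      unfolding mX_def by simp
    moreover have "(1 + C\<^sup>2) * \<epsilon> * (\<beta> - \<alpha>) = C\<^sup>2 * \<epsilon> * (\<beta> - \<alpha>) + \<epsilon> * (\<beta> - \<alpha>)" by algebra
    ultimately have "3 / 4 * mX \<le> measure lborel D" using 1 2 \<beta>\<epsilon> by linarith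
    moreover have "emeasure lborel D = ennreal (measure lborel D)"
      by (rule fin) (auto simp: D_def U_def)
    ultimately show ?thesis unfolding D_def[symmetric] by (simp add: ennreal_leI)
  qed
  \<comment> \<open>Three quarters of \<open>X\<close> remain on each branch and the Jacobian over
    \<open>X\<close> is at least four times smaller than at \<open>x'\<close>; hence the factor
    3.\<close>
  have Wlow: "(\<Sum>i\<in>T t. ennreal (3 * mX / J t (x' + real i))) \<le> emeasure circle_lebesgue (W t)" if t: "t \<in> {n..N}" for t
  proof -
    have "(\<Sum>i\<in>T t. ennreal (3 * mX / J t (x' + real i))) \<le>
      (\<Sum>i\<in>T t. ennreal (4 / J t (x' + real i)) * emeasure lborel {x \<in> U. proj ((G ^^ t) (x + real i)) \<in> E})"
    proof (rule sum_mono)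
      fix i assume i: "i \<in> T t"
      have "ennreal (3 * mX / J t (x' + real i)) = ennreal (4 / J t (x' + real i)) * ennreal (3 / 4 * mX)"
        using J_pos[of t "x' + real i"] mX by (simp add: ennreal_mult[symmetric])
      also have "\<dots> \<le> ennreal (4 / J t (x' + real i)) * emeasure lborel {x \<in> U. proj ((G ^^ t) (x + real i)) \<in> E}"
        by (intro mult_left_mono branch t i) simp
      finally show "ennreal (3 * mX / J t (x' + real i)) \<le>
        ennreal (4 / J t (x' + real i)) * emeasure lborel {x \<in> U. proj ((G ^^ t) (x + real i)) \<in> E}" .
    qed
    also have "\<dots> = (\<Sum>i\<in>T t. \<integral>\<^sup>+x. ennreal (4 / J t (x' + real i)) * indicator {x \<in> U. proj ((G ^^ t) (x + real i)) \<in> E} x \<partial>lborel)"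
    proof (intro sum.cong refl nn_integral_cmult_indicator[symmetric])
      fix i
      have "{x \<in> U. proj ((G ^^ t) (x + real i)) \<in> E} = U \<inter> ((\<lambda>x. proj ((G ^^ t) (x + real i))) -` E \<inter> space borel)" by auto
      also have "\<dots> \<in> sets borel" by measurable
      finally show "{x \<in> U. proj ((G ^^ t) (x + real i)) \<in> E} \<in> sets lborel" by simp
    qed
    also have "\<dots> \<le> (\<Sum>i\<in>T t. \<integral>\<^sup>+x. indicator (W t) (proj ((G ^^ t) (x + real i))) * ennreal (1 / J t (x + real i)) * indicator {0..<1} x \<partial>lborel)"
    proof (intro sum_mono nn_integral_mono)
      fix i x assume i: "i \<in> T t"
      show "ennreal (4 / J t (x' + real i)) * indicator {x \<in> U. proj ((G ^^ t) (x + real i)) \<in> E} x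
        \<le> indicator (W t) (proj ((G ^^ t) (x + real i))) * ennreal (1 / J t (x + real i)) * indicator {0..<1} x"
      proof (cases "x \<in> {x \<in> U. proj ((G ^^ t) (x + real i)) \<in> E}")
        case True
        then have x: "x \<in> X" "x \<in> {\<alpha><..<\<beta>}" "x \<in> U" "x \<in> {0..<1}" using ab by (auto simp: U_def)
        have "(f ^^ t) (proj ((G ^^ t) (x + real i))) = proj x" by (simp add: f_pow_proj)
        then have "rep01 ((f ^^ t) (proj ((G ^^ t) (x + real i)))) = x" using rep01_proj[OF x(4)] by simp
        then have "proj ((G ^^ t) (x + real i)) \<in> W t"
          using True i t x(3) by (auto simp: W_def S_def b_def)
        moreover have "4 / J t (x' + real i) \<le> 1 / J t (x + real i)"
          using J4[OF t, of x i] x J_pos[of t "x' + real i"] J_pos[of t "x + real i"] by (simp add: divide_simps)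
        ultimately show ?thesis using True x(4) by (simp add: ennreal_leI)
      qed simp
    qed
    also have "\<dots> \<le> (\<Sum>i<nat \<bar>d ^ t\<bar>. \<integral>\<^sup>+x. indicator (W t) (proj ((G ^^ t) (x + real i))) * ennreal (1 / J t (x + real i)) * indicator {0..<1} x \<partial>lborel)"
      by (rule sum_mono2) (auto simp: T_def)
    also have "\<dots> = (\<integral>\<^sup>+x\<in>{0..<1}. indicator UNIV (proj x) *
      (\<Sum>i<nat \<bar>d ^ t\<bar>. indicator (W t) (proj ((G ^^ t) (x + real i))) * ennreal (1 / J t (x + real i))) \<partial>lborel)"
      unfolding sum_distrib_left sum_distrib_right by (subst nn_integral_sum) simp_all
    also have "\<dots> = emeasure circle_lebesgue (W t \<inter> (f ^^ t) -` UNIV)"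
      by (rule emeasure_vimage[symmetric]) auto
    finally show ?thesis by simp
  qed
  have "ennreal (a * 3 * mX) * (\<Sum>t\<in>{n..N}. \<Sum>i\<in>T t. ennreal (1 / J t (x' + real i))) =
      ennreal a * (\<Sum>t\<in>{n..N}. \<Sum>i\<in>T t. ennreal (3 * mX / J t (x' + real i)))"
  proof -
    have "ennreal (3 * mX / J t (x' + real i)) = ennreal (3 * mX) * ennreal (1 / J t (x' + real i))" for t i
      using mX J_pos[of t "x' + real i"] by (simp add: ennreal_mult[symmetric])
    then show ?thesis using a mX by (simp add: sum_distrib_left ennreal_mult mult.assoc)
  qed
  also have "\<dots> \<le> ennreal a * (\<Sum>t\<in>{n..N}. emeasure circle_lebesgue (W t))"
    by (intro mult_left_mono sum_mono Wlow) auto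
  also have "\<dots> \<le> ennreal a * (\<Sum>t\<le>N. emeasure circle_lebesgue (W t))"
    by (intro mult_left_mono sum_mono2) auto
  also have "\<dots> \<le> ennreal (q * a) * ennreal mX" using main unfolding emmX .
  also have "\<dots> = ennreal (a * 3 * mX) * ennreal (q / 3)"
    using a q mX by (simp add: ennreal_mult[symmetric] mult_ac)
  finally have "(\<Sum>t\<in>{n..N}. \<Sum>i\<in>T t. ennreal (1 / J t (x' + real i))) \<le> ennreal (q / 3)"
    using a mX by (subst (asm) ennreal_mult_le_mult_iff) auto
  moreover have "(\<Sum>i<nat \<bar>d ^ t\<bar>. indicator (V t) (proj ((G ^^ t) (x' + real i))) * ennreal (1 / J t (x' + real i)))
     = (\<Sum>i\<in>T t. ennreal (1 / J t (x' + real i)))" for t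
    by (rule sum.mono_neutral_cong_right) (auto simp: T_def)
  ultimately show ?thesis by simp
qed



text \<open>Balance of mass for the \<open>n\<close>-th return to \<open>B\<close>. Almost all of
  \<open>B\<close> returns; the mass arriving outside \<open>Y\<close> is at most
  \<open>1 + \<epsilon>\<close> times the measure there, the mass arriving in \<open>Y\<close> at
  most a third of that rate. Hence the measure of \<open>Y\<close> is of order
  \<open>\<epsilon>\<close>. But \<open>Y\<close>, the part of \<open>B\<close> over
  \<open>X'\<close>, has proportion about \<open>\<kappa>\<close>.\<close>

lemma oscillates_contradiction:
  assumes osc: "oscillates \<kappa> C k"
    and \<mu>: "acisigma f \<mu>" and E[measurable]: "E \<in> sets borel" and mE: "measure circle_lebesgue E > 0"
    and a: "a > 0" and \<epsilon>: "0 < \<epsilon>" "(1 + C\<^sup>2) * \<epsilon> \<le> \<kappa> / 4" and C: "1 \<le> C" and \<kappa>: "\<kappa> > 0"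
    and lower: "\<And>A. A \<in> sets borel \<Longrightarrow> A \<subseteq> E \<Longrightarrow> ennreal a * emeasure circle_lebesgue A \<le> emeasure \<mu> A"
    and upper: "\<And>A. A \<in> sets borel \<Longrightarrow> A \<subseteq> E \<Longrightarrow> emeasure \<mu> A \<le> ennreal ((1 + \<epsilon>) * a) * emeasure circle_lebesgue A"
    and B[measurable]: "B \<in> sets borel" and BE: "B \<subseteq> E"
    and EB: "measure circle_lebesgue (E - B) \<le> \<epsilon> * measure circle_lebesgue E"
    and dens: "\<And>a b x. a < x \<Longrightarrow> x < b \<Longrightarrow> b - a < r \<Longrightarrow> proj x \<in> B \<Longrightarrow>
      measure lborel ({a<..<b} - proj -` E) \<le> \<epsilon> * (b - a)"
    and k: "1 < real k * r" "1 \<le> real k * (\<epsilon> * measure circle_lebesgue E)"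
  shows False
proof -
  obtain n N c p a' X X' where
    A: "1 \<le> n \<and> 0 < c \<and> real k * real n \<le> c * real N \<and>
     (\<forall>t\<le>N. \<forall>x. c \<le> (\<Sum>i<nat \<bar>d ^ t\<bar>. 1 / J t (x + real i))) \<and>
     a' 0 = 0 \<and> a' p = 1 \<and> (\<forall>l<p. a' l < a' (Suc l) \<and> real k * (a' (Suc l) - a' l) \<le> 1) \<and>
     X \<in> sets borel \<and> X' \<in> sets borel \<and>
     (\<forall>l<p. \<kappa> * (a' (Suc l) - a' l) \<le> measure lborel (X \<inter> {a' l<..<a' (Suc l)}) \<and>
            \<kappa> * (a' (Suc l) - a' l) \<le> measure lborel (X' \<inter> {a' l<..<a' (Suc l)})) \<and>
     (\<forall>l<p. \<forall>t\<in>{n..N}. \<forall>i::nat. \<forall>x\<in>{a' l..a' (Suc l)}. \<forall>x'\<in>{a' l..a' (Suc l)}.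
        1 \<le> J t (x + real i) \<and> J t (x + real i) \<le> C * J t (x' + real i) \<and>
        (x \<in> X \<and> x' \<in> X' \<longrightarrow> 4 * J t (x + real i) \<le> J t (x' + real i)))"
    using osc unfolding oscillates_def by (elim exE) (rule that)
  then have n: "1 \<le> n" and c: "0 < c" and kN: "real k * real n \<le> c * real N"
    and a'0: "a' 0 = 0" and a'p: "a' p = 1"
    and X[measurable]: "X \<in> sets borel" and X'[measurable]: "X' \<in> sets borel"
    by - ((elim conjE, assumption)+)
  have low: "c \<le> (\<Sum>i<nat \<bar>d ^ t\<bar>. 1 / J t (x + real i))" if "t \<le> N" for t x
    using A that by - (elim conjE, blast)
  have a': "a' l < a' (Suc l)" "real k * (a' (Suc l) - a' l) \<le> 1" if "l < p" for l
    using A that by - ((elim conjE, blast)+)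
  have XX: "\<kappa> * (a' (Suc l) - a' l) \<le> measure lborel (X \<inter> {a' l<..<a' (Suc l)})"
            "\<kappa> * (a' (Suc l) - a' l) \<le> measure lborel (X' \<inter> {a' l<..<a' (Suc l)})" if "l < p" for l
    using A that by - ((elim conjE, blast)+)
  have JJ: "1 \<le> J t (x + real i) \<and> J t (x + real i) \<le> C * J t (x' + real i) \<and>
        (x \<in> X \<and> x' \<in> X' \<longrightarrow> 4 * J t (x + real i) \<le> J t (x' + real i))"
    if "l < p" "t \<in> {n..N}" "x \<in> {a' l..a' (Suc l)}" "x' \<in> {a' l..a' (Suc l)}" for l t i x x'
    using A[THEN conjunct2, THEN conjunct2, THEN conjunct2, THEN conjunct2, THEN conjunct2, THEN conjunct2,
        THEN conjunct2, THEN conjunct2, THEN conjunct2, THEN conjunct2] that by blast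
  let ?m = "measure circle_lebesgue"
  have E'[measurable]: "proj -` E \<in> sets borel" using measurable_sets[OF proj_measurable E] by simp
  have mono: "a' l \<le> a' m" if "l \<le> m" "m \<le> p" for l m
    using that
  proof (induction m rule: dec_induct)
    case (step j)
    then show ?case using a'(1)[of j] by simp
  qed simp
  have len: "a' (Suc l) - a' l < r" if "l < p" for l
  proof -
    have "real k * (a' (Suc l) - a' l) < real k * r" using a'(2)[OF that] k(1) by linarith
    then show ?thesis by (simp add: mult_less_cancel_left)
  qed
  have range: "0 \<le> a' l" "a' (Suc l) \<le> 1" if "l < p" for l
    using mono[of 0 l] mono[of "Suc l" p] a'0 a'p that by auto
  define I where "I l = {a' l<..<a' (Suc l)}" for l
  have Idisj: "l = m" if "x \<in> I l" "x \<in> I m" "l < p" "m < p" for x l m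
  proof (rule ccontr)
    assume "l \<noteq> m"
    then consider "Suc l \<le> m" | "Suc m \<le> l" by linarith
    then show False using that mono[of "Suc l" m] mono[of "Suc m" l] by cases (auto simp: I_def)
  qed
  have Icov: "\<exists>l<p. x \<in> I l" if x: "x \<in> {0..<1}" "x \<notin> a' ` {..p}" for x
  proof -
    define l where "l = (LEAST l. x < a' l)"
    have l: "x < a' l" unfolding l_def by (rule LeastI[of _ p]) (use x a'p in auto)
    have lp: "l \<le> p" unfolding l_def by (rule Least_le) (use x a'p in auto)
    obtain l' where l': "l = Suc l'" using l x a'0 by (cases l) auto
    have "\<not> x < a' l'" using not_less_Least[of l' "\<lambda>l. x < a' l"] l' unfolding l_def by auto
    moreover have "x \<noteq> a' l'" using x lp l' by auto
    ultimately show ?thesis using l l' lp by (intro exI[of _ l']) (auto simp: I_def)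
  qed
  define V where "V = (\<lambda>t. returns f B n t)"
  have fm[measurable]: "f \<in> borel_measurable borel" using f_pow_measurable[of 1] by (simp add: comp_def)
  have V[measurable]: "V t \<in> sets borel" for t unfolding V_def by (rule returns_measurable) auto
  \<comment> \<open>Grid points are excluded so that each point of \<open>Y\<close> lies in the
    interior of one interval, as \<open>return_density\<close> demands.\<close>
  define Y where "Y = {y \<in> B. rep01 y \<in> X' \<inter> (\<Union>l<p. I l)}"
  have Y[measurable]: "Y \<in> sets borel"
  proof -
    have "Y = B \<inter> {y. rep01 y \<in> X' \<inter> (\<Union>l<p. I l)}" by (auto simp: Y_def)
    also have "\<dots> \<in> sets borel" by (intro sets.Int B rep01_vimage_measurable) (auto simp: I_def)
    finally show ?thesis .
  qed
  have YB: "Y \<subseteq> B" by (auto simp: Y_def)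

  \<comment> \<open>The points with too few returns: their measure is at most
    \<open>n / (c * N) \<le> 1 / k\<close>, and \<open>k\<close> is so large that this is at most
    \<open>\<epsilon>\<close> times the measure of \<open>E\<close>.\<close>
  define Q where "Q = {y \<in> B. visits f B N y < n}"
  have "c * real N * ?m Q \<le> real n" unfolding Q_def by (rule few_returns) (use c low in auto)
  moreover have "real k * real n * ?m Q \<le> c * real N * ?m Q" by (rule mult_right_mono[OF kN]) simp
  ultimately have "real n * (real k * ?m Q) \<le> real n * 1" by (simp add: mult_ac)
  then have kQ: "real k * ?m Q \<le> 1" using n by (subst (asm) mult_le_cancel_left_pos) auto
  have "k > 0" using k(2) by (cases k) auto
  moreover have "real k * ?m Q \<le> real k * (\<epsilon> * ?m E)" using kQ k(2) by linarith
  ultimately have mQ: "?m Q \<le> \<epsilon> * ?m E" using mult_left_le_imp_le[of "real k"] of_nat_0_less_iff by blast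
  have Qm[measurable]: "Q \<in> sets borel"
  proof -
    have "real (visits f B N y) = (\<Sum>s\<in>{1..N}. indicator B ((f ^^ s) y))" for y
      unfolding visits_def by (simp add: indicator_def sum.If_cases Int_def)
    then have "visits f B N y < n \<longleftrightarrow> (\<Sum>s\<in>{1..N}. indicator B ((f ^^ s) y)) < real n" for y
      by (metis of_nat_less_iff)
    then have "Q = {y \<in> space borel. y \<in> B \<and> (\<Sum>s\<in>{1..N}. indicator B ((f ^^ s) y)) < real n}"
      unfolding Q_def by simp
    then show ?thesis by simp
  qed
  have "?m B \<le> ?m (Q \<union> (\<Union>t\<in>{n..N}. V t))"
  proof (rule circle_lebesgue.finite_measure_mono)
    show "B \<subseteq> Q \<union> (\<Union>t\<in>{n..N}. V t)"
    proof
      fix y assume "y \<in> B"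
      show "y \<in> Q \<union> (\<Union>t\<in>{n..N}. V t)"
      proof (cases "visits f B N y < n")
        case True
        then show ?thesis using \<open>y \<in> B\<close> by (simp add: Q_def)
      next
        case False
        then have "n \<le> visits f B N y" by simp
        from returns_exhaust[OF \<open>y \<in> B\<close> this n] show ?thesis unfolding V_def by blast
      qed
    qed
  qed auto
  also have "\<dots> \<le> ?m Q + ?m (\<Union>t\<in>{n..N}. V t)" by (rule measure_Un_le) auto
  also have "?m (\<Union>t\<in>{n..N}. V t) \<le> (\<Sum>t\<in>{n..N}. ?m (V t))" by (rule measure_UNION_le) auto
  finally have VB: "?m B - \<epsilon> * ?m E \<le> (\<Sum>t\<in>{n..N}. ?m (V t))" using mQ by linarith

  \<comment> \<open>No Jacobians here: the antichain bound alone compares the returning mass with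
    the measure of the target.\<close>
  have part1: "(\<Sum>t\<in>{n..N}. ?m (V t \<inter> (f ^^ t) -` (B - Y))) \<le> (1 + \<epsilon>) * ?m (B - Y)"
  proof -
    define W where "W t = (if n \<le> t then V t \<inter> (f ^^ t) -` (B - Y) else {})" for t
    have W[measurable]: "W t \<in> sets borel" for t
      unfolding W_def using vimage_pow_measurable[of "B - Y" t] by auto
    have "ennreal a * (\<Sum>t\<le>N. emeasure circle_lebesgue (W t)) \<le> (\<Sum>t\<le>N. emeasure \<mu> (W t))"
      unfolding sum_distrib_left using BE by (intro sum_mono lower W) (auto simp: W_def V_def returns_def)
    also have "\<dots> \<le> emeasure \<mu> (B - Y)"
    proof (rule acisigma_antichain[OF \<mu> fm])
      show "W t \<subseteq> (f ^^ t) -` (B - Y)" for t by (auto simp: W_def)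
      show False if "t' < t" "t \<le> N" "y \<in> W t" "(f ^^ (t - t')) y \<in> W t'" for t t' y
        using returns_antichain[of y f B n t t'] that by (auto simp: W_def V_def split: if_splits)
    qed (use W in auto)
    also have "\<dots> \<le> ennreal ((1 + \<epsilon>) * a) * emeasure circle_lebesgue (B - Y)"
      using BE by (intro upper) auto
    finally have "ennreal a * ennreal (\<Sum>t\<le>N. ?m (W t)) \<le> ennreal a * ennreal ((1 + \<epsilon>) * ?m (B - Y))"
      using a \<epsilon> by (simp add: circle_lebesgue.emeasure_eq_measure sum_ennreal ennreal_mult[symmetric] mult_ac)
    then have "(\<Sum>t\<le>N. ?m (W t)) \<le> (1 + \<epsilon>) * ?m (B - Y)"
      using a \<epsilon> by (subst (asm) ennreal_mult_le_mult_iff) (auto simp: ennreal_le_iff)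
    moreover have "(\<Sum>t\<in>{n..N}. ?m (V t \<inter> (f ^^ t) -` (B - Y))) = (\<Sum>t\<le>N. ?m (W t))"
      by (rule sum.mono_neutral_cong_left) (auto simp: W_def)
    ultimately show ?thesis by simp
  qed

  have part2: "(\<Sum>t\<in>{n..N}. ?m (V t \<inter> (f ^^ t) -` Y)) \<le> (1 + \<epsilon>) / 3 * ?m Y"
  proof -
    let ?s = "\<lambda>t x. (\<Sum>i<nat \<bar>d ^ t\<bar>. indicator (V t) (proj ((G ^^ t) (x + real i))) * ennreal (1 / J t (x + real i)))"
    have "ennreal (\<Sum>t\<in>{n..N}. ?m (V t \<inter> (f ^^ t) -` Y)) = (\<Sum>t\<in>{n..N}. emeasure circle_lebesgue (V t \<inter> (f ^^ t) -` Y))"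
      by (simp add: circle_lebesgue.emeasure_eq_measure sum_ennreal)
    also have "\<dots> = (\<Sum>t\<in>{n..N}. \<integral>\<^sup>+x\<in>{0..<1}. indicator Y (proj x) * ?s t x \<partial>lborel)"
      by (intro sum.cong refl emeasure_vimage V Y)
    also have "\<dots> = (\<integral>\<^sup>+x. (\<Sum>t\<in>{n..N}. indicator Y (proj x) * ?s t x * indicator {0..<1} x) \<partial>lborel)"
      by (rule nn_integral_sum[symmetric]) measurable
    also have "\<dots> \<le> (\<integral>\<^sup>+x. ennreal ((1 + \<epsilon>) / 3) * (indicator Y (proj x) * indicator {0..<1} x) \<partial>lborel)"
    proof (rule nn_integral_mono)
      fix x :: real
      have "(\<Sum>t\<in>{n..N}. ?s t x) \<le> ennreal ((1 + \<epsilon>) / 3)" if x: "proj x \<in> Y" "x \<in> {0..<1}"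
      proof -
        obtain l where l: "l < p" "x \<in> I l" "x \<in> X'" "proj x \<in> B"
          using x by (auto simp: Y_def rep01_proj)
        show ?thesis
        proof (rule return_density[OF \<mu> E a _ lower upper B _ _ \<epsilon>(2) C \<kappa>])
          show "measure lborel ({a<..<b} - proj -` E) \<le> \<epsilon> * (b - a)"
            if "a < x" "x < b" "b - a < r" "proj x \<in> B" for a b x by (rule dens[OF that])
          show "0 \<le> a' l" "a' (Suc l) \<le> 1" by (rule range[OF l(1)])+
          show "a' l < a' (Suc l)" by (rule a'(1)[OF l(1)])
          show "a' (Suc l) - a' l < r" by (rule len[OF l(1)])
          show "X \<in> sets borel" by (rule X)
          show "\<kappa> * (a' (Suc l) - a' l) \<le> measure lborel (X \<inter> {a' l<..<a' (Suc l)})" by (rule XX(1)[OF l(1)])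
          show "x \<in> {a' l<..<a' (Suc l)}" using l(2) by (simp add: I_def)
          show "proj x \<in> B" by (rule l(4))
          show "V = (\<lambda>t. returns f B n t)" by (rule V_def)
          show "1 \<le> J t (z + real i)" if "t \<in> {n..N}" "z \<in> {a' l..a' (Suc l)}" for t i z
            using JJ[OF l(1) that that(2)] by blast
          show "J t (z + real i) \<le> C * J t (w + real i)"
            if "t \<in> {n..N}" "z \<in> {a' l..a' (Suc l)}" "w \<in> {a' l..a' (Suc l)}" for t i z w
            using JJ[OF l(1) that] by blast
          have x: "x \<in> {a' l..a' (Suc l)}" using l(2) by (simp add: I_def)
          show "4 * J t (z + real i) \<le> J t (x + real i)"
            if "t \<in> {n..N}" "z \<in> {a' l..a' (Suc l)}" "z \<in> X" for t i z
            using JJ[OF l(1) that(1,2) x] that(3) l(3) by blast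
        qed (use \<epsilon>(1) in simp_all)
      qed
      then show "(\<Sum>t\<in>{n..N}. indicator Y (proj x) * ?s t x * indicator {0..<1} x)
          \<le> ennreal ((1 + \<epsilon>) / 3) * (indicator Y (proj x) * indicator {0..<1} x)"
        by (auto simp: indicator_def)
    qed
    also have "\<dots> = ennreal ((1 + \<epsilon>) / 3) * emeasure circle_lebesgue Y"
      unfolding emeasure_circle[OF Y] by (rule nn_integral_cmult) simp
    also have "\<dots> = ennreal ((1 + \<epsilon>) / 3 * ?m Y)"
      using \<epsilon> ennreal_mult[of "(1 + \<epsilon>) / 3" "?m Y"] by (simp add: circle_lebesgue.emeasure_eq_measure)
    finally show ?thesis using \<epsilon> by (subst (asm) ennreal_le_iff) auto
  qed

  have "(\<Sum>t\<in>{n..N}. ?m (V t)) = (\<Sum>t\<in>{n..N}. ?m (V t \<inter> (f ^^ t) -` (B - Y)) + ?m (V t \<inter> (f ^^ t) -` Y))"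
  proof (rule sum.cong[OF refl])
    fix t
    have "V t = (V t \<inter> (f ^^ t) -` (B - Y)) \<union> (V t \<inter> (f ^^ t) -` Y)"
      using YB by (auto simp: V_def returns_def)
    moreover have "?m \<dots> = ?m (V t \<inter> (f ^^ t) -` (B - Y)) + ?m (V t \<inter> (f ^^ t) -` Y)"
      using vimage_pow_measurable[of "B - Y" t] vimage_pow_measurable[of Y t]
      by (intro circle_lebesgue.finite_measure_Union) auto
    ultimately show "?m (V t) = ?m (V t \<inter> (f ^^ t) -` (B - Y)) + ?m (V t \<inter> (f ^^ t) -` Y)" by simp
  qed
  also have "\<dots> \<le> (1 + \<epsilon>) * ?m (B - Y) + (1 + \<epsilon>) / 3 * ?m Y"
    unfolding sum.distrib using part1 part2 by (rule add_mono)
  also have "?m (B - Y) = ?m B - ?m Y"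
    using YB by (intro circle_lebesgue.finite_measure_Diff) auto
  finally have total: "?m B - \<epsilon> * ?m E \<le> (1 + \<epsilon>) * ?m B - 2 / 3 * (1 + \<epsilon>) * ?m Y"
    using VB by (simp add: field_simps)

  define Z where "Z l = {y. rep01 y \<in> X' \<inter> I l \<inter> proj -` E}" for l
  define BB where "BB l = {y \<in> B. rep01 y \<in> I l}" for l
  have [measurable]: "Z l \<in> sets borel" for l
    unfolding Z_def by (rule rep01_vimage_measurable) (simp add: I_def)
  have [measurable]: "BB l \<in> sets borel" for l
  proof -
    have "BB l = B \<inter> {y. rep01 y \<in> I l}" by (auto simp: BB_def)
    also have "\<dots> \<in> sets borel" by (intro sets.Int B rep01_vimage_measurable) (simp add: I_def)
    finally show ?thesis .
  qed
  \<comment> \<open>An interval that meets \<open>B\<close> is filled by \<open>E\<close> up to a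
    proportion \<open>\<epsilon>\<close>, so at least \<open>\<kappa> - \<epsilon>\<close> of it
    lies in both \<open>X'\<close> and \<open>E\<close>; an interval missing \<open>B\<close>
    contributes nothing on the left.\<close>
  have ZB: "(\<kappa> - \<epsilon>) * ?m (BB l) \<le> ?m (Z l)" if l: "l < p" for l
  proof (cases "BB l = {}")
    case False
    then obtain y where y: "y \<in> B" "rep01 y \<in> I l" by (auto simp: BB_def)
    have fin: "emeasure lborel A = ennreal (measure lborel A)" if "A \<subseteq> I l" for A
    proof -
      have "emeasure lborel A \<le> emeasure lborel (I l)" by (rule emeasure_mono) (use that in \<open>auto simp: I_def\<close>)
      also have "\<dots> < \<infinity>" using a'(1)[OF l] by (simp add: I_def)
      finally show ?thesis by (intro emeasure_eq_ennreal_measure) simp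
    qed
    have "measure lborel (I l - proj -` E) \<le> \<epsilon> * (a' (Suc l) - a' l)"
      unfolding I_def by (rule dens[of _ "rep01 y"]) (use y len[OF l] in \<open>auto simp: I_def rep01\<close>)
    moreover have "measure lborel (X' \<inter> I l) \<le> measure lborel ((X' \<inter> I l \<inter> proj -` E) \<union> (I l - proj -` E))"
    proof (rule measure_mono_fmeasurable)
      have "I l \<in> fmeasurable lborel" using a'(1)[OF l] unfolding I_def by (intro fmeasurableI) simp_all
      then show "X' \<inter> I l \<inter> proj -` E \<union> (I l - proj -` E) \<in> fmeasurable lborel"
        by (rule fmeasurableI2) (auto simp: I_def)
    qed (auto simp: I_def)
    moreover have "\<dots> \<le> measure lborel (X' \<inter> I l \<inter> proj -` E) + measure lborel (I l - proj -` E)"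
      by (rule measure_Un_le) (auto simp: I_def)
    ultimately have 1: "(\<kappa> - \<epsilon>) * (a' (Suc l) - a' l) \<le> measure lborel (X' \<inter> I l \<inter> proj -` E)"
      using XX(2)[OF l] unfolding I_def by (simp add: algebra_simps)
    have "emeasure circle_lebesgue (Z l) = emeasure lborel (X' \<inter> I l \<inter> proj -` E)"
      unfolding Z_def
    proof (subst emeasure_rep01)
      have "X' \<inter> I l \<inter> proj -` E \<inter> {0..<1} = X' \<inter> I l \<inter> proj -` E" using range[OF l] by (auto simp: I_def)
      then show "emeasure lborel (X' \<inter> I l \<inter> proj -` E \<inter> {0..<1}) = emeasure lborel (X' \<inter> I l \<inter> proj -` E)" by simp
    qed (auto simp: I_def)
    then have 2: "?m (Z l) = measure lborel (X' \<inter> I l \<inter> proj -` E)"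
      by (simp add: measure_def)
    have "emeasure circle_lebesgue (BB l) \<le> emeasure circle_lebesgue {y. rep01 y \<in> I l}"
      by (rule emeasure_mono) (auto simp: BB_def I_def intro: rep01_vimage_measurable)
    also have "\<dots> \<le> emeasure lborel (I l)" by (subst emeasure_rep01) (auto simp: I_def intro!: emeasure_mono)
    also have "\<dots> = ennreal (a' (Suc l) - a' l)" using a'(1)[OF l] by (simp add: I_def)
    finally have 3: "?m (BB l) \<le> a' (Suc l) - a' l"
      using a'(1)[OF l] by (simp add: circle_lebesgue.emeasure_eq_measure)
    have "(1 + C\<^sup>2) * \<epsilon> \<ge> 1 * \<epsilon>" using \<epsilon> by (intro mult_right_mono) auto
    then have "\<kappa> - \<epsilon> \<ge> 0" using \<epsilon>(2) \<kappa> by simp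
    then have "(\<kappa> - \<epsilon>) * ?m (BB l) \<le> (\<kappa> - \<epsilon>) * (a' (Suc l) - a' l)" by (rule mult_left_mono[OF 3])
    then show ?thesis using 1 2 by linarith
  qed simp
  have "?m B \<le> ?m ((\<Union>l<p. BB l) \<union> {y. rep01 y \<in> a' ` {..p}})"
  proof (rule circle_lebesgue.finite_measure_mono)
    show "B \<subseteq> (\<Union>l<p. BB l) \<union> {y. rep01 y \<in> a' ` {..p}}"
      using Icov[OF rep01(2)] by (auto simp: BB_def)
    have "a' ` {..p} \<in> sets borel" by (intro borel_closed finite_imp_closed) simp
    then show "(\<Union>l<p. BB l) \<union> {y. rep01 y \<in> a' ` {..p}} \<in> sets circle_lebesgue"
      using rep01_vimage_measurable by auto
  qed
  also have "\<dots> \<le> ?m (\<Union>l<p. BB l) + ?m {y. rep01 y \<in> a' ` {..p}}"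
  proof (rule measure_Un_le)
    have "a' ` {..p} \<in> sets borel" by (intro borel_closed finite_imp_closed) simp
    then show "{y. rep01 y \<in> a' ` {..p}} \<in> sets circle_lebesgue"
      using rep01_vimage_measurable by auto
  qed auto
  also have "?m {y. rep01 y \<in> a' ` {..p}} = 0"
  proof -
    have "a' ` {..p} \<in> sets borel" by (intro borel_closed finite_imp_closed) simp
    then have "emeasure circle_lebesgue {y. rep01 y \<in> a' ` {..p}} \<le> emeasure lborel (a' ` {..p})"
      by (subst emeasure_rep01) (auto intro!: emeasure_mono)
    also have "\<dots> = 0" by (rule emeasure_lborel_countable) (simp add: countable_finite)
    finally show ?thesis by (simp add: measure_def)
  qed
  also have "?m (\<Union>l<p. BB l) \<le> (\<Sum>l<p. ?m (BB l))" by (rule measure_UNION_le) auto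
  finally have B1: "?m B \<le> (\<Sum>l<p. ?m (BB l))" by simp
  have \<kappa>\<epsilon>: "8 * \<epsilon> \<le> \<kappa>"
  proof -
    have "1 \<le> C\<^sup>2" using C by simp
    then have "2 * \<epsilon> \<le> (1 + C\<^sup>2) * \<epsilon>" using \<epsilon>(1) by (intro mult_right_mono) auto
    then show ?thesis using \<epsilon>(2) by simp
  qed
  have "(\<kappa> - \<epsilon>) * ?m B \<le> (\<kappa> - \<epsilon>) * (\<Sum>l<p. ?m (BB l))"
    using B1 \<kappa>\<epsilon> \<epsilon> by (intro mult_left_mono) auto
  also have "\<dots> \<le> (\<Sum>l<p. ?m (Z l))" unfolding sum_distrib_left by (rule sum_mono) (simp add: ZB)
  also have "\<dots> = ?m (\<Union>l<p. Z l)"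
  proof (rule circle_lebesgue.finite_measure_finite_Union[symmetric])
    show "Z ` {..<p} \<subseteq> sets circle_lebesgue" by auto
    show "disjoint_family_on Z {..<p}"
      unfolding disjoint_family_on_def Z_def using Idisj by blast
  qed simp
  also have "\<dots> \<le> ?m (Y \<union> (E - B))"
  proof (rule circle_lebesgue.finite_measure_mono)
    show "(\<Union>l<p. Z l) \<subseteq> Y \<union> (E - B)" unfolding Z_def Y_def by (auto simp: rep01(1))
  qed auto
  also have "\<dots> \<le> ?m Y + ?m (E - B)" by (rule measure_Un_le) auto
  finally have mY: "(\<kappa> - \<epsilon>) * ?m B - \<epsilon> * ?m E \<le> ?m Y" using EB by linarith
  have mB: "?m B \<le> ?m E" "?m E - \<epsilon> * ?m E \<le> ?m B"
    using EB circle_lebesgue.finite_measure_Diff[of E B] circle_lebesgue.finite_measure_mono[OF BE] E B BE by simp_all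
  \<comment> \<open>What remains is arithmetic:
    \<open>7 * \<epsilon> * ?m B - \<epsilon> * ?m E \<le> ?m Y\<close> and
    \<open>?m Y \<le> 3 * \<epsilon> * ?m E\<close> give \<open>7 * ?m B \<le> 4 * ?m E\<close>,
    although \<open>?m B \<ge> (1 - \<epsilon>) * ?m E\<close> and
    \<open>\<epsilon> \<le> 1 / 8\<close>.\<close>
  have "2 / 3 * ?m Y \<le> 2 / 3 * (1 + \<epsilon>) * ?m Y" using \<epsilon> by (intro mult_right_mono) auto
  then have "2 / 3 * ?m Y \<le> \<epsilon> * ?m B + \<epsilon> * ?m E" using total by (simp add: algebra_simps)
  also have "\<dots> \<le> 2 * \<epsilon> * ?m E" using mult_left_mono[OF mB(1), of \<epsilon>] \<epsilon>(1) by linarith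
  finally have "?m Y \<le> 3 * \<epsilon> * ?m E" by simp
  moreover have "7 * \<epsilon> * ?m B \<le> (\<kappa> - \<epsilon>) * ?m B" using \<kappa>\<epsilon> by (intro mult_right_mono) auto
  ultimately have "7 * \<epsilon> * ?m B \<le> 4 * \<epsilon> * ?m E" using mY by linarith
  then have "7 * ?m B \<le> 4 * ?m E" using \<epsilon>(1) by simp
  moreover have "7 * (?m E - \<epsilon> * ?m E) \<le> 7 * ?m B" using mB(2) by (intro mult_left_mono) simp_all
  ultimately have "7 * (?m E - \<epsilon> * ?m E) \<le> 4 * ?m E" by (rule order_trans[rotated])
  then have "3 * ?m E \<le> 7 * \<epsilon> * ?m E" by (simp add: algebra_simps)
  then have "3 \<le> 7 * \<epsilon>" using mE by simp
  \<comment> \<open>\<open>X\<close> cannot occupy more than a whole interval; with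
    \<open>8 * \<epsilon> \<le> \<kappa>\<close> this bounds \<open>\<epsilon>\<close> by
    1/8.\<close>
  moreover have "\<kappa> \<le> 1"
  proof (cases "p = 0")
    case True
    then show ?thesis using a'0 a'p by simp
  next
    case False
    then have "\<kappa> * (a' 1 - a' 0) \<le> measure lborel (X \<inter> {a' 0<..<a' 1})" using XX(1)[of 0] by simp
    also have "\<dots> \<le> measure lborel {a' 0<..<a' 1}"
      using a'(1)[of 0] False by (intro measure_mono_fmeasurable) (auto simp: fmeasurable_def)
    also have "\<dots> = a' 1 - a' 0" using a'(1)[of 0] False by simp
    finally show ?thesis using a'(1)[of 0] False by simp
  qed
  ultimately show False using \<kappa>\<epsilon> by simp
qed

end

text \<open>The order of choices: \<open>\<epsilon>\<close> from \<open>\<kappa>\<close> and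
  \<open>C\<close> alone, then \<open>E\<close> with its level \<open>a\<close>, then the scale
  \<open>r\<close> and the set \<open>B\<close> of density points, and \<open>k\<close> last. It may
  depend on \<open>\<mu>\<close>, since oscillation is assumed for every \<open>k\<close>.\<close>

lemma no_acisigma_if_oscillates:
  assumes osc: "\<And>k. \<exists>F F' d. circle_lift F F' d f \<and> lift.oscillates F F' d \<kappa> C k"
    and \<kappa>: "0 < \<kappa>" and C: "1 \<le> C" and \<mu>: "acisigma f \<mu>"
  shows False
proof -
  define \<epsilon> where "\<epsilon> = \<kappa> / (4 * (1 + C\<^sup>2))"
  have C2: "1 + C\<^sup>2 > 0" by (simp add: add_pos_nonneg)
  have \<epsilon>: "\<epsilon> > 0" "(1 + C\<^sup>2) * \<epsilon> \<le> \<kappa> / 4" using \<kappa> C2 unfolding \<epsilon>_def by (auto simp: divide_simps)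
  obtain E a where E: "E \<in> sets borel" "measure circle_lebesgue E > 0" "a > 0"
    "\<And>A. A \<in> sets borel \<Longrightarrow> A \<subseteq> E \<Longrightarrow> ennreal a * emeasure circle_lebesgue A \<le> emeasure \<mu> A"
    "\<And>A. A \<in> sets borel \<Longrightarrow> A \<subseteq> E \<Longrightarrow> emeasure \<mu> A \<le> ennreal ((1 + \<epsilon>) * a) * emeasure circle_lebesgue A"
    using acisigma_level_set[OF \<mu>, of "1 + \<epsilon>"] \<epsilon>(1) by (metis less_add_same_cancel1)
  have "\<epsilon> * measure circle_lebesgue E > 0" using \<epsilon> E by simp
  from density_circle[OF E(1) \<epsilon>(1) this]
  obtain r B where r: "r > 0" "B \<in> sets borel" "B \<subseteq> E"
    "measure circle_lebesgue (E - B) \<le> \<epsilon> * measure circle_lebesgue E"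
    "\<And>a b x. a < x \<Longrightarrow> x < b \<Longrightarrow> b - a < r \<Longrightarrow> proj x \<in> B \<Longrightarrow>
      measure lborel ({a<..<b} - proj -` E) \<le> \<epsilon> * (b - a)" by blast
  obtain k1 where k1: "1 < real k1 * r" using reals_Archimedean3[OF r(1)] by blast
  obtain k2 where k2: "1 < real k2 * (\<epsilon> * measure circle_lebesgue E)"
    using reals_Archimedean3[OF \<open>\<epsilon> * measure circle_lebesgue E > 0\<close>] by blast
  define k where "k = max k1 k2"
  have kk: "real k1 \<le> real k" "real k2 \<le> real k" by (simp_all add: k_def)
  have "1 < real k * r"
    using k1 mult_right_mono[OF kk(1), of r] r(1) by linarith
  moreover have "1 \<le> real k * (\<epsilon> * measure circle_lebesgue E)"
    using k2 \<open>\<epsilon> * measure circle_lebesgue E > 0\<close>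
      mult_right_mono[OF kk(2), of "\<epsilon> * measure circle_lebesgue E"] by linarith
  moreover obtain F F' d where FL: "circle_lift F F' d f" and os: "lift.oscillates F F' d \<kappa> C k" using osc by blast
  ultimately show False
  proof (intro circle_lift.oscillates_contradiction[OF FL os \<mu> E(1-3) \<epsilon> C \<kappa> _ _ r(2-4)])
    show "ennreal a * emeasure circle_lebesgue A \<le> emeasure \<mu> A" if "A \<in> sets borel" "A \<subseteq> E" for A
      by (rule E(4)[OF that])
    show "emeasure \<mu> A \<le> ennreal ((1 + \<epsilon>) * a) * emeasure circle_lebesgue A" if "A \<in> sets borel" "A \<subseteq> E" for A
      by (rule E(5)[OF that])
    show "measure lborel ({a<..<b} - proj -` E) \<le> \<epsilon> * (b - a)"
      if "a < x" "x < b" "b - a < r" "proj x \<in> B" for a b x by (rule r(5)[OF that])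
  qed
qed

section \<open>Mixing of expanding maps with Lipschitz derivative\<close>

definition avg :: "(real \<Rightarrow> real) \<Rightarrow> real" where
  "avg h = (LINT x:{0..<1}|lborel. h x)"

definition bdd_borel :: "(real \<Rightarrow> real) \<Rightarrow> bool" where
  "bdd_borel h \<longleftrightarrow> h \<in> borel_measurable borel \<and> (\<exists>B. \<forall>x. \<bar>h x\<bar> \<le> B)"

lemma bdd_borel_measurable: "bdd_borel h \<Longrightarrow> h \<in> borel_measurable borel" by (simp add: bdd_borel_def)

lemma bdd_borelI: "h \<in> borel_measurable borel \<Longrightarrow> (\<And>x. \<bar>h x\<bar> \<le> B) \<Longrightarrow> bdd_borel h" by (auto simp: bdd_borel_def)

lemma bdd_borel_integrable:
  assumes "bdd_borel h" shows "set_integrable lborel {0..<1} h"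
proof -
  obtain B where B: "\<And>x. \<bar>h x\<bar> \<le> B" using assms by (auto simp: bdd_borel_def)
  have [measurable]: "h \<in> borel_measurable borel" using assms by (rule bdd_borel_measurable)
  show ?thesis unfolding set_integrable_def
    by (rule integrableI_bounded_set_indicator[where B = B]) (use B in auto)
qed

lemma bdd_borel_const: "bdd_borel (\<lambda>x. c)" by (rule bdd_borelI[of _ "\<bar>c\<bar>"]) auto

lemma bdd_borel_add:
  assumes f: "bdd_borel f" and g: "bdd_borel g" shows "bdd_borel (\<lambda>x. f x + g x)"
proof -
  obtain B where B: "\<And>x. \<bar>f x\<bar> \<le> B" using f unfolding bdd_borel_def by blast
  obtain C where C: "\<And>x. \<bar>g x\<bar> \<le> C" using g unfolding bdd_borel_def by blast
  show ?thesis
  proof (rule bdd_borelI)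
    show "(\<lambda>x. f x + g x) \<in> borel_measurable borel"
      by (rule borel_measurable_add[OF bdd_borel_measurable[OF f] bdd_borel_measurable[OF g]])
    show "\<bar>f x + g x\<bar> \<le> B + C" for x using B[of x] C[of x] by linarith
  qed
qed

lemma bdd_borel_mult:
  assumes f: "bdd_borel f" and g: "bdd_borel g" shows "bdd_borel (\<lambda>x. f x * g x)"
proof -
  obtain B where B: "\<And>x. \<bar>f x\<bar> \<le> B" using f unfolding bdd_borel_def by blast
  obtain C where C: "\<And>x. \<bar>g x\<bar> \<le> C" using g unfolding bdd_borel_def by blast
  have "0 \<le> B" using B[of 0] by linarith
  show ?thesis
  proof (rule bdd_borelI)
    show "(\<lambda>x. f x * g x) \<in> borel_measurable borel"
      by (rule borel_measurable_times[OF bdd_borel_measurable[OF f] bdd_borel_measurable[OF g]])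
    show "\<bar>f x * g x\<bar> \<le> B * C" for x
      unfolding abs_mult by (rule mult_mono[OF B C \<open>0 \<le> B\<close> abs_ge_zero])
  qed
qed

lemma bdd_borel_cmult: "bdd_borel f \<Longrightarrow> bdd_borel (\<lambda>x. c * f x)" by (rule bdd_borel_mult[OF bdd_borel_const])

lemma bdd_borel_diff: "bdd_borel f \<Longrightarrow> bdd_borel g \<Longrightarrow> bdd_borel (\<lambda>x. f x - g x)"
  using bdd_borel_add[of f "\<lambda>x. - 1 * g x"] bdd_borel_cmult[of g "- 1"] by simp

lemma bdd_borel_comp: "bdd_borel f \<Longrightarrow> g \<in> borel_measurable borel \<Longrightarrow> bdd_borel (\<lambda>x. f (g x))"
  unfolding bdd_borel_def by auto

lemma avg_const [simp]: "avg (\<lambda>x. c) = c" by (simp add: avg_def set_lebesgue_integral_def)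

lemma avg_add: "bdd_borel f \<Longrightarrow> bdd_borel g \<Longrightarrow> avg (\<lambda>x. f x + g x) = avg f + avg g"
  unfolding avg_def by (intro set_integral_add bdd_borel_integrable)

lemma avg_diff: "bdd_borel f \<Longrightarrow> bdd_borel g \<Longrightarrow> avg (\<lambda>x. f x - g x) = avg f - avg g"
  unfolding avg_def by (intro set_integral_diff bdd_borel_integrable)

lemma avg_cmult: "avg (\<lambda>x. c * f x) = c * avg f" unfolding avg_def by simp

lemma avg_mono: "bdd_borel f \<Longrightarrow> bdd_borel g \<Longrightarrow> (\<And>x. x \<in> {0..<1} \<Longrightarrow> f x \<le> g x) \<Longrightarrow> avg f \<le> avg g"
  unfolding avg_def by (intro set_integral_mono bdd_borel_integrable)

lemma avg_abs_le:
  assumes "bdd_borel f" "bdd_borel g" "\<And>x. x \<in> {0..<1} \<Longrightarrow> \<bar>f x\<bar> \<le> g x" shows "\<bar>avg f\<bar> \<le> avg g"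
proof -
  have "avg f \<le> avg g" using assms by (intro avg_mono) force+
  moreover have "avg (\<lambda>x. - 1 * g x) \<le> avg f" using assms by (intro avg_mono bdd_borel_cmult) (force, force, force)
  ultimately show ?thesis unfolding avg_cmult by simp
qed

lemma avg_nn:
  assumes "h \<in> borel_measurable borel" "\<And>x. 0 \<le> h x"
  shows "avg h = enn2real (\<integral>\<^sup>+x\<in>{0..<1}. ennreal (h x) \<partial>lborel)"
  unfolding avg_def set_lebesgue_integral_def using assms
  by (subst integral_eq_nn_integral) (auto simp: indicator_def intro!: arg_cong[where f = enn2real] nn_integral_cong)

lemma avg_indicator:
  assumes "U \<in> sets borel" shows "avg (indicator U) = measure lborel (U \<inter> {0..<1})"
proof -
  have "avg (indicator U) = (LINT x|lborel. indicator (U \<inter> {0..<1}) x)"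
    unfolding avg_def set_lebesgue_integral_def by (intro Bochner_Integration.integral_cong) (auto simp: indicator_def)
  then show ?thesis using assms by simp
qed

section \<open>Densities with Lipschitz logarithm\<close>

definition log_lip :: "real \<Rightarrow> (real \<Rightarrow> real) \<Rightarrow> bool" where
  "log_lip K \<phi> \<longleftrightarrow> continuous_on UNIV \<phi> \<and> (\<forall>x. \<phi> x > 0) \<and> (\<forall>x. \<phi> (x + 1) = \<phi> x) \<and>
     (\<forall>x y. \<phi> x \<le> exp (K * \<bar>x - y\<bar>) * \<phi> y)"

lemma periodic_int:
  assumes "\<And>x. \<phi> (x + 1) = (\<phi> x :: 'a)" shows "\<phi> (x + of_int i) = \<phi> x"
proof -
  have nat: "\<phi> (x + of_nat n) = \<phi> x" for x n
    by (induction n) (simp_all, metis assms add.commute add.left_commute)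
  show ?thesis
  proof (cases "i \<ge> 0")
    case True
    then show ?thesis using nat[of x "nat i"] by simp
  next
    case False
    then show ?thesis using nat[of "x + of_int i" "nat (- i)"] by simp
  qed
qed

lemma periodic_frac:
  assumes "\<And>x. \<phi> (x + 1) = (\<phi> x :: 'a)" shows "\<phi> (frac x) = \<phi> x"
  using periodic_int[of \<phi> "frac x" "\<lfloor>x\<rfloor>", OF assms] by (simp add: frac_def)

lemma log_lip_bdd_borel:
  assumes "log_lip K \<phi>" shows "bdd_borel \<phi>"
proof (rule bdd_borelI)
  show "\<phi> \<in> borel_measurable borel" using assms by (auto simp: log_lip_def intro: borel_measurable_continuous_onI)
  fix x
  have p: "\<phi> (frac x) = \<phi> x" using assms by (intro periodic_frac) (simp add: log_lip_def)
  have "\<phi> (frac x) \<le> exp (K * \<bar>frac x - 0\<bar>) * \<phi> 0" using assms by (simp only: log_lip_def)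
  also have "\<dots> \<le> exp (\<bar>K\<bar>) * \<phi> 0"
  proof (intro mult_right_mono)
    have "K * \<bar>frac x - 0\<bar> \<le> \<bar>K\<bar> * 1" using frac_lt_1[of x] by (intro mult_mono) auto
    then show "exp (K * \<bar>frac x - 0\<bar>) \<le> exp \<bar>K\<bar>" by simp
  qed (use assms in \<open>simp add: log_lip_def less_imp_le\<close>)
  finally show "\<bar>\<phi> x\<bar> \<le> exp (\<bar>K\<bar>) * \<phi> 0" using assms p by (simp add: log_lip_def abs_of_pos)
qed

text \<open>Over one period the density varies by a factor of at most \<open>exp K\<close>, and its
  mean is 1.\<close>

lemma log_lip_lower:
  assumes \<phi>: "log_lip K \<phi>" and a: "avg \<phi> = 1" and K: "K \<ge> 0"
  shows "exp (- K) \<le> \<phi> x"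
proof -
  have p: "\<phi> (frac x) = \<phi> x" using \<phi> by (intro periodic_frac) (simp add: log_lip_def)
  have "avg \<phi> \<le> avg (\<lambda>y. exp K * \<phi> x)"
  proof (rule avg_mono[OF log_lip_bdd_borel[OF \<phi>] bdd_borel_const])
    fix y :: real assume y: "y \<in> {0..<1}"
    have "\<phi> y \<le> exp (K * \<bar>y - frac x\<bar>) * \<phi> (frac x)" using \<phi> by (simp add: log_lip_def)
    also have "\<dots> \<le> exp K * \<phi> x"
    proof -
      have "\<bar>y - frac x\<bar> \<le> 1" using y frac_ge_0[of x] frac_lt_1[of x] unfolding abs_le_iff atLeastLessThan_iff by linarith
      then have "K * \<bar>y - frac x\<bar> \<le> K" using K by (simp add: mult_left_le)
      then show ?thesis unfolding p using \<phi> by (intro mult_right_mono) (auto simp: log_lip_def less_imp_le)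
    qed
    finally show "\<phi> y \<le> exp K * \<phi> x" .
  qed
  then show ?thesis using a by (simp add: exp_minus field_simps)
qed

text \<open>Removing at most half of \<open>\<phi>\<close> at most doubles the relative slope, which
  comes down to \<open>2 * e - 1 \<le> e\<^sup>2\<close>. The division by
  \<open>1 - \<alpha>\<close> keeps mean 1 for a density of mean 1.\<close>

lemma log_lip_subtract:
  assumes \<phi>: "log_lip K \<phi>" and low: "\<And>x. 2 * \<alpha> \<le> \<phi> x" and \<alpha>: "0 < \<alpha>" "\<alpha> < 1" and K: "K \<ge> 0"
  shows "log_lip (2 * K) (\<lambda>x. (\<phi> x - \<alpha>) / (1 - \<alpha>))"
  unfolding log_lip_def
proof (intro conjI allI)
  show "continuous_on UNIV (\<lambda>x. (\<phi> x - \<alpha>) / (1 - \<alpha>))"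
    using \<phi> \<alpha> by (intro continuous_intros) (auto simp: log_lip_def)
  show "(\<phi> x - \<alpha>) / (1 - \<alpha>) > 0" for x using low[of x] \<alpha> by simp
  show "(\<phi> (x + 1) - \<alpha>) / (1 - \<alpha>) = (\<phi> x - \<alpha>) / (1 - \<alpha>)" for x using \<phi> by (simp add: log_lip_def)
  fix x y
  define e where "e = exp (K * \<bar>x - y\<bar>)"
  have e: "e \<ge> 1" using K by (simp add: e_def)
  have "\<phi> x \<le> e * \<phi> y" using \<phi> by (simp add: log_lip_def e_def)
  then have "\<phi> x - \<alpha> \<le> (\<phi> y - \<alpha>) + (e - 1) * \<phi> y" by (simp add: algebra_simps)
  also have "\<dots> \<le> (\<phi> y - \<alpha>) + (e - 1) * (2 * (\<phi> y - \<alpha>))" using e low[of y] by (intro add_left_mono mult_left_mono) auto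
  also have "\<dots> = (2 * e - 1) * (\<phi> y - \<alpha>)" by (simp add: algebra_simps)
  also have "\<dots> \<le> e\<^sup>2 * (\<phi> y - \<alpha>)"
  proof (rule mult_right_mono)
    have "0 \<le> (e - 1)\<^sup>2" by simp
    then show "2 * e - 1 \<le> e\<^sup>2" by (simp add: power2_eq_square algebra_simps)
  qed (use low[of y] \<alpha> in simp)
  also have "e\<^sup>2 = exp (2 * K * \<bar>x - y\<bar>)" by (simp add: e_def power2_eq_square flip: exp_add)
  finally show "(\<phi> x - \<alpha>) / (1 - \<alpha>) \<le> exp (2 * K * \<bar>x - y\<bar>) * ((\<phi> y - \<alpha>) / (1 - \<alpha>))"
    using \<alpha> by (simp add: divide_right_mono)
qed

section \<open>Bounded distortion and transfer operators\<close>

locale expanding_lift = lift +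
  fixes L c r :: real
  assumes log_F'_lip: "\<And>x y. \<bar>ln \<bar>F' x\<bar> - ln \<bar>F' y\<bar>\<bar> \<le> L * \<bar>x - y\<bar>"
    and c: "0 < c" "c \<le> 1" and r: "1 < r" and J_ge: "\<And>n x. c * r ^ n \<le> J n x"
begin

definition Kd where "Kd = L / (c * (r - 1))"

lemma L_nonneg: "0 \<le> L" using log_F'_lip[of 0 1] by simp

lemma Kd_nonneg: "0 \<le> Kd" unfolding Kd_def using L_nonneg c r by simp

lemma G_pow_contract: "\<bar>(G ^^ t) x - (G ^^ t) y\<bar> \<le> \<bar>x - y\<bar> / (c * r ^ t)"
proof -
  have *: "\<bar>(G ^^ t) x - (G ^^ t) y\<bar> \<le> \<bar>x - y\<bar> / (c * r ^ t)" if "x \<le> y" for x y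
    by (rule G_pow_lipschitz) (use J_ge c r that in auto)
  show ?thesis using *[of x y] *[of y x] by (cases "x \<le> y") (auto simp: abs_minus_commute)
qed

text \<open>Backward orbits approach each other geometrically, so the logarithms differ by at most a
  geometric series, whose sum is \<open>Kd\<close> times the distance.\<close>

lemma J_distortion: "J t x \<le> exp (Kd * \<bar>x - y\<bar>) * J t y"
proof -
  have ln: "ln (J t z) = (\<Sum>s<t. ln \<bar>F' ((G ^^ Suc s) z)\<bar>)" for z
    unfolding J_def using F'_nz by (subst ln_prod) auto
  have "ln (J t x) - ln (J t y) = (\<Sum>s<t. ln \<bar>F' ((G ^^ Suc s) x)\<bar> - ln \<bar>F' ((G ^^ Suc s) y)\<bar>)"
    unfolding ln by (simp add: sum_subtractf)
  also have "\<dots> \<le> (\<Sum>s<t. L * (\<bar>x - y\<bar> / (c * r ^ Suc s)))"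
  proof (rule sum_mono)
    fix s
    have "ln \<bar>F' ((G ^^ Suc s) x)\<bar> - ln \<bar>F' ((G ^^ Suc s) y)\<bar> \<le> L * \<bar>(G ^^ Suc s) x - (G ^^ Suc s) y\<bar>"
      using log_F'_lip[of "(G ^^ Suc s) x" "(G ^^ Suc s) y"] by linarith
    also have "\<dots> \<le> L * (\<bar>x - y\<bar> / (c * r ^ Suc s))" using G_pow_contract L_nonneg by (rule mult_left_mono)
    finally show "ln \<bar>F' ((G ^^ Suc s) x)\<bar> - ln \<bar>F' ((G ^^ Suc s) y)\<bar> \<le> L * (\<bar>x - y\<bar> / (c * r ^ Suc s))" .
  qed
  also have "\<dots> = L / c * \<bar>x - y\<bar> * (\<Sum>s<t. (1 / r) ^ Suc s)"
    by (simp add: sum_distrib_left power_divide field_simps)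
  also have "\<dots> \<le> L / c * \<bar>x - y\<bar> * (1 / (r - 1))"
  proof (rule mult_left_mono)
    have "(r - 1) * (\<Sum>s<t. (1 / r) ^ Suc s) = 1 - (1 / r) ^ t"
    proof (induction t)
      case (Suc t)
      have "(r - 1) * (1 / r) ^ Suc t = (1 / r) ^ t - (1 / r) ^ Suc t" using r by (simp add: field_simps)
      then show ?case using Suc by (simp add: distrib_left)
    qed simp
    then have "(\<Sum>s<t. (1 / r) ^ Suc s) = (1 - (1 / r) ^ t) / (r - 1)"
      using r by (simp add: eq_divide_eq mult.commute)
    also have "\<dots> \<le> 1 / (r - 1)" using r by (intro divide_right_mono) auto
    finally show "(\<Sum>s<t. (1 / r) ^ Suc s) \<le> 1 / (r - 1)" .
  qed (use L_nonneg c in simp)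
  also have "\<dots> = Kd * \<bar>x - y\<bar>" by (simp add: Kd_def field_simps)
  finally have "ln (J t x) \<le> Kd * \<bar>x - y\<bar> + ln (J t y)" by simp
  then have "exp (ln (J t x)) \<le> exp (Kd * \<bar>x - y\<bar> + ln (J t y))" by simp
  then show ?thesis using J_pos by (simp add: exp_add)
qed

text \<open>The Perron-Frobenius operator of the \<open>t\<close>-th iterate for Lebesgue measure,
  summed over inverse branches.\<close>

definition transfer :: "nat \<Rightarrow> (real \<Rightarrow> real) \<Rightarrow> real \<Rightarrow> real" where
  "transfer t \<phi> x = (\<Sum>i<nat \<bar>d ^ t\<bar>. \<phi> ((G ^^ t) (x + real i)) / J t (x + real i))"

text \<open>Contraction of the inverse branches divides the logarithmic slope of
  \<open>\<phi>\<close> by \<open>c * r ^ t\<close>; the Jacobian adds the distortion constant,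
  whatever \<open>t\<close> is.\<close>

lemma transfer_log_lip:
  assumes \<phi>: "log_lip K \<phi>" and K: "K \<ge> 0"
  shows "log_lip (K / (c * r ^ t) + Kd) (transfer t \<phi>)"
  unfolding log_lip_def
proof (intro conjI allI)
  have \<phi>c: "continuous_on UNIV \<phi>" and \<phi>0: "\<And>x. \<phi> x > 0" and \<phi>1: "\<And>x. \<phi> (x + 1) = \<phi> x"
    and \<phi>K: "\<And>x y. \<phi> x \<le> exp (K * \<bar>x - y\<bar>) * \<phi> y" using \<phi> by (auto simp: log_lip_def)
  show "continuous_on UNIV (transfer t \<phi>)"
    unfolding transfer_def[abs_def]
    by (intro continuous_intros continuous_on_compose2[OF \<phi>c] continuous_on_compose2[OF G_pow_cont[of UNIV]]
        continuous_on_compose2[OF J_cont[of UNIV]]) (auto simp: J_pos less_imp_neq[OF J_pos, symmetric])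
  show "transfer t \<phi> x > 0" for x
    unfolding transfer_def by (intro sum_pos) (auto simp: J_pos \<phi>0 lessThan_empty_iff d_nz)
  define u where "u y = \<phi> ((G ^^ t) y) / J t y" for y
  have ud: "u (y + of_int (i * d ^ t)) = u y" for y i
    unfolding u_def J_shift G_pow_shift by (simp add: periodic_int[of \<phi>, OF \<phi>1])
  have "u (y + real (nat \<bar>d ^ t\<bar>)) = u y" for y
  proof -
    have "real (nat \<bar>e\<bar>) = of_int (sgn e * e)" for e :: int by (simp add: sgn_if)
    then show ?thesis using ud[of y "sgn (d ^ t)"] by (simp only:)
  qed
  \<comment> \<open>The summand has period \<open>nat \<bar>d ^ t\<bar>\<close>, so shifting
    \<open>x\<close> by 1 permutes the branches cyclically.\<close>
  then have sh: "(\<Sum>i<nat \<bar>d ^ t\<bar>. u (x + real (Suc i))) = (\<Sum>i<nat \<bar>d ^ t\<bar>. u (x + real i))" for x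
    using sum.lessThan_Suc[of "\<lambda>i. u (x + real i)" "nat \<bar>d ^ t\<bar>"]
      sum.lessThan_Suc_shift[of "\<lambda>i. u (x + real i)" "nat \<bar>d ^ t\<bar>"] by simp
  show "transfer t \<phi> (x + 1) = transfer t \<phi> x" for x
  proof -
    have "x + 1 + real i = x + real (Suc i)" for i by simp
    then show ?thesis unfolding transfer_def u_def[symmetric] by (simp only: sh)
  qed
  fix x y
  show "transfer t \<phi> x \<le> exp ((K / (c * r ^ t) + Kd) * \<bar>x - y\<bar>) * transfer t \<phi> y"
    unfolding transfer_def sum_distrib_left
  proof (rule sum_mono)
    fix i :: nat
    let ?x = "x + real i" and ?y = "y + real i"
    have "\<phi> ((G ^^ t) ?x) \<le> exp (K * \<bar>(G ^^ t) ?x - (G ^^ t) ?y\<bar>) * \<phi> ((G ^^ t) ?y)" by (rule \<phi>K)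
    also have "\<dots> \<le> exp (K / (c * r ^ t) * \<bar>x - y\<bar>) * \<phi> ((G ^^ t) ?y)"
      using mult_left_mono[OF G_pow_contract[of t ?x ?y] K] \<phi>0[of "(G ^^ t) ?y"]
      by (intro mult_right_mono) (auto simp: less_imp_le)
    finally have 1: "\<phi> ((G ^^ t) ?x) \<le> exp (K / (c * r ^ t) * \<bar>x - y\<bar>) * \<phi> ((G ^^ t) ?y)" .
    have "J t ?y \<le> exp (Kd * \<bar>x - y\<bar>) * J t ?x" using J_distortion[of t ?y ?x] by (simp add: abs_minus_commute)
    then have 2: "1 / J t ?x \<le> exp (Kd * \<bar>x - y\<bar>) * (1 / J t ?y)" using J_pos by (simp add: field_simps)
    have 3: "\<phi> ((G ^^ t) ?x) * (1 / J t ?x) \<le>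
      (exp (K / (c * r ^ t) * \<bar>x - y\<bar>) * \<phi> ((G ^^ t) ?y)) * (exp (Kd * \<bar>x - y\<bar>) * (1 / J t ?y))"
      by (rule mult_mono[OF 1 2]) (use \<phi>0 J_pos in \<open>auto simp: less_imp_le\<close>)
    show "\<phi> ((G ^^ t) ?x) / J t ?x \<le>
       exp ((K / (c * r ^ t) + Kd) * \<bar>x - y\<bar>) * (\<phi> ((G ^^ t) ?y) / J t ?y)"
    proof -
      have "(exp (K / (c * r ^ t) * \<bar>x - y\<bar>) * \<phi> ((G ^^ t) ?y)) * (exp (Kd * \<bar>x - y\<bar>) * (1 / J t ?y)) =
        exp ((K / (c * r ^ t) + Kd) * \<bar>x - y\<bar>) * (\<phi> ((G ^^ t) ?y) / J t ?y)"
        by (simp only: distrib_right exp_add) simp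
      moreover have "\<phi> ((G ^^ t) ?x) * (1 / J t ?x) = \<phi> ((G ^^ t) ?x) / J t ?x" by simp
      ultimately show ?thesis using 3 by (simp only:)
    qed
  qed
qed

lemma F_pow_measurable [measurable]: "(F ^^ t) \<in> borel_measurable borel"
  by (rule borel_measurable_continuous_onI) (rule F_pow_cont)

lemma F_pow_periodic: assumes "\<And>x. \<psi> (x + 1) = (\<psi> x :: 'a)" shows "\<psi> ((F ^^ t) (x + 1)) = \<psi> ((F ^^ t) x)"
  unfolding lift.F_shift1[OF lift_pow] by (rule periodic_int) (rule assms)

lemma transfer_dual:
  assumes \<phi>: "log_lip K \<phi>" and \<psi>: "bdd_borel \<psi>" "\<And>x. 0 \<le> \<psi> x" "\<And>x. \<psi> (x + 1) = \<psi> x"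
  shows "avg (\<lambda>x. \<psi> ((F ^^ t) x) * \<phi> x) = avg (\<lambda>x. \<psi> x * transfer t \<phi> x)"
proof -
  have [measurable]: "\<psi> \<in> borel_measurable borel" "\<phi> \<in> borel_measurable borel"
    using \<psi> log_lip_bdd_borel[OF \<phi>] by (auto dest: bdd_borel_measurable)
  have Gm[measurable]: "(G ^^ t) \<in> borel_measurable borel" "J t \<in> borel_measurable borel"
    by (auto intro!: borel_measurable_continuous_onI G_pow_cont J_cont)
  have \<phi>0: "\<phi> x > 0" and \<phi>1: "\<phi> (x + 1) = \<phi> x" for x using \<phi> by (auto simp: log_lip_def)
  have "(\<integral>\<^sup>+y\<in>{0..<1}. ennreal (\<psi> ((F ^^ t) y) * \<phi> y) \<partial>lborel) =
    (\<Sum>i<nat \<bar>d ^ t\<bar>. \<integral>\<^sup>+x\<in>{0..<1}. ennreal (\<psi> ((F ^^ t) ((G ^^ t) (x + real i))) * \<phi> ((G ^^ t) (x + real i)))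
      * ennreal (1 / J t (x + real i)) \<partial>lborel)"
    by (rule nn_integral_lift_pow) (use F_pow_periodic[of \<psi>, OF \<psi>(3)] \<phi>1 in auto)
  also have "\<dots> = (\<Sum>i<nat \<bar>d ^ t\<bar>. \<integral>\<^sup>+x\<in>{0..<1}. ennreal (\<psi> x * (\<phi> ((G ^^ t) (x + real i)) / J t (x + real i))) \<partial>lborel)"
  proof (intro sum.cong refl nn_integral_cong)
    fix i :: nat and x :: real
    have "\<psi> (x + real i) = \<psi> x" using periodic_int[of \<psi> x "int i", OF \<psi>(3)] by simp
    then show "ennreal (\<psi> ((F ^^ t) ((G ^^ t) (x + real i))) * \<phi> ((G ^^ t) (x + real i))) * ennreal (1 / J t (x + real i)) * indicator {0..<1} x
      = ennreal (\<psi> x * (\<phi> ((G ^^ t) (x + real i)) / J t (x + real i))) * indicator {0..<1} x"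
      using \<psi>(2) \<phi>0 J_pos by (simp add: ennreal_mult[symmetric] less_imp_le)
  qed
  also have "\<dots> = (\<integral>\<^sup>+x. (\<Sum>i<nat \<bar>d ^ t\<bar>. ennreal (\<psi> x * (\<phi> ((G ^^ t) (x + real i)) / J t (x + real i))) * indicator {0..<1} x) \<partial>lborel)"
    by (rule nn_integral_sum[symmetric]) measurable
  also have "\<dots> = (\<integral>\<^sup>+x\<in>{0..<1}. ennreal (\<psi> x * transfer t \<phi> x) \<partial>lborel)"
    using \<psi>(2) \<phi>0 J_pos unfolding transfer_def sum_distrib_left
    by (intro nn_integral_cong) (auto simp: indicator_def sum_ennreal less_imp_le)
  finally have e: "(\<integral>\<^sup>+y\<in>{0..<1}. ennreal (\<psi> ((F ^^ t) y) * \<phi> y) \<partial>lborel) = (\<integral>\<^sup>+x\<in>{0..<1}. ennreal (\<psi> x * transfer t \<phi> x) \<partial>lborel)" .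
  have [measurable]: "transfer t \<phi> \<in> borel_measurable borel" unfolding transfer_def[abs_def] by measurable
  have t0: "transfer t \<phi> x \<ge> 0" for x unfolding transfer_def using \<phi>0 J_pos by (intro sum_nonneg) (simp add: less_imp_le)
  show ?thesis
    by (subst (1 2) avg_nn) (use \<psi>(2) \<phi>0 t0 e in \<open>auto simp: less_imp_le\<close>)
qed

lemma transfer_avg:
  assumes "log_lip K \<phi>" shows "avg (transfer t \<phi>) = avg \<phi>"
  using transfer_dual[OF assms, of "\<lambda>x. 1" t] by (simp add: bdd_borel_const)

text \<open>Both densities contain the same constant \<open>\<alpha>\<close>, which cancels in the
  difference. The rest, renormalised, is back in the same class of densities after \<open>p\<close>
  steps, and the difference has lost the factor \<open>1 - \<alpha>\<close>.\<close>

lemma coupling: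
  defines "K \<equiv> 2 * Kd + 1"
  assumes p: "4 \<le> c * r ^ p"
    and \<phi>: "log_lip K \<phi>" "avg \<phi> = 1" and \<eta>: "log_lip K \<eta>" "avg \<eta> = 1"
    and \<psi>: "bdd_borel \<psi>" "\<And>x. 0 \<le> \<psi> x" "\<And>x. \<psi> x \<le> 1" "\<And>x. \<psi> (x + 1) = \<psi> x"
  shows "\<bar>avg (\<lambda>x. \<psi> ((F ^^ (p * k)) x) * \<phi> x) - avg (\<lambda>x. \<psi> ((F ^^ (p * k)) x) * \<eta> x)\<bar> \<le> (1 - exp (- K) / 2) ^ k"
  using \<phi> \<eta>
proof (induction k arbitrary: \<phi> \<eta>)
  case 0
  have *: "0 \<le> avg (\<lambda>x. \<psi> x * \<phi> x) \<and> avg (\<lambda>x. \<psi> x * \<phi> x) \<le> 1" if "log_lip K \<phi>" "avg \<phi> = 1" for \<phi>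
  proof
    have b: "bdd_borel (\<lambda>x. \<psi> x * \<phi> x)" by (intro bdd_borel_mult \<psi> log_lip_bdd_borel[OF that(1)])
    have p: "\<phi> x > 0" for x using that by (simp add: log_lip_def)
    have "avg (\<lambda>x. 0) \<le> avg (\<lambda>x. \<psi> x * \<phi> x)"
      by (rule avg_mono[OF bdd_borel_const b]) (use \<psi>(2) p in \<open>simp add: less_imp_le\<close>)
    then show "0 \<le> avg (\<lambda>x. \<psi> x * \<phi> x)" by simp
    have "avg (\<lambda>x. \<psi> x * \<phi> x) \<le> avg \<phi>"
      by (rule avg_mono[OF b log_lip_bdd_borel[OF that(1)]])
        (use mult_right_mono[OF \<psi>(3)] p in \<open>force simp: less_imp_le\<close>)
    then show "avg (\<lambda>x. \<psi> x * \<phi> x) \<le> 1" using that by simp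
  qed
  show ?case using *[OF 0(1,2)] *[OF 0(3,4)] by (auto simp: abs_le_iff)
next
  case (Suc k)
  define \<alpha> where "\<alpha> = exp (- K) / 2"
  have K: "K \<ge> 0" using Kd_nonneg by (simp add: K_def)
  have \<alpha>: "0 < \<alpha>" "\<alpha> < 1"
  proof -
    have "exp (- K) \<le> 1" using K by simp
    then show "\<alpha> < 1" unfolding \<alpha>_def by linarith
  qed (simp add: \<alpha>_def)
  define T where "T \<phi> = transfer p (\<lambda>x. (\<phi> x - \<alpha>) / (1 - \<alpha>))" for \<phi>
  have T: "log_lip K (T \<phi>)" "avg (T \<phi>) = 1"
    "avg (\<lambda>x. \<psi> ((F ^^ (p * Suc k)) x) * \<phi> x) =
      \<alpha> * avg (\<lambda>x. \<psi> ((F ^^ (p * Suc k)) x)) + (1 - \<alpha>) * avg (\<lambda>x. \<psi> ((F ^^ (p * k)) x) * T \<phi> x)"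
    if \<phi>: "log_lip K \<phi>" "avg \<phi> = 1" for \<phi>
  proof -
    let ?\<phi> = "\<lambda>x. (\<phi> x - \<alpha>) / (1 - \<alpha>)"
    have low: "2 * \<alpha> \<le> \<phi> x" for x using log_lip_lower[OF \<phi> K, of x] by (simp add: \<alpha>_def)
    have l: "log_lip (2 * K) ?\<phi>" by (rule log_lip_subtract[OF \<phi>(1) low \<alpha> K])
    have m: "log_lip (2 * K / (c * r ^ p) + Kd) (T \<phi>)" unfolding T_def by (rule transfer_log_lip[OF l]) (use K in simp)
    \<comment> \<open>With \<open>c * r ^ p \<ge> 4\<close> the doubled slope \<open>2 * K\<close>
      becomes at most \<open>K / 2\<close>, and \<open>K / 2 + Kd \<le> K\<close> by the choice of
      \<open>K\<close>.\<close>
    have "2 * K / (c * r ^ p) \<le> 2 * K / 4" using p K c r by (intro divide_left_mono) auto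
    moreover have "K = 2 * Kd + 1" by (simp add: K_def)
    ultimately have le: "2 * K / (c * r ^ p) + Kd \<le> K" by linarith
    show "log_lip K (T \<phi>)" unfolding log_lip_def
    proof (intro conjI allI)
      fix x y
      have "T \<phi> x \<le> exp ((2 * K / (c * r ^ p) + Kd) * \<bar>x - y\<bar>) * T \<phi> y" using m by (simp add: log_lip_def)
      also have "\<dots> \<le> exp (K * \<bar>x - y\<bar>) * T \<phi> y"
        using mult_right_mono[OF le, of "\<bar>x - y\<bar>"] m by (intro mult_right_mono) (auto simp: log_lip_def less_imp_le)
      finally show "T \<phi> x \<le> exp (K * \<bar>x - y\<bar>) * T \<phi> y" .
    qed (use m in \<open>auto simp: log_lip_def\<close>)
    have b: "bdd_borel \<phi>" by (rule log_lip_bdd_borel[OF \<phi>(1)])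
    have "avg ?\<phi> = avg (\<lambda>x. (1 / (1 - \<alpha>)) * (\<phi> x - \<alpha>))" by simp
    also have "\<dots> = (1 / (1 - \<alpha>)) * (avg \<phi> - \<alpha>)" unfolding avg_cmult by (simp add: avg_diff[OF b bdd_borel_const])
    finally have a1: "avg ?\<phi> = 1" using \<phi>(2) \<alpha> by simp
    show "avg (T \<phi>) = 1" unfolding T_def using transfer_avg[OF l] a1 by simp
    have b\<psi>: "bdd_borel (\<lambda>x. \<psi> ((F ^^ t) x))" for t by (rule bdd_borel_comp[OF \<psi>(1) F_pow_measurable])
    have "avg (\<lambda>x. \<psi> ((F ^^ (p * Suc k)) x) * \<phi> x) =
      avg (\<lambda>x. \<alpha> * \<psi> ((F ^^ (p * Suc k)) x) + (1 - \<alpha>) * (\<psi> ((F ^^ (p * Suc k)) x) * ?\<phi> x))"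
    proof (rule arg_cong[of _ _ avg], rule ext)
      fix x
      have "(1 - \<alpha>) * ?\<phi> x = \<phi> x - \<alpha>" using \<alpha> by simp
      then have "(1 - \<alpha>) * (\<psi> ((F ^^ (p * Suc k)) x) * ?\<phi> x) = \<psi> ((F ^^ (p * Suc k)) x) * (\<phi> x - \<alpha>)" by algebra
      then show "\<psi> ((F ^^ (p * Suc k)) x) * \<phi> x = \<alpha> * \<psi> ((F ^^ (p * Suc k)) x) + (1 - \<alpha>) * (\<psi> ((F ^^ (p * Suc k)) x) * ?\<phi> x)"
        by algebra
    qed
    also have "\<dots> = \<alpha> * avg (\<lambda>x. \<psi> ((F ^^ (p * Suc k)) x)) + (1 - \<alpha>) * avg (\<lambda>x. \<psi> ((F ^^ (p * Suc k)) x) * ?\<phi> x)"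
      by (subst avg_add) (intro bdd_borel_cmult bdd_borel_mult b\<psi> log_lip_bdd_borel[OF l], intro bdd_borel_cmult bdd_borel_mult b\<psi> log_lip_bdd_borel[OF l], simp only: avg_cmult)
    also have "avg (\<lambda>x. \<psi> ((F ^^ (p * Suc k)) x) * ?\<phi> x) = avg (\<lambda>x. \<psi> ((F ^^ (p * k)) ((F ^^ p) x)) * ?\<phi> x)"
      using funpow_add[of "p * k" p F] by (simp add: add.commute)
    also have "\<dots> = avg (\<lambda>x. \<psi> ((F ^^ (p * k)) x) * T \<phi> x)"
      unfolding T_def by (rule transfer_dual[OF l]) (use b\<psi> \<psi>(2) F_pow_periodic[of \<psi>, OF \<psi>(4)] in auto)
    finally show "avg (\<lambda>x. \<psi> ((F ^^ (p * Suc k)) x) * \<phi> x) =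
      \<alpha> * avg (\<lambda>x. \<psi> ((F ^^ (p * Suc k)) x)) + (1 - \<alpha>) * avg (\<lambda>x. \<psi> ((F ^^ (p * k)) x) * T \<phi> x)" .
  qed
  have "\<bar>avg (\<lambda>x. \<psi> ((F ^^ (p * Suc k)) x) * \<phi> x) - avg (\<lambda>x. \<psi> ((F ^^ (p * Suc k)) x) * \<eta> x)\<bar>
    = \<bar>(1 - \<alpha>) * (avg (\<lambda>x. \<psi> ((F ^^ (p * k)) x) * T \<phi> x) - avg (\<lambda>x. \<psi> ((F ^^ (p * k)) x) * T \<eta> x))\<bar>"
    unfolding T(3)[OF Suc.prems(1,2)] T(3)[OF Suc.prems(3,4)] by (simp add: algebra_simps)
  also have "\<dots> = (1 - \<alpha>) * \<bar>avg (\<lambda>x. \<psi> ((F ^^ (p * k)) x) * T \<phi> x) - avg (\<lambda>x. \<psi> ((F ^^ (p * k)) x) * T \<eta> x)\<bar>"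
    using \<alpha> by (simp add: abs_mult)
  also have "\<dots> \<le> (1 - \<alpha>) * (1 - \<alpha>) ^ k"
    using Suc.IH[OF T(1,2)[OF Suc.prems(1,2)] T(1,2)[OF Suc.prems(3,4)]] \<alpha> unfolding \<alpha>_def[symmetric]
    by (intro mult_left_mono) auto
  finally show ?case unfolding \<alpha>_def[symmetric] by simp
qed


lemma ex_power_ge: "\<exists>t0. \<forall>t\<ge>t0. B \<le> c * r ^ t"
proof -
  obtain t0 where t0: "B / c < r ^ t0" using real_arch_pow[OF r] by blast
  have "B \<le> c * r ^ t" if "t \<ge> t0" for t
  proof -
    have "B / c < r ^ t" using t0 power_increasing[OF that, of r] r by linarith
    then show ?thesis using c by (simp add: divide_less_eq mult.commute less_imp_le)
  qed
  then show ?thesis by blast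
qed

text \<open>No invariant measure is constructed: an average at a late time \<open>M'\<close> stands
  in for the integral against it. Both averages are compared with the one at the fixed time
  \<open>p * k\<close>, and the estimate is uniform in \<open>\<psi>\<close>.\<close>

lemma mixing:
  assumes K: "0 \<le> K" and e: "e > 0"
  shows "\<exists>M0. \<forall>M\<ge>M0. \<forall>M'\<ge>M0. \<forall>\<phi> \<psi>. log_lip K \<phi> \<longrightarrow> avg \<phi> = 1 \<longrightarrow> bdd_borel \<psi> \<longrightarrow> (\<forall>x. 0 \<le> \<psi> x \<and> \<psi> x \<le> 1) \<longrightarrow>
    (\<forall>x. \<psi> (x + 1) = \<psi> x) \<longrightarrow> \<bar>avg (\<lambda>x. \<psi> ((F ^^ M) x) * \<phi> x) - avg (\<lambda>x. \<psi> ((F ^^ M') x))\<bar> \<le> e"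
proof -
  define K1 where "K1 = 2 * Kd + 1"
  have K1: "K1 > 0" using Kd_nonneg by (simp add: K1_def)
  define q where "q = 1 - exp (- K1) / 2"
  have q: "0 \<le> q" "q < 1"
  proof -
    have "exp (- K1) \<le> 1" using K1 by simp
    then show "0 \<le> q" unfolding q_def by linarith
  qed (simp add: q_def)
  have "(\<lambda>k. q ^ k) \<longlonglongrightarrow> 0" using q by (intro LIMSEQ_power_zero) auto
  then obtain k where k: "q ^ k < e / 2"
    using order_tendstoD(2)[of "\<lambda>k. q ^ k" 0 sequentially "e / 2"] e by (auto simp: eventually_sequentially)
  obtain p where p: "4 \<le> c * r ^ p" using ex_power_ge by blast
  obtain t0 where t0: "\<And>t. t \<ge> t0 \<Longrightarrow> K \<le> c * r ^ t" using ex_power_ge by blast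
  \<comment> \<open>The first \<open>t\<close> steps bring the density of slope \<open>K\<close>
    into the class of slope \<open>K1\<close>; the remaining \<open>p * k\<close> steps couple it
    with the constant density.\<close>
  have half: "\<bar>avg (\<lambda>x. \<psi> ((F ^^ M) x) * \<phi> x) - avg (\<lambda>x. \<psi> ((F ^^ (p * k)) x))\<bar> \<le> e / 2"
    if M: "M \<ge> p * k + t0" and \<phi>: "log_lip K \<phi>" "avg \<phi> = 1"
      and \<psi>: "bdd_borel \<psi>" "\<forall>x. 0 \<le> \<psi> x \<and> \<psi> x \<le> 1" "\<forall>x. \<psi> (x + 1) = \<psi> x" for M \<phi> \<psi>
  proof -
    define t where "t = M - p * k"
    have t: "t \<ge> t0" "M = p * k + t" using M by (auto simp: t_def)
    have m: "log_lip (K / (c * r ^ t) + Kd) (transfer t \<phi>)" by (rule transfer_log_lip[OF \<phi>(1) K])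
    have "K / (c * r ^ t) \<le> 1" using t0[OF t(1)] c r by (simp add: divide_le_eq)
    then have le: "K / (c * r ^ t) + Kd \<le> K1" using Kd_nonneg unfolding K1_def by linarith
    have m1: "log_lip K1 (transfer t \<phi>)" unfolding log_lip_def
    proof (intro conjI allI)
      fix x y
      have "transfer t \<phi> x \<le> exp ((K / (c * r ^ t) + Kd) * \<bar>x - y\<bar>) * transfer t \<phi> y" using m by (simp add: log_lip_def)
      also have "\<dots> \<le> exp (K1 * \<bar>x - y\<bar>) * transfer t \<phi> y"
        using mult_right_mono[OF le, of "\<bar>x - y\<bar>"] m by (intro mult_right_mono) (auto simp: log_lip_def less_imp_le)
      finally show "transfer t \<phi> x \<le> exp (K1 * \<bar>x - y\<bar>) * transfer t \<phi> y" .
    qed (use m in \<open>auto simp: log_lip_def\<close>)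
    have one: "log_lip K1 (\<lambda>x. 1)" using K1 by (simp add: log_lip_def)
    have b: "bdd_borel (\<lambda>x. \<psi> ((F ^^ (p * k)) x))" by (rule bdd_borel_comp[OF \<psi>(1) F_pow_measurable])
    have "avg (\<lambda>x. \<psi> ((F ^^ M) x) * \<phi> x) = avg (\<lambda>x. \<psi> ((F ^^ (p * k)) ((F ^^ t) x)) * \<phi> x)"
      unfolding t(2) by (simp add: funpow_add)
    also have "\<dots> = avg (\<lambda>x. \<psi> ((F ^^ (p * k)) x) * transfer t \<phi> x)"
      by (rule transfer_dual[OF \<phi>(1) b]) (use \<psi> F_pow_periodic[of \<psi>] in auto)
    finally have "avg (\<lambda>x. \<psi> ((F ^^ M) x) * \<phi> x) = avg (\<lambda>x. \<psi> ((F ^^ (p * k)) x) * transfer t \<phi> x)" .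
    moreover have "\<bar>avg (\<lambda>x. \<psi> ((F ^^ (p * k)) x) * transfer t \<phi> x) - avg (\<lambda>x. \<psi> ((F ^^ (p * k)) x) * 1)\<bar> \<le> q ^ k"
      unfolding q_def K1_def
      by (rule coupling[OF p m1[unfolded K1_def] _ one[unfolded K1_def]])
        (use transfer_avg[OF \<phi>(1)] \<phi>(2) \<psi> in auto)
    ultimately show ?thesis using k by simp
  qed
  have one: "log_lip K (\<lambda>x. 1)" using K by (simp add: log_lip_def)
  show ?thesis
  proof (intro exI[of _ "p * k + t0"] allI impI)
    fix M M' \<phi> \<psi>
    assume a: "p * k + t0 \<le> M" "p * k + t0 \<le> M'" "log_lip K \<phi>" "avg \<phi> = 1" "bdd_borel \<psi>"
      "\<forall>x. 0 \<le> \<psi> x \<and> \<psi> x \<le> 1" "\<forall>x. \<psi> (x + 1) = \<psi> x"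
    show "\<bar>avg (\<lambda>x. \<psi> ((F ^^ M) x) * \<phi> x) - avg (\<lambda>x. \<psi> ((F ^^ M') x))\<bar> \<le> e"
      using half[OF a(1,3-7)] half[OF a(2) one avg_const a(5-7), unfolded mult_1_right] by linarith
  qed
qed

text \<open>Indicators of intervals are not log-Lipschitz; approximate them by positive functions that are.\<close>

lemma mixing_interval:
  assumes ab: "0 \<le> \<alpha>" "\<alpha> \<le> \<beta>" "\<beta> \<le> 1" and e: "e > 0"
  shows "\<exists>M0. \<forall>M\<ge>M0. \<forall>M'\<ge>M0. \<forall>\<psi>. bdd_borel \<psi> \<longrightarrow> (\<forall>x. 0 \<le> \<psi> x \<and> \<psi> x \<le> 1) \<longrightarrow>
    (\<forall>x. \<psi> (x + 1) = \<psi> x) \<longrightarrow>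
    \<bar>avg (\<lambda>x. indicator {\<alpha><..<\<beta>} x * \<psi> ((F ^^ M) x)) - (\<beta> - \<alpha>) * avg (\<lambda>x. \<psi> ((F ^^ M') x))\<bar> \<le> e"
proof -
  \<comment> \<open>Error budget: replacing the indicator by \<open>\<zeta>\<close> costs
    \<open>2 * \<delta>\<close> twice, together \<open>e / 4\<close>, and mixing for the smoothed
    density costs \<open>3 * e / 8\<close>.\<close>
  define \<delta> where "\<delta> = e / 16"
  define \<tau> where "\<tau> = min 1 (e / 8)"
  have \<delta>: "\<delta> > 0" and \<tau>: "\<tau> > 0" "\<tau> \<le> 1" "\<tau> \<le> e / 8" using e by (auto simp: \<delta>_def \<tau>_def)
  define S where "S = {x. frac x \<notin> {\<alpha><..<\<beta>}}"
  have S0: "0 \<in> S" using ab by (simp add: S_def)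
  have S1: "x + 1 \<in> S \<longleftrightarrow> x \<in> S" for x by (simp add: S_def frac_1_eq)
  \<comment> \<open>A trapezoid: 0 off the interval, 1 at depth \<open>\<delta>\<close> inside it,
    and periodic since \<open>S\<close> is.\<close>
  define \<zeta> where "\<zeta> x = min 1 (infdist x S / \<delta>)" for x
  have \<zeta>01: "0 \<le> \<zeta> x" "\<zeta> x \<le> 1" for x using \<delta> infdist_nonneg[of x S] by (auto simp: \<zeta>_def)
  have \<zeta>lip: "\<zeta> x \<le> \<zeta> y + \<bar>x - y\<bar> / \<delta>" for x y
  proof -
    have "infdist x S \<le> infdist y S + \<bar>x - y\<bar>" using infdist_triangle[of x S y] by (simp add: dist_real_def)
    then have "infdist x S / \<delta> \<le> infdist y S / \<delta> + \<bar>x - y\<bar> / \<delta>"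
      using \<delta> by (simp add: divide_right_mono flip: add_divide_distrib)
    moreover have "0 \<le> \<bar>x - y\<bar> / \<delta>" using \<delta> by simp
    ultimately show ?thesis unfolding \<zeta>_def by linarith
  qed
  have \<zeta>c: "continuous_on UNIV \<zeta>"
    unfolding \<zeta>_def[abs_def] using \<delta> by (intro continuous_intros) auto
  have \<zeta>1: "\<zeta> (x + 1) = \<zeta> x" for x
  proof -
    have im: "(\<lambda>a. a + 1) ` S = S"
    proof (intro set_eqI iffI)
      fix a assume "a \<in> S"
      then show "a \<in> (\<lambda>a. a + 1) ` S" using S1[of "a - 1"] by (intro image_eqI[of _ _ "a - 1"]) auto
    qed (use S1 in auto)
    have "infdist (x + 1) S = (INF a\<in>(\<lambda>a. a + 1) ` S. dist (x + 1) a)" using S0 im by (auto simp: infdist_def)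
    also have "\<dots> = (INF a\<in>S. dist x a)" by (simp add: image_image dist_real_def)
    also have "\<dots> = infdist x S" using S0 by (auto simp: infdist_def)
    finally show ?thesis by (simp add: \<zeta>_def)
  qed
  have \<zeta>out: "\<zeta> x = 0" if "x \<in> {0..<1}" "x \<notin> {\<alpha><..<\<beta>}" for x
  proof -
    have "frac x = x" using that by (simp add: frac_eq)
    then have "x \<in> S" using that by (simp add: S_def)
    then show ?thesis using \<delta> by (simp add: \<zeta>_def)
  qed
  have \<zeta>in: "\<zeta> x = 1" if x: "\<alpha> + \<delta> \<le> x" "x \<le> \<beta> - \<delta>" for x
  proof -
    have Sne: "S \<noteq> {}" using S0 by auto
    have "\<delta> \<le> infdist x S"
      unfolding infdist_notempty[OF Sne]
    proof (rule cINF_greatest[OF Sne])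
      fix s assume "s \<in> S"
      then have "\<not> (\<alpha> < s \<and> s < \<beta>)" using ab by (auto simp: S_def frac_eq)
      then show "\<delta> \<le> dist x s" using x \<delta> by (auto simp: dist_real_def abs_if)
    qed
    then show ?thesis using \<delta> by (simp add: \<zeta>_def)
  qed
  \<comment> \<open>\<open>\<zeta>\<close> has slope at most \<open>1 / \<delta>\<close>, and
    \<open>\<zeta> + \<tau>\<close> is at least \<open>\<tau>\<close>; so the logarithm of the
    density has slope at most \<open>1 / (\<delta> * \<tau>)\<close>.\<close>
  define K where "K = 1 / (\<delta> * \<tau>)"
  have K: "K \<ge> 0" using \<delta> \<tau> by (simp add: K_def)
  define Z where "Z = avg \<zeta> + \<tau>"
  have \<zeta>b: "bdd_borel \<zeta>"
    by (rule bdd_borelI[of _ 1]) (use \<zeta>01 \<zeta>c in \<open>auto intro: borel_measurable_continuous_onI\<close>)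
  have "avg (\<lambda>x. 0) \<le> avg \<zeta>" by (rule avg_mono[OF bdd_borel_const \<zeta>b]) (use \<zeta>01 in auto)
  then have \<zeta>0: "0 \<le> avg \<zeta>" by simp
  have "avg \<zeta> \<le> avg (\<lambda>x. 1)" by (rule avg_mono[OF \<zeta>b bdd_borel_const]) (use \<zeta>01 in auto)
  then have Z: "Z > 0" "Z \<le> 2" using \<zeta>0 \<tau> by (auto simp: Z_def)
  define \<phi> where "\<phi> x = (\<zeta> x + \<tau>) / Z" for x
  have \<phi>: "log_lip K \<phi>" unfolding log_lip_def
  proof (intro conjI allI)
    show "continuous_on UNIV \<phi>" unfolding \<phi>_def[abs_def] using Z by (intro continuous_intros \<zeta>c) auto
    show "0 < \<phi> x" for x using \<zeta>01(1)[of x] \<tau> Z by (simp add: \<phi>_def add_nonneg_pos)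
    show "\<phi> (x + 1) = \<phi> x" for x by (simp add: \<phi>_def \<zeta>1)
    fix x y
    have "\<zeta> x + \<tau> \<le> (\<zeta> y + \<tau>) + K * \<bar>x - y\<bar> * \<tau>"
      using \<zeta>lip[of x y] \<tau> \<delta> by (simp add: K_def)
    also have "K * \<bar>x - y\<bar> * \<tau> \<le> K * \<bar>x - y\<bar> * (\<zeta> y + \<tau>)" using K \<zeta>01 by (intro mult_left_mono) auto
    also have "(\<zeta> y + \<tau>) + K * \<bar>x - y\<bar> * (\<zeta> y + \<tau>) = (1 + K * \<bar>x - y\<bar>) * (\<zeta> y + \<tau>)" by (simp add: algebra_simps)
    also have "\<dots> \<le> exp (K * \<bar>x - y\<bar>) * (\<zeta> y + \<tau>)"
      using exp_ge_add_one_self[of "K * \<bar>x - y\<bar>"] \<zeta>01(1)[of y] \<tau> by (intro mult_right_mono) auto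
    finally show "\<phi> x \<le> exp (K * \<bar>x - y\<bar>) * \<phi> y" using Z by (simp add: \<phi>_def divide_right_mono)
  qed
  have \<phi>a: "avg \<phi> = 1"
  proof -
    have "avg \<phi> = avg (\<lambda>x. 1 / Z * (\<zeta> x + \<tau>))" by (simp add: \<phi>_def[abs_def])
    also have "\<dots> = 1 / Z * (avg \<zeta> + \<tau>)" unfolding avg_cmult by (simp add: avg_add[OF \<zeta>b bdd_borel_const])
    also have "\<dots> = 1" using Z by (simp add: Z_def)
    finally show ?thesis .
  qed
  have Ib: "bdd_borel (indicator {\<alpha><..<\<beta>})" by (rule bdd_borelI[of _ 1]) (auto simp: indicator_def)
  have err: "\<bar>avg (\<lambda>x. g x * (indicator {\<alpha><..<\<beta>} x - \<zeta> x))\<bar> \<le> 2 * \<delta>"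
    if g: "bdd_borel g" "\<And>x. 0 \<le> g x" "\<And>x. g x \<le> 1" for g
  proof -
    let ?U = "{\<alpha>..\<alpha> + \<delta>} \<union> {\<beta> - \<delta>..\<beta>}"
    have Ub: "bdd_borel (indicator ?U)" by (rule bdd_borelI[of _ 1]) (auto simp: indicator_def)
    have "\<bar>avg (\<lambda>x. g x * (indicator {\<alpha><..<\<beta>} x - \<zeta> x))\<bar> \<le> avg (indicator ?U)"
    proof (rule avg_abs_le[OF bdd_borel_mult[OF g(1) bdd_borel_diff[OF Ib \<zeta>b]] Ub])
      fix x :: real assume x: "x \<in> {0..<1}"
      have "\<bar>g x * (indicator {\<alpha><..<\<beta>} x - \<zeta> x)\<bar> \<le> 1 * \<bar>indicator {\<alpha><..<\<beta>} x - \<zeta> x\<bar>"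
        unfolding abs_mult using g(2,3)[of x] by (intro mult_right_mono) auto
      also have "\<dots> \<le> indicator ?U x"
        using \<zeta>out[OF x] \<zeta>in[of x] \<zeta>01[of x] by (auto simp: indicator_def)
      finally show "\<bar>g x * (indicator {\<alpha><..<\<beta>} x - \<zeta> x)\<bar> \<le> indicator ?U x" .
    qed
    also have "\<dots> = measure lborel (?U \<inter> {0..<1})" by (rule avg_indicator) auto
    also have "\<dots> \<le> measure lborel ?U"
    proof (rule measure_mono_fmeasurable)
      show "?U \<in> fmeasurable lborel"
        by (rule fmeasurable.Un; rule fmeasurableI) (simp_all add: emeasure_lborel_Icc_eq)
    qed auto
    also have "\<dots> \<le> measure lborel {\<alpha>..\<alpha> + \<delta>} + measure lborel {\<beta> - \<delta>..\<beta>}" by (rule measure_Un_le) auto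
    also have "\<dots> = 2 * \<delta>" using \<delta> by simp
    finally show ?thesis .
  qed
  have "e / 8 > 0" using e by simp
  from mixing[OF K this] obtain M0 where M0': "\<forall>M\<ge>M0. \<forall>M'\<ge>M0. \<forall>\<phi> \<psi>. log_lip K \<phi> \<longrightarrow> avg \<phi> = 1 \<longrightarrow> bdd_borel \<psi> \<longrightarrow>
    (\<forall>x. 0 \<le> \<psi> x \<and> \<psi> x \<le> 1) \<longrightarrow> (\<forall>x. \<psi> (x + 1) = \<psi> x) \<longrightarrow>
    \<bar>avg (\<lambda>x. \<psi> ((F ^^ M) x) * \<phi> x) - avg (\<lambda>x. \<psi> ((F ^^ M') x))\<bar> \<le> e / 8" ..
  show ?thesis
  proof (intro exI[of _ M0] allI impI)
    fix M M' \<psi>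
    assume M: "M0 \<le> M" "M0 \<le> M'" and \<psi>: "bdd_borel \<psi>" "\<forall>x. 0 \<le> \<psi> x \<and> \<psi> x \<le> 1" "\<forall>x. \<psi> (x + 1) = \<psi> x"
    define g where "g x = \<psi> ((F ^^ M) x)" for x
    define P where "P = avg (\<lambda>x. \<psi> ((F ^^ M') x))"
    have gb: "bdd_borel g" unfolding g_def[abs_def] by (rule bdd_borel_comp[OF \<psi>(1) F_pow_measurable])
    have g01: "0 \<le> g x" "g x \<le> 1" for x using \<psi>(2) by (auto simp: g_def)
    have Pb: "bdd_borel (\<lambda>x. \<psi> ((F ^^ M') x))" by (rule bdd_borel_comp[OF \<psi>(1) F_pow_measurable])
    have "avg (\<lambda>x. 0) \<le> P" unfolding P_def by (rule avg_mono[OF bdd_borel_const Pb]) (use \<psi>(2) in auto)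
    moreover have "P \<le> avg (\<lambda>x. 1)" unfolding P_def by (rule avg_mono[OF Pb bdd_borel_const]) (use \<psi>(2) in auto)
    ultimately have P01: "0 \<le> P" "P \<le> 1" by simp_all
    have "avg (\<lambda>x. 0) \<le> avg g" by (rule avg_mono[OF bdd_borel_const gb]) (use g01 in auto)
    moreover have "avg g \<le> avg (\<lambda>x. 1)" by (rule avg_mono[OF gb bdd_borel_const]) (use g01 in auto)
    ultimately have ga01: "0 \<le> avg g" "avg g \<le> 1" by simp_all
    have 1: "\<bar>avg (\<lambda>x. g x * \<phi> x) - P\<bar> \<le> e / 8"
      unfolding g_def P_def by (rule M0'[rule_format, OF M \<phi> \<phi>a \<psi>(1)]) (use \<psi> in blast)+
    have "avg (\<lambda>x. g x * \<zeta> x) = avg (\<lambda>x. Z * (g x * \<phi> x) - \<tau> * g x)"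
      using Z by (intro arg_cong[of _ _ avg] ext) (simp add: \<phi>_def field_simps)
    also have "\<dots> = Z * avg (\<lambda>x. g x * \<phi> x) - \<tau> * avg g"
      by (subst avg_diff) (intro bdd_borel_cmult bdd_borel_mult gb log_lip_bdd_borel[OF \<phi>], intro bdd_borel_cmult gb, simp only: avg_cmult)
    finally have "avg (\<lambda>x. g x * \<zeta> x) - avg \<zeta> * P = Z * (avg (\<lambda>x. g x * \<phi> x) - P) + \<tau> * (P - avg g)"
      by (simp add: Z_def algebra_simps)
    moreover have "\<bar>Z * (avg (\<lambda>x. g x * \<phi> x) - P)\<bar> \<le> 2 * (e / 8)"
      unfolding abs_mult using Z by (intro mult_mono 1) auto
    moreover have "\<bar>\<tau> * (P - avg g)\<bar> \<le> e / 8 * 1"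
      unfolding abs_mult using \<tau> P01 ga01 by (intro mult_mono) auto
    ultimately have 2: "\<bar>avg (\<lambda>x. g x * \<zeta> x) - avg \<zeta> * P\<bar> \<le> 3 * e / 8" by linarith
    have "avg (\<lambda>x. g x * (indicator {\<alpha><..<\<beta>} x - \<zeta> x)) = avg (\<lambda>x. g x * indicator {\<alpha><..<\<beta>} x - g x * \<zeta> x)"
      by (simp add: algebra_simps)
    also have "\<dots> = avg (\<lambda>x. g x * indicator {\<alpha><..<\<beta>} x) - avg (\<lambda>x. g x * \<zeta> x)"
      by (intro avg_diff bdd_borel_mult gb Ib \<zeta>b)
    finally have 3: "\<bar>avg (\<lambda>x. g x * indicator {\<alpha><..<\<beta>} x) - avg (\<lambda>x. g x * \<zeta> x)\<bar> \<le> 2 * \<delta>"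
      using err[OF gb g01] by simp
    have "avg (\<lambda>x. 1 * (indicator {\<alpha><..<\<beta>} x - \<zeta> x)) = avg (indicator {\<alpha><..<\<beta>}) - avg \<zeta>"
      by (simp add: avg_diff[OF Ib \<zeta>b])
    also have "avg (indicator {\<alpha><..<\<beta>}) = \<beta> - \<alpha>"
    proof -
      have "{\<alpha><..<\<beta>} \<inter> {0..<1} = {\<alpha><..<\<beta>}" using ab by auto
      then show ?thesis using ab by (subst avg_indicator) auto
    qed
    finally have "\<bar>(\<beta> - \<alpha>) - avg \<zeta>\<bar> \<le> 2 * \<delta>" using err[of "\<lambda>x. 1"] bdd_borel_const[of 1] by simp
    then have "\<bar>((\<beta> - \<alpha>) - avg \<zeta>) * P\<bar> \<le> 2 * \<delta> * 1"
      unfolding abs_mult using P01 \<delta> by (intro mult_mono) auto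
    then have 4: "\<bar>(\<beta> - \<alpha>) * P - avg \<zeta> * P\<bar> \<le> 2 * \<delta>" by (simp add: algebra_simps)
    have "\<bar>avg (\<lambda>x. g x * indicator {\<alpha><..<\<beta>} x) - (\<beta> - \<alpha>) * P\<bar> \<le> e"
      using 2 3 4 unfolding \<delta>_def abs_le_iff by linarith
    then show "\<bar>avg (\<lambda>x. indicator {\<alpha><..<\<beta>} x * \<psi> ((F ^^ M) x)) - (\<beta> - \<alpha>) * avg (\<lambda>x. \<psi> ((F ^^ M') x))\<bar> \<le> e"
      unfolding g_def P_def by (simp add: mult.commute)
  qed
qed

end

section \<open>Slowly varying functions\<close>

definition int_dist :: "real \<Rightarrow> real" where "int_dist x = dist (proj x) (proj 0)"

lemma int_dist_lip: "\<bar>int_dist x - int_dist y\<bar> \<le> \<bar>x - y\<bar>"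
  using dist_proj_diff_le[of x 0 y 0] by (simp add: int_dist_def)

lemma int_dist_1: "int_dist (x + 1) = int_dist x" by (simp add: int_dist_def)

lemma int_dist_bounds: "0 \<le> int_dist x" "int_dist x \<le> 1 / 2"
  unfolding int_dist_def by (rule zero_le_dist, rule dist_circle_le)

lemma int_dist_cont: "continuous_on A int_dist"
  unfolding int_dist_def by (intro continuous_intros continuous_on_proj)

lemma int_dist_measurable [measurable]: "int_dist \<in> borel_measurable borel"
  by (rule borel_measurable_continuous_onI) (rule int_dist_cont)

lemma int_dist_cases: "x \<in> {0..<1} \<Longrightarrow> int_dist x = x \<or> int_dist x = 1 - x"
proof -
  assume x: "x \<in> {0..<1}"
  have "round x = 0 \<or> round x = 1"
  proof (cases "x < 1 / 2")
    case True
    then have "round x = 0" using x by (intro round_unique) auto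
    then show ?thesis ..
  next
    case False
    then have "round x = 1" using x by (intro round_unique) auto
    then show ?thesis ..
  qed
  then show ?thesis using x by (auto simp: int_dist_def dist_proj)
qed

lemma avg_shell:
  assumes "s \<le> s'" shows "avg (indicator {x. s < int_dist x \<and> int_dist x \<le> s'}) \<le> 2 * (s' - s)"
proof -
  let ?U = "{s..s'} \<union> {1 - s'..1 - s}"
  have m: "{x. s < int_dist x \<and> int_dist x \<le> s'} \<in> sets borel"
  proof -
    have "{x \<in> space borel. s < int_dist x \<and> int_dist x \<le> s'} \<in> sets borel" by measurable
    then show ?thesis by simp
  qed
  have "avg (indicator {x. s < int_dist x \<and> int_dist x \<le> s'}) = measure lborel ({x. s < int_dist x \<and> int_dist x \<le> s'} \<inter> {0..<1})"
    by (rule avg_indicator[OF m])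
  also have "\<dots> \<le> measure lborel ?U"
  proof (rule measure_mono_fmeasurable)
    show "{x. s < int_dist x \<and> int_dist x \<le> s'} \<inter> {0..<1} \<subseteq> ?U" using int_dist_cases by fastforce
    show "?U \<in> fmeasurable lborel"
      by (rule fmeasurable.Un; rule fmeasurableI) (simp_all add: emeasure_lborel_Icc_eq)
  qed (use m in auto)
  also have "\<dots> \<le> measure lborel {s..s'} + measure lborel {1 - s'..1 - s}" by (rule measure_Un_le) auto
  also have "\<dots> = 2 * (s' - s)" using assms by simp
  finally show ?thesis .
qed

lemma periodic_ucont:
  fixes \<phi> :: "real \<Rightarrow> real"
  assumes c: "continuous_on UNIV \<phi>" and p: "\<And>x. \<phi> (x + 1) = \<phi> x" and e: "e > 0"
  obtains \<delta> where "\<delta> > 0" "\<And>x y. \<bar>x - y\<bar> < \<delta> \<Longrightarrow> \<bar>\<phi> x - \<phi> y\<bar> < e"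
proof -
  have "uniformly_continuous_on {-1..2} \<phi>"
    by (rule compact_uniformly_continuous) (auto intro: continuous_on_subset[OF c])
  then obtain \<delta> where \<delta>: "\<delta> > 0" "\<And>x y. x \<in> {-1..2} \<Longrightarrow> y \<in> {-1..2} \<Longrightarrow> dist y x < \<delta> \<Longrightarrow> dist (\<phi> y) (\<phi> x) < e"
    unfolding uniformly_continuous_on_def using e by metis
  show ?thesis
  proof (rule that[of "min \<delta> 1"])
    fix x y :: real assume xy: "\<bar>x - y\<bar> < min \<delta> 1"
    let ?i = "- \<lfloor>x\<rfloor>"
    have fl: "of_int \<lfloor>x\<rfloor> \<le> x" "x < of_int \<lfloor>x\<rfloor> + 1" by linarith+
    have xy': "\<bar>x - y\<bar> < 1" using xy by simp
    have x: "x + of_int ?i \<in> {-1..2}" and y: "y + of_int ?i \<in> {-1..2}"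
      using xy' fl unfolding atLeastAtMost_iff by (intro conjI; linarith)+
    have "dist (\<phi> (x + of_int ?i)) (\<phi> (y + of_int ?i)) < e"
      by (rule \<delta>(2)[OF y x]) (use xy in \<open>simp add: dist_real_def\<close>)
    then show "\<bar>\<phi> x - \<phi> y\<bar> < e" unfolding periodic_int[of \<phi>, OF p] dist_real_def .
  qed (use \<delta> in simp)
qed

lemma periodic_bounded:
  fixes \<phi> :: "real \<Rightarrow> real"
  assumes c: "continuous_on UNIV \<phi>" and p: "\<And>x. \<phi> (x + 1) = \<phi> x"
  obtains B where "B \<ge> 1" "\<And>x. \<bar>\<phi> x\<bar> \<le> B"
proof -
  have "compact (\<phi> ` {0..1})" by (intro compact_continuous_image continuous_on_subset[OF c]) auto
  then obtain B where B: "\<And>y. y \<in> \<phi> ` {0..1} \<Longrightarrow> norm y \<le> B"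
    using compact_imp_bounded bounded_iff by metis
  have "\<bar>\<phi> x\<bar> \<le> max 1 B" for x
  proof -
    have "\<phi> (frac x) \<in> \<phi> ` {0..1}" using frac_ge_0[of x] frac_lt_1[of x] by (intro imageI) (auto simp: less_imp_le)
    from B[OF this] show ?thesis using periodic_frac[of \<phi> x, OF p] by simp
  qed
  then show ?thesis using that[of "max 1 B"] by simp
qed

lemma (in lift) F'_bounds:
  obtains m B where "0 < m" "m \<le> 1" "B \<ge> 1" "\<And>x. m \<le> \<bar>F' x\<bar>" "\<And>x. \<bar>F' x\<bar> \<le> B"
proof -
  obtain B where B: "B \<ge> 1" "\<And>x. \<bar>F' x\<bar> \<le> B" using periodic_bounded[OF F'_cont F'_shift1] by blast
  have "continuous_on UNIV (\<lambda>x. inverse (F' x))" by (intro continuous_intros F'_cont) (use F'_nz in auto)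
  then obtain C where C: "C \<ge> 1" "\<And>x. \<bar>inverse (F' x)\<bar> \<le> C"
    using periodic_bounded[of "\<lambda>x. inverse (F' x)"] F'_shift1 by metis
  have "1 / C \<le> \<bar>F' x\<bar>" for x
  proof -
    have "1 / \<bar>F' x\<bar> \<le> C" using C(2)[of x] by (simp add: abs_inverse divide_inverse)
    then show ?thesis using C(1) F'_nz[of x] by (simp add: field_simps)
  qed
  then show ?thesis using that[of "1 / C" B] B C(1) by simp
qed

lemma (in lift) F_lipschitz:
  assumes "\<And>x. \<bar>F' x\<bar> \<le> B" shows "\<bar>F x - F y\<bar> \<le> B * \<bar>x - y\<bar>"
  using field_differentiable_bound[of UNIV F F' B x y] assms F_deriv by simp

lemma (in lift) F_pow_lipschitz:
  assumes "\<And>x. \<bar>F' x\<bar> \<le> B" "B \<ge> 1" shows "\<bar>(F ^^ i) x - (F ^^ i) y\<bar> \<le> B ^ i * \<bar>x - y\<bar>"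
proof (induction i)
  case (Suc i)
  have "\<bar>(F ^^ Suc i) x - (F ^^ Suc i) y\<bar> \<le> B * \<bar>(F ^^ i) x - (F ^^ i) y\<bar>"
    using F_lipschitz[OF assms(1)] by simp
  also have "\<dots> \<le> B * (B ^ i * \<bar>x - y\<bar>)" using Suc assms(2) by (intro mult_left_mono) auto
  finally show ?case by simp
qed simp

section \<open>A marker function for visits near the integers\<close>

definition tent :: "nat \<Rightarrow> nat \<Rightarrow> real" where
  "tent w i = max 0 (1 - \<bar>real i / (2 * real w) - 1\<bar>)"

lemma tent_bounds: "0 \<le> tent w i" "tent w i \<le> 1" by (auto simp: tent_def)

lemma tent_ends: "w \<ge> 1 \<Longrightarrow> tent w 0 = 0" "w \<ge> 1 \<Longrightarrow> tent w (4 * w) = 0"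
  by (auto simp: tent_def)

lemma tent_step: "w \<ge> 1 \<Longrightarrow> \<bar>tent w (Suc i) - tent w i\<bar> \<le> 1 / (2 * real w)"
proof -
  assume w: "w \<ge> 1"
  have "real (Suc i) / (2 * real w) = real i / (2 * real w) + 1 / (2 * real w)" by (simp add: add_divide_distrib)
  moreover have "1 / (2 * real w) \<ge> 0" by simp
  ultimately have *: "\<bar>(1 - \<bar>real (Suc i) / (2 * real w) - 1\<bar>) - (1 - \<bar>real i / (2 * real w) - 1\<bar>)\<bar> \<le> 1 / (2 * real w)"
    by linarith
  have "\<bar>max 0 a - max 0 b\<bar> \<le> \<bar>a - b\<bar>" for a b :: real by (simp add: max_def)
  from order_trans[OF this *] show ?thesis unfolding tent_def .
qed

lemma tent_mid: "w \<ge> 1 \<Longrightarrow> w \<le> i \<Longrightarrow> i \<le> 3 * w \<Longrightarrow> tent w i \<ge> 1 / 2"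
proof -
  assume w: "w \<ge> 1" "w \<le> i" "i \<le> 3 * w"
  have "1 / 2 \<le> real i / (2 * real w)" using w by (simp add: divide_simps)
  moreover have "real i / (2 * real w) \<le> 3 / 2" using w by (simp add: divide_simps)
  ultimately have "1 / 2 \<le> 1 - \<bar>real i / (2 * real w) - 1\<bar>" by linarith
  then show ?thesis unfolding tent_def by (rule max.coboundedI2)
qed

definition bump :: "real \<Rightarrow> real \<Rightarrow> real \<Rightarrow> real" where
  "bump s \<delta> x = max 0 (min 1 ((s + \<delta> - int_dist x) / \<delta>))"

lemma bump_bounds: "0 \<le> bump s \<delta> x" "bump s \<delta> x \<le> 1" by (auto simp: bump_def)

lemma bump_1: "\<delta> > 0 \<Longrightarrow> int_dist x \<le> s \<Longrightarrow> bump s \<delta> x = 1" by (simp add: bump_def)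

lemma bump_0: "\<delta> > 0 \<Longrightarrow> s + \<delta> \<le> int_dist x \<Longrightarrow> bump s \<delta> x = 0" by (auto simp: bump_def divide_le_0_iff)

lemma bump_lip: "\<delta> > 0 \<Longrightarrow> \<bar>bump s \<delta> x - bump s \<delta> y\<bar> \<le> \<bar>x - y\<bar> / \<delta>"
proof -
  assume \<delta>: "\<delta> > 0"
  have "\<bar>(s + \<delta> - int_dist x) / \<delta> - (s + \<delta> - int_dist y) / \<delta>\<bar> = \<bar>int_dist x - int_dist y\<bar> / \<delta>"
    using \<delta> by (simp flip: diff_divide_distrib add: abs_divide abs_minus_commute)
  also have "\<dots> \<le> \<bar>x - y\<bar> / \<delta>" using int_dist_lip \<delta> by (simp add: divide_right_mono)
  finally have *: "\<bar>(s + \<delta> - int_dist x) / \<delta> - (s + \<delta> - int_dist y) / \<delta>\<bar> \<le> \<bar>x - y\<bar> / \<delta>" .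
  have "\<bar>max 0 (min 1 a) - max 0 (min 1 b)\<bar> \<le> \<bar>a - b\<bar>" for a b :: real by (simp add: max_def min_def)
  from order_trans[OF this *] show ?thesis unfolding bump_def .
qed

context expanding_lift
begin

text \<open>The largest weight, over times up to \<open>4 * w\<close>, of a visit near the integers.
  The tent in time rises from 0 to 1 at \<open>2 * w\<close> and falls back to 0 at
  \<open>4 * w\<close>, so a unit shift of time changes the weights by at most
  \<open>1 / (2 * w)\<close>; a maximum, unlike a sum, keeps this bound and the range [0, 1] for any
  number of visits.\<close>

definition marker :: "nat \<Rightarrow> real \<Rightarrow> real \<Rightarrow> real \<Rightarrow> real" where
  "marker w s \<delta> x = Max ((\<lambda>i. tent w i * bump s \<delta> ((F ^^ i) x)) ` {..4 * w})"

lemma marker_ge: "i \<le> 4 * w \<Longrightarrow> tent w i * bump s \<delta> ((F ^^ i) x) \<le> marker w s \<delta> x"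
  unfolding marker_def by (rule Max_ge) auto

lemma marker_le: "(\<And>i. i \<le> 4 * w \<Longrightarrow> tent w i * bump s \<delta> ((F ^^ i) x) \<le> B) \<Longrightarrow> marker w s \<delta> x \<le> B"
  unfolding marker_def by (subst Max_le_iff) auto

lemma marker_bounds: "0 \<le> marker w s \<delta> x" "marker w s \<delta> x \<le> 1"
proof -
  have "0 \<le> tent w 0 * bump s \<delta> ((F ^^ 0) x)" using tent_bounds bump_bounds by (intro mult_nonneg_nonneg)
  then show "0 \<le> marker w s \<delta> x" using marker_ge[of 0 w s \<delta> x] by linarith
  show "marker w s \<delta> x \<le> 1" by (rule marker_le) (use mult_le_one[OF tent_bounds(2) bump_bounds] in auto)
qed

lemma marker_periodic: "marker w s \<delta> (x + 1) = marker w s \<delta> x"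
proof -
  have b: "bump s \<delta> (x + 1) = bump s \<delta> x" for x by (simp add: bump_def int_dist_1)
  show ?thesis unfolding marker_def F_pow_periodic[of "bump s \<delta>", OF b] ..
qed

text \<open>\<open>F x\<close> sees the same orbit one time unit earlier, so every term changes by
  one step of the tent. The terms that enter or leave at the two ends have weight 0.\<close>

lemma marker_slow:
  assumes w: "w \<ge> 1" shows "\<bar>marker w s \<delta> (F x) - marker w s \<delta> x\<bar> \<le> 1 / (2 * real w)"
proof -
  let ?b = "\<lambda>i. bump s \<delta> ((F ^^ i) x)"
  have Fb: "bump s \<delta> ((F ^^ i) (F x)) = ?b (Suc i)" for i by (simp add: funpow_swap1)
  have step: "tent w i * ?b j \<le> tent w i' * ?b j + 1 / (2 * real w)"
    if "\<bar>tent w i - tent w i'\<bar> \<le> 1 / (2 * real w)" for i i' j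
  proof -
    have "(tent w i - tent w i') * ?b j \<le> \<bar>tent w i - tent w i'\<bar> * ?b j"
      using bump_bounds by (intro mult_right_mono) auto
    also have "\<dots> \<le> \<bar>tent w i - tent w i'\<bar> * 1" using bump_bounds by (intro mult_left_mono) auto
    finally show ?thesis using that by (simp add: algebra_simps)
  qed
  have nn: "0 \<le> 1 / (2 * real w)" by simp
  have "marker w s \<delta> (F x) \<le> marker w s \<delta> x + 1 / (2 * real w)"
  proof (rule marker_le)
    fix i assume i: "i \<le> 4 * w"
    show "tent w i * bump s \<delta> ((F ^^ i) (F x)) \<le> marker w s \<delta> x + 1 / (2 * real w)"
    proof (cases "i = 4 * w")
      case True
      then show ?thesis using tent_ends(2)[OF w] marker_bounds(1)[of w s \<delta> x] nn by simp
    next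
      case False
      have "tent w i * ?b (Suc i) \<le> tent w (Suc i) * ?b (Suc i) + 1 / (2 * real w)"
        by (rule step) (use tent_step[OF w, of i] in linarith)
      also have "tent w (Suc i) * ?b (Suc i) \<le> marker w s \<delta> x" by (rule marker_ge) (use i False in simp)
      finally show ?thesis unfolding Fb by simp
    qed
  qed
  moreover have "marker w s \<delta> x \<le> marker w s \<delta> (F x) + 1 / (2 * real w)"
  proof (rule marker_le)
    fix i assume i: "i \<le> 4 * w"
    show "tent w i * ?b i \<le> marker w s \<delta> (F x) + 1 / (2 * real w)"
    proof (cases i)
      case 0
      then show ?thesis using tent_ends(1)[OF w] marker_bounds(1)[of w s \<delta> "F x"] nn by simp
    next
      case (Suc j)
      have "tent w (Suc j) * ?b (Suc j) \<le> tent w j * ?b (Suc j) + 1 / (2 * real w)"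
        by (rule step) (rule tent_step[OF w])
      also have "tent w j * ?b (Suc j) \<le> marker w s \<delta> (F x)"
        using marker_ge[of j w s \<delta> "F x"] i Suc unfolding Fb by simp
      finally show ?thesis using Suc by simp
    qed
  qed
  ultimately show ?thesis by linarith
qed

text \<open>Iterates up to time \<open>4 * w\<close> enter, each with Lipschitz constant at most
  \<open>\<Lambda> ^ (4 * w)\<close>. The resulting constant may be huge; this is harmless, because
  the smallest time \<open>n\<close> of the oscillation is chosen after it.\<close>

lemma marker_lipschitz:
  assumes \<delta>: "\<delta> > 0" obtains B where "B \<ge> 0" "\<And>x y. \<bar>marker w s \<delta> x - marker w s \<delta> y\<bar> \<le> B * \<bar>x - y\<bar>"
proof -
  obtain \<Lambda> where \<Lambda>: "\<Lambda> \<ge> 1" "\<And>x. \<bar>F' x\<bar> \<le> \<Lambda>" by (rule F'_bounds) (rule that)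
  have one: "marker w s \<delta> x \<le> marker w s \<delta> y + \<Lambda> ^ (4 * w) / \<delta> * \<bar>x - y\<bar>" for x y
  proof (rule marker_le)
    fix i assume i: "i \<le> 4 * w"
    have "tent w i * (bump s \<delta> ((F ^^ i) x) - bump s \<delta> ((F ^^ i) y)) \<le>
        tent w i * \<bar>bump s \<delta> ((F ^^ i) x) - bump s \<delta> ((F ^^ i) y)\<bar>"
      by (rule mult_left_mono[OF abs_ge_self tent_bounds(1)])
    also have "\<dots> \<le> 1 * \<bar>bump s \<delta> ((F ^^ i) x) - bump s \<delta> ((F ^^ i) y)\<bar>"
      by (rule mult_right_mono[OF tent_bounds(2) abs_ge_zero])
    finally have "tent w i * bump s \<delta> ((F ^^ i) x) - tent w i * bump s \<delta> ((F ^^ i) y) \<le>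
        1 * \<bar>bump s \<delta> ((F ^^ i) x) - bump s \<delta> ((F ^^ i) y)\<bar>"
      by (simp only: right_diff_distrib)
    also have "\<dots> \<le> \<bar>(F ^^ i) x - (F ^^ i) y\<bar> / \<delta>" using bump_lip[OF \<delta>] by simp
    also have "\<dots> \<le> (\<Lambda> ^ (4 * w) * \<bar>x - y\<bar>) / \<delta>"
    proof (rule divide_right_mono)
      have "\<bar>(F ^^ i) x - (F ^^ i) y\<bar> \<le> \<Lambda> ^ i * \<bar>x - y\<bar>" by (rule F_pow_lipschitz[OF \<Lambda>(2,1)])
      also have "\<dots> \<le> \<Lambda> ^ (4 * w) * \<bar>x - y\<bar>" using i \<Lambda> by (intro mult_right_mono power_increasing) auto
      finally show "\<bar>(F ^^ i) x - (F ^^ i) y\<bar> \<le> \<Lambda> ^ (4 * w) * \<bar>x - y\<bar>" .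
    qed (use \<delta> in simp)
    finally show "tent w i * bump s \<delta> ((F ^^ i) x) \<le> marker w s \<delta> y + \<Lambda> ^ (4 * w) / \<delta> * \<bar>x - y\<bar>"
      using marker_ge[OF i, of s \<delta> y] by simp
  qed
  show ?thesis
  proof (rule that[of "\<Lambda> ^ (4 * w) / \<delta>"])
    show "\<bar>marker w s \<delta> x - marker w s \<delta> y\<bar> \<le> \<Lambda> ^ (4 * w) / \<delta> * \<bar>x - y\<bar>" for x y
      using one[of x y] one[of y x] by (simp add: abs_minus_commute abs_le_iff)
  qed (use \<Lambda> \<delta> in simp)
qed

text \<open>The transferred constant density has mean 1 and logarithmic slope \<open>Kd\<close>,
  hence is at most \<open>exp Kd\<close> on a period.\<close>

lemma F_pow_avg_le:
  assumes \<psi>: "bdd_borel \<psi>" "\<And>x. 0 \<le> \<psi> x" "\<And>x. \<psi> (x + 1) = \<psi> x"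
  shows "avg (\<lambda>x. \<psi> ((F ^^ t) x)) \<le> exp Kd * avg \<psi>"
proof -
  have one: "log_lip 0 (\<lambda>x. 1)" by (simp add: log_lip_def)
  define T where "T = transfer t (\<lambda>x. 1)"
  have T: "log_lip Kd T" using transfer_log_lip[OF one, of t] by (simp add: T_def)
  have Ta: "avg T = 1" using transfer_avg[OF one, of t] by (simp add: T_def)
  have le: "T x \<le> exp Kd" if "x \<in> {0..<1}" for x
  proof -
    have "avg (\<lambda>y. exp (- Kd) * T x) \<le> avg T"
    proof (rule avg_mono[OF bdd_borel_const log_lip_bdd_borel[OF T]])
      fix y :: real assume y: "y \<in> {0..<1}"
      have "T x \<le> exp (Kd * \<bar>x - y\<bar>) * T y" using T by (simp add: log_lip_def)
      also have "\<dots> \<le> exp Kd * T y"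
      proof -
        have "\<bar>x - y\<bar> \<le> 1" using y that unfolding abs_le_iff atLeastLessThan_iff by linarith
        then have "Kd * \<bar>x - y\<bar> \<le> Kd" using Kd_nonneg by (simp add: mult_left_le)
        then show ?thesis using T by (intro mult_right_mono) (auto simp: log_lip_def less_imp_le)
      qed
      finally show "exp (- Kd) * T x \<le> T y" by (simp add: exp_minus field_simps)
    qed
    then show ?thesis using Ta by (simp add: exp_minus field_simps)
  qed
  have "avg (\<lambda>x. \<psi> ((F ^^ t) x)) = avg (\<lambda>x. \<psi> ((F ^^ t) x) * 1)" by simp
  also have "\<dots> = avg (\<lambda>x. \<psi> x * T x)" unfolding T_def by (rule transfer_dual[OF one \<psi>])
  also have "\<dots> \<le> avg (\<lambda>x. exp Kd * \<psi> x)"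
  proof (rule avg_mono[OF bdd_borel_mult[OF \<psi>(1) log_lip_bdd_borel[OF T]] bdd_borel_cmult[OF \<psi>(1)]])
    fix x :: real assume "x \<in> {0..<1}"
    from mult_left_mono[OF le[OF this] \<psi>(2)[of x]] show "\<psi> x * T x \<le> exp Kd * \<psi> x" by (simp only: mult.commute)
  qed
  finally show ?thesis unfolding avg_cmult .
qed

section \<open>Hitting probabilities of a neighbourhood of the integers\<close>

definition hits :: "real \<Rightarrow> nat \<Rightarrow> real set" where
  "hits s k = {x. \<exists>i\<le>k. int_dist ((F ^^ i) x) \<le> s}"

lemma hits_measurable [measurable]: "hits s k \<in> sets borel"
proof -
  have "{x \<in> space borel. \<exists>i\<in>{..k}. int_dist ((F ^^ i) x) \<le> s} \<in> sets borel" by measurable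
  then show ?thesis by (simp add: hits_def)
qed

lemma hits_periodic: "indicator (hits s k) (x + 1) = (indicator (hits s k) x :: real)"
  by (simp add: indicator_def hits_def F_pow_periodic[of int_dist, OF int_dist_1])

lemma hits_bdd_borel: "bdd_borel (indicator (hits s k))"
  by (rule bdd_borelI[of _ 1]) (auto simp: indicator_def)

definition hit_prob :: "nat \<Rightarrow> nat \<Rightarrow> real \<Rightarrow> real" where
  "hit_prob M k s = avg (\<lambda>x. indicator (hits s k) ((F ^^ M) x))"

lemma hits_comp_bdd_borel: "bdd_borel (\<lambda>x. indicator (hits s k) ((F ^^ M) x))"
  by (rule bdd_borel_comp[OF hits_bdd_borel F_pow_measurable])

text \<open>An orbit that comes within \<open>s'\<close> but never within \<open>s\<close> has one
  of its \<open>k + 1\<close> points in a shell of measure at most \<open>2 * (s' - s)\<close>;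
  pulling the shell back costs at most the factor \<open>exp Kd\<close> at any time.\<close>

lemma hit_prob_step:
  assumes "s \<le> s'"
  shows "hit_prob M k s \<le> hit_prob M k s'"
    and "hit_prob M k s' \<le> hit_prob M k s + real (Suc k) * (exp Kd * 2) * (s' - s)"
proof -
  show "hit_prob M k s \<le> hit_prob M k s'"
    unfolding hit_prob_def by (rule avg_mono[OF hits_comp_bdd_borel hits_comp_bdd_borel])
      (use assms in \<open>auto simp: indicator_def hits_def intro: order_trans\<close>)
  let ?S = "{x. s < int_dist x \<and> int_dist x \<le> s'}"
  have m: "?S \<in> sets borel"
  proof -
    have "{x \<in> space borel. s < int_dist x \<and> int_dist x \<le> s'} \<in> sets borel" by measurable
    then show ?thesis by simp
  qed
  have Sb: "bdd_borel (indicator ?S)" by (rule bdd_borelI[of _ 1]) (use m in \<open>auto simp: indicator_def\<close>)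
  have Sc: "bdd_borel (\<lambda>x. indicator ?S ((F ^^ t) x))" for t by (rule bdd_borel_comp[OF Sb F_pow_measurable])
  have sum: "bdd_borel (\<lambda>x. \<Sum>i<n. indicator ?S ((F ^^ (i + M)) x)) \<and>
    avg (\<lambda>x. \<Sum>i<n. indicator ?S ((F ^^ (i + M)) x)) \<le> real n * (exp Kd * 2) * (s' - s)" for n
  proof (induction n)
    case (Suc n)
    have "avg (\<lambda>x. indicator ?S ((F ^^ (n + M)) x)) \<le> exp Kd * avg (indicator ?S)"
      by (rule F_pow_avg_le[OF Sb]) (auto simp: indicator_def int_dist_1)
    also have "\<dots> \<le> exp Kd * (2 * (s' - s))" using avg_shell[OF assms] by (intro mult_left_mono) auto
    finally have "avg (\<lambda>x. indicator ?S ((F ^^ (n + M)) x)) \<le> exp Kd * 2 * (s' - s)" by (simp only: mult.assoc)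
    then show ?case using Suc Sc bdd_borel_add avg_add[OF Suc[THEN conjunct1] Sc] by (simp add: algebra_simps)
  qed (simp add: bdd_borel_const)
  have "hit_prob M k s' \<le> avg (\<lambda>x. indicator (hits s k) ((F ^^ M) x) + (\<Sum>i<Suc k. indicator ?S ((F ^^ (i + M)) x)))"
    unfolding hit_prob_def
  proof (rule avg_mono[OF hits_comp_bdd_borel bdd_borel_add[OF hits_comp_bdd_borel sum[THEN conjunct1]]])
    fix x
    show "indicator (hits s' k) ((F ^^ M) x) \<le> indicator (hits s k) ((F ^^ M) x) + (\<Sum>i<Suc k. indicator ?S ((F ^^ (i + M)) x) :: real)"
    proof (cases "(F ^^ M) x \<in> hits s' k \<and> (F ^^ M) x \<notin> hits s k")
      case True
      then obtain i where i: "i \<le> k" "int_dist ((F ^^ i) ((F ^^ M) x)) \<le> s'" "s < int_dist ((F ^^ i) ((F ^^ M) x))"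
        unfolding hits_def by force
      then have "(F ^^ (i + M)) x \<in> ?S" by (simp add: funpow_add)
      then have "1 \<le> (\<Sum>i<Suc k. indicator ?S ((F ^^ (i + M)) x) :: real)"
        using i(1) member_le_sum[of i "{..<Suc k}" "\<lambda>i. indicator ?S ((F ^^ (i + M)) x) :: real"] by simp
      then show ?thesis using True by simp
    next
      case False
      moreover have "0 \<le> (\<Sum>i<Suc k. indicator ?S ((F ^^ (i + M)) x) :: real)" by (intro sum_nonneg) simp
      ultimately show ?thesis by (auto simp: indicator_def)
    qed
  qed
  also have "\<dots> = hit_prob M k s + avg (\<lambda>x. \<Sum>i<Suc k. indicator ?S ((F ^^ (i + M)) x))"
    unfolding hit_prob_def by (rule avg_add[OF hits_comp_bdd_borel sum[THEN conjunct1]])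
  finally show "hit_prob M k s' \<le> hit_prob M k s + real (Suc k) * (exp Kd * 2) * (s' - s)"
    using sum[of "Suc k"] by linarith
qed

text \<open>The probability is continuous in \<open>s\<close>; no orbit hits for
  \<open>s = -1\<close> and all do for \<open>s = 1 / 2\<close>.\<close>

lemma hit_prob_half: "\<exists>s. hit_prob M k s = 1 / 2"
proof -
  define B where "B = real (Suc k) * (exp Kd * 2)"
  have B: "B > 0" by (simp add: B_def)
  have lip: "\<bar>hit_prob M k s - hit_prob M k s'\<bar> \<le> B * \<bar>s - s'\<bar>" for s s'
  proof -
    have *: "\<bar>hit_prob M k s - hit_prob M k s'\<bar> \<le> B * \<bar>s - s'\<bar>" if "s \<le> s'" for s s'
      using hit_prob_step[OF that, of M k] that by (simp add: B_def abs_minus_commute)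
    show ?thesis using *[of s s'] *[of s' s] by (cases "s \<le> s'") (auto simp: abs_minus_commute)
  qed
  have "continuous_on {-1..1/2} (hit_prob M k)"
    unfolding continuous_on_iff
  proof (intro ballI allI impI)
    fix x e :: real assume e: "e > 0"
    show "\<exists>d>0. \<forall>x'\<in>{-1..1/2}. dist x' x < d \<longrightarrow> dist (hit_prob M k x') (hit_prob M k x) < e"
    proof (intro exI[of _ "e / B"] conjI ballI impI)
      fix x' assume "dist x' x < e / B"
      then have "B * \<bar>x' - x\<bar> < e" using B by (simp add: dist_real_def field_simps)
      then show "dist (hit_prob M k x') (hit_prob M k x) < e" using lip[of x' x] by (simp add: dist_real_def)
    qed (use e B in simp)
  qed
  moreover have "hit_prob M k (-1) \<le> 1 / 2"
  proof -
    have "hits (-1) k = {}" using int_dist_bounds(1) by (auto simp: hits_def) (meson dual_order.trans not_one_le_zero neg_0_le_iff_le)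
    then show ?thesis by (simp add: hit_prob_def)
  qed
  moreover have "hit_prob M k (1 / 2) \<ge> 1 / 2"
  proof -
    have "hits (1 / 2) k = UNIV" using int_dist_bounds(2) by (auto simp: hits_def)
    then show ?thesis by (simp add: hit_prob_def)
  qed
  ultimately show ?thesis using IVT'[of "hit_prob M k" "-1" "1 / 2" "1 / 2"] by auto
qed

text \<open>Take \<open>s\<close> so that the orbit hits the \<open>s\<close>-neighbourhood within
  \<open>4 * w\<close> steps with probability 1/2. Without a hit of the slightly larger
  neighbourhood the marker is 0. A hit lies in the first or in the second half of the window, so by
  near-stationarity the middle half, where the tent is at least 1/2, is hit with probability nearly
  1/4.\<close>

lemma marker_exists:
  assumes w: "w \<ge> 1"
  shows "\<exists>M0. \<forall>M\<ge>M0. \<exists>u B. (\<forall>x. u (x + 1) = u x) \<and> (\<forall>x. 0 \<le> u x \<and> u x \<le> 1) \<and> 0 \<le> B \<and> (\<forall>x y. \<bar>u x - u y\<bar> \<le> B * \<bar>x - y\<bar>) \<and>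
    (\<forall>x. \<bar>u (F x) - u x\<bar> \<le> 1 / (2 * real w)) \<and>
    avg (\<lambda>x. indicator {x. u x = 0} ((F ^^ M) x)) \<ge> 49 / 100 \<and>
    avg (\<lambda>x. indicator {x. u x \<ge> 1 / 2} ((F ^^ M) x)) \<ge> 24 / 100"
proof -
  have "0 \<le> (0::real)" "(0::real) < 1 / 100" by simp_all
  from mixing[OF this] obtain M0 where M0: "\<forall>M\<ge>M0. \<forall>M'\<ge>M0. \<forall>\<phi> \<psi>. log_lip 0 \<phi> \<longrightarrow> avg \<phi> = 1 \<longrightarrow> bdd_borel \<psi> \<longrightarrow>
    (\<forall>x. 0 \<le> \<psi> x \<and> \<psi> x \<le> 1) \<longrightarrow> (\<forall>x. \<psi> (x + 1) = \<psi> x) \<longrightarrow>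
    \<bar>avg (\<lambda>x. \<psi> ((F ^^ M) x) * \<phi> x) - avg (\<lambda>x. \<psi> ((F ^^ M') x))\<bar> \<le> 1 / 100" ..
  show ?thesis
  proof (intro exI[of _ M0] allI impI)
    fix M assume M: "M0 \<le> M"
    \<comment> \<open>Late hit probabilities are nearly independent of the time; this replaces the
      use of an invariant measure.\<close>
    have stat: "\<bar>hit_prob (M + i) k s - hit_prob (M + j) k s\<bar> \<le> 1 / 100" for i j k s
    proof -
      have one: "log_lip 0 (\<lambda>x. 1)" by (simp add: log_lip_def)
      have "\<bar>avg (\<lambda>x. indicator (hits s k) ((F ^^ (M + i)) x) * 1) - avg (\<lambda>x. indicator (hits s k) ((F ^^ (M + j)) x))\<bar> \<le> 1 / 100"
        by (rule M0[rule_format, OF _ _ one avg_const hits_bdd_borel])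
          (use M in \<open>auto simp: hits_periodic indicator_le_1\<close>)
      then show ?thesis by (simp add: hit_prob_def)
    qed
    obtain s where s: "hit_prob M (4 * w) s = 1 / 2" using hit_prob_half by blast
    define B1 where "B1 = real (Suc (4 * w)) * (exp Kd * 2)"
    have B1: "B1 > 0" by (simp add: B1_def)
    \<comment> \<open>Enlarging the radius by \<open>\<delta>\<close> raises the hit probability by
      at most 1/100.\<close>
    define \<delta> where "\<delta> = 1 / (100 * B1)"
    have \<delta>: "\<delta> > 0" using B1 by (simp add: \<delta>_def)
    have s\<delta>: "hit_prob M (4 * w) (s + \<delta>) \<le> 51 / 100"
    proof -
      have "hit_prob M (4 * w) (s + \<delta>) \<le> hit_prob M (4 * w) s + B1 * (s + \<delta> - s)"
        unfolding B1_def by (rule hit_prob_step) (use \<delta> in simp)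
      also have "B1 * (s + \<delta> - s) = 1 / 100" using B1 by (simp add: \<delta>_def)
      finally show ?thesis using s by simp
    qed
    define u where "u = marker w s \<delta>"
    obtain B where B: "B \<ge> 0" "\<And>x y. \<bar>u x - u y\<bar> \<le> B * \<bar>x - y\<bar>" using marker_lipschitz[OF \<delta>] unfolding u_def by blast
    have uc: "continuous_on UNIV u"
      unfolding continuous_on_iff
    proof (intro ballI allI impI)
      fix x e :: real assume e: "e > 0"
      show "\<exists>d>0. \<forall>x'\<in>UNIV. dist x' x < d \<longrightarrow> dist (u x') (u x) < e"
      proof (intro exI[of _ "e / (B + 1)"] conjI ballI impI)
        fix x' assume "dist x' x < e / (B + 1)"
        then have "(B + 1) * \<bar>x' - x\<bar> < e" using B(1) by (simp add: dist_real_def field_simps)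
        then show "dist (u x') (u x) < e" using B(2)[of x' x] by (simp add: dist_real_def algebra_simps)
      qed (use e B(1) in simp)
    qed
    have [measurable]: "u \<in> borel_measurable borel" by (rule borel_measurable_continuous_onI[OF uc])
    have m0: "{x. u x = 0} \<in> sets borel" "{x. u x \<ge> 1 / 2} \<in> sets borel"
    proof -
      have "{x \<in> space borel. u x = 0} \<in> sets borel" "{x \<in> space borel. u x \<ge> 1 / 2} \<in> sets borel" by measurable
      then show "{x. u x = 0} \<in> sets borel" "{x. u x \<ge> 1 / 2} \<in> sets borel" by simp_all
    qed
    have ib: "bdd_borel (\<lambda>x. indicator A ((F ^^ M) x))" if "A \<in> sets borel" for A
      by (rule bdd_borel_comp[OF bdd_borelI[of _ 1] F_pow_measurable]) (use that in \<open>auto simp: indicator_def\<close>)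
    have low: "avg (\<lambda>x. indicator {x. u x = 0} ((F ^^ M) x)) \<ge> 49 / 100"
    proof -
      have "1 - hit_prob M (4 * w) (s + \<delta>) = avg (\<lambda>x. 1 - indicator (hits (s + \<delta>) (4 * w)) ((F ^^ M) x))"
        unfolding hit_prob_def by (subst avg_diff[OF bdd_borel_const hits_comp_bdd_borel]) simp
      also have "\<dots> \<le> avg (\<lambda>x. indicator {x. u x = 0} ((F ^^ M) x))"
      proof (rule avg_mono[OF bdd_borel_diff[OF bdd_borel_const hits_comp_bdd_borel] ib[OF m0(1)]])
        fix x
        have "u y = 0" if "y \<notin> hits (s + \<delta>) (4 * w)" for y
        proof -
          have "u y \<le> 0" unfolding u_def
          proof (rule marker_le)
            fix i assume "i \<le> 4 * w"
            then have "s + \<delta> \<le> int_dist ((F ^^ i) y)" using that by (force simp: hits_def)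
            then show "tent w i * bump s \<delta> ((F ^^ i) y) \<le> 0" using bump_0[OF \<delta>] by simp
          qed
          then show ?thesis using marker_bounds(1)[of w s \<delta> y] unfolding u_def by linarith
        qed
        then show "1 - indicator (hits (s + \<delta>) (4 * w)) ((F ^^ M) x) \<le> (indicator {x. u x = 0} ((F ^^ M) x) :: real)"
          by (auto simp: indicator_def)
      qed
      finally show ?thesis using s\<delta> by linarith
    qed
    have high: "avg (\<lambda>x. indicator {x. u x \<ge> 1 / 2} ((F ^^ M) x)) \<ge> 24 / 100"
    proof -
      have "hit_prob M (4 * w) s \<le> avg (\<lambda>x. indicator (hits s (2 * w)) ((F ^^ M) x) + indicator (hits s (2 * w)) ((F ^^ (M + 2 * w)) x))"
        unfolding hit_prob_def
      proof (rule avg_mono[OF hits_comp_bdd_borel bdd_borel_add[OF hits_comp_bdd_borel hits_comp_bdd_borel]])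
        fix x
        have "(F ^^ M) x \<in> hits s (2 * w) \<or> (F ^^ (M + 2 * w)) x \<in> hits s (2 * w)" if h: "(F ^^ M) x \<in> hits s (4 * w)"
        proof -
          obtain i where i: "i \<le> 4 * w" "int_dist ((F ^^ i) ((F ^^ M) x)) \<le> s" using h unfolding hits_def by blast
          show ?thesis
          proof (cases "i \<le> 2 * w")
            case True
            then show ?thesis using i(2) by (auto simp: hits_def)
          next
            case False
            then have e: "i + M = (i - 2 * w) + (M + 2 * w)" by simp
            have "(F ^^ i) ((F ^^ M) x) = (F ^^ (i + M)) x" by (simp add: funpow_add)
            also have "\<dots> = (F ^^ (i - 2 * w)) ((F ^^ (M + 2 * w)) x)" unfolding e funpow_add by (simp add: comp_def)
            finally have "int_dist ((F ^^ (i - 2 * w)) ((F ^^ (M + 2 * w)) x)) \<le> s" using i(2) by simp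
            then show ?thesis using i(1) False unfolding hits_def by (intro disjI2 CollectI exI[of _ "i - 2 * w"]) auto
          qed
        qed
        then show "indicator (hits s (4 * w)) ((F ^^ M) x) \<le>
          indicator (hits s (2 * w)) ((F ^^ M) x) + (indicator (hits s (2 * w)) ((F ^^ (M + 2 * w)) x) :: real)"
          by (auto simp: indicator_def)
      qed
      also have "\<dots> = hit_prob M (2 * w) s + hit_prob (M + 2 * w) (2 * w) s"
        unfolding hit_prob_def by (rule avg_add[OF hits_comp_bdd_borel hits_comp_bdd_borel])
      finally have "1 / 2 \<le> hit_prob M (2 * w) s + hit_prob (M + 2 * w) (2 * w) s" using s by simp
      \<comment> \<open>If \<open>p\<close> is the probability of the middle window, then
        \<open>1 / 2 \<le> 2 * p + 2 / 100\<close>.\<close>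
      then have "24 / 100 \<le> hit_prob (M + w) (2 * w) s"
        using stat[of 0 "2 * w" s w, unfolded add_0_right] stat[of "2 * w" "2 * w" s w]
        unfolding abs_le_iff by linarith
      also have "\<dots> \<le> avg (\<lambda>x. indicator {x. u x \<ge> 1 / 2} ((F ^^ M) x))"
        unfolding hit_prob_def
      proof (rule avg_mono[OF hits_comp_bdd_borel ib[OF m0(2)]])
        fix x
        have "u ((F ^^ M) x) \<ge> 1 / 2" if h: "(F ^^ (M + w)) x \<in> hits s (2 * w)"
        proof -
          obtain i where i: "i \<le> 2 * w" "int_dist ((F ^^ i) ((F ^^ (M + w)) x)) \<le> s" using h unfolding hits_def by blast
          have "(F ^^ i) ((F ^^ (M + w)) x) = (F ^^ (i + (M + w))) x" by (simp add: funpow_add)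
          also have "i + (M + w) = (i + w) + M" by simp
          also have "(F ^^ \<dots>) x = (F ^^ (i + w)) ((F ^^ M) x)" by (simp add: funpow_add)
          finally have "bump s \<delta> ((F ^^ (i + w)) ((F ^^ M) x)) = 1" using i(2) bump_1[OF \<delta>] by simp
          moreover have "tent w (i + w) \<ge> 1 / 2" by (rule tent_mid) (use w i in auto)
          ultimately show ?thesis
            using marker_ge[of "i + w" w s \<delta> "(F ^^ M) x"] i(1) w unfolding u_def by simp
        qed
        then show "indicator (hits s (2 * w)) ((F ^^ (M + w)) x) \<le> (indicator {x. u x \<ge> 1 / 2} ((F ^^ M) x) :: real)"
          by (auto simp: indicator_def)
      qed
      finally show ?thesis .
    qed
    show "\<exists>u B. (\<forall>x. u (x + 1) = u x) \<and> (\<forall>x. 0 \<le> u x \<and> u x \<le> 1) \<and> 0 \<le> B \<and> (\<forall>x y. \<bar>u x - u y\<bar> \<le> B * \<bar>x - y\<bar>) \<and>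
      (\<forall>x. \<bar>u (F x) - u x\<bar> \<le> 1 / (2 * real w)) \<and>
      avg (\<lambda>x. indicator {x. u x = 0} ((F ^^ M) x)) \<ge> 49 / 100 \<and>
      avg (\<lambda>x. indicator {x. u x \<ge> 1 / 2} ((F ^^ M) x)) \<ge> 24 / 100"
      using marker_periodic[of w s \<delta>] marker_bounds[of w s \<delta>] marker_slow[OF w, of s \<delta>] B low high
      by (intro exI[of _ u] exI[of _ B]) (simp add: u_def)
  qed
qed

end

section \<open>Slowly varying conjugacies\<close>

text \<open>\<open>oscillates\<close> at all times from \<open>n\<close> on, and with 2 and 6 in
  place of 1 and 4: the surplus is what a perturbation may consume over finitely many times.\<close>

definition (in lift) strongly_oscillates :: "real \<Rightarrow> real \<Rightarrow> nat \<Rightarrow> bool" where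
  "strongly_oscillates \<kappa> C k \<longleftrightarrow> (\<exists>n c p a X X'.
     1 \<le> n \<and> 0 < c \<and>
     (\<forall>t x. c \<le> (\<Sum>i<nat \<bar>d ^ t\<bar>. 1 / J t (x + real i))) \<and>
     a 0 = 0 \<and> a p = 1 \<and> (\<forall>l<p. a l < a (Suc l) \<and> real k * (a (Suc l) - a l) \<le> 1) \<and>
     X \<in> sets borel \<and> X' \<in> sets borel \<and>
     (\<forall>l<p. \<kappa> * (a (Suc l) - a l) \<le> measure lborel (X \<inter> {a l<..<a (Suc l)}) \<and>
            \<kappa> * (a (Suc l) - a l) \<le> measure lborel (X' \<inter> {a l<..<a (Suc l)})) \<and>
     (\<forall>l<p. \<forall>t\<ge>n. \<forall>i::nat. \<forall>x\<in>{a l..a (Suc l)}. \<forall>x'\<in>{a l..a (Suc l)}.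
        2 \<le> J t (x + real i) \<and> J t (x + real i) \<le> C * J t (x' + real i) \<and>
        (x \<in> X \<and> x' \<in> X' \<longrightarrow> 6 * J t (x + real i) \<le> J t (x' + real i))))"

text \<open>\<open>exp (amp * v)\<close> is 64 to the power \<open>v\<close>; a difference of 1/2 in
  \<open>v\<close> gives the factor 8.\<close>

definition amp :: real where "amp = 2 * ln 8"

lemma exp_amp: "exp amp = 64" "exp (amp / 2) = 8" "amp > 0"
proof -
  have "exp amp = exp (ln 8) * exp (ln 8)" unfolding amp_def by (simp only: mult_2 exp_add)
  then show "exp amp = 64" by simp
qed (simp_all add: amp_def)

lemma exp_small: "x \<le> 1 / 100 \<Longrightarrow> exp x \<le> (11 / 10 :: real)"
proof -
  assume "x \<le> 1 / 100"
  then have "exp x \<le> exp (1 / 100)" by simp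
  also have "\<dots> \<le> 1 + 1 / 100 + (1 / 100)\<^sup>2" by (rule exp_bound) simp_all
  also have "\<dots> \<le> 11 / 10" by (simp add: power2_eq_square)
  finally show ?thesis .
qed

text \<open>\<open>Z\<close> is the mean of \<open>exp (amp * v)\<close>, so that \<open>h\<close>
  advances by 1 over a period. The slowness \<open>s\<close> along orbits controls how far the
  derivative of the conjugate is from \<open>F'\<close>; the spatial constant \<open>Bv\<close> may
  be large and is outweighed by the contraction at large times.\<close>

locale slow_conjugacy = expanding_lift +
  fixes h v :: "real \<Rightarrow> real" and Bv Z s :: real
  assumes hD: "\<And>x. (h has_real_derivative exp (amp * v x) / Z) (at x)"
    and v_per: "\<And>x. v (x + 1) = v x" and v01: "\<And>x. 0 \<le> v x" "\<And>x. v x \<le> 1"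
    and v_lip: "\<And>x y. \<bar>v x - v y\<bar> \<le> Bv * \<bar>x - y\<bar>" and v_slow: "\<And>x. \<bar>v (F x) - v x\<bar> \<le> s"
    and Z: "1 \<le> Z" "Z \<le> 64" and h0: "h 0 = 0" and h1: "h 1 = 1"
begin

definition h' where "h' x = exp (amp * v x) / Z"

lemma v_cont: "continuous_on A v"
proof -
  have Bv: "0 \<le> Bv" using v_lip[of 0 1] by simp
  have "continuous_on UNIV v"
    unfolding continuous_on_iff
  proof (intro ballI allI impI)
    fix x e :: real assume e: "e > 0"
    show "\<exists>d>0. \<forall>x'\<in>UNIV. dist x' x < d \<longrightarrow> dist (v x') (v x) < e"
    proof (intro exI[of _ "e / (Bv + 1)"] conjI ballI impI)
      fix x' assume "dist x' x < e / (Bv + 1)"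
      then have "(Bv + 1) * \<bar>x' - x\<bar> < e" using Bv by (simp add: dist_real_def field_simps)
      then show "dist (v x') (v x) < e" using v_lip[of x' x] by (simp add: dist_real_def algebra_simps)
    qed (use e Bv in simp)
  qed
  then show ?thesis by (rule continuous_on_subset) simp
qed

lemma h'_cont: "continuous_on UNIV h'"
  unfolding h'_def[abs_def] by (intro continuous_intros v_cont) (use Z in auto)

lemma h'_pos: "h' x > 0" using Z by (simp add: h'_def)

lemma h'_ratio: "h' x / h' y = exp (amp * (v x - v y))"
  using Z by (simp add: h'_def right_diff_distrib exp_diff)

lemma h'_ratio_le: "h' x / h' y \<le> 64"
proof -
  have "amp * (v x - v y) \<le> amp * 1" using exp_amp(3) v01[of x] v01[of y] by (intro mult_left_mono) auto
  then have "exp (amp * (v x - v y)) \<le> exp amp" by simp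
  then show ?thesis by (simp add: h'_ratio exp_amp)
qed

lemma h'_le: "h' x \<le> 64 * h' y" using h'_ratio_le[of x y] h'_pos[of y] by (simp add: divide_le_eq)

lemma h'_bounds: "1 / 64 \<le> h' x" "h' x \<le> 64"
proof -
  have 1: "1 \<le> exp (amp * v x)" using exp_amp(3) v01 by simp
  have "amp * v x \<le> amp * 1" using exp_amp(3) v01 by (intro mult_left_mono) auto
  then have "exp (amp * v x) \<le> exp amp" by simp
  then have 2: "exp (amp * v x) \<le> 64" by (simp only: exp_amp)
  show "1 / 64 \<le> h' x" unfolding h'_def using frac_le[OF _ 1 _ Z(2)] Z by simp
  show "h' x \<le> 64" unfolding h'_def using frac_le[OF _ 2 _ Z(1)] by simp
qed

sublocale h: lift h h' 1
proof
  have "((\<lambda>x. h (x + 1) - h x) has_real_derivative 0) (at x)" for x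
    using DERIV_diff[OF DERIV_shift[THEN iffD1, OF hD[of "x + 1"]] hD[of x]] v_per by simp
  then have hc: "h (x + 1) - h x = h (0 + 1) - h 0" for x by (intro DERIV_isconst_all) auto
  show "h (x + 1) = h x + of_int 1" for x using hc[of x] h0 h1 by simp
  show "(h has_real_derivative h' x) (at x)" for x unfolding h'_def by (rule hD)
  show "h' x \<noteq> 0" for x using h'_pos[of x] by simp
qed (rule h'_cont)

abbreviation g where "g \<equiv> inv h"

lemma h_mono: "x < y \<Longrightarrow> h x < h y"
  using DERIV_pos_imp_increasing[of x y h] h.F_deriv h'_pos by blast

lemma h_less_iff: "h x < h y \<longleftrightarrow> x < y"
  using h_mono[of x y] h_mono[of y x] by (metis less_asym linorder_neqE_linordered_idom)

lemma h_le_iff: "h x \<le> h y \<longleftrightarrow> x \<le> y" using h_less_iff[of y x] by (simp add: not_less[symmetric])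

lemma g_less_iff: "g x < y \<longleftrightarrow> x < h y" using h_less_iff[of "g x" y] by simp

lemma less_g_iff: "y < g x \<longleftrightarrow> h y < x" using h_less_iff[of y "g x"] by simp

lemma g_shift: "g (x + real i) = g x + real i" using h.G_shift[of x "int i"] by simp

lemma v_int: "v (x + of_int i) = v x" by (rule periodic_int) (rule v_per)

lemma h'_int: "h' (x + real i) = h' x" using v_int[of x "int i"] by (simp add: h'_def)

definition H where "H x = h (F (g x))"
definition H' where "H' x = h' (F (g x)) * F' (g x) / h' (g x)"

sublocale H: lift H H' d
proof
  fix x
  have "((\<lambda>x. h (F (g x))) has_real_derivative h' (F (g x)) * (F' (g x) * inverse (h' (g x)))) (at x)"
    by (rule DERIV_chain2[OF h.F_deriv DERIV_chain2[OF F_deriv h.G_deriv]])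
  then show "(H has_real_derivative H' x) (at x)" by (simp add: H_def[abs_def] H'_def divide_inverse mult.assoc)
  show "continuous_on UNIV H'" unfolding H'_def[abs_def]
    by (intro continuous_intros continuous_on_compose2[OF h'_cont] continuous_on_compose2[OF F_cont[of UNIV]]
        continuous_on_compose2[OF F'_cont] h.G_cont) (use h'_pos in \<open>auto simp: less_imp_neq[symmetric]\<close>)
  show "H (x + 1) = H x + of_int d"
    using g_shift[of x 1] F_shift1[of "g x"] h.F_shift[of "F (g x)" d] by (simp add: H_def)
  show "H' x \<noteq> 0" using F'_nz h'_pos by (simp add: H'_def less_imp_neq[symmetric])
qed

lemma H_inv_pow: "(inv H ^^ t) x = h ((G ^^ t) (g x))"
proof -
  have i: "inv H = (\<lambda>x. h (G (g x)))" by (rule inv_equality) (simp_all add: H_def)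
  show ?thesis by (induction t) (simp_all add: i)
qed

text \<open>In the chain rule for the conjugate the factors \<open>h'\<close> telescope along the
  orbit; only those at its two ends remain.\<close>

lemma H_J: "H.J t x = J t (g x) * h' (g x) / h' ((G ^^ t) (g x))"
proof (induction t)
  case 0
  then show ?case using h'_pos[of "g x"] by simp
next
  case (Suc t)
  have "H' ((inv H ^^ Suc t) x) = h' ((G ^^ t) (g x)) * F' ((G ^^ Suc t) (g x)) / h' ((G ^^ Suc t) (g x))"
    unfolding H_inv_pow H'_def by simp
  then have "\<bar>H' ((inv H ^^ Suc t) x)\<bar> = h' ((G ^^ t) (g x)) * \<bar>F' ((G ^^ Suc t) (g x))\<bar> / h' ((G ^^ Suc t) (g x))"
    using h'_pos by (simp add: abs_mult abs_of_pos)
  then show ?case unfolding H.J_Suc J_Suc Suc using h'_pos[of "(G ^^ t) (g x)"] by simp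
qed

lemma H_J_ge: "J t (g x) / 64 \<le> H.J t x"
proof -
  have "1 / 64 \<le> h' (g x) / h' ((G ^^ t) (g x))"
    using h'_le[of "(G ^^ t) (g x)" "g x"] h'_pos by (simp add: le_divide_eq)
  then have "J t (g x) * (1 / 64) \<le> J t (g x) * (h' (g x) / h' ((G ^^ t) (g x)))"
    by (rule mult_left_mono) (simp add: J_pos less_imp_le)
  then show ?thesis unfolding H_J by simp
qed

text \<open>The transferred constant density is at least \<open>exp (- Kd)\<close> for every
  \<open>t\<close>, and conjugation changes Jacobians by at most the factor 64.\<close>

lemma H_sum_lower: "exp (- Kd) / 64 \<le> (\<Sum>i<nat \<bar>d ^ t\<bar>. 1 / H.J t (x + real i))"
proof -
  have one: "log_lip 0 (\<lambda>x. 1)" by (simp add: log_lip_def)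
  have T: "log_lip Kd (transfer t (\<lambda>x. 1))" using transfer_log_lip[OF one, of t] by simp
  have "exp (- Kd) \<le> transfer t (\<lambda>x. 1) (g x)"
    by (rule log_lip_lower[OF T _ Kd_nonneg]) (simp add: transfer_avg[OF one])
  also have "\<dots> = (\<Sum>i<nat \<bar>d ^ t\<bar>. 1 / J t (g x + real i))" by (simp add: transfer_def)
  also have "\<dots> \<le> (\<Sum>i<nat \<bar>d ^ t\<bar>. 64 * (1 / H.J t (x + real i)))"
  proof (rule sum_mono)
    fix i :: nat
    let ?y = "g x + real i"
    have "1 \<le> 64 * (h' ((G ^^ t) ?y) / h' (g x))"
      using h'_le[of "g x" "(G ^^ t) ?y"] h'_pos[of "g x"] by (simp add: le_divide_eq)
    then have "1 / J t ?y * 1 \<le> 1 / J t ?y * (64 * (h' ((G ^^ t) ?y) / h' (g x)))"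
      by (rule mult_left_mono) (simp add: J_pos less_imp_le)
    then show "1 / J t ?y \<le> 64 * (1 / H.J t (x + real i))"
      unfolding H_J g_shift h'_int by simp
  qed
  finally have "exp (- Kd) \<le> 64 * (\<Sum>i<nat \<bar>d ^ t\<bar>. 1 / H.J t (x + real i))"
    by (simp only: sum_distrib_left[symmetric])
  then show ?thesis by simp
qed

text \<open>The derivative of the conjugate is \<open>exp q * F' y\<close> with
  \<open>\<bar>q\<bar> \<le> amp * s\<close>: not the size of the oscillation of \<open>h'\<close>
  enters, only its change in one step of the orbit.\<close>

lemma H_close:
  assumes near: "\<And>x. \<bar>h x - x\<bar> \<le> e" and \<Lambda>: "\<And>x. \<bar>F' x\<bar> \<le> \<Lambda>"
    and uc: "\<And>x y. \<bar>x - y\<bar> \<le> e \<Longrightarrow> \<bar>F' x - F' y\<bar> \<le> e'"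
  shows "\<bar>H x - F x\<bar> \<le> e + \<Lambda> * e" "\<bar>H' x - F' x\<bar> \<le> \<Lambda> * (exp (amp * s) - 1) + e'"
proof -
  define y where "y = g x"
  have hy: "h y = x" by (simp add: y_def)
  have yx: "\<bar>y - x\<bar> \<le> e" using near[of y] hy by (simp add: abs_minus_commute)
  have \<Lambda>0: "0 \<le> \<Lambda>" using \<Lambda>[of 0] by linarith
  have "\<bar>F y - F x\<bar> \<le> \<Lambda> * \<bar>y - x\<bar>" by (rule F_lipschitz[OF \<Lambda>])
  also have "\<dots> \<le> \<Lambda> * e" using yx \<Lambda>0 by (rule mult_left_mono)
  finally show "\<bar>H x - F x\<bar> \<le> e + \<Lambda> * e" using near[of "F y"] unfolding H_def y_def by linarith
  define q where "q = amp * (v (F y) - v y)"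
  have q: "\<bar>q\<bar> \<le> amp * s" unfolding q_def abs_mult using v_slow[of y] exp_amp(3) by (simp add: mult_left_mono)
  have "H' x = exp q * F' y" unfolding H'_def y_def[symmetric] q_def h'_ratio[symmetric] by simp
  then have "H' x - F' x = (exp q - 1) * F' y + (F' y - F' x)" by (simp add: algebra_simps)
  then have "\<bar>H' x - F' x\<bar> \<le> \<bar>(exp q - 1) * F' y\<bar> + \<bar>F' y - F' x\<bar>" by linarith
  also have "\<bar>(exp q - 1) * F' y\<bar> \<le> (exp (amp * s) - 1) * \<Lambda>"
    unfolding abs_mult
  proof (rule mult_mono)
    have up: "exp q \<le> exp (amp * s)" using q by simp
    \<comment> \<open>\<open>cosh q \<ge> 1\<close> bounds the defect \<open>1 - exp q\<close> by
      the excess \<open>exp (- q) - 1\<close>, which covers negative \<open>q\<close>.\<close>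
    have "1 - exp q \<le> exp (- q) - 1"
      using cosh_real_ge_1[of q] by (simp add: cosh_def)
    moreover have "exp (- q) \<le> exp (amp * s)" using q by simp
    ultimately show "\<bar>exp q - 1\<bar> \<le> exp (amp * s) - 1" using up by linarith
    then show "0 \<le> exp (amp * s) - 1" by (rule order_trans[OF abs_ge_zero])
  qed (use \<Lambda> in auto)
  also have "\<bar>F' y - F' x\<bar> \<le> e'" using uc yx by blast
  finally show "\<bar>H' x - F' x\<bar> \<le> \<Lambda> * (exp (amp * s) - 1) + e'" by (simp add: mult.commute)
qed

text \<open>Change of variables by \<open>h\<close>, whose derivative is at least 1/64.\<close>

lemma preimage_measure:
  assumes V[measurable]: "V \<in> sets borel" and ab: "0 \<le> \<alpha>" "\<alpha> < \<beta>" "\<beta> \<le> 1"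
    and Vper: "\<And>x. x + 1 \<in> V \<longleftrightarrow> x \<in> V"
  shows "measure lborel (V \<inter> {\<alpha><..<\<beta>}) \<le> 64 * measure lborel ({x. g x \<in> V} \<inter> {h \<alpha><..<h \<beta>})"
proof -
  have [measurable]: "g \<in> borel_measurable borel" "h' \<in> borel_measurable borel"
    by (auto intro!: borel_measurable_continuous_onI h.G_cont h'_cont)
  have gV[measurable]: "{x. g x \<in> V} \<in> sets borel"
    using measurable_sets[of g borel borel V] by (simp add: vimage_def)
  define P where "P = {y. frac y \<in> {\<alpha><..<\<beta>} \<and> y \<in> V}"
  have P[measurable]: "P \<in> sets borel"
  proof -
    have [measurable]: "(frac :: real \<Rightarrow> real) \<in> borel_measurable borel" unfolding frac_def[abs_def] by measurable
    have "{y \<in> space borel. frac y \<in> {\<alpha><..<\<beta>} \<and> y \<in> V} \<in> sets borel" by measurable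
    then show ?thesis by (simp add: P_def)
  qed
  have per: "indicator P (x + 1) = (indicator P x :: ennreal)" for x
    by (simp add: P_def indicator_def frac_1_eq Vper)
  have "emeasure lborel (V \<inter> {\<alpha><..<\<beta>}) = (\<integral>\<^sup>+y. indicator (V \<inter> {\<alpha><..<\<beta>}) y \<partial>lborel)" by simp
  also have "\<dots> = (\<integral>\<^sup>+y\<in>{0..<1}. indicator P y \<partial>lborel)"
  proof (rule nn_integral_cong)
    fix y
    have "y \<in> V \<inter> {\<alpha><..<\<beta>} \<longleftrightarrow> y \<in> P \<and> y \<in> {0..<1}"
      using ab by (auto simp: P_def frac_eq)
    then show "indicator (V \<inter> {\<alpha><..<\<beta>}) y = (indicator P y * indicator {0..<1} y :: ennreal)"
      by (auto simp: indicator_def)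
  qed
  also have "\<dots> = (\<Sum>i<nat \<bar>1\<bar>. \<integral>\<^sup>+x\<in>{0..<1}. indicator P (g (x + real i)) * ennreal (1 / \<bar>h' (g (x + real i))\<bar>) \<partial>lborel)"
    by (rule h.nn_integral_lift) (auto simp: per)
  also have "\<dots> = (\<integral>\<^sup>+x\<in>{0..<1}. indicator P (g x) * ennreal (1 / \<bar>h' (g x)\<bar>) \<partial>lborel)" by simp
  also have "\<dots> \<le> (\<integral>\<^sup>+x. ennreal 64 * indicator ({x. g x \<in> V} \<inter> {h \<alpha><..<h \<beta>}) x \<partial>lborel)"
  proof (rule nn_integral_mono)
    fix x
    have "1 / \<bar>h' (g x)\<bar> \<le> 64" using h'_bounds(1)[of "g x"] h'_pos[of "g x"] by (simp add: divide_le_eq)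
    moreover have "g x \<in> P \<Longrightarrow> x \<in> {0..<1} \<Longrightarrow> x \<in> {x. g x \<in> V} \<inter> {h \<alpha><..<h \<beta>}"
    proof -
      assume gP: "g x \<in> P" and x: "x \<in> {0..<1}"
      have "0 \<le> g x" "g x < 1" using x less_g_iff[of 0 x] g_less_iff[of x 0] g_less_iff[of x 1] h0 h1 by auto
      then have "frac (g x) = g x" by (simp add: frac_eq)
      then show ?thesis using gP by (simp add: P_def g_less_iff less_g_iff)
    qed
    ultimately show "indicator P (g x) * ennreal (1 / \<bar>h' (g x)\<bar>) * indicator {0..<1} x
      \<le> ennreal 64 * indicator ({x. g x \<in> V} \<inter> {h \<alpha><..<h \<beta>}) x"
      by (auto simp: indicator_def intro: ennreal_leI[of _ 64, simplified])
  qed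
  also have "\<dots> = ennreal 64 * emeasure lborel ({x. g x \<in> V} \<inter> {h \<alpha><..<h \<beta>})"
    by (rule nn_integral_cmult_indicator) simp
  finally have le: "emeasure lborel (V \<inter> {\<alpha><..<\<beta>}) \<le> ennreal 64 * emeasure lborel ({x. g x \<in> V} \<inter> {h \<alpha><..<h \<beta>})" .
  have fin: "emeasure lborel (A \<inter> {a<..<b}) = ennreal (measure lborel (A \<inter> {a<..<b}))" if "a < b" for A and a b :: real
  proof -
    have "emeasure lborel (A \<inter> {a<..<b}) \<le> emeasure lborel {a<..<b}" by (rule emeasure_mono) auto
    also have "\<dots> < \<infinity>" using that by simp
    finally show ?thesis by (intro emeasure_eq_ennreal_measure) simp
  qed
  have "ennreal (measure lborel (V \<inter> {\<alpha><..<\<beta>})) \<le> ennreal (64 * measure lborel ({x. g x \<in> V} \<inter> {h \<alpha><..<h \<beta>}))"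
    using le unfolding fin[OF ab(2)] fin[OF h_mono[OF ab(2)]]
    using ennreal_mult[of 64 "measure lborel ({x. g x \<in> V} \<inter> {h \<alpha><..<h \<beta>})"] by simp
  then show ?thesis by (subst (asm) ennreal_le_iff) auto
qed

text \<open>On one branch three ratios separate \<open>x\<close> from \<open>x'\<close>: that of
  \<open>J\<close>, close to 1 because the interval is short; that of \<open>h'\<close> at the start
  of the orbit, close to 1 because late branches contract; and that of \<open>h'\<close> at the end
  point, which is at most 64, and at most 1/8 between a point of \<open>X\<close> and one of
  \<open>X'\<close>.\<close>

lemma oscillation:
  assumes P: "P \<ge> 1" "Kd / real P \<le> 1 / 100" "64 * real k / real P \<le> 1"
    and low: "\<And>l. l < P \<Longrightarrow> 23 / 100 / real P \<le> measure lborel ({x. v x = 0} \<inter> {real l / real P<..<real (Suc l) / real P})"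
    and high: "\<And>l. l < P \<Longrightarrow> 23 / 100 / real P \<le> measure lborel ({x. v x \<ge> 1 / 2} \<inter> {real l / real P<..<real (Suc l) / real P})"
  shows "H.strongly_oscillates (1 / 20000) 5000 k"
proof -
  have P0: "real P > 0" using P by simp
  have Bv: "0 \<le> Bv" using v_lip[of 0 1] by simp
  define a where "a l = h (real l / real P)" for l
  define X X' where "X = {x. g x \<in> {x. v x = 0}}" and "X' = {x. g x \<in> {x. v x \<ge> 1 / 2}}"
  have vm: "{x. v x = 0} \<in> sets borel" "{x. v x \<ge> 1 / 2} \<in> sets borel"
  proof -
    have [measurable]: "v \<in> borel_measurable borel" by (intro borel_measurable_continuous_onI v_cont)
    have "{x \<in> space borel. v x = 0} \<in> sets borel" "{x \<in> space borel. v x \<ge> 1 / 2} \<in> sets borel" by measurable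
    then show "{x. v x = 0} \<in> sets borel" "{x. v x \<ge> 1 / 2} \<in> sets borel" by simp_all
  qed
  have gm: "g \<in> borel_measurable borel" by (intro borel_measurable_continuous_onI h.G_cont)
  have Xm: "X \<in> sets borel" "X' \<in> sets borel"
    using measurable_sets[OF gm vm(1)] measurable_sets[OF gm vm(2)] by (simp_all add: X_def X'_def vimage_def)
  have step: "real l / real P < real (Suc l) / real P" for l using P0 by (simp add: divide_strict_right_mono)
  have a_len: "a (Suc l) - a l \<le> 64 / real P" for l
  proof -
    obtain z where "h (real (Suc l) / real P) - h (real l / real P) = (real (Suc l) / real P - real l / real P) * h' z"
      using MVT2[OF step[of l], of h h'] h.F_deriv by blast
    also have "real (Suc l) / real P - real l / real P = 1 / real P" by (simp flip: diff_divide_distrib)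
    also have "1 / real P * h' z \<le> 1 / real P * 64" using h'_bounds(2) P0 by (intro mult_left_mono) auto
    finally show ?thesis by (simp add: a_def)
  qed
  have in01: "0 \<le> real l / real P" "real (Suc l) / real P \<le> 1" if "l < P" for l using that P0 by auto
  \<comment> \<open>\<open>64 * 64 / 20000 < 23 / 100\<close>: one factor 64 bounds the length of
    the image interval, the other the loss of measure under \<open>h\<close>.\<close>
  have meas: "1 / 20000 * (a (Suc l) - a l) \<le> measure lborel ({x. g x \<in> V} \<inter> {a l<..<a (Suc l)})"
    if "l < P" "V \<in> sets borel" "\<And>x. x + 1 \<in> V \<longleftrightarrow> x \<in> V"
      and V: "23 / 100 / real P \<le> measure lborel (V \<inter> {real l / real P<..<real (Suc l) / real P})" for l V
  proof -
    have "23 / 100 / real P \<le> 64 * measure lborel ({x. g x \<in> V} \<inter> {a l<..<a (Suc l)})"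
      unfolding a_def using V preimage_measure[OF that(2) in01(1)[OF that(1)] step in01(2)[OF that(1)] that(3)] by linarith
    moreover have "1 / 20000 * (a (Suc l) - a l) \<le> 1 / 20000 * (64 / real P)" using a_len by (intro mult_left_mono) auto
    moreover have "64 * (1 / 20000 * (64 / real P)) \<le> 23 / 100 / real P" using P0 by (simp add: field_simps)
    ultimately show ?thesis by linarith
  qed
  \<comment> \<open>\<open>128 = 64 * 2\<close> gives the lower bound 2 on the conjugated Jacobian;
    \<open>n2\<close> makes the variation of \<open>amp * v\<close> on a branch at most
    1/100.\<close>
  obtain n1 where n1: "\<And>t. t \<ge> n1 \<Longrightarrow> 128 \<le> c * r ^ t" using ex_power_ge by blast
  obtain n2 where n2: "\<And>t. t \<ge> n2 \<Longrightarrow> 100 * (amp * Bv) \<le> c * r ^ t" using ex_power_ge by blast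
  define n where "n = max 1 (max n1 n2)"
  have main: "2 \<le> H.J t (x + real i) \<and> H.J t (x + real i) \<le> 5000 * H.J t (x' + real i) \<and>
        (x \<in> X \<and> x' \<in> X' \<longrightarrow> 6 * H.J t (x + real i) \<le> H.J t (x' + real i))"
    if l: "l < P" and t: "t \<ge> n" and x: "x \<in> {a l..a (Suc l)}" and x': "x' \<in> {a l..a (Suc l)}" for l t i x x'
  proof -
    define y y' where "y = g x + real i" and "y' = g x' + real i"
    have gx: "real l / real P \<le> g z \<and> g z \<le> real (Suc l) / real P" if "z \<in> {a l..a (Suc l)}" for z
      using that h_le_iff[of "real l / real P" "g z"] h_le_iff[of "g z" "real (Suc l) / real P"] by (simp add: a_def)
    have yy: "\<bar>y - y'\<bar> \<le> 1 / real P"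
    proof -
      have "real (Suc l) / real P - real l / real P = 1 / real P" by (simp flip: diff_divide_distrib)
      then show ?thesis using gx[OF x] gx[OF x'] unfolding y_def y'_def by linarith
    qed
    have yy1: "\<bar>y - y'\<bar> \<le> 1"
    proof -
      have "1 / real P \<le> 1" using P by simp
      then show ?thesis using yy by linarith
    qed
    have dist: "J t y \<le> 11 / 10 * J t y'"
    proof -
      have "Kd * \<bar>y - y'\<bar> \<le> Kd * (1 / real P)" using yy Kd_nonneg by (rule mult_left_mono)
      moreover have "Kd * (1 / real P) = Kd / real P" by simp
      ultimately have "Kd * \<bar>y - y'\<bar> \<le> 1 / 100" using P(2) by linarith
      then have "exp (Kd * \<bar>y - y'\<bar>) * J t y' \<le> 11 / 10 * J t y'"
        by (intro mult_right_mono exp_small) (simp_all add: J_pos less_imp_le)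
      then show ?thesis using J_distortion[of t y y'] by linarith
    qed
    let ?z = "h' ((G ^^ t) y)" and ?z' = "h' ((G ^^ t) y')"
    have Jx: "H.J t (x + real i) = J t y * (h' (g x) / ?z)" "H.J t (x' + real i) = J t y' * (h' (g x') / ?z')"
      unfolding H_J g_shift h'_int y_def y'_def by simp_all
    have "c * r ^ t \<le> J t y" by (rule J_ge)
    moreover have "128 \<le> c * r ^ t" using n1 t by (simp add: n_def)
    ultimately have two: "2 \<le> H.J t (x + real i)" using H_J_ge[of t "x + real i"] unfolding g_shift y_def by linarith
    have zz: "?z' / ?z \<le> 11 / 10"
    proof -
      have "v ((G ^^ t) y') - v ((G ^^ t) y) \<le> Bv * \<bar>(G ^^ t) y' - (G ^^ t) y\<bar>" using v_lip[of "(G ^^ t) y'" "(G ^^ t) y"] by linarith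
      also have "\<dots> \<le> Bv * (\<bar>y' - y\<bar> / (c * r ^ t))" by (rule mult_left_mono[OF G_pow_contract Bv])
      also have "\<dots> \<le> Bv * (1 / (c * r ^ t))"
        using yy1 c r Bv by (intro mult_left_mono divide_right_mono) (auto simp: abs_minus_commute)
      finally have "amp * (v ((G ^^ t) y') - v ((G ^^ t) y)) \<le> amp * (Bv * (1 / (c * r ^ t)))"
        using exp_amp(3) by (intro mult_left_mono) auto
      also have "\<dots> = (amp * Bv) / (c * r ^ t)" by simp
      also have "\<dots> \<le> 1 / 100"
      proof -
        have "100 * (amp * Bv) \<le> c * r ^ t" using n2 t by (simp add: n_def)
        moreover have "0 < c * r ^ t" using c r by simp
        ultimately show ?thesis by (simp add: divide_le_eq)
      qed
      finally show ?thesis unfolding h'_ratio by (rule exp_small)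
    qed
    have e1: "h' (g x) / ?z = (h' (g x) / h' (g x')) * (?z' / ?z) * (h' (g x') / ?z')"
      using h'_pos[of "g x'"] h'_pos[of "(G ^^ t) y'"] by simp
    have pos: "0 < h' (g x') / ?z'" "0 < h' (g x) / h' (g x')" "0 < ?z' / ?z" "0 < J t y'" "0 < J t y"
      using h'_pos J_pos by auto
    \<comment> \<open>Two factors 11/10 come from \<open>J\<close> and from the start of the orbit.
      Afterwards \<open>121 / 100 * 64 \<le> 5000\<close> and
      \<open>6 * (121 / 100) / 8 \<le> 1\<close>.\<close>
    have gen: "H.J t (x + real i) \<le> (121 / 100 * B) * H.J t (x' + real i)" if B: "h' (g x) / h' (g x') \<le> B" for B
    proof -
      have B0: "0 < B" using B pos(2) by linarith
      have "(h' (g x) / h' (g x')) * (?z' / ?z) \<le> B * (11 / 10)"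
        using B zz pos B0 by (intro mult_mono) auto
      then have "h' (g x) / ?z \<le> B * (11 / 10) * (h' (g x') / ?z')"
        unfolding e1 using pos(1) by (intro mult_right_mono) auto
      then have "J t y * (h' (g x) / ?z) \<le> (11 / 10 * J t y') * (B * (11 / 10) * (h' (g x') / ?z'))"
        using dist pos B0 h'_pos by (intro mult_mono) (auto simp: less_imp_le)
      then show ?thesis unfolding Jx by (simp add: mult_ac)
    qed
    have "H.J t (x + real i) \<le> (121 / 100 * 64) * H.J t (x' + real i)" by (rule gen[OF h'_ratio_le])
    also have "\<dots> \<le> 5000 * H.J t (x' + real i)" using H.J_pos[of t "x' + real i"] by (intro mult_right_mono) auto
    finally have five: "H.J t (x + real i) \<le> 5000 * H.J t (x' + real i)" .
    have six: "6 * H.J t (x + real i) \<le> H.J t (x' + real i)" if "x \<in> X" "x' \<in> X'"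
    proof -
      have "v (g x) - v (g x') \<le> - 1 / 2" using that by (simp add: X_def X'_def)
      then have "amp * (v (g x) - v (g x')) \<le> amp * (- 1 / 2)" using exp_amp(3) by (intro mult_left_mono) auto
      then have "exp (amp * (v (g x) - v (g x'))) \<le> exp (- (amp / 2))" by simp
      also have "\<dots> = 1 / 8" by (simp add: exp_minus exp_amp)
      finally have "H.J t (x + real i) \<le> (121 / 100 * (1 / 8)) * H.J t (x' + real i)"
        by (intro gen) (simp add: h'_ratio)
      then show ?thesis using H.J_pos[of t "x' + real i"] by simp
    qed
    show ?thesis using two five six by blast
  qed
  have per: "x + 1 \<in> {x. v x = 0} \<longleftrightarrow> x \<in> {x. v x = 0}" "x + 1 \<in> {x. v x \<ge> 1 / 2} \<longleftrightarrow> x \<in> {x. v x \<ge> 1 / 2}" for x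
    by (simp_all add: v_per)
  show ?thesis unfolding H.strongly_oscillates_def
  proof (rule exI[of _ n], rule exI[of _ "exp (- Kd) / 64"], rule exI[of _ P], rule exI[of _ a],
      rule exI[of _ X], rule exI[of _ X'], intro conjI allI impI ballI)
    show "1 \<le> n" by (simp add: n_def)
    show "0 < exp (- Kd) / 64" by simp
    show "exp (- Kd) / 64 \<le> (\<Sum>i<nat \<bar>d ^ t\<bar>. 1 / H.J t (x + real i))" for t x by (rule H_sum_lower)
    show "a 0 = 0" by (simp add: a_def h0)
    show "a P = 1" using P by (simp add: a_def h1)
    show "a l < a (Suc l)" for l unfolding a_def by (rule h_mono[OF step])
    show "real k * (a (Suc l) - a l) \<le> 1" for l
    proof -
      have "real k * (a (Suc l) - a l) \<le> real k * (64 / real P)" by (intro mult_left_mono a_len) simp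
      then show ?thesis using P(3) by (simp add: mult.commute)
    qed
    show "X \<in> sets borel" "X' \<in> sets borel" by (rule Xm)+
    show "1 / 20000 * (a (Suc l) - a l) \<le> measure lborel (X \<inter> {a l<..<a (Suc l)})" if "l < P" for l
      unfolding X_def by (rule meas[OF that vm(1) per(1) low[OF that]])
    show "1 / 20000 * (a (Suc l) - a l) \<le> measure lborel (X' \<inter> {a l<..<a (Suc l)})" if "l < P" for l
      unfolding X'_def by (rule meas[OF that vm(2) per(2) high[OF that]])
  qed (use main in blast)+
qed

end

section \<open>Construction of the oscillating perturbation\<close>

lemma avg_interval_antiderivative:
  assumes D: "\<And>x. (h has_real_derivative w x) (at x)" and c: "continuous_on UNIV w" and ab: "0 \<le> a" "a \<le> b" "b \<le> 1"
  shows "avg (\<lambda>x. indicator {a<..<b} x * w x) = h b - h a"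
proof -
  have "(\<integral>x. w x * indicator {a..b} x \<partial>lborel) = h b - h a"
    by (rule integral_FTC_Icc_real) (use ab D c in \<open>auto simp: continuous_on_eq_continuous_at\<close>)
  moreover have "avg (\<lambda>x. indicator {a<..<b} x * w x) = (\<integral>x. w x * indicator {a..b} x \<partial>lborel)"
    unfolding avg_def set_lebesgue_integral_def
  proof (rule integral_cong_AE)
    have [measurable]: "w \<in> borel_measurable borel" by (rule borel_measurable_continuous_onI[OF c])
    show "(\<lambda>x. indicat_real {0..<1} x *\<^sub>R (indicat_real {a<..<b} x * w x)) \<in> borel_measurable lborel" by measurable
    show "(\<lambda>x. w x * indicat_real {a..b} x) \<in> borel_measurable lborel" by measurable
    show "AE x in lborel. indicat_real {0..<1} x *\<^sub>R (indicat_real {a<..<b} x * w x) = w x * indicat_real {a..b} x"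
      using AE_lborel_singleton[of a] AE_lborel_singleton[of b]
      by eventually_elim (use ab in \<open>auto simp: indicator_def\<close>)
  qed
  ultimately show ?thesis by simp
qed

lemma (in expanding_lift) uniform_mixing:
  assumes A: "finite A" "\<And>q. q \<in> A \<Longrightarrow> 0 \<le> fst q \<and> fst q \<le> snd q \<and> snd q \<le> 1" and e: "e > 0"
  shows "\<exists>M0. \<forall>M\<ge>M0. \<forall>q\<in>A. \<forall>\<psi>. bdd_borel \<psi> \<longrightarrow> (\<forall>x. 0 \<le> \<psi> x \<and> \<psi> x \<le> 1) \<longrightarrow> (\<forall>x. \<psi> (x + 1) = \<psi> x) \<longrightarrow>
    \<bar>avg (\<lambda>x. indicator {fst q<..<snd q} x * \<psi> ((F ^^ M) x)) - (snd q - fst q) * avg (\<lambda>x. \<psi> ((F ^^ M) x))\<bar> \<le> e"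
proof -
  let ?Q = "\<lambda>M q. \<forall>\<psi>. bdd_borel \<psi> \<longrightarrow> (\<forall>x. 0 \<le> \<psi> x \<and> \<psi> x \<le> 1) \<longrightarrow> (\<forall>x. \<psi> (x + 1) = \<psi> x) \<longrightarrow>
    \<bar>avg (\<lambda>x. indicator {fst q<..<snd q} x * \<psi> ((F ^^ M) x)) - (snd q - fst q) * avg (\<lambda>x. \<psi> ((F ^^ M) x))\<bar> \<le> e"
  have "\<forall>\<^sub>F M in sequentially. \<forall>q\<in>A. ?Q M q"
  proof (rule eventually_ball_finite[OF A(1)], rule ballI)
    fix q assume "q \<in> A"
    with A(2) have q: "0 \<le> fst q" "fst q \<le> snd q" "snd q \<le> 1" by auto
    from mixing_interval[OF q e] show "\<forall>\<^sub>F M in sequentially. ?Q M q"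
      unfolding eventually_sequentially by (elim exE) (rule exI, blast)
  qed
  then show ?thesis unfolding eventually_sequentially .
qed

text \<open>The function \<open>u\<close> depends on \<open>M\<close>, so \<open>M\<close> must be
  large enough for mixing before \<open>u\<close> is known; this is why the threshold
  \<open>M1\<close> is uniform over all test functions. The other parameters come in the order
  \<open>e\<close> for the closeness of \<open>h\<close> to the identity, \<open>w\<close> for
  slowness, \<open>P\<close> for the mesh, \<open>\<epsilon>\<close> for the accuracy of
  mixing.\<close>

lemma (in expanding_lift) oscillating_perturbation:
  assumes \<eta>: "\<eta> > 0"
  shows "\<exists>H H'. lift H H' d \<and> (\<forall>x. \<bar>H x - F x\<bar> \<le> \<eta>) \<and> (\<forall>x. \<bar>H' x - F' x\<bar> \<le> \<eta>) \<and>
    (\<forall>n x. c / 64 * r ^ n \<le> lift.J H H' n x) \<and> lift.strongly_oscillates H H' d (1 / 20000) 5000 k"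
proof -
  obtain \<Lambda> where \<Lambda>: "\<Lambda> \<ge> 1" "\<And>x. \<bar>F' x\<bar> \<le> \<Lambda>" by (rule F'_bounds) (rule that)
  obtain \<delta> where \<delta>: "\<delta> > 0" "\<And>x y. \<bar>x - y\<bar> < \<delta> \<Longrightarrow> \<bar>F' x - F' y\<bar> < \<eta> / 2"
    using periodic_ucont[OF F'_cont F'_shift1, of "\<eta> / 2"] \<eta> by (metis half_gt_zero)
  define e where "e = min (\<delta> / 2) (\<eta> / (2 * \<Lambda>))"
  have e: "e > 0" "e < \<delta>" "2 * \<Lambda> * e \<le> \<eta>"
  proof -
    show "e > 0" "e < \<delta>" using \<delta> \<eta> \<Lambda> by (auto simp: e_def)
    have "e \<le> \<eta> / (2 * \<Lambda>)" by (simp add: e_def)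
    then show "2 * \<Lambda> * e \<le> \<eta>" using \<Lambda>(1) by (simp add: le_divide_eq mult.commute)
  qed
  have eF: "e + \<Lambda> * e \<le> \<eta>"
  proof -
    have "1 * e \<le> \<Lambda> * e" using \<Lambda>(1) e(1) by (intro mult_right_mono) auto
    then show ?thesis using e(3) by simp
  qed
  \<comment> \<open>\<open>w\<close> makes the relative change of the derivative under conjugation
    at most \<open>\<eta> / (2 * \<Lambda>)\<close>.\<close>
  obtain w :: nat where w: "w \<ge> 1" "\<Lambda> * (exp (amp * (1 / (2 * real w))) - 1) \<le> \<eta> / 2"
  proof -
    define q where "q = ln (1 + \<eta> / (2 * \<Lambda>))"
    have q: "q > 0" using \<eta> \<Lambda>(1) by (simp add: q_def ln_gt_zero)
    obtain w0 :: nat where w0: "amp < real w0 * q" using reals_Archimedean3[OF q] by blast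
    define w where "w = max 1 w0"
    have "real w0 * q \<le> real w * q" using q by (intro mult_right_mono) (auto simp: w_def)
    moreover have "0 \<le> real w * q" using q by simp
    ultimately have "amp \<le> 2 * (real w * q)" using w0 by linarith
    moreover have "real w \<ge> 1" by (simp add: w_def)
    ultimately have "amp * (1 / (2 * real w)) \<le> q" by (simp add: divide_le_eq mult_ac)
    then have "exp (amp * (1 / (2 * real w))) \<le> exp q" by simp
    also have "exp q = 1 + \<eta> / (2 * \<Lambda>)" using \<eta> \<Lambda>(1) unfolding q_def by (intro exp_ln) (simp add: add_pos_nonneg)
    finally have "\<Lambda> * (exp (amp * (1 / (2 * real w))) - 1) \<le> \<Lambda> * (\<eta> / (2 * \<Lambda>))"
      using \<Lambda>(1) by (intro mult_left_mono) auto
    then have "\<Lambda> * (exp (amp * (1 / (2 * real w))) - 1) \<le> \<eta> / 2" using \<Lambda>(1) by simp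
    then show ?thesis using that[of w] by (simp add: w_def)
  qed
  obtain P :: nat where P: "P \<ge> 1" "Kd / real P \<le> 1 / 100" "64 * real k / real P \<le> 1" "1 / real P \<le> e / 2"
  proof -
    obtain P :: nat where P: "real P > max (max 1 (100 * Kd)) (max (64 * real k) (2 / e))"
      using reals_Archimedean2 by blast
    then have 1: "real P > 1" "real P > 100 * Kd" "real P > 64 * real k" "real P > 2 / e" by auto
    have "2 < real P * e" using 1(4) e(1) by (simp add: divide_less_eq)
    then show ?thesis using that[of P] 1(1-3) by (simp add: field_simps)
  qed
  have P0: "real P > 0" using P by simp
  \<comment> \<open>The first bound lowers 24/100 to no less than 23/100 on each interval, the
    second makes \<open>h\<close> close to the identity at grid points.\<close>
  define \<epsilon> where "\<epsilon> = min (1 / (100 * real P)) (e / 128)"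
  have \<epsilon>: "\<epsilon> > 0" "\<epsilon> \<le> 1 / 100 / real P" "64 * \<epsilon> \<le> e / 2" using P0 e by (auto simp: \<epsilon>_def)
  \<comment> \<open>Grid intervals for the proportions of \<open>X\<close> and \<open>X'\<close>,
    initial segments for the values of \<open>h\<close> at grid points.\<close>
  define A where "A = (\<lambda>l. (real l / real P, real (Suc l) / real P)) ` {..<P} \<union> (\<lambda>l. (0, real l / real P)) ` {..P}"
  have "finite A" "0 \<le> fst q \<and> fst q \<le> snd q \<and> snd q \<le> 1" if "q \<in> A" for q
    using that P0 by (auto simp: A_def divide_right_mono)
  then have A: "finite A" "\<And>q. q \<in> A \<Longrightarrow> 0 \<le> fst q \<and> fst q \<le> snd q \<and> snd q \<le> 1" by (auto simp: A_def)
  from uniform_mixing[OF A \<epsilon>(1)] obtain M1 where M1: "\<And>M q \<psi>. M \<ge> M1 \<Longrightarrow> q \<in> A \<Longrightarrow> bdd_borel \<psi> \<Longrightarrow>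
    \<forall>x. 0 \<le> \<psi> x \<and> \<psi> x \<le> 1 \<Longrightarrow> \<forall>x. \<psi> (x + 1) = \<psi> x \<Longrightarrow>
    \<bar>avg (\<lambda>x. indicator {fst q<..<snd q} x * \<psi> ((F ^^ M) x)) - (snd q - fst q) * avg (\<lambda>x. \<psi> ((F ^^ M) x))\<bar> \<le> \<epsilon>"
    by blast
  from marker_exists[OF w(1)] obtain M2 where M2: "\<forall>M\<ge>M2. \<exists>u B. (\<forall>x. u (x + 1) = u x) \<and> (\<forall>x. 0 \<le> u x \<and> u x \<le> 1) \<and> 0 \<le> B \<and>
    (\<forall>x y. \<bar>u x - u y\<bar> \<le> B * \<bar>x - y\<bar>) \<and> (\<forall>x. \<bar>u (F x) - u x\<bar> \<le> 1 / (2 * real w)) \<and>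
    avg (\<lambda>x. indicator {x. u x = 0} ((F ^^ M) x)) \<ge> 49 / 100 \<and>
    avg (\<lambda>x. indicator {x. u x \<ge> 1 / 2} ((F ^^ M) x)) \<ge> 24 / 100" ..
  define M where "M = max M1 M2"
  obtain u B where u: "\<And>x. u (x + 1) = u x" "\<And>x. 0 \<le> u x" "\<And>x. u x \<le> 1" "0 \<le> B"
    "\<And>x y. \<bar>u x - u y\<bar> \<le> B * \<bar>x - y\<bar>" "\<And>x. \<bar>u (F x) - u x\<bar> \<le> 1 / (2 * real w)"
    "avg (\<lambda>x. indicator {x. u x = 0} ((F ^^ M) x)) \<ge> 49 / 100"
    "avg (\<lambda>x. indicator {x. u x \<ge> 1 / 2} ((F ^^ M) x)) \<ge> 24 / 100"
    using M2[rule_format, of M] unfolding M_def by (auto simp del: of_nat_max)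
  have uc: "continuous_on UNIV u"
    unfolding continuous_on_iff
  proof (intro ballI allI impI)
    fix x e :: real assume e: "e > 0"
    show "\<exists>d>0. \<forall>x'\<in>UNIV. dist x' x < d \<longrightarrow> dist (u x') (u x) < e"
    proof (intro exI[of _ "e / (B + 1)"] conjI ballI impI)
      fix x' assume "dist x' x < e / (B + 1)"
      then have "(B + 1) * \<bar>x' - x\<bar> < e" using u(4) by (simp add: dist_real_def field_simps)
      then show "dist (u x') (u x) < e" using u(5)[of x' x] by (simp add: dist_real_def algebra_simps)
    qed (use e u(4) in simp)
  qed
  have [measurable]: "u \<in> borel_measurable borel" by (rule borel_measurable_continuous_onI[OF uc])
  define v where "v x = u ((F ^^ M) x)" for x
  define \<psi> where "\<psi> y = exp (amp * u y) / 64" for y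
  have \<psi>01: "0 \<le> \<psi> y" "\<psi> y \<le> 1" "1 / 64 \<le> \<psi> y" for y
  proof -
    have "amp * u y \<le> amp * 1" using u(3) exp_amp(3) by (intro mult_left_mono) auto
    then have "exp (amp * u y) \<le> exp amp" by simp
    then show "\<psi> y \<le> 1" unfolding \<psi>_def exp_amp by simp
    have "1 \<le> exp (amp * u y)" using u(2) exp_amp(3) by simp
    then show "1 / 64 \<le> \<psi> y" unfolding \<psi>_def by simp
  qed (simp add: \<psi>_def)
  have \<psi>b: "bdd_borel \<psi>" by (rule bdd_borelI[of _ 1]) (use \<psi>01 in \<open>auto simp: \<psi>_def[abs_def]\<close>)
  have \<psi>b': "bdd_borel (\<lambda>x. \<psi> ((F ^^ M) x))" by (rule bdd_borel_comp[OF \<psi>b F_pow_measurable])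
  define Z where "Z = 64 * avg (\<lambda>x. \<psi> ((F ^^ M) x))"
  have "avg (\<lambda>x. 1 / 64) \<le> avg (\<lambda>x. \<psi> ((F ^^ M) x))" by (rule avg_mono[OF bdd_borel_const \<psi>b' \<psi>01(3)])
  moreover have "avg (\<lambda>x. \<psi> ((F ^^ M) x)) \<le> avg (\<lambda>x. 1)" by (rule avg_mono[OF \<psi>b' bdd_borel_const \<psi>01(2)])
  ultimately have Z: "1 \<le> Z" "Z \<le> 64" by (simp_all add: Z_def)
  define h1 where "h1 x = exp (amp * v x) / Z" for x
  have h1\<psi>: "h1 x = 64 / Z * \<psi> ((F ^^ M) x)" for x by (simp add: h1_def \<psi>_def v_def)
  have h1c: "continuous_on UNIV h1"
    unfolding h1_def[abs_def] v_def using Z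
    by (intro continuous_intros continuous_on_compose2[OF uc F_pow_cont]) auto
  obtain h0 where h0: "\<And>x. (h0 has_vector_derivative h1 x) (at x)"
    using einterval_antiderivative[of "-\<infinity>" "\<infinity>" h1] h1c by (auto simp: continuous_on_eq_continuous_at)
  define h where "h x = h0 x - h0 0" for x
  have hD: "(h has_real_derivative h1 x) (at x)" for x
    unfolding h_def using h0[of x] by (auto intro!: derivative_eq_intros simp: has_real_derivative_iff_has_vector_derivative)
  have h_0: "h 0 = 0" by (simp add: h_def)
  have hval: "h b = 64 / Z * avg (\<lambda>x. indicator {0<..<b} x * \<psi> ((F ^^ M) x))" if "0 \<le> b" "b \<le> 1" for b
  proof -
    have "h b - h 0 = avg (\<lambda>x. indicator {0<..<b} x * h1 x)"
      using avg_interval_antiderivative[OF hD h1c, of 0 b] that by simp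
    also have "\<dots> = avg (\<lambda>x. 64 / Z * (indicator {0<..<b} x * \<psi> ((F ^^ M) x)))"
      unfolding h1\<psi> by (simp only: mult.left_commute)
    finally show ?thesis unfolding avg_cmult h_0 by simp
  qed
  have grid: "\<bar>h (real l / real P) - real l / real P\<bar> \<le> 64 * \<epsilon>" if "l \<le> P" for l
  proof -
    let ?b = "real l / real P"
    have b: "0 \<le> ?b" "?b \<le> 1" using that P0 by auto
    have Z64: "0 \<le> 64 / Z" using Z by simp
    have "(0, ?b) \<in> A" using that by (auto simp: A_def)
    from M1[OF _ this \<psi>b, of M] \<psi>01 u(1)
    have "\<bar>avg (\<lambda>x. indicator {0<..<?b} x * \<psi> ((F ^^ M) x)) - ?b * avg (\<lambda>x. \<psi> ((F ^^ M) x))\<bar> \<le> \<epsilon>"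
      by (simp add: M_def \<psi>_def)
    then have "64 / Z * \<bar>avg (\<lambda>x. indicator {0<..<?b} x * \<psi> ((F ^^ M) x)) - ?b * avg (\<lambda>x. \<psi> ((F ^^ M) x))\<bar> \<le> 64 / Z * \<epsilon>"
      using Z by (intro mult_left_mono) auto
    also have "64 / Z * \<epsilon> \<le> 64 * \<epsilon>" using Z \<epsilon>(1) by (simp add: divide_le_eq)
    also have "64 / Z * \<bar>avg (\<lambda>x. indicator {0<..<?b} x * \<psi> ((F ^^ M) x)) - ?b * avg (\<lambda>x. \<psi> ((F ^^ M) x))\<bar> =
      \<bar>64 / Z * (avg (\<lambda>x. indicator {0<..<?b} x * \<psi> ((F ^^ M) x)) - ?b * avg (\<lambda>x. \<psi> ((F ^^ M) x)))\<bar>"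
      by (simp only: abs_mult abs_of_nonneg[OF Z64])
    also have "64 / Z * (avg (\<lambda>x. indicator {0<..<?b} x * \<psi> ((F ^^ M) x)) - ?b * avg (\<lambda>x. \<psi> ((F ^^ M) x))) = h ?b - ?b"
    proof -
      have "64 / Z * (?b * avg (\<lambda>x. \<psi> ((F ^^ M) x))) = ?b" using Z by (simp add: Z_def)
      then show ?thesis unfolding hval[OF b] by (simp only: right_diff_distrib)
    qed
    finally show ?thesis .
  qed
  have h_1: "h 1 = 1"
  proof -
    have "avg (\<lambda>x. indicator {0<..<1} x * \<psi> ((F ^^ M) x)) = avg (\<lambda>x. \<psi> ((F ^^ M) x))"
      unfolding avg_def set_lebesgue_integral_def
    proof (rule integral_cong_AE)
      have m[measurable]: "(\<lambda>x. \<psi> ((F ^^ M) x)) \<in> borel_measurable borel" by (rule bdd_borel_measurable[OF \<psi>b'])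
      show "(\<lambda>x. indicat_real {0..<1} x *\<^sub>R (indicat_real {0<..<1} x * \<psi> ((F ^^ M) x))) \<in> borel_measurable lborel" by measurable
      show "(\<lambda>x. indicat_real {0..<1} x *\<^sub>R \<psi> ((F ^^ M) x)) \<in> borel_measurable lborel" by measurable
      show "AE x in lborel. indicat_real {0..<1} x *\<^sub>R (indicat_real {0<..<1} x * \<psi> ((F ^^ M) x)) = indicat_real {0..<1} x *\<^sub>R \<psi> ((F ^^ M) x)"
        using AE_lborel_singleton[of 0] by eventually_elim (auto simp: indicator_def)
    qed
    then show ?thesis using hval[of 1] Z by (simp add: Z_def)
  qed
  interpret S: slow_conjugacy F F' d L c r h v "B * \<Lambda> ^ M" Z "1 / (2 * real w)"
  proof
    show "(h has_real_derivative exp (amp * v x) / Z) (at x)" for x using hD[of x] by (simp add: h1_def)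
    show "v (x + 1) = v x" for x unfolding v_def by (rule F_pow_periodic) (rule u(1))
    show "0 \<le> v x" "v x \<le> 1" for x unfolding v_def by (rule u)+
    show "\<bar>v x - v y\<bar> \<le> B * \<Lambda> ^ M * \<bar>x - y\<bar>" for x y
    proof -
      have "\<bar>v x - v y\<bar> \<le> B * \<bar>(F ^^ M) x - (F ^^ M) y\<bar>" unfolding v_def by (rule u(5))
      also have "\<dots> \<le> B * (\<Lambda> ^ M * \<bar>x - y\<bar>)" by (rule mult_left_mono[OF F_pow_lipschitz[OF \<Lambda>(2,1)] u(4)])
      finally show ?thesis by (simp add: mult.assoc)
    qed
    show "\<bar>v (F x) - v x\<bar> \<le> 1 / (2 * real w)" for x
      using u(6)[of "(F ^^ M) x"] by (simp add: v_def funpow_swap1)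
  qed (rule Z h_0 h_1)+
  \<comment> \<open>Between grid points the monotonicity of \<open>h\<close> suffices, because the
    mesh and the error at grid points are each at most \<open>e / 2\<close>.\<close>
  have near: "\<bar>h x - x\<bar> \<le> e" for x
  proof -
    have near01: "\<bar>h x - x\<bar> \<le> e" if x: "x \<in> {0..<1}" for x
    proof -
      define l where "l = nat \<lfloor>real P * x\<rfloor>"
      have Px: "0 \<le> real P * x" "real P * x < real P" using x P0 by auto
      have l: "real l \<le> real P * x" "real P * x < real l + 1" unfolding l_def using Px by linarith+
      have lP: "Suc l \<le> P" using l(1) Px(2) by linarith
      have 1: "real l / real P \<le> x" "x \<le> real (Suc l) / real P" using l P0 by (auto simp: field_simps)
      then have "h (real l / real P) \<le> h x" "h x \<le> h (real (Suc l) / real P)" by (simp_all only: S.h_le_iff)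
      moreover have "real (Suc l) / real P = real l / real P + 1 / real P" by (simp add: add_divide_distrib)
      ultimately show ?thesis using grid[of l] grid[OF lP] lP 1 P(4) \<epsilon>(3) by (simp add: abs_le_iff)
    qed
    have "h (frac x + of_int \<lfloor>x\<rfloor>) = h (frac x) + of_int (\<lfloor>x\<rfloor> * 1)" by (rule S.h.F_shift)
    then have "h x - x = h (frac x) - frac x" by (simp add: frac_def)
    then show ?thesis using near01[of "frac x"] frac_ge_0[of x] frac_lt_1[of x] by simp
  qed
  have uc2: "\<bar>F' x - F' y\<bar> \<le> \<eta> / 2" if "\<bar>x - y\<bar> \<le> e" for x y
    using \<delta>(2)[of x y] that e(2) by simp
  have portion: "23 / 100 / real P \<le> measure lborel ({x. v x \<in> U} \<inter> {real l / real P<..<real (Suc l) / real P})"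
    if l: "l < P" and U: "U \<in> sets borel" and q: "24 / 100 \<le> avg (\<lambda>x. indicator {x. u x \<in> U} ((F ^^ M) x))" for l U
  proof -
    let ?I = "{real l / real P<..<real (Suc l) / real P}"
    have Um: "{x. u x \<in> U} \<in> sets borel"
      using measurable_sets[of u borel borel U] U by (simp add: vimage_def)
    have ib: "bdd_borel (indicator {x. u x \<in> U})" by (rule bdd_borelI[of _ 1]) (use Um in \<open>auto simp: indicator_def\<close>)
    have "(real l / real P, real (Suc l) / real P) \<in> A" using l by (auto simp: A_def)
    from M1[OF _ this ib, of M] u(1)
    have "\<bar>avg (\<lambda>x. indicator ?I x * indicator {x. u x \<in> U} ((F ^^ M) x)) -
       (real (Suc l) / real P - real l / real P) * avg (\<lambda>x. indicator {x. u x \<in> U} ((F ^^ M) x))\<bar> \<le> \<epsilon>"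
      by (simp add: M_def indicator_def)
    moreover have "real (Suc l) / real P - real l / real P = 1 / real P" by (simp flip: diff_divide_distrib)
    ultimately have 1: "\<bar>avg (\<lambda>x. indicator ?I x * indicator {x. u x \<in> U} ((F ^^ M) x)) -
       1 / real P * avg (\<lambda>x. indicator {x. u x \<in> U} ((F ^^ M) x))\<bar> \<le> \<epsilon>" by (simp only:)
    have 2: "1 / real P * (24 / 100) \<le> 1 / real P * avg (\<lambda>x. indicator {x. u x \<in> U} ((F ^^ M) x))"
      using q P0 by (intro mult_left_mono) auto
    have 3: "1 / real P * (24 / 100) - 1 / 100 / real P = 23 / 100 / real P" by (simp add: field_simps)
    have gen: "t3 \<le> A" if "\<bar>A - b\<bar> \<le> \<epsilon>" "t1 \<le> b" "t1 - t2 = t3" "\<epsilon> \<le> t2" for A b t1 t2 t3 :: real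
      using that unfolding abs_le_iff by linarith
    have "23 / 100 / real P \<le> avg (\<lambda>x. indicator ?I x * indicator {x. u x \<in> U} ((F ^^ M) x))"
      by (rule gen[OF 1 2 3 \<epsilon>(2)])
    also have "(\<lambda>x. indicator ?I x * indicator {x. u x \<in> U} ((F ^^ M) x)) = (indicator ({x. v x \<in> U} \<inter> ?I) :: real \<Rightarrow> real)"
      by (rule ext) (auto simp: indicator_def v_def)
    also have "avg \<dots> = measure lborel ({x. v x \<in> U} \<inter> ?I \<inter> {0..<1})"
    proof (rule avg_indicator)
      have "v \<in> borel_measurable borel" unfolding v_def by measurable
      then show "{x. v x \<in> U} \<inter> ?I \<in> sets borel"
        using measurable_sets[of v borel borel U] U by (simp add: vimage_def)
    qed
    also have "{x. v x \<in> U} \<inter> ?I \<inter> {0..<1} = {x. v x \<in> U} \<inter> ?I"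
    proof -
      have "real (Suc l) / real P \<le> 1" using l P0 by simp
      moreover have "0 \<le> real l / real P" by simp
      ultimately have "?I \<subseteq> {0..<1}"
        unfolding subset_iff greaterThanLessThan_iff atLeastLessThan_iff by (meson less_imp_le le_less_trans less_le_trans)
      then show ?thesis by blast
    qed
    finally show ?thesis .
  qed
  have "S.H.strongly_oscillates (1 / 20000) 5000 k"
  proof (rule S.oscillation[OF P(1-3)])
    show "23 / 100 / real P \<le> measure lborel ({x. v x = 0} \<inter> {real l / real P<..<real (Suc l) / real P})" if "l < P" for l
      using portion[OF that, of "{0}"] u(7) by simp
    show "23 / 100 / real P \<le> measure lborel ({x. v x \<ge> 1 / 2} \<inter> {real l / real P<..<real (Suc l) / real P})" if "l < P" for l
      using portion[OF that, of "{1 / 2..}"] u(8) by simp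
  qed
  moreover have "\<bar>S.H x - F x\<bar> \<le> \<eta>" for x
    using S.H_close(1)[OF near \<Lambda>(2) uc2, of x] eF by linarith
  moreover have "\<bar>S.H' x - F' x\<bar> \<le> \<eta>" for x
    using S.H_close(2)[OF near \<Lambda>(2) uc2, of x] w(2) by linarith
  moreover have "c / 64 * r ^ n \<le> S.H.J n x" for n x
    using S.H_J_ge[of n x] J_ge[of n "S.g x"] by simp
  ultimately show ?thesis using S.H.lift_axioms by blast
qed

section \<open>Stability and density\<close>

context lift
begin

lemma F_expand:
  assumes "\<And>x. m \<le> \<bar>F' x\<bar>" shows "m * \<bar>x - y\<bar> \<le> \<bar>F x - F y\<bar>"
proof -
  have *: "m * \<bar>x - y\<bar> \<le> \<bar>F x - F y\<bar>" if xy: "x < y" for x y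
  proof -
    obtain z where z: "F y - F x = (y - x) * F' z" using MVT2[OF xy, of F F'] F_deriv by blast
    have "m * (y - x) \<le> \<bar>F' z\<bar> * (y - x)" using assms xy by (intro mult_right_mono) auto
    also have "\<dots> = \<bar>F y - F x\<bar>" unfolding z abs_mult using xy by simp
    finally show ?thesis using xy by (simp add: abs_minus_commute)
  qed
  show ?thesis using *[of x y] *[of y x] by (cases x y rule: linorder_cases) (auto simp: abs_minus_commute)
qed

text \<open>\<open>F\<close> expands distances at least by \<open>m\<close>, so bounds on the
  previous preimages and on \<open>K - F\<close> pull back uniformly on the whole line.\<close>

lemma inverse_stable:
  assumes "e > 0"
  shows "\<exists>\<delta>>0. \<forall>K K'. lift K K' d \<longrightarrow> (\<forall>x. \<bar>K x - F x\<bar> \<le> \<delta>) \<longrightarrow> (\<forall>x. \<bar>(inv K ^^ t) x - (G ^^ t) x\<bar> \<le> e)"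
  using assms
proof (induction t arbitrary: e)
  case 0
  then show ?case by (intro exI[of _ 1]) auto
next
  case (Suc t)
  obtain m where m: "0 < m" "\<And>x. m \<le> \<bar>F' x\<bar>" by (rule F'_bounds) (rule that)
  have "m * e / 2 > 0" using m(1) Suc.prems by simp
  from Suc.IH[OF this] obtain \<delta> where \<delta>: "\<delta> > 0"
    "\<And>K K' x. lift K K' d \<Longrightarrow> \<forall>x. \<bar>K x - F x\<bar> \<le> \<delta> \<Longrightarrow> \<bar>(inv K ^^ t) x - (G ^^ t) x\<bar> \<le> m * e / 2" by blast
  show ?case
  proof (intro exI[of _ "min \<delta> (m * e / 2)"] conjI allI impI)
    show "0 < min \<delta> (m * e / 2)" using \<delta>(1) \<open>m * e / 2 > 0\<close> by simp
    fix K K' x assume K: "lift K K' d" and near: "\<forall>x. \<bar>K x - F x\<bar> \<le> min \<delta> (m * e / 2)"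
    define z y where "z = (inv K ^^ Suc t) x" and "y = (G ^^ Suc t) x"
    have Kz: "K z = (inv K ^^ t) x" using lift.FG[OF K] by (simp add: z_def)
    have Fy: "F y = (G ^^ t) x" by (simp add: y_def)
    have "\<bar>(inv K ^^ t) x - (G ^^ t) x\<bar> \<le> m * e / 2" by (rule \<delta>(2)[OF K]) (use near in auto)
    moreover have "\<bar>K z - F z\<bar> \<le> m * e / 2" using near by simp
    ultimately have "\<bar>F z - F y\<bar> \<le> m * e" unfolding Kz Fy by linarith
    then have "m * \<bar>z - y\<bar> \<le> m * e" using F_expand[OF m(2), of z y] by linarith
    then show "\<bar>(inv K ^^ Suc t) x - (G ^^ Suc t) x\<bar> \<le> e" using m(1) unfolding z_def y_def by (subst (asm) mult_le_cancel_left_pos) auto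
  qed
qed

lemma J_stable1:
  assumes "\<theta> > 1"
  shows "\<exists>\<delta>>0. \<forall>K K'. lift K K' d \<longrightarrow> (\<forall>x. \<bar>K x - F x\<bar> \<le> \<delta>) \<longrightarrow> (\<forall>x. \<bar>K' x - F' x\<bar> \<le> \<delta>) \<longrightarrow>
    (\<forall>x. lift.J K K' t x \<le> \<theta> * J t x \<and> J t x \<le> \<theta> * lift.J K K' t x)"
  using assms
proof (induction t arbitrary: \<theta>)
  case 0
  show ?case
  proof (intro exI[of _ 1] conjI allI impI)
    fix K K' x assume K: "lift K K' d"
    show "lift.J K K' 0 x \<le> \<theta> * J 0 x" "J 0 x \<le> \<theta> * lift.J K K' 0 x"
      using 0 by (simp_all add: lift.J_0[OF K])
  qed simp
next
  case (Suc t)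
  \<comment> \<open>One factor \<open>q\<close> is spent on the first \<open>t\<close> derivatives
    of the product, the other on the last one.\<close>
  define q where "q = sqrt \<theta>"
  have q: "q > 1" "q * q = \<theta>" using Suc.prems by (simp_all add: q_def)
  obtain m where m: "0 < m" "\<And>x. m \<le> \<bar>F' x\<bar>" by (rule F'_bounds) (rule that)
  \<comment> \<open>The solution of \<open>\<epsilon> = (q - 1) * (m - \<epsilon>)\<close>: an error
    \<open>\<epsilon>\<close> in a derivative of modulus at least \<open>m\<close> then changes it
    by a factor of at most \<open>q\<close> in either direction.\<close>
  define \<epsilon> where "\<epsilon> = (q - 1) * m / q"
  have \<epsilon>: "\<epsilon> > 0" "\<epsilon> \<le> (q - 1) * m" "\<epsilon> = (q - 1) * (m - \<epsilon>)"
  proof -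
    show "\<epsilon> > 0" using q m by (simp add: \<epsilon>_def)
    have "q * \<epsilon> = (q - 1) * m" using q by (simp add: \<epsilon>_def)
    then show e: "\<epsilon> = (q - 1) * (m - \<epsilon>)" by (simp add: algebra_simps)
    have "(q - 1) * (m - \<epsilon>) \<le> (q - 1) * m" using q \<open>\<epsilon> > 0\<close> by (intro mult_left_mono) auto
    then show "\<epsilon> \<le> (q - 1) * m" using e by linarith
  qed
  have "\<epsilon> / 2 > 0" using \<epsilon> by simp
  from periodic_ucont[OF F'_cont F'_shift1 this]
  obtain \<delta>u where \<delta>u: "\<delta>u > 0" "\<And>x y. \<bar>x - y\<bar> < \<delta>u \<Longrightarrow> \<bar>F' x - F' y\<bar> < \<epsilon> / 2" by blast
  have "\<delta>u / 2 > 0" using \<delta>u by simp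
  from inverse_stable[OF this, of "Suc t"] obtain \<delta>1 where \<delta>1: "\<delta>1 > 0"
    "\<And>K K' x. lift K K' d \<Longrightarrow> \<forall>x. \<bar>K x - F x\<bar> \<le> \<delta>1 \<Longrightarrow> \<bar>(inv K ^^ Suc t) x - (G ^^ Suc t) x\<bar> \<le> \<delta>u / 2" by blast
  from Suc.IH[OF q(1)] obtain \<delta>2 where \<delta>2: "\<delta>2 > 0"
    "\<And>K K' x. lift K K' d \<Longrightarrow> \<forall>x. \<bar>K x - F x\<bar> \<le> \<delta>2 \<Longrightarrow> \<forall>x. \<bar>K' x - F' x\<bar> \<le> \<delta>2 \<Longrightarrow>
      lift.J K K' t x \<le> q * J t x \<and> J t x \<le> q * lift.J K K' t x" by blast
  define \<delta> where "\<delta> = min (\<epsilon> / 2) (min \<delta>1 \<delta>2)"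
  have \<delta>: "\<delta> > 0" "\<delta> \<le> \<epsilon> / 2" "\<delta> \<le> \<delta>1" "\<delta> \<le> \<delta>2" using \<epsilon>(1) \<delta>1(1) \<delta>2(1) by (auto simp: \<delta>_def)
  have main: "lift.J K K' (Suc t) x \<le> \<theta> * J (Suc t) x \<and> J (Suc t) x \<le> \<theta> * lift.J K K' (Suc t) x"
    if K: "lift K K' d" and near: "\<forall>x. \<bar>K x - F x\<bar> \<le> \<delta>" and near': "\<forall>x. \<bar>K' x - F' x\<bar> \<le> \<delta>" for K K' x
  proof -
    define z y where "z = (inv K ^^ Suc t) x" and "y = (G ^^ Suc t) x"
    have "\<forall>x. \<bar>K x - F x\<bar> \<le> \<delta>1" using near \<delta>(3) order_trans by blast
    from \<delta>1(2)[OF K this, of x] have "\<bar>z - y\<bar> < \<delta>u" using \<delta>u(1) unfolding z_def[symmetric] y_def[symmetric] by (simp add: field_simps)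
    then have "\<bar>F' z - F' y\<bar> < \<epsilon> / 2" by (rule \<delta>u(2))
    moreover have "\<bar>K' z - F' z\<bar> \<le> \<epsilon> / 2" using near' \<delta>(2) order_trans by blast
    ultimately have zy: "\<bar>K' z - F' y\<bar> \<le> \<epsilon>" by linarith
    have a: "\<bar>K' z\<bar> \<le> q * \<bar>F' y\<bar>"
    proof -
      have "(q - 1) * m \<le> (q - 1) * \<bar>F' y\<bar>" using q m(2) by (intro mult_left_mono) auto
      then have "\<epsilon> \<le> q * \<bar>F' y\<bar> - \<bar>F' y\<bar>" using \<epsilon>(2) by (simp add: algebra_simps)
      then show ?thesis using zy by linarith
    qed
    have b: "\<bar>F' y\<bar> \<le> q * \<bar>K' z\<bar>"
    proof -
      have "m - \<epsilon> \<le> \<bar>K' z\<bar>" using zy m(2)[of y] by linarith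
      then have "(q - 1) * (m - \<epsilon>) \<le> (q - 1) * \<bar>K' z\<bar>" using q by (intro mult_left_mono) auto
      then have "\<epsilon> \<le> q * \<bar>K' z\<bar> - \<bar>K' z\<bar>" using \<epsilon>(3) by (simp add: algebra_simps)
      then show ?thesis using zy by linarith
    qed
    have "\<forall>x. \<bar>K x - F x\<bar> \<le> \<delta>2" "\<forall>x. \<bar>K' x - F' x\<bar> \<le> \<delta>2" using near near' \<delta>(4) order_trans by blast+
    from \<delta>2(2)[OF K this] have J: "lift.J K K' t x \<le> q * J t x" "J t x \<le> q * lift.J K K' t x" for x by blast+
    have pos: "0 < J t x" "0 < lift.J K K' t x" using J_pos lift.J_pos[OF K] by blast+
    have "lift.J K K' t x * \<bar>K' z\<bar> \<le> (q * J t x) * (q * \<bar>F' y\<bar>)"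
      using J(1)[of x] a pos q by (intro mult_mono) auto
    moreover have "J t x * \<bar>F' y\<bar> \<le> (q * lift.J K K' t x) * (q * \<bar>K' z\<bar>)"
      using J(2)[of x] b pos q by (intro mult_mono) auto
    ultimately show ?thesis unfolding J_Suc lift.J_Suc[OF K] z_def[symmetric] y_def[symmetric] q(2)[symmetric]
      by (simp add: mult_ac)
  qed
  show ?case using \<delta>(1) main by blast
qed

lemma J_stable:
  assumes \<theta>: "\<theta> > 1"
  shows "\<exists>\<delta>>0. \<forall>K K'. lift K K' d \<longrightarrow> (\<forall>x. \<bar>K x - F x\<bar> \<le> \<delta>) \<longrightarrow> (\<forall>x. \<bar>K' x - F' x\<bar> \<le> \<delta>) \<longrightarrow>
    (\<forall>t\<le>N. \<forall>x. lift.J K K' t x \<le> \<theta> * J t x \<and> J t x \<le> \<theta> * lift.J K K' t x)"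
proof (induction N)
  case 0
  from J_stable1[OF \<theta>, of 0] show ?case by simp
next
  case (Suc N)
  then obtain \<delta>1 where 1: "\<delta>1 > 0" "\<And>K K' t x. lift K K' d \<Longrightarrow> \<forall>x. \<bar>K x - F x\<bar> \<le> \<delta>1 \<Longrightarrow> \<forall>x. \<bar>K' x - F' x\<bar> \<le> \<delta>1 \<Longrightarrow> t \<le> N \<Longrightarrow>
      lift.J K K' t x \<le> \<theta> * J t x \<and> J t x \<le> \<theta> * lift.J K K' t x" by blast
  from J_stable1[OF \<theta>, of "Suc N"]
  obtain \<delta>2 where 2: "\<delta>2 > 0" "\<And>K K' x. lift K K' d \<Longrightarrow> \<forall>x. \<bar>K x - F x\<bar> \<le> \<delta>2 \<Longrightarrow> \<forall>x. \<bar>K' x - F' x\<bar> \<le> \<delta>2 \<Longrightarrow>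
      lift.J K K' (Suc N) x \<le> \<theta> * J (Suc N) x \<and> J (Suc N) x \<le> \<theta> * lift.J K K' (Suc N) x" by blast
  show ?case
  proof (intro exI[of _ "min \<delta>1 \<delta>2"] conjI allI impI)
    fix K K' t x assume a: "lift K K' d" "\<forall>x. \<bar>K x - F x\<bar> \<le> min \<delta>1 \<delta>2" "\<forall>x. \<bar>K' x - F' x\<bar> \<le> min \<delta>1 \<delta>2" "t \<le> Suc N"
    then have b: "\<forall>x. \<bar>K x - F x\<bar> \<le> \<delta>1" "\<forall>x. \<bar>K' x - F' x\<bar> \<le> \<delta>1" "\<forall>x. \<bar>K x - F x\<bar> \<le> \<delta>2" "\<forall>x. \<bar>K' x - F' x\<bar> \<le> \<delta>2" by auto
    have "lift.J K K' t x \<le> \<theta> * J t x \<and> J t x \<le> \<theta> * lift.J K K' t x"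
    proof (cases "t \<le> N")
      case True
      then show ?thesis by (rule 1(2)[OF a(1) b(1,2)])
    next
      case False
      then have "t = Suc N" using a(4) by simp
      then show ?thesis using 2(2)[OF a(1) b(3,4)] by simp
    qed
    then show "lift.J K K' t x \<le> \<theta> * J t x" "J t x \<le> \<theta> * lift.J K K' t x" by blast+
  qed (use 1(1) 2(1) in simp)
qed

text \<open>\<open>N\<close> is fixed first, from \<open>k\<close>, \<open>n\<close> and
  \<open>c\<close>, and the size of the perturbation afterwards; strong oscillation allows this
  because it bounds no times from above. With Jacobians exact up to the factor 6/5, the bound 2
  leaves at least 1, the ratio 6 leaves \<open>6 * 25 / 36 \<ge> 4\<close>, and \<open>C\<close> at
  most doubles.\<close>

lemma oscillates_stable:
  assumes "strongly_oscillates \<kappa> C k" and C: "C \<ge> 0"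
  shows "\<exists>\<delta>>0. \<forall>K K'. lift K K' d \<longrightarrow> (\<forall>x. \<bar>K x - F x\<bar> \<le> \<delta>) \<longrightarrow> (\<forall>x. \<bar>K' x - F' x\<bar> \<le> \<delta>) \<longrightarrow>
    lift.oscillates K K' d \<kappa> (2 * C) k"
proof -
  obtain n c p a X X' where A: "1 \<le> n \<and> 0 < c \<and>
     (\<forall>t x. c \<le> (\<Sum>i<nat \<bar>d ^ t\<bar>. 1 / J t (x + real i))) \<and>
     a 0 = 0 \<and> a p = 1 \<and> (\<forall>l<p. a l < a (Suc l) \<and> real k * (a (Suc l) - a l) \<le> 1) \<and>
     X \<in> sets borel \<and> X' \<in> sets borel \<and>
     (\<forall>l<p. \<kappa> * (a (Suc l) - a l) \<le> measure lborel (X \<inter> {a l<..<a (Suc l)}) \<and>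
            \<kappa> * (a (Suc l) - a l) \<le> measure lborel (X' \<inter> {a l<..<a (Suc l)})) \<and>
     (\<forall>l<p. \<forall>t\<ge>n. \<forall>i::nat. \<forall>x\<in>{a l..a (Suc l)}. \<forall>x'\<in>{a l..a (Suc l)}.
        2 \<le> J t (x + real i) \<and> J t (x + real i) \<le> C * J t (x' + real i) \<and>
        (x \<in> X \<and> x' \<in> X' \<longrightarrow> 6 * J t (x + real i) \<le> J t (x' + real i)))"
    using assms(1) unfolding strongly_oscillates_def by (elim exE) (rule that)
  note A1 = A[THEN conjunct1] and A2 = A[THEN conjunct2, THEN conjunct1]
    and A3 = A[THEN conjunct2, THEN conjunct2, THEN conjunct1, rule_format]
    and A4 = A[THEN conjunct2, THEN conjunct2, THEN conjunct2]
  note A5 = A4[THEN conjunct2, THEN conjunct2, THEN conjunct2, THEN conjunct2, THEN conjunct2, THEN conjunct2]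
  define N where "N = nat \<lceil>real k * real n * (6 / 5) / c\<rceil>"
  have N: "real k * real n \<le> (5 / 6 * c) * real N"
  proof -
    have "real k * real n * (6 / 5) / c \<le> real N" unfolding N_def by (rule real_nat_ceiling_ge)
    then have "real k * real n * (6 / 5) \<le> real N * c" using A2 by (simp add: divide_le_eq)
    then show ?thesis by (simp add: mult_ac)
  qed
  from J_stable[of "6 / 5" N] obtain \<delta> where \<delta>: "\<delta> > 0"
    "\<And>K K' t x. lift K K' d \<Longrightarrow> \<forall>x. \<bar>K x - F x\<bar> \<le> \<delta> \<Longrightarrow> \<forall>x. \<bar>K' x - F' x\<bar> \<le> \<delta> \<Longrightarrow> t \<le> N \<Longrightarrow>
      lift.J K K' t x \<le> 6 / 5 * J t x \<and> J t x \<le> 6 / 5 * lift.J K K' t x" by auto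
  have main: "lift.oscillates K K' d \<kappa> (2 * C) k"
    if K: "lift K K' d" and near: "\<forall>x. \<bar>K x - F x\<bar> \<le> \<delta>" "\<forall>x. \<bar>K' x - F' x\<bar> \<le> \<delta>" for K K'
  proof -
    have J: "lift.J K K' t x \<le> 6 / 5 * J t x" "J t x \<le> 6 / 5 * lift.J K K' t x" if "t \<le> N" for t x
      using \<delta>(2)[OF K near that] by blast+
    have pos: "0 < J t x" "0 < lift.J K K' t x" for t x using J_pos lift.J_pos[OF K] by blast+
    have sum: "5 / 6 * c \<le> (\<Sum>i<nat \<bar>d ^ t\<bar>. 1 / lift.J K K' t (x + real i))" if t: "t \<le> N" for t x
    proof -
      have "5 / 6 * c \<le> 5 / 6 * (\<Sum>i<nat \<bar>d ^ t\<bar>. 1 / J t (x + real i))" using A3[of t x] by simp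
      also have "\<dots> \<le> (\<Sum>i<nat \<bar>d ^ t\<bar>. 1 / lift.J K K' t (x + real i))"
        unfolding sum_distrib_left
      proof (rule sum_mono)
        fix i :: nat
        let ?x = "x + real i"
        have "1 / (6 / 5 * J t ?x) \<le> 1 / lift.J K K' t ?x"
          using J(1)[OF t, of ?x] pos by (intro divide_left_mono) auto
        then show "5 / 6 * (1 / J t ?x) \<le> 1 / lift.J K K' t ?x" by simp
      qed
      finally show ?thesis .
    qed
    have osc: "1 \<le> lift.J K K' t (x + real i) \<and> lift.J K K' t (x + real i) \<le> (2 * C) * lift.J K K' t (x' + real i) \<and>
        (x \<in> X \<and> x' \<in> X' \<longrightarrow> 4 * lift.J K K' t (x + real i) \<le> lift.J K K' t (x' + real i))"
      if h: "l < p" "t \<in> {n..N}" "x \<in> {a l..a (Suc l)}" "x' \<in> {a l..a (Suc l)}" for l t i x x'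
    proof -
      have t: "n \<le> t" "t \<le> N" using h(2) by auto
      from A5[rule_format, OF h(1) t(1) h(3,4)]
      have o: "2 \<le> J t (x + real i)" "J t (x + real i) \<le> C * J t (x' + real i)"
        "x \<in> X \<and> x' \<in> X' \<longrightarrow> 6 * J t (x + real i) \<le> J t (x' + real i)" by blast+
      have "1 \<le> lift.J K K' t (x + real i)" using o(1) J(2)[OF t(2), of "x + real i"] by linarith
      moreover have "lift.J K K' t (x + real i) \<le> (2 * C) * lift.J K K' t (x' + real i)"
      proof -
        have "C * J t (x' + real i) \<le> C * (6 / 5 * lift.J K K' t (x' + real i))"
          using J(2)[OF t(2)] C by (rule mult_left_mono)
        then have "lift.J K K' t (x + real i) \<le> 6 / 5 * (C * (6 / 5 * lift.J K K' t (x' + real i)))"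
          using J(1)[OF t(2), of "x + real i"] o(2) by linarith
        also have "\<dots> = (36 / 25) * (C * lift.J K K' t (x' + real i))" by simp
        also have "\<dots> \<le> 2 * (C * lift.J K K' t (x' + real i))"
          using C pos by (intro mult_right_mono mult_nonneg_nonneg) (auto simp: less_imp_le)
        finally show ?thesis by simp
      qed
      moreover have "4 * lift.J K K' t (x + real i) \<le> lift.J K K' t (x' + real i)" if "x \<in> X \<and> x' \<in> X'"
        using o(3) that J(1)[OF t(2), of "x + real i"] J(2)[OF t(2), of "x' + real i"] pos[of t "x' + real i"] by linarith
      ultimately show ?thesis by blast
    qed
    show ?thesis unfolding lift.oscillates_def[OF K]
      by (rule exI[of _ n], rule exI[of _ N], rule exI[of _ "5 / 6 * c"], rule exI[of _ p], rule exI[of _ a],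
          rule exI[of _ X], rule exI[of _ X'])
        (use A1 A2 A4 N sum osc in \<open>auto simp del: mult_2\<close>)
  qed
  show ?thesis using \<delta>(1) main by blast
qed

section \<open>Uniform expansion from one iterate, and smoothing\<close>

lemma expanding_from_power:
  assumes p: "p \<ge> 1" "\<And>x. 3 / 2 \<le> J p x"
  shows "\<exists>c r. 0 < c \<and> c \<le> 1 \<and> 1 < r \<and> (\<forall>n x. c * r ^ n \<le> J n x)"
proof -
  obtain m where m: "0 < m" "m \<le> 1" "\<And>x. m \<le> \<bar>F' x\<bar>" by (rule F'_bounds) (rule that)
  define r where "r = root p (3 / 2)"
  have r: "1 < r" "r ^ p = 3 / 2" using p(1) by (simp_all add: r_def)
  \<comment> \<open>Full blocks of \<open>p\<close> steps give the factor 3/2 each. The incomplete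
    last block may lose \<open>m ^ p\<close>, and 2/3 covers the power of \<open>r\<close> that
    belongs to it.\<close>
  define c where "c = m ^ p * (2 / 3)"
  have Jm: "m ^ j \<le> J j x" for j x
  proof (induction j)
    case (Suc j)
    then have "m ^ j * m \<le> J j x * \<bar>F' ((G ^^ Suc j) x)\<bar>" using m J_pos by (intro mult_mono) (auto simp: less_imp_le)
    then show ?case unfolding J_Suc by (simp add: mult.commute)
  qed simp
  have Jp: "(3 / 2) ^ k \<le> J (p * k) x" for k x
  proof (induction k arbitrary: x)
    case (Suc k)
    have "(3 / 2) * (3 / 2) ^ k \<le> J p x * J (p * k) ((G ^^ p) x)" using p(2)[of x] Suc[of "(G ^^ p) x"] by (intro mult_mono) (auto simp: J_pos less_imp_le)
    then show ?case using J_add[of p "p * k" x] by simp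
  qed simp
  have "c * r ^ n \<le> J n x" for n x
  proof -
    define k j where "k = n div p" and "j = n mod p"
    have n: "n = p * k + j" and j: "j \<le> p" using p(1) by (auto simp: k_def j_def less_imp_le)
    have "r ^ j \<le> r ^ p" using j r by (intro power_increasing) auto
    then have "r ^ n \<le> (3 / 2) ^ k * (3 / 2)" unfolding n power_add power_mult r(2) by (intro mult_left_mono) (auto simp: r(2))
    then have "c * r ^ n \<le> c * ((3 / 2) ^ k * (3 / 2))" using m by (intro mult_left_mono) (auto simp: c_def)
    also have "\<dots> = (3 / 2) ^ k * m ^ p" by (simp add: c_def)
    also have "\<dots> \<le> (3 / 2) ^ k * m ^ j" using m j by (intro mult_left_mono power_decreasing) auto
    also have "\<dots> \<le> J (p * k) x * J j ((G ^^ (p * k)) x)" using Jp Jm m by (intro mult_mono) (auto simp: J_pos less_imp_le)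
    also have "\<dots> = J n x" unfolding n J_add ..
    finally show ?thesis .
  qed
  moreover have "c \<le> 1"
  proof -
    have "m ^ p \<le> 1" using m by (intro power_le_one) auto
    then show ?thesis by (simp add: c_def)
  qed
  ultimately show ?thesis using m r by (intro exI[of _ c] exI[of _ r]) (auto simp: c_def)
qed

text \<open>Averaging \<open>F\<close> over windows of length \<open>\<delta>\<close> turns the
  derivative into a difference quotient of \<open>F\<close>, which is Lipschitz. By the mean value
  theorem it is a nearby value of \<open>F'\<close>, so it stays close to \<open>F'\<close> and away
  from 0.\<close>

lemma smoothing:
  assumes \<eta>: "\<eta> > 0"
  shows "\<exists>K K' L. lift K K' d \<and> (\<forall>x. \<bar>K x - F x\<bar> \<le> \<eta>) \<and> (\<forall>x. \<bar>K' x - F' x\<bar> \<le> \<eta>) \<and>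
    (\<forall>x y. \<bar>ln \<bar>K' x\<bar> - ln \<bar>K' y\<bar>\<bar> \<le> L * \<bar>x - y\<bar>)"
proof -
  obtain m \<Lambda> where m: "0 < m" "\<And>x. m \<le> \<bar>F' x\<bar>" and \<Lambda>: "\<Lambda> \<ge> 1" "\<And>x. \<bar>F' x\<bar> \<le> \<Lambda>" by (rule F'_bounds) (rule that)
  obtain \<delta>0 where \<delta>0: "\<delta>0 > 0" "\<And>x y. \<bar>x - y\<bar> < \<delta>0 \<Longrightarrow> \<bar>F' x - F' y\<bar> < \<eta>"
    using periodic_ucont[OF F'_cont F'_shift1 \<eta>] by blast
  define \<delta> where "\<delta> = min (\<delta>0 / 2) (\<eta> / \<Lambda>)"
  have \<delta>: "\<delta> > 0" "\<delta> < \<delta>0" "\<Lambda> * \<delta> \<le> \<eta>"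
  proof -
    show "\<delta> > 0" "\<delta> < \<delta>0" using \<delta>0 \<eta> \<Lambda>(1) by (auto simp: \<delta>_def)
    have "\<delta> \<le> \<eta> / \<Lambda>" by (simp add: \<delta>_def)
    then show "\<Lambda> * \<delta> \<le> \<eta>" using \<Lambda>(1) by (simp add: le_divide_eq mult.commute)
  qed
  obtain \<Phi> where "\<And>x. (\<Phi> has_vector_derivative F x) (at x)"
    using einterval_antiderivative[of "-\<infinity>" "\<infinity>" F] F_cont[of UNIV] by (auto simp: continuous_on_eq_continuous_at)
  then have \<Phi>: "(\<Phi> has_real_derivative F x) (at x)" for x by (simp add: has_real_derivative_iff_has_vector_derivative)
  define K where "K x = (\<Phi> (x + \<delta>) - \<Phi> x) / \<delta>" for x
  define K' where "K' x = (F (x + \<delta>) - F x) / \<delta>" for x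
  have \<Phi>s: "((\<lambda>x. \<Phi> (x + b)) has_real_derivative F (x + b)) (at x)" for x b
    using \<Phi>[of "x + b"] by (simp add: DERIV_shift)
  have K'1: "\<exists>z. x < z \<and> z < x + \<delta> \<and> K' x = F' z" for x
  proof -
    have "x < x + \<delta>" using \<delta> by simp
    from MVT2[OF this, of F F'] F_deriv obtain z where "x < z" "z < x + \<delta>" "F (x + \<delta>) - F x = \<delta> * F' z" by auto
    then show ?thesis using \<delta>(1) by (intro exI[of _ z]) (simp add: K'_def)
  qed
  have K1: "\<exists>z. x < z \<and> z < x + \<delta> \<and> K x = F z" for x
  proof -
    have "x < x + \<delta>" using \<delta> by simp
    from MVT2[OF this, of \<Phi> F] \<Phi> obtain z where "x < z" "z < x + \<delta>" "\<Phi> (x + \<delta>) - \<Phi> x = \<delta> * F z" by auto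
    then show ?thesis using \<delta>(1) by (intro exI[of _ z]) (simp add: K_def)
  qed
  have K'm: "m \<le> \<bar>K' x\<bar>" for x using K'1[of x] m(2) by auto
  have "lift K K' d"
  proof
    fix x
    show "(K has_real_derivative K' x) (at x)"
      unfolding K_def[abs_def] K'_def using \<delta>(1) by (intro DERIV_cdivide DERIV_diff \<Phi>s \<Phi>)
    show "continuous_on UNIV K'"
      unfolding K'_def[abs_def] using \<delta>(1)
      by (intro continuous_intros continuous_on_compose2[OF F_cont[of UNIV]] F_cont) auto
    show "K' x \<noteq> 0" using K'm[of x] m(1) by auto
    \<comment> \<open>The increment of the antiderivative over a period is affine with slope
      \<open>d\<close>; its difference quotient gives the shift of \<open>K\<close> by
      \<open>d\<close>.\<close>
    have "((\<lambda>x. \<Phi> (x + 1) - \<Phi> x - of_int d * x) has_real_derivative F (x + 1) - F x - of_int d * 1) (at x)" for x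
      by (intro DERIV_diff \<Phi>s \<Phi> DERIV_cmult DERIV_ident)
    then have "((\<lambda>x. \<Phi> (x + 1) - \<Phi> x - of_int d * x) has_real_derivative 0) (at x)" for x
      using F_shift1 by simp
    then have cst: "\<Phi> (x + 1) - \<Phi> x - of_int d * x = \<Phi> (y + 1) - \<Phi> y - of_int d * y" for x y
      by (intro DERIV_isconst_all[where f = "\<lambda>x. \<Phi> (x + 1) - \<Phi> x - of_int d * x"]) auto
    have "\<Phi> (x + \<delta> + 1) - \<Phi> (x + 1) = \<Phi> (x + \<delta>) - \<Phi> x + of_int d * \<delta>"
      using cst[of "x + \<delta>" x] by (simp add: algebra_simps)
    then have "(\<Phi> (x + 1 + \<delta>) - \<Phi> (x + 1)) / \<delta> = (\<Phi> (x + \<delta>) - \<Phi> x) / \<delta> + of_int d * \<delta> / \<delta>"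
      by (simp add: add.commute add.left_commute add_divide_distrib)
    then show "K (x + 1) = K x + of_int d" using \<delta>(1) by (simp add: K_def)
  qed
  moreover have "\<bar>K x - F x\<bar> \<le> \<eta>" for x
  proof -
    obtain z where z: "x < z" "z < x + \<delta>" "K x = F z" using K1 by blast
    have "\<bar>F z - F x\<bar> \<le> \<Lambda> * \<bar>z - x\<bar>" by (rule F_lipschitz[OF \<Lambda>(2)])
    also have "\<dots> \<le> \<Lambda> * \<delta>" using z \<Lambda>(1) by (intro mult_left_mono) auto
    finally show ?thesis using \<delta>(3) z(3) by simp
  qed
  moreover have "\<bar>K' x - F' x\<bar> \<le> \<eta>" for x
  proof -
    obtain z where z: "x < z" "z < x + \<delta>" "K' x = F' z" using K'1 by blast
    then have "\<bar>z - x\<bar> < \<delta>0" using \<delta>(2) by simp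
    from \<delta>0(2)[OF this] show ?thesis using z(3) by simp
  qed
  moreover have "\<bar>ln \<bar>K' x\<bar> - ln \<bar>K' y\<bar>\<bar> \<le> 2 * \<Lambda> / (\<delta> * m) * \<bar>x - y\<bar>" for x y
  proof -
    have lnle: "ln \<bar>a\<bar> - ln \<bar>b\<bar> \<le> \<bar>a - b\<bar> / m" if "m \<le> \<bar>a\<bar>" "m \<le> \<bar>b\<bar>" for a b :: real
    proof -
      have pos: "0 < \<bar>a\<bar>" "0 < \<bar>b\<bar>" using that m(1) by auto
      have "ln \<bar>a\<bar> - ln \<bar>b\<bar> = ln (\<bar>a\<bar> / \<bar>b\<bar>)" using pos by (simp add: ln_div)
      also have "\<dots> \<le> \<bar>a\<bar> / \<bar>b\<bar> - 1" using pos by (intro ln_le_minus_one) simp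
      also have "\<dots> = (\<bar>a\<bar> - \<bar>b\<bar>) / \<bar>b\<bar>" using pos by (simp add: diff_divide_distrib)
      also have "\<dots> \<le> \<bar>a - b\<bar> / \<bar>b\<bar>" using pos by (intro divide_right_mono) auto
      also have "\<dots> \<le> \<bar>a - b\<bar> / m" using that m(1) by (intro divide_left_mono) auto
      finally show ?thesis .
    qed
    have "\<bar>ln \<bar>K' x\<bar> - ln \<bar>K' y\<bar>\<bar> \<le> \<bar>K' x - K' y\<bar> / m"
      using lnle[OF K'm[of x] K'm[of y]] lnle[OF K'm[of y] K'm[of x]] by (simp add: abs_le_iff abs_minus_commute)
    also have "\<bar>K' x - K' y\<bar> \<le> (2 * \<Lambda> * \<bar>x - y\<bar>) / \<delta>"
    proof -
      have "\<bar>(F (x + \<delta>) - F (y + \<delta>)) - (F x - F y)\<bar> \<le> \<Lambda> * \<bar>x - y\<bar> + \<Lambda> * \<bar>x - y\<bar>"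
        using F_lipschitz[OF \<Lambda>(2), of "x + \<delta>" "y + \<delta>"] F_lipschitz[OF \<Lambda>(2), of x y] by simp
      then have "\<bar>(F (x + \<delta>) - F (y + \<delta>)) - (F x - F y)\<bar> / \<delta> \<le> (2 * \<Lambda> * \<bar>x - y\<bar>) / \<delta>"
        using \<delta>(1) by (intro divide_right_mono) auto
      moreover have "K' x - K' y = ((F (x + \<delta>) - F (y + \<delta>)) - (F x - F y)) / \<delta>"
        by (simp add: K'_def diff_divide_distrib)
      ultimately show ?thesis using \<delta>(1) by (simp add: abs_divide)
    qed
    finally have "\<bar>ln \<bar>K' x\<bar> - ln \<bar>K' y\<bar>\<bar> \<le> (2 * \<Lambda> * \<bar>x - y\<bar>) / \<delta> / m" using m(1) by (simp add: divide_right_mono)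
    then show ?thesis by simp
  qed
  ultimately show ?thesis by blast
qed

end

section \<open>The residual set\<close>

text \<open>10000 is \<open>2 * 5000\<close>, the distortion bound of
  \<open>oscillating_perturbation\<close> after a further perturbation.\<close>

definition wild :: "nat \<Rightarrow> (circle \<Rightarrow> circle) \<Rightarrow> bool" where
  "wild k f \<longleftrightarrow> (\<exists>F F' d. circle_lift F F' d f \<and> lift.oscillates F F' d (1 / 20000) 10000 k)"

text \<open>Smoothing, then the oscillating conjugacy, then stability. Closeness controls only
  finitely many iterates, so expansion of the smoothed map is recovered from one power
  \<open>p\<close> whose Jacobian is at least 2 for \<open>f\<close> and thus at least 3/2 after
  smoothing.\<close>

lemma wild_ball_dense:
  assumes f: "f \<in> expanding_maps" and \<eta>: "\<eta> > 0"
  obtains g \<delta> where "g \<in> expanding_maps" "C1_dist f g < \<eta>" "\<delta> > 0"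
    "\<And>h. h \<in> expanding_maps \<Longrightarrow> C1_dist g h < \<delta> \<Longrightarrow> wild k h"
proof -
  obtain F F' d where Fl: "circle_lift F F' d f" using expanding_lift[OF f] by blast
  interpret F: circle_lift F F' d f by (rule Fl)
  obtain c0 r0 where c0: "c0 > 0" "r0 > 1" "\<And>n x. n \<ge> 1 \<Longrightarrow> F.J n x > c0 * r0 ^ n"
    using f unfolding F.expanding_iff by blast
  obtain p0 where p0: "2 / c0 < r0 ^ p0" using real_arch_pow[OF c0(2)] by blast
  define p where "p = max 1 p0"
  have p: "p \<ge> 1" "2 \<le> F.J p x" for x
  proof -
    show "p \<ge> 1" by (simp add: p_def)
    have "r0 ^ p0 \<le> r0 ^ p" using c0(2) by (intro power_increasing) (auto simp: p_def)
    then have "2 / c0 < r0 ^ p" using p0 by linarith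
    then have "2 < c0 * r0 ^ p" using c0(1) by (simp add: divide_less_eq mult.commute)
    then show "2 \<le> F.J p x" using c0(3)[OF \<open>p \<ge> 1\<close>, of x] by linarith
  qed
  from F.J_stable[of "4 / 3" p] obtain \<delta>1 where \<delta>1: "\<delta>1 > 0"
    "\<And>K K' t x. lift K K' d \<Longrightarrow> \<forall>x. \<bar>K x - F x\<bar> \<le> \<delta>1 \<Longrightarrow> \<forall>x. \<bar>K' x - F' x\<bar> \<le> \<delta>1 \<Longrightarrow> t \<le> p \<Longrightarrow>
      F.J t x \<le> 4 / 3 * lift.J K K' t x" by auto
  \<comment> \<open>Two modifications move the lift and its derivative by at most \<open>e\<close>
    each, so the total distance is at most \<open>4 * e < \<eta>\<close>.\<close>
  define e where "e = min \<delta>1 (\<eta> / 5)"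
  have e: "e > 0" "e \<le> \<delta>1" "e \<le> \<eta> / 5" using \<delta>1(1) \<eta> by (auto simp: e_def)
  from F.smoothing[OF e(1)] obtain K K' L where K: "lift K K' d" "\<forall>x. \<bar>K x - F x\<bar> \<le> e" "\<forall>x. \<bar>K' x - F' x\<bar> \<le> e"
    "\<forall>x y. \<bar>ln \<bar>K' x\<bar> - ln \<bar>K' y\<bar>\<bar> \<le> L * \<bar>x - y\<bar>" by blast
  interpret K: lift K K' d by (rule K(1))
  have "3 / 2 \<le> K.J p x" for x
  proof -
    have "\<forall>x. \<bar>K x - F x\<bar> \<le> \<delta>1" "\<forall>x. \<bar>K' x - F' x\<bar> \<le> \<delta>1" using K(2,3) e(2) order_trans by blast+
    from \<delta>1(2)[OF K(1) this order_refl, of x] p(2)[of x] show ?thesis by linarith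
  qed
  from K.expanding_from_power[OF p(1) this] obtain c r where cr: "0 < c" "c \<le> 1" "1 < r" "\<forall>n x. c * r ^ n \<le> K.J n x"
    by blast
  interpret K: expanding_lift K K' d L c r by standard (use K(4) cr in auto)
  from K.oscillating_perturbation[OF e(1), of k] obtain H H' where H: "lift H H' d" "\<forall>x. \<bar>H x - K x\<bar> \<le> e"
    "\<forall>x. \<bar>H' x - K' x\<bar> \<le> e" "\<forall>n x. c / 64 * r ^ n \<le> lift.J H H' n x"
    "lift.strongly_oscillates H H' d (1 / 20000) 5000 k" by blast
  obtain g where g: "circle_lift H H' d g" using lift.circle_lift_exists[OF H(1)] by blast
  interpret H: circle_lift H H' d g by (rule g)
  have gE: "g \<in> expanding_maps"
    unfolding H.expanding_iff
  \<comment> \<open>The inequality in \<open>expanding_maps\<close> is strict, hence half of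
    \<open>c / 64\<close>.\<close>
  proof (rule exI[of _ "c / 128"], intro conjI, goal_cases)
    case 2
    show ?case
    proof (rule exI[of _ r], intro conjI allI impI)
      fix n x
      have "c / 128 * r ^ n < c / 64 * r ^ n" using cr by simp
      then show "c / 128 * r ^ n < H.J n x" using H(4)[rule_format, of n x] by linarith
    qed (use cr in auto)
  qed (use cr in auto)
  have "\<bar>F x - H x\<bar> \<le> 2 * e" "\<bar>F' x - H' x\<bar> \<le> 2 * e" for x
    using K(2,3)[rule_format, of x] H(2,3)[rule_format, of x] by linarith+
  then have "C1_dist f g \<le> 2 * e + 2 * e" by (rule C1_dist_le_lift[OF Fl g])
  then have dist: "C1_dist f g < \<eta>" using e(3) \<eta> by linarith
  have "(0::real) \<le> 5000" by simp
  from H.oscillates_stable[OF H(5) this] obtain \<delta>2 where \<delta>2: "\<delta>2 > 0"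
    "\<And>W W'. lift W W' d \<Longrightarrow> \<forall>x. \<bar>W x - H x\<bar> \<le> \<delta>2 \<Longrightarrow> \<forall>x. \<bar>W' x - H' x\<bar> \<le> \<delta>2 \<Longrightarrow> lift.oscillates W W' d (1 / 20000) (2 * 5000) k"
    by blast
  define \<delta> where "\<delta> = min (1 / 2) (\<delta>2 / 2)"
  have \<delta>: "\<delta> > 0" "\<delta> < 1" "2 * \<delta> \<le> \<delta>2" using \<delta>2(1) by (auto simp: \<delta>_def)
  have "wild k h" if h: "h \<in> expanding_maps" "C1_dist g h < \<delta>" for h
  proof -
    have hC: "h \<in> C1_maps" using h(1) by (simp add: expanding_maps_def)
    obtain W W' where W: "circle_lift W W' d h" "\<And>x. \<bar>H x - W x\<bar> \<le> 2 * \<delta>" "\<And>x. \<bar>H' x - W' x\<bar> \<le> \<delta>"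
      using close_lift[OF g hC expanding_deriv_nz[OF h(1)] h(2) \<delta>(2)] by blast
    have "\<bar>W x - H x\<bar> \<le> \<delta>2" "\<bar>W' x - H' x\<bar> \<le> \<delta>2" for x
      using W(2)[of x] W(3)[of x] \<delta> by linarith+
    then have "lift.oscillates W W' d (1 / 20000) (2 * 5000) k"
      using \<delta>2(2)[OF circle_lift.axioms(1)[OF W(1)]] by blast
    then show ?thesis unfolding wild_def using W(1) by (intro exI[of _ W] exI[of _ W'] exI[of _ d]) simp
  qed
  then show ?thesis using that[OF gE dist \<delta>(1)] by blast
qed

text \<open>Openness is built in by taking balls all of whose expanding members are wild; density
  comes from \<open>wild_ball_dense\<close>.\<close>

definition wild_nhd :: "nat \<Rightarrow> (circle \<Rightarrow> circle) set" where
  "wild_nhd k = expanding_maps \<inter> \<Union>{C1.mball g \<delta> | g \<delta>. \<forall>h\<in>C1.mball g \<delta> \<inter> expanding_maps. wild k h}"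

lemma wild_nhd_open: "openin expanding_topology (wild_nhd k)"
  unfolding expanding_topology_def openin_subtopology wild_nhd_def
  by (intro exI[of _ "\<Union>{C1.mball g \<delta> | g \<delta>. \<forall>h\<in>C1.mball g \<delta> \<inter> expanding_maps. wild k h}"] conjI openin_Union) auto

lemma wild_nhd_dense: "expanding_topology closure_of wild_nhd k = expanding_maps"
proof -
  have "f \<in> expanding_topology closure_of wild_nhd k" if f: "f \<in> expanding_maps" for f
    unfolding closure_of_def
  proof (intro CollectI conjI allI impI)
    show "f \<in> topspace expanding_topology" using f by simp
    fix T assume T: "f \<in> T \<and> openin expanding_topology T"
    then obtain S where S: "openin C1.mtopology S" "T = S \<inter> expanding_maps"
      unfolding expanding_topology_def openin_subtopology by blast
    have "f \<in> S" using T S by blast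
    then obtain \<eta> where \<eta>: "\<eta> > 0" "C1.mball f \<eta> \<subseteq> S" using S(1) unfolding C1.openin_mtopology by blast
    obtain g \<delta> where g: "g \<in> expanding_maps" "C1_dist f g < \<eta>" "\<delta> > 0"
      "\<And>h. h \<in> expanding_maps \<Longrightarrow> C1_dist g h < \<delta> \<Longrightarrow> wild k h"
      using wild_ball_dense[OF f \<eta>(1), of k] by blast
    have C: "f \<in> C1_maps" "g \<in> C1_maps" using f g(1) by (simp_all add: expanding_maps_def)
    have "g \<in> C1.mball f \<eta>" using C g(2) by simp
    then have "g \<in> T" using \<eta>(2) S(2) g(1) by blast
    moreover have "g \<in> wild_nhd k"
    proof -
      have "g \<in> C1.mball g \<delta>" using C(2) g(3) by simp
      moreover have "\<forall>h\<in>C1.mball g \<delta> \<inter> expanding_maps. wild k h" using g(4) by auto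
      ultimately show ?thesis unfolding wild_nhd_def using g(1) by blast
    qed
    ultimately show "\<exists>y\<in>wild_nhd k. y \<in> T" by blast
  qed
  moreover have "expanding_topology closure_of wild_nhd k \<subseteq> expanding_maps"
    using closure_of_subset_topspace[of expanding_topology] by simp
  ultimately show ?thesis by blast
qed

theorem theorem1:
  shows "\<exists>R. R \<subseteq> expanding_maps \<and> residual_in expanding_topology R \<and>
    (\<forall>f\<in>R. \<not> (\<exists>\<mu>. acisigma f \<mu>))"
proof (intro exI[of _ "\<Inter>k. wild_nhd k"] conjI ballI notI)
  show sub: "(\<Inter>k. wild_nhd k) \<subseteq> expanding_maps" by (auto simp: wild_nhd_def)
  then show "residual_in expanding_topology (\<Inter>k. wild_nhd k)"
    unfolding residual_in_def using wild_nhd_open wild_nhd_dense by (intro conjI exI[of _ wild_nhd]) auto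
  fix f assume f: "f \<in> (\<Inter>k. wild_nhd k)" and "\<exists>\<mu>. acisigma f \<mu>"
  then obtain \<mu> where \<mu>: "acisigma f \<mu>" by blast
  have "wild k f" for k using f unfolding wild_nhd_def by blast
  \<comment> \<open>All scales share the constants 1/20000 and 10000, as
    \<open>no_acisigma_if_oscillates\<close> demands.\<close>
  then show False unfolding wild_def by (intro no_acisigma_if_oscillates[OF _ _ _ \<mu>]) auto
qed

end
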